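(* Let $n\ge 1$ and $\lambda>n$. The following three $C^*$-algebras generated by Toeplitz operators with moment map symbols are commutative. \begin{itemize} \item (Abelian Elliptic) The $C^*$-algebra $\mathcal{T}^{(\lambda)}\big(L^\infty(D^{III}_n)^{\mu^{\mathbb{T}}}\big)$ acting on $\mathcal{A}^2_\lambda(D^{III}_n)$, obtained from the moment map $\mu^{\mathbb{T}}$ of the $\mathbb{T}$-action $t\cdot Z=t^2Z$ on $D^{III}_n$. \item (Abelian Hyperbolic) The $C^*$-algebra $\mathcal{T}^{(\lambda)}\big(L^\infty(\mathscr{S}_n)^{\mu^{\mathbb{R}_+}}\big)$ acting on $\mathcal{A}^2_\lambda(\mathscr{S}_n)$, obtained from the moment map $\mu^{\mathbb{R}_+}$ of the $\mathbb{R}_+$-action $r\cdot Z=r^2Z$ on $\mathscr{S}_n$. \item (Parabolic) The $C^*$-algebra $\mathcal{T}^{(\lambda)}\big(L^\infty(\mathscr{S}_n)^{\mu^{\mathrm{Symm}(n,\mathbb{R})}}\big)$ acting on $\mathcal{A}^2_\lambda(\mathscr{S}_n)$, obtained from the moment map $\mu^{\mathrm{Symm}(n,\mathbb{R})}$ of the $\mathrm{Symm}(n,\mathbb{R})$-action $S\cdot Z=Z+S$ on $\mathscr{S}_n$. \end{itemize}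
   Context: $\mathrm{Symm}(n,\mathbb{F})$ is the space of symmetric $n\times n$ matrices over $\mathbb{F}=\mathbb{R},\mathbb{C}$; $\mathrm{Re}(Z)$, $\mathrm{Im}(Z)$ are entrywise real and imaginary parts. $D^{III}_n=\{Z\in\mathrm{Symm}(n,\mathbb{C}) : I_n-Z\overline{Z}>0\}$ and $\mathscr{S}_n=\{Z\in\mathrm{Symm}(n,\mathbb{C}) : \mathrm{Im}(Z)>0\}$. Weighted Bergman spaces: for $\lambda>n$, $v_\lambda$ is the probability measure on $D^{III}_n$ that is a constant multiple of $\det(I_n-Z\overline{Z})^{\lambda-n-1}dZ$ ($dZ$ Lebesgue measure), and $\widehat{v}_\lambda$ is the measure on $\mathscr{S}_n$ equal to a positive constant (depending only on $n,\lambda$) times $\det(-i(Z-\overline{Z}))^{\lambda-n-1}dZ$. $\mathcal{A}^2_\lambda(D^{III}_n)$ and $\mathcal{A}^2_\lambda(\mathscr{S}_n)$ are the closed subspaces of holomorphic functions in $L^2(D^{III}_n,v_\lambda)$ and $L^2(\mathscr{S}_n,\widehat{v}_\lambda)$. For $D$ either domain, $B_{D,\lambda}$ is the orthogonal projection of the $L^2$ space onto $\mathcal{A}^2_\lambda(D)$, and for $a\in L^\infty(D)$ the Toeplitz operator is $T^{(\lambda)}_a=B_{D,\lambda}\circ M_a$ on $\mathcal{A}^2_\lambda(D)$, with $M_a$ multiplication by $a$. For a set $\mathcal{A}\subset L^\infty(D)$, $\mathcal{T}^{(\lambda)}(\mathcal{A})$ is the $C^*$-algebra generated by all $T^{(\lambda)}_a$,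 $a\in\mathcal{A}$. Moment maps of the three actions (with Lie algebra duals identified with $\mathbb{R}$, $\mathbb{R}$ and, via the trace inner product, $\mathrm{Symm}(n,\mathbb{R})$): $\mu^{\mathbb{T}}(Z)=-2\,\mathrm{tr}\big((I_n-Z\overline{Z})^{-1}\big)$ on $D^{III}_n$; $\mu^{\mathbb{R}_+}(Z)=-4\,\mathrm{tr}\big(\mathrm{Im}(Z)^{-1}\mathrm{Re}(Z)\big)$ on $\mathscr{S}_n$; $\mu^{\mathrm{Symm}(n,\mathbb{R})}(Z)=-2\,\mathrm{Im}(Z)^{-1}$ on $\mathscr{S}_n$. For a moment map $\mu^H$ on $D$, $L^\infty(D)^{\mu^H}$ is the space of all $a\in L^\infty(D)$ that can be written as $a=f\circ\mu^H$ for some measurable function $f$. *)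

theory Defs
  imports "HOL-Analysis.Analysis" "HOL-Library.FuncSet"
begin

section \<open>Matrices and the two domains\<close>

text \<open>The matrix size \<open>n\<close> is the cardinality of the finite index type \<open>'n\<close>.\<close>

definition cnj_mat :: "complex^'n^'m \<Rightarrow> complex^'n^'m" where
  "cnj_mat Z = (\<chi> i j. cnj (Z $ i $ j))"

definition Re_mat :: "complex^'n^'m \<Rightarrow> real^'n^'m" where
  "Re_mat Z = (\<chi> i j. Re (Z $ i $ j))"

definition Im_mat :: "complex^'n^'m \<Rightarrow> real^'n^'m" where
  "Im_mat Z = (\<chi> i j. Im (Z $ i $ j))"

definition pos_def_complex :: "complex^'n^'n \<Rightarrow> bool" where
  "pos_def_complex A \<longleftrightarrow>
     transpose (cnj_mat A) = A \<and>
     (\<forall>v. v \<noteq> 0 \<longrightarrow> 0 < Re (\<Sum>i\<in>UNIV. cnj (v $ i) * (A *v v) $ i))"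

definition pos_def_real :: "real^'n^'n \<Rightarrow> bool" where
  "pos_def_real A \<longleftrightarrow> transpose A = A \<and> (\<forall>v. v \<noteq> 0 \<longrightarrow> 0 < v \<bullet> (A *v v))"

definition Symm_complex :: "(complex^'n^'n) set" where
  "Symm_complex = {Z. transpose Z = Z}"

definition D_III :: "(complex^'n^'n) set" where
  "D_III = {Z \<in> Symm_complex. pos_def_complex (mat 1 - Z ** cnj_mat Z)}"

definition Siegel :: "(complex^'n^'n) set" where
  "Siegel = {Z \<in> Symm_complex. pos_def_real (Im_mat Z)}"


section \<open>Lebesgue measure on symmetric matrices and the weighted measures\<close>

text \<open>
  For an unordered pair \<open>{i, j}\<close> and \<open>c \<in> {1, \<i>}\<close>, the basis contains the matrix with entry \<open>c\<close> at
  the positions \<open>(i, j)\<close> and \<open>(j, i)\<close>.  The coordinates with respect to this real basis are the real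
  and imaginary parts of the entries of \<open>Z\<close> on and above the diagonal.
\<close>

definition symm_basis :: "(complex^'n^'n) set" where
  "symm_basis = {(\<chi> k l. if {k, l} = {i, j} then c else 0) | i j c. c \<in> {1, \<i>}}"

text \<open>
  The measure \<open>dZ\<close>: Lebesgue measure on the real vector space of symmetric complex matrices,
  built from coordinates in the same way as \<^term>\<open>lborel\<close>.  As a measure on all square
  matrices it is concentrated on \<^term>\<open>Symm_complex\<close>.
\<close>

definition lebesgue_symm :: "(complex^'n^'n) measure" where
  "lebesgue_symm =
     distr (Pi\<^sub>M symm_basis (\<lambda>_. lborel)) borel (\<lambda>x. \<Sum>b\<in>symm_basis. x b *\<^sub>R b)"

text \<open>The determinants below are positive real numbers on the respective domains.\<close>

definition D_III_weighted :: "real \<Rightarrow> (complex^'n^'n) measure" where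
  "D_III_weighted lam =
     density (restrict_space lebesgue_symm D_III)
       (\<lambda>Z. ennreal (Re (det (mat 1 - Z ** cnj_mat Z)) powr (lam - real CARD('n) - 1)))"

definition D_III_measure :: "real \<Rightarrow> (complex^'n^'n) measure" where
  "D_III_measure lam =
     scale_measure (inverse (emeasure (D_III_weighted lam) (D_III :: (complex^'n^'n) set)))
       (D_III_weighted lam)"

definition Siegel_measure :: "real \<Rightarrow> real \<Rightarrow> (complex^'n^'n) measure" where
  "Siegel_measure c lam =
     scale_measure (ennreal c)
       (density (restrict_space lebesgue_symm Siegel)
         (\<lambda>Z. ennreal (Re (det (\<chi> i j. - \<i> * (Z $ i $ j - cnj (Z $ i $ j))))
                        powr (lam - real CARD('n) - 1))))"


section \<open>Square-integrable functions and Bergman spaces\<close>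

text \<open>
  Elements of \<open>L\<^sup>2\<close> and \<open>L\<^sup>\<infinity>\<close> are represented by measurable functions; equality in these spaces is
  equality almost everywhere.
\<close>

definition L2 :: "'a measure \<Rightarrow> ('a \<Rightarrow> complex) set" where
  "L2 M = {f \<in> borel_measurable M. integrable M (\<lambda>x. (cmod (f x))\<^sup>2)}"

definition L2_inner :: "'a measure \<Rightarrow> ('a \<Rightarrow> complex) \<Rightarrow> ('a \<Rightarrow> complex) \<Rightarrow> complex" where
  "L2_inner M f g = (LINT x|M. f x * cnj (g x))"

definition L2_norm :: "'a measure \<Rightarrow> ('a \<Rightarrow> complex) \<Rightarrow> real" where
  "L2_norm M f = sqrt (LINT x|M. (cmod (f x))\<^sup>2)"

definition Linfty :: "(complex^'n^'n) set \<Rightarrow> (complex^'n^'n \<Rightarrow> complex) set" where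
  "Linfty D = {a \<in> borel_measurable (restrict_space lebesgue_symm D).
                 \<exists>C. AE Z in restrict_space lebesgue_symm D. cmod (a Z) \<le> C}"

text \<open>
  \<open>D\<close> is a relatively open subset of the space of symmetric matrices, so the derivative is taken
  within \<open>D\<close>.  It is determined on symmetric directions only, and any complex linear functional
  there extends to a complex linear functional on all matrices.
\<close>

definition holomorphic_symm :: "(complex^'n^'n \<Rightarrow> complex) \<Rightarrow> (complex^'n^'n) set \<Rightarrow> bool" where
  "holomorphic_symm f D \<longleftrightarrow>
     (\<forall>Z\<in>D. \<exists>f'. (f has_derivative f') (at Z within D) \<and>
                 (\<forall>c V. f' (\<chi> i j. c * V $ i $ j) = c * f' V))"

text \<open>
  The measures used have full support in \<open>D\<close>, so a class in \<open>L\<^sup>2\<close> contains at most one function that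
  is holomorphic on \<open>D\<close>; the value 0 outside \<open>D\<close> makes the representative unique as a
  total function.
\<close>

definition bergman_space ::
    "(complex^'n^'n) set \<Rightarrow> (complex^'n^'n) measure \<Rightarrow> (complex^'n^'n \<Rightarrow> complex) set" where
  "bergman_space D M = {f \<in> L2 M. holomorphic_symm f D \<and> (\<forall>Z. Z \<notin> D \<longrightarrow> f Z = 0)}"

definition orthogonal_projection ::
    "'a measure \<Rightarrow> ('a \<Rightarrow> complex) set \<Rightarrow> ('a \<Rightarrow> complex) \<Rightarrow> ('a \<Rightarrow> complex)" where
  "orthogonal_projection M H f =
     (THE g. g \<in> H \<and> (\<forall>h\<in>H. L2_inner M (\<lambda>x. f x - g x) h = 0))"


section \<open>Operators and the generated \<open>C\<^sup>*\<close>-algebra\<close>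

text \<open>
  Operators on a space \<open>H\<close> of functions are elements of \<^term>\<open>H \<rightarrow>\<^sub>E H\<close>, so that equality of
  operators is equality on \<open>H\<close>.
\<close>

definition bounded_operators ::
    "'a measure \<Rightarrow> ('a \<Rightarrow> complex) set \<Rightarrow> (('a \<Rightarrow> complex) \<Rightarrow> ('a \<Rightarrow> complex)) set" where
  "bounded_operators M H = {T \<in> H \<rightarrow>\<^sub>E H.
     (\<forall>f\<in>H. \<forall>g\<in>H. T (\<lambda>x. f x + g x) = (\<lambda>x. T f x + T g x)) \<and>
     (\<forall>c. \<forall>f\<in>H. T (\<lambda>x. c * f x) = (\<lambda>x. c * T f x)) \<and>
     (\<exists>C. \<forall>f\<in>H. L2_norm M (T f) \<le> C * L2_norm M f)}"

definition is_adjoint ::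
    "'a measure \<Rightarrow> ('a \<Rightarrow> complex) set \<Rightarrow>
     (('a \<Rightarrow> complex) \<Rightarrow> ('a \<Rightarrow> complex)) \<Rightarrow> (('a \<Rightarrow> complex) \<Rightarrow> ('a \<Rightarrow> complex)) \<Rightarrow> bool" where
  "is_adjoint M H T S \<longleftrightarrow> (\<forall>f\<in>H. \<forall>g\<in>H. L2_inner M (T f) g = L2_inner M f (S g))"

text \<open>
  The last conjunct is closedness in the operator norm: \<open>T\<close> belongs to the algebra whenever
  for every \<open>e > 0\<close> some \<open>S\<close> in the algebra has operator norm distance at most \<open>e\<close> from \<open>T\<close>.
\<close>

definition cstar_subalgebra ::
    "'a measure \<Rightarrow> ('a \<Rightarrow> complex) set \<Rightarrow> (('a \<Rightarrow> complex) \<Rightarrow> ('a \<Rightarrow> complex)) set \<Rightarrow> bool" where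
  "cstar_subalgebra M H \<C> \<longleftrightarrow>
     \<C> \<subseteq> bounded_operators M H \<and>
     (\<lambda>f\<in>H. \<lambda>x. 0) \<in> \<C> \<and>
     (\<forall>S\<in>\<C>. \<forall>T\<in>\<C>. (\<lambda>f\<in>H. \<lambda>x. S f x + T f x) \<in> \<C>) \<and>
     (\<forall>c. \<forall>T\<in>\<C>. (\<lambda>f\<in>H. \<lambda>x. c * T f x) \<in> \<C>) \<and>
     (\<forall>S\<in>\<C>. \<forall>T\<in>\<C>. compose H S T \<in> \<C>) \<and>
     (\<forall>T\<in>\<C>. \<forall>S\<in>bounded_operators M H. is_adjoint M H T S \<longrightarrow> S \<in> \<C>) \<and>
     (\<forall>T\<in>bounded_operators M H.
        (\<forall>e>0. \<exists>S\<in>\<C>. \<forall>f\<in>H. L2_norm M (\<lambda>x. T f x - S f x) \<le> e * L2_norm M f) \<longrightarrow> T \<in> \<C>)"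

definition cstar_generated ::
    "'a measure \<Rightarrow> ('a \<Rightarrow> complex) set \<Rightarrow> (('a \<Rightarrow> complex) \<Rightarrow> ('a \<Rightarrow> complex)) set \<Rightarrow>
     (('a \<Rightarrow> complex) \<Rightarrow> ('a \<Rightarrow> complex)) set" where
  "cstar_generated M H X = \<Inter> {\<C>. cstar_subalgebra M H \<C> \<and> X \<subseteq> \<C>}"

definition commutative_operators ::
    "('a \<Rightarrow> complex) set \<Rightarrow> (('a \<Rightarrow> complex) \<Rightarrow> ('a \<Rightarrow> complex)) set \<Rightarrow> bool" where
  "commutative_operators H \<C> \<longleftrightarrow> (\<forall>S\<in>\<C>. \<forall>T\<in>\<C>. compose H S T = compose H T S)"


section \<open>Toeplitz operators and moment map symbols\<close>

definition toeplitz ::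
    "(complex^'n^'n) set \<Rightarrow> (complex^'n^'n) measure \<Rightarrow> (complex^'n^'n \<Rightarrow> complex) \<Rightarrow>
     ((complex^'n^'n \<Rightarrow> complex) \<Rightarrow> (complex^'n^'n \<Rightarrow> complex))" where
  "toeplitz D M a =
     (\<lambda>f\<in>bergman_space D M. orthogonal_projection M (bergman_space D M) (\<lambda>Z. a Z * f Z))"

definition toeplitz_algebra ::
    "(complex^'n^'n) set \<Rightarrow> (complex^'n^'n) measure \<Rightarrow> (complex^'n^'n \<Rightarrow> complex) set \<Rightarrow>
     ((complex^'n^'n \<Rightarrow> complex) \<Rightarrow> (complex^'n^'n \<Rightarrow> complex)) set" where
  "toeplitz_algebra D M \<A> = cstar_generated M (bergman_space D M) (toeplitz D M ` \<A>)"

text \<open>The trace in \<open>mu_T\<close> is real on the domain, and the dual of the Lie algebra is identified with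
  the real numbers.\<close>

definition mu_T :: "complex^'n^'n \<Rightarrow> real" where
  "mu_T Z = - 2 * Re (trace (matrix_inv (mat 1 - Z ** cnj_mat Z)))"

definition mu_R :: "complex^'n^'n \<Rightarrow> real" where
  "mu_R Z = - 4 * trace (matrix_inv (Im_mat Z) ** Re_mat Z)"

definition mu_Symm :: "complex^'n^'n \<Rightarrow> real^'n^'n" where
  "mu_Symm Z = (- 2) *\<^sub>R matrix_inv (Im_mat Z)"

text \<open>Being an identity in \<open>L\<^sup>\<infinity>\<close>, the equation \<open>a = f \<circ> \<mu>\<close> holds almost everywhere.  For \<open>mu_Symm\<close>, a
  Borel function on the closed subspace of symmetric real matrices extends by 0 to all matrices.\<close>

definition moment_symbols ::
    "(complex^'n^'n) set \<Rightarrow> (complex^'n^'n \<Rightarrow> 'h::topological_space) \<Rightarrow> (complex^'n^'n \<Rightarrow> complex) set"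
  where
  "moment_symbols D \<mu> =
     {a \<in> Linfty D. \<exists>f\<in>borel_measurable borel.
        AE Z in restrict_space lebesgue_symm D. a Z = f (\<mu> Z)}"

end

theory Submission
  imports Defs "HOL-Complex_Analysis.Conformal_Mappings"
begin

text \<open>
  A Bergman space is a reproducing kernel Hilbert space.  Each of the three moment maps is constant
  on the orbits of a group \<open>G\<close> of holomorphic automorphisms \<open>h\<close> which multiply the weighted measure
  by a constant, so that \<open>f \<mapsto> f \<circ> h\<close> is a multiple of a unitary operator: the maps
  \<open>Z \<mapsto> V Z V\<^sup>T\<close> with \<open>V\<close> unitary, \<open>Z \<mapsto> A Z A\<^sup>T\<close> with \<open>A\<close> real invertible, and \<open>Z \<mapsto> Z + S\<close> with \<open>S\<close>
  real symmetric.  The Toeplitz operators therefore lie in the commutant of \<open>G\<close>, which is a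
  \<open>C\<^sup>*\<close>-algebra, and it suffices that this commutant is commutative.

  This is the argument of Faraut and Thomas, with an anti-holomorphic involution \<open>\<sigma>\<close> of the domain
  that preserves every orbit of \<open>G\<close>.  Up to a holomorphic multiplier, \<open>f \<mapsto> cnj (f \<circ> \<sigma>)\<close> is an
  antiunitary operator \<open>J\<close>.  For \<open>T\<close> in the commutant the kernels of \<open>T J\<close> and \<open>J T\<^sup>*\<close> agree on the
  diagonal by invariance under \<open>G\<close>, and a sesqui-holomorphic kernel is determined by the diagonal;
  so \<open>T J = J T\<^sup>*\<close>, which reverses products.

  The involutions are \<open>cnj Z\<close>, \<open>(cnj Z)\<^sup>-\<^sup>1\<close> and \<open>- cnj Z\<close>.  Preservation of orbits is Takagi's
  factorisation in the first case and the simultaneous diagonalisation of \<open>Re Z\<close> and \<open>Im Z\<close> in the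
  second.
\<close>

section \<open>Reproducing kernel Hilbert spaces\<close>

text \<open>In the first two cases \<open>G\<close> must be larger than the circle or the dilations:
  for n > 1 the commutant of the circle action contains all operators on the space of polynomials of
  a fixed degree, so it is not commutative. The moment maps are traces, and this makes the larger
  symmetry available.

  In the hyperbolic case write Z = X + iY. The orbits of \<open>G\<close> are labelled by the
  eigenvalues x of Y^-1 X. The map \<open>- cnj Z\<close> changes the sign of each x, whereas 1/(x -
  i) = (x + i)/(x^2 + 1) is a positive multiple of x + i, so the inverse stays on the orbit. The
  price is a scaling factor different from 1, compensated by a multiplier that is a holomorphic
  branch of a real power of det Z; building this branch is the purpose of the minors.

  The remaining obstacle is measure theoretic. For n < \<lambda> < n + 1 the weight on
  \<open>D_III\<close> blows up at the boundary, so its total mass has to be shown finite before the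
  normalisation makes sense. Jacobians are never computed as determinants: uniqueness of Haar
  measure gives a scaling constant, and an invariant set or a multiplicative decomposition evaluates
  it.\<close>

lemma L2_I: "f \<in> borel_measurable M \<Longrightarrow> integrable M (\<lambda>x. (cmod (f x))\<^sup>2) \<Longrightarrow> f \<in> L2 M"
  by (simp add: L2_def)

lemma L2_measurable: "f \<in> L2 M \<Longrightarrow> f \<in> borel_measurable M"
  by (simp add: L2_def)

lemma L2_integrable: "f \<in> L2 M \<Longrightarrow> integrable M (\<lambda>x. (cmod (f x))\<^sup>2)"
  by (simp add: L2_def)

lemma borel_measurable_cnj [measurable]:
  "f \<in> borel_measurable M \<Longrightarrow> (\<lambda>x. cnj (f x)) \<in> borel_measurable M"
  by (rule measurable_compose[OF _ borel_measurable_continuous_onI]) (auto intro: continuous_intros)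

lemma L2_mult_integrable:
  assumes "f \<in> L2 M" "g \<in> L2 M"
  shows "integrable M (\<lambda>x. f x * cnj (g x))"
proof (rule Bochner_Integration.integrable_bound[of M "\<lambda>x. (cmod (f x))\<^sup>2 + (cmod (g x))\<^sup>2"])
  show "integrable M (\<lambda>x. (cmod (f x))\<^sup>2 + (cmod (g x))\<^sup>2)"
    using assms by (auto intro: L2_integrable)
  show "(\<lambda>x. f x * cnj (g x)) \<in> borel_measurable M"
    using assms[THEN L2_measurable] by measurable
  have "cmod a * cmod b \<le> (cmod a)\<^sup>2 + (cmod b)\<^sup>2" for a b
    using sum_squares_bound[of "cmod a" "cmod b"] mult_nonneg_nonneg[OF norm_ge_zero[of a] norm_ge_zero[of b]]
    by linarith
  then show "AE x in M. norm (f x * cnj (g x)) \<le> norm ((cmod (f x))\<^sup>2 + (cmod (g x))\<^sup>2)"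
    by (auto simp: norm_mult)
qed

lemma L2_zero [simp]: "(\<lambda>x. 0) \<in> L2 M"
  by (simp add: L2_def)

lemma L2_add:
  assumes "f \<in> L2 M" "g \<in> L2 M"
  shows "(\<lambda>x. f x + g x) \<in> L2 M"
proof (rule L2_I)
  show "(\<lambda>x. f x + g x) \<in> borel_measurable M"
    using assms[THEN L2_measurable] by measurable
  show "integrable M (\<lambda>x. (cmod (f x + g x))\<^sup>2)"
  proof (rule Bochner_Integration.integrable_bound[of M "\<lambda>x. 2 * (cmod (f x))\<^sup>2 + 2 * (cmod (g x))\<^sup>2"])
    show "integrable M (\<lambda>x. 2 * (cmod (f x))\<^sup>2 + 2 * (cmod (g x))\<^sup>2)"
      using assms[THEN L2_integrable] by simp
    show "(\<lambda>x. (cmod (f x + g x))\<^sup>2) \<in> borel_measurable M"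
      using assms[THEN L2_measurable] by measurable
    have "(cmod (a + b))\<^sup>2 \<le> 2 * (cmod a)\<^sup>2 + 2 * (cmod b)\<^sup>2" for a b
    proof -
      have "(cmod (a + b))\<^sup>2 \<le> (cmod a + cmod b)\<^sup>2"
        by (simp add: norm_triangle_ineq power_mono)
      also have "\<dots> \<le> 2 * (cmod a)\<^sup>2 + 2 * (cmod b)\<^sup>2"
        using sum_squares_bound[of "cmod a" "cmod b"] by (simp add: power2_sum)
      finally show ?thesis .
    qed
    then show "AE x in M. norm ((cmod (f x + g x))\<^sup>2) \<le> norm (2 * (cmod (f x))\<^sup>2 + 2 * (cmod (g x))\<^sup>2)"
      by auto
  qed
qed

lemma L2_scale:
  assumes "f \<in> L2 M"
  shows "(\<lambda>x. c * f x) \<in> L2 M"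
  using assms by (auto simp: L2_def norm_mult power_mult_distrib)

lemma L2_diff:
  assumes "f \<in> L2 M" "g \<in> L2 M"
  shows "(\<lambda>x. f x - g x) \<in> L2 M"
  using L2_add[OF assms(1) L2_scale[OF assms(2), of "-1"]] by simp

lemma L2_inner_add_left:
  "f \<in> L2 M \<Longrightarrow> g \<in> L2 M \<Longrightarrow> h \<in> L2 M \<Longrightarrow>
   L2_inner M (\<lambda>x. f x + g x) h = L2_inner M f h + L2_inner M g h"
  unfolding L2_inner_def
  by (simp add: distrib_right L2_mult_integrable)

lemma L2_inner_scale_left: "L2_inner M (\<lambda>x. c * f x) h = c * L2_inner M f h"
  unfolding L2_inner_def by (simp add: mult.assoc)

lemma L2_inner_cnj: "cnj (L2_inner M f g) = L2_inner M g f"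
  unfolding L2_inner_def by (subst Bochner_Integration.integral_cnj[symmetric]) (simp add: mult.commute)

lemma L2_inner_add_right:
  assumes "f \<in> L2 M" "g \<in> L2 M" "h \<in> L2 M"
  shows "L2_inner M h (\<lambda>x. f x + g x) = L2_inner M h f + L2_inner M h g"
  using L2_inner_add_left[OF assms] by (metis L2_inner_cnj complex_cnj_add)

lemma L2_inner_scale_right: "L2_inner M h (\<lambda>x. c * f x) = cnj c * L2_inner M h f"
  by (metis L2_inner_cnj L2_inner_scale_left complex_cnj_mult)

lemma L2_inner_diff_left:
  assumes "f \<in> L2 M" "g \<in> L2 M" "h \<in> L2 M"
  shows "L2_inner M (\<lambda>x. f x - g x) h = L2_inner M f h - L2_inner M g h"
  using L2_inner_add_left[OF assms(1) L2_scale[OF assms(2), of "-1"] assms(3)]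
    L2_inner_scale_left[of M "-1" g h] by simp

lemma L2_inner_diff_right:
  assumes "f \<in> L2 M" "g \<in> L2 M" "h \<in> L2 M"
  shows "L2_inner M h (\<lambda>x. f x - g x) = L2_inner M h f - L2_inner M h g"
  using L2_inner_diff_left[OF assms] by (metis L2_inner_cnj complex_cnj_diff)

lemma L2_inner_zero_left [simp]: "L2_inner M (\<lambda>x. 0) h = 0"
  by (simp add: L2_inner_def)

lemma L2_inner_zero_right [simp]: "L2_inner M h (\<lambda>x. 0) = 0"
  by (simp add: L2_inner_def)

lemma L2_norm_nonneg [simp]: "0 \<le> L2_norm M f"
  by (simp add: L2_norm_def)

lemma L2_norm_sq: "(L2_norm M f)\<^sup>2 = (LINT x|M. (cmod (f x))\<^sup>2)"
  by (simp add: L2_norm_def)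

lemma L2_inner_self: "L2_inner M f f = of_real ((L2_norm M f)\<^sup>2)"
  unfolding L2_inner_def L2_norm_sq
  by (simp flip: complex_norm_square integral_complex_of_real)

lemma L2_norm_scale: "L2_norm M (\<lambda>x. c * f x) = cmod c * L2_norm M f"
  by (simp add: L2_norm_def norm_mult power_mult_distrib real_sqrt_mult)

lemma L2_norm_zero [simp]: "L2_norm M (\<lambda>x. 0) = 0"
  by (simp add: L2_norm_def)

lemma L2_norm_add_sq:
  assumes "f \<in> L2 M" "g \<in> L2 M"
  shows "(L2_norm M (\<lambda>x. f x + g x))\<^sup>2 = (L2_norm M f)\<^sup>2 + (L2_norm M g)\<^sup>2 + 2 * Re (L2_inner M f g)"
proof -
  have "complex_of_real ((L2_norm M (\<lambda>x. f x + g x))\<^sup>2)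
      = L2_inner M f f + L2_inner M g g + (L2_inner M f g + cnj (L2_inner M f g))"
    unfolding L2_inner_self[symmetric]
    by (simp add: L2_inner_add_left L2_inner_add_right assms L2_add L2_inner_cnj)
  also have "\<dots> = of_real ((L2_norm M f)\<^sup>2 + (L2_norm M g)\<^sup>2 + 2 * Re (L2_inner M f g))"
    unfolding L2_inner_self complex_add_cnj by simp
  finally show ?thesis using of_real_eq_iff by blast
qed

lemma L2_norm_diff_sq:
  assumes "f \<in> L2 M" "g \<in> L2 M"
  shows "(L2_norm M (\<lambda>x. f x - g x))\<^sup>2 = (L2_norm M f)\<^sup>2 + (L2_norm M g)\<^sup>2 - 2 * Re (L2_inner M f g)"
  using L2_norm_add_sq[OF assms(1) L2_scale[OF assms(2), of "-1"]]
  by (simp only: L2_norm_scale L2_inner_scale_right) simp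

text \<open>\<open>L2_norm\<close> is only a seminorm on functions, so the usual minimisation over
  \<open>t\<close> requires \<open>b > 0\<close>. For \<open>b = 0\<close> the quadratic term
  disappears and the remaining linear inequality forces \<open>p = 0\<close>.\<close>

lemma L2_Cauchy_Schwarz:
  assumes f: "f \<in> L2 M" and g: "g \<in> L2 M"
  shows "cmod (L2_inner M f g) \<le> L2_norm M f * L2_norm M g"
proof -
  define p a b where "p = L2_inner M f g" and "a = L2_norm M f" and "b = L2_norm M g"
  have ab: "a \<ge> 0" "b \<ge> 0" by (auto simp: a_def b_def)
  have *: "0 \<le> a\<^sup>2 + (cmod t)\<^sup>2 * b\<^sup>2 - 2 * Re (cnj t * p)" for t
    using L2_norm_diff_sq[OF f L2_scale[OF g, of t]]
      zero_le_power2[of "L2_norm M (\<lambda>x. f x - t * g x)"]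
    by (simp add: L2_norm_scale L2_inner_scale_right a_def b_def p_def power_mult_distrib)
  have re: "Re (cnj p * p) = (cmod p)\<^sup>2"
    using cmod_power2[of p] by (simp add: power2_eq_square)
  show ?thesis
  proof (cases "b = 0")
    case True
    have "p = 0"
    proof (rule ccontr)
      assume "p \<noteq> 0"
      \<comment> \<open>With this factor the linear term is 2 a^2 + 2, more than the constant term
        a^2 can absorb.\<close>
      define s where "s = (a\<^sup>2 + 1) / (cmod p)\<^sup>2"
      have re_mult: "Re (of_real s * z) = s * Re z" for z by simp
      have "Re (cnj (of_real s * p) * p) = s * (cmod p)\<^sup>2"
        by (simp only: complex_cnj_mult complex_cnj_complex_of_real mult.assoc re_mult re)
      also have "\<dots> = a\<^sup>2 + 1" using \<open>p \<noteq> 0\<close> by (simp add: s_def)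
      finally have e: "Re (cnj (of_real s * p) * p) = a\<^sup>2 + 1" .
      have "0 \<le> a\<^sup>2 - (2 * a\<^sup>2 + 2)" using *[of "of_real s * p"] True unfolding e by simp
      then show False using zero_le_power2[of a] by linarith
    qed
    then show ?thesis using ab by (simp add: p_def a_def b_def)
  next
    case False
    then have b: "b > 0" using ab by simp
    define t where "t = p / of_real (b\<^sup>2)"
    have e1: "Re (cnj t * p) = (cmod p)\<^sup>2 / b\<^sup>2"
    proof -
      have "cnj t * p = (cnj p * p) / of_real (b\<^sup>2)" by (simp add: t_def)
      then show ?thesis by (simp only: Re_divide_of_real re)
    qed
    have e2: "(cmod t)\<^sup>2 * b\<^sup>2 = (cmod p)\<^sup>2 / b\<^sup>2"
      using b by (simp add: t_def norm_divide power_divide power2_eq_square norm_mult)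
    have "(cmod p)\<^sup>2 / b\<^sup>2 \<le> a\<^sup>2" using *[of t] unfolding e1 e2 by simp
    then have "(cmod p)\<^sup>2 \<le> (a * b)\<^sup>2" using b by (simp add: divide_le_eq power_mult_distrib)
    then show ?thesis using ab unfolding p_def a_def b_def
      by (meson mult_nonneg_nonneg power2_le_imp_le L2_norm_nonneg)
  qed
qed

lemma L2_norm_triangle:
  assumes f: "f \<in> L2 M" and g: "g \<in> L2 M"
  shows "L2_norm M (\<lambda>x. f x + g x) \<le> L2_norm M f + L2_norm M g"
proof (rule power2_le_imp_le)
  have "Re (L2_inner M f g) \<le> L2_norm M f * L2_norm M g"
    using L2_Cauchy_Schwarz[OF f g] complex_Re_le_cmod order_trans by blast
  then show "(L2_norm M (\<lambda>x. f x + g x))\<^sup>2 \<le> (L2_norm M f + L2_norm M g)\<^sup>2"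
    unfolding L2_norm_add_sq[OF f g] power2_sum by simp
qed simp

lemma L2_norm_minus_commute: "L2_norm M (\<lambda>x. f x - g x) = L2_norm M (\<lambda>x. g x - f x)"
  by (simp add: L2_norm_def norm_minus_commute)

lemma L2_norm_triangle_diff:
  assumes "f \<in> L2 M" "g \<in> L2 M" "h \<in> L2 M"
  shows "L2_norm M (\<lambda>x. f x - h x) \<le> L2_norm M (\<lambda>x. f x - g x) + L2_norm M (\<lambda>x. g x - h x)"
  using L2_norm_triangle[OF L2_diff[OF assms(1,2)] L2_diff[OF assms(2,3)]] by simp

lemma L2_norm_diff_abs:
  assumes "f \<in> L2 M" "g \<in> L2 M"
  shows "\<bar>L2_norm M f - L2_norm M g\<bar> \<le> L2_norm M (\<lambda>x. f x - g x)"
  using L2_norm_triangle_diff[OF assms(1) assms(2) L2_zero] L2_norm_triangle_diff[OF assms(2) assms(1) L2_zero]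
    L2_norm_minus_commute[of M f g] by simp

lemma L2_norm_diff_tendsto_trans:
  assumes "\<And>n. f n \<in> L2 M" "\<And>n. g n \<in> L2 M" "h \<in> L2 M"
    and "(\<lambda>n. L2_norm M (\<lambda>x. f n x - g n x)) \<longlonglongrightarrow> 0"
    and "(\<lambda>n. L2_norm M (\<lambda>x. g n x - h x)) \<longlonglongrightarrow> 0"
  shows "(\<lambda>n. L2_norm M (\<lambda>x. f n x - h x)) \<longlonglongrightarrow> 0"
proof (rule tendsto_sandwich[OF _ _ tendsto_const])
  show "(\<lambda>n. L2_norm M (\<lambda>x. f n x - g n x) + L2_norm M (\<lambda>x. g n x - h x)) \<longlonglongrightarrow> 0"
    using tendsto_add[OF assms(4,5)] by simp
qed (auto intro!: always_eventually L2_norm_triangle_diff assms)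

lemma L2_inner_tendsto:
  assumes f: "\<And>n. f n \<in> L2 M" "f' \<in> L2 M" and g: "\<And>n. g n \<in> L2 M" "g' \<in> L2 M"
    and lf: "(\<lambda>n. L2_norm M (\<lambda>x. f n x - f' x)) \<longlonglongrightarrow> 0"
    and lg: "(\<lambda>n. L2_norm M (\<lambda>x. g n x - g' x)) \<longlonglongrightarrow> 0"
  shows "(\<lambda>n. L2_inner M (f n) (g n)) \<longlonglongrightarrow> L2_inner M f' g'"
proof -
  define u where "u n = L2_norm M (\<lambda>x. f n x - f' x)" for n
  define v where "v n = L2_norm M (\<lambda>x. g n x - g' x)" for n
  have bound: "cmod (L2_inner M (f n) (g n) - L2_inner M f' g') \<le> u n * (L2_norm M g' + v n) + L2_norm M f' * v n" for n
  proof -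
    have "L2_inner M (f n) (g n) - L2_inner M f' g'
        = L2_inner M (\<lambda>x. f n x - f' x) (g n) + L2_inner M f' (\<lambda>x. g n x - g' x)"
      by (simp add: L2_inner_diff_left L2_inner_diff_right f g)
    also have "cmod \<dots> \<le> cmod (L2_inner M (\<lambda>x. f n x - f' x) (g n)) + cmod (L2_inner M f' (\<lambda>x. g n x - g' x))"
      by (rule norm_triangle_ineq)
    also have "\<dots> \<le> u n * L2_norm M (g n) + L2_norm M f' * v n"
      unfolding u_def v_def by (intro add_mono L2_Cauchy_Schwarz L2_diff f g)
    also have "\<dots> \<le> u n * (L2_norm M g' + v n) + L2_norm M f' * v n"
    proof -
      have "L2_norm M (g n) \<le> L2_norm M g' + v n"
        using L2_norm_diff_abs[OF g(1)[of n] g(2)] by (simp add: v_def)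
      then show ?thesis by (simp add: mult_left_mono u_def)
    qed
    finally show ?thesis .
  qed
  have "(\<lambda>n. u n * (L2_norm M g' + v n) + L2_norm M f' * v n) \<longlonglongrightarrow> 0 * (L2_norm M g' + 0) + L2_norm M f' * 0"
    using lf lg unfolding u_def v_def by (intro tendsto_intros)
  then have "(\<lambda>n. u n * (L2_norm M g' + v n) + L2_norm M f' * v n) \<longlonglongrightarrow> 0" by simp
  then have "(\<lambda>n. L2_inner M (f n) (g n) - L2_inner M f' g') \<longlonglongrightarrow> 0"
    by (rule Lim_null_comparison[rotated, OF _ always_eventually]) (rule allI, rule bound)
  then show ?thesis by (rule LIM_zero_cancel)
qed

text \<open>Elements of \<open>H\<close> are honest functions, not classes. Bounded point
  evaluations (\<open>eval\<close>) turn the seminorm into a norm on \<open>H\<close>, make norm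
  limits pointwise limits, and provide reproducing kernels.\<close>

locale function_hilbert =
  fixes M :: "'a measure" and H :: "('a \<Rightarrow> complex) set"
  assumes sub: "H \<subseteq> L2 M"
    and zero: "(\<lambda>x. 0) \<in> H"
    and add: "f \<in> H \<Longrightarrow> g \<in> H \<Longrightarrow> (\<lambda>x. f x + g x) \<in> H"
    and scale: "f \<in> H \<Longrightarrow> (\<lambda>x. c * f x) \<in> H"
    and eval: "\<exists>C. \<forall>f\<in>H. cmod (f x) \<le> C * L2_norm M f"
    and complete: "(\<And>n. s n \<in> H) \<Longrightarrow>
        (\<And>e. e > 0 \<Longrightarrow> \<exists>N. \<forall>m\<ge>N. \<forall>n\<ge>N. L2_norm M (\<lambda>x. s m x - s n x) < e) \<Longrightarrow>
        \<exists>g\<in>H. (\<lambda>n. L2_norm M (\<lambda>x. s n x - g x)) \<longlonglongrightarrow> 0"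
begin

abbreviation ip where "ip \<equiv> L2_inner M"
abbreviation nm where "nm \<equiv> L2_norm M"

lemma inL2 [simp]: "f \<in> H \<Longrightarrow> f \<in> L2 M"
  using sub by auto

lemma diff: "f \<in> H \<Longrightarrow> g \<in> H \<Longrightarrow> (\<lambda>x. f x - g x) \<in> H"
  using add[OF _ scale[of g "-1"], of f] by simp

lemma norm_zero_imp: "f \<in> H \<Longrightarrow> nm f = 0 \<Longrightarrow> f = (\<lambda>x. 0)"
  using eval by (fastforce simp: fun_eq_iff)

lemma eq_of_inner:
  assumes "f \<in> H" "g \<in> H" and "\<And>h. h \<in> H \<Longrightarrow> ip h f = ip h g"
  shows "f = g"
proof -
  let ?d = "\<lambda>x. f x - g x"
  have d: "?d \<in> H" using diff assms by blast
  have "ip ?d ?d = 0" using assms d by (simp add: L2_inner_diff_right)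
  then have "nm ?d = 0" by (simp add: L2_inner_self)
  from norm_zero_imp[OF d this] show ?thesis by (auto simp: fun_eq_iff)
qed

lemma eq_of_inner_left:
  assumes "f \<in> H" "g \<in> H" and "\<And>h. h \<in> H \<Longrightarrow> ip f h = ip g h"
  shows "f = g"
proof (rule eq_of_inner[OF assms(1,2)])
  fix h assume "h \<in> H"
  then have "cnj (ip f h) = cnj (ip g h)" using assms(3) by simp
  then show "ip h f = ip h g" by (simp add: L2_inner_cnj)
qed

lemma pointwise_limit:
  assumes "\<And>n. s n \<in> H" "g \<in> H" "(\<lambda>n. nm (\<lambda>x. s n x - g x)) \<longlonglongrightarrow> 0"
  shows "(\<lambda>n. s n x) \<longlonglongrightarrow> g x"
proof -
  obtain C where C: "\<forall>f\<in>H. cmod (f x) \<le> C * nm f" using eval by blast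
  have b: "cmod (s n x - g x) \<le> C * nm (\<lambda>x. s n x - g x)" for n
    using bspec[OF C diff[OF assms(1)[of n] assms(2)]] .
  have "(\<lambda>n. C * nm (\<lambda>x. s n x - g x)) \<longlonglongrightarrow> 0"
    using tendsto_mult_left[OF assms(3), of C] by simp
  then have "(\<lambda>n. s n x - g x) \<longlonglongrightarrow> 0"
    by (rule Lim_null_comparison[rotated, OF _ always_eventually]) (rule allI, rule b)
  then show ?thesis by (rule LIM_zero_cancel)
qed

text \<open>The representing vector minimises \<open>\<parallel>h\<parallel>\<^sup>2 - 2 Re (l h)\<close>.\<close>

lemma Riesz:
  assumes ladd: "\<And>f g. f \<in> H \<Longrightarrow> g \<in> H \<Longrightarrow> l (\<lambda>x. f x + g x) = l f + l g"
    and lscale: "\<And>c f. f \<in> H \<Longrightarrow> l (\<lambda>x. c * f x) = c * l f"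
    and lbound: "\<And>f. f \<in> H \<Longrightarrow> cmod (l f) \<le> C * nm f"
  shows "\<exists>g\<in>H. \<forall>h\<in>H. l h = ip h g"
proof -
  define Phi where "Phi h = (nm h)\<^sup>2 - 2 * Re (l h)" for h
  have lower: "Phi h \<ge> - C\<^sup>2" if "h \<in> H" for h
  proof -
    have "Re (l h) \<le> C * nm h"
      using lbound[OF that] complex_Re_le_cmod order_trans by blast
    moreover have "(nm h - C)\<^sup>2 \<ge> 0" by simp
    ultimately show ?thesis unfolding Phi_def power2_diff by (simp add: algebra_simps)
  qed
  define d where "d = Inf (Phi ` H)"
  have bdd: "bdd_below (Phi ` H)" using lower by (intro bdd_belowI[of _ "- C\<^sup>2"]) auto
  have dle: "d \<le> Phi h" if "h \<in> H" for h
    unfolding d_def using bdd that by (auto intro: cINF_lower)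
  have "\<exists>h\<in>H. Phi h < d + 1 / real (Suc n)" for n
  proof -
    have "Inf (Phi ` H) < d + 1 / real (Suc n)" by (simp add: d_def)
    from cInf_lessD[OF _ this] zero show ?thesis by auto
  qed
  then obtain s where sH: "\<And>n. s n \<in> H" and s: "\<And>n. Phi (s n) < d + 1 / real (Suc n)" by metis
  \<comment> \<open>Parallelogram law: \<open>Phi\<close> at the midpoint is at least
    \<open>d\<close>, so almost minimal vectors are close together and a minimising sequence is
    Cauchy.\<close>
  have diff_bound: "(nm (\<lambda>x. f x - g x))\<^sup>2 \<le> 2 * (Phi f - d) + 2 * (Phi g - d)" if f: "f \<in> H" and g: "g \<in> H" for f g
  proof -
    have e: "(\<lambda>x. (1/2) * (f x + g x)) \<in> H" by (intro scale add f g)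
    have "Phi (\<lambda>x. (1/2) * (f x + g x)) = (1/4) * ((nm f)\<^sup>2 + (nm g)\<^sup>2 + 2 * Re (ip f g)) - Re (l f) - Re (l g)"
      unfolding Phi_def lscale[OF add[OF f g]] L2_norm_scale ladd[OF f g]
      using L2_norm_add_sq[OF inL2[OF f] inL2[OF g]]
      by (simp add: power_mult_distrib power2_eq_square field_simps)
    then have "d \<le> (1/4) * ((nm f)\<^sup>2 + (nm g)\<^sup>2 + 2 * Re (ip f g)) - Re (l f) - Re (l g)"
      using dle[OF e] by argo
    then show ?thesis unfolding L2_norm_diff_sq[OF inL2[OF f] inL2[OF g]] Phi_def by argo
  qed
  have "\<exists>N. \<forall>m\<ge>N. \<forall>n\<ge>N. nm (\<lambda>x. s m x - s n x) < e" if "e > 0" for e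
  proof -
    obtain N where N: "1 / real (Suc N) < e\<^sup>2 / 4"
      using \<open>e > 0\<close> nat_approx_posE[of "e\<^sup>2/4"] by auto
    have "nm (\<lambda>x. s m x - s n x) < e" if "m \<ge> N" "n \<ge> N" for m n
    proof (rule power2_less_imp_less)
      have "1 / real (Suc m) \<le> 1 / real (Suc N)" "1 / real (Suc n) \<le> 1 / real (Suc N)"
        using that by (auto simp: frac_le)
      then show "(nm (\<lambda>x. s m x - s n x))\<^sup>2 < e\<^sup>2"
        using diff_bound[OF sH[of m] sH[of n]] s[of m] s[of n] N by argo
    qed (use \<open>e > 0\<close> in simp)
    then show ?thesis by blast
  qed
  from complete[OF sH this] obtain g where g: "g \<in> H"
    and lim: "(\<lambda>n. nm (\<lambda>x. s n x - g x)) \<longlonglongrightarrow> 0"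
    by metis
  have ub: "(\<lambda>n. d + 1 / real (Suc n)) \<longlonglongrightarrow> d"
    using tendsto_add[OF tendsto_const[of d] LIMSEQ_inverse_real_of_nat] by (simp add: inverse_eq_divide)
  have "Phi g \<le> d"
  proof (rule LIMSEQ_le[OF _ ub])
    have "(\<lambda>n. l (s n) - l g) \<longlonglongrightarrow> 0"
    proof (rule Lim_null_comparison[rotated, OF _ always_eventually])
      show "(\<lambda>n. C * nm (\<lambda>x. s n x - g x)) \<longlonglongrightarrow> 0"
        using tendsto_mult_left[OF lim, of C] by simp
      have "l (\<lambda>x. s n x - g x) = l (s n) - l g" for n
        using ladd[OF sH scale[OF g, of "-1"], of n] lscale[OF g, of "-1"] by simp
      then show "\<forall>n. norm (l (s n) - l g) \<le> C * nm (\<lambda>x. s n x - g x)"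
        by (metis lbound diff sH g)
    qed
    then have l1: "(\<lambda>n. l (s n)) \<longlonglongrightarrow> l g" by (rule LIM_zero_cancel)
    have "(\<lambda>n. ip (s n) (s n)) \<longlonglongrightarrow> ip g g"
      by (rule L2_inner_tendsto) (use sH g lim in auto)
    then have "(\<lambda>n. Re (ip (s n) (s n))) \<longlonglongrightarrow> Re (ip g g)" by (rule tendsto_Re)
    then have l2: "(\<lambda>n. (nm (s n))\<^sup>2) \<longlonglongrightarrow> (nm g)\<^sup>2" by (simp add: L2_inner_self)
    show "(\<lambda>n. Phi (s n)) \<longlonglongrightarrow> Phi g"
      unfolding Phi_def by (intro tendsto_intros l1 l2)
    show "\<exists>N. \<forall>n\<ge>N. Phi (s n) \<le> d + 1 / real (Suc n)" using s less_imp_le by blast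
  qed
  then have min: "Phi g \<le> Phi h" if "h \<in> H" for h using dle that order_trans by blast
  \<comment> \<open>First variation at the minimiser \<open>g\<close> along real multiples of
    \<open>h\<close>: a nonzero linear coefficient \<open>a\<close> would make the quadratic in
    \<open>t\<close> negative at a suitable small \<open>t\<close>.\<close>
  have re: "Re (l h) = Re (ip h g)" if h: "h \<in> H" for h
  proof -
    define a where "a = Re (ip h g) - Re (l h)"
    have "0 \<le> 2 * t * a + t\<^sup>2 * (nm h)\<^sup>2" for t :: real
    proof -
      have th: "(\<lambda>x. of_real t * h x) \<in> H" by (rule scale[OF h])
      have "ip g (\<lambda>x. of_real t * h x) = of_real t * cnj (ip h g)"
        by (simp add: L2_inner_scale_right L2_inner_cnj)
      then have "(nm (\<lambda>x. g x + of_real t * h x))\<^sup>2 = (nm g)\<^sup>2 + t\<^sup>2 * (nm h)\<^sup>2 + 2 * t * Re (ip h g)"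
        unfolding L2_norm_add_sq[OF inL2[OF g] inL2[OF th]] L2_norm_scale
        by (simp add: power_mult_distrib)
      moreover have "Re (l (\<lambda>x. g x + of_real t * h x)) = Re (l g) + t * Re (l h)"
        unfolding ladd[OF g th] lscale[OF h] by simp
      ultimately show ?thesis using min[OF add[OF g th]]
        unfolding Phi_def a_def by (simp add: algebra_simps)
    qed
    note quad = this
    have "a = 0"
    proof (rule ccontr)
      assume "a \<noteq> 0"
      define t where "t = - a / ((nm h)\<^sup>2 + 1)"
      define D where "D = (nm h)\<^sup>2 + 1"
      have D: "D > 0" unfolding D_def by (simp add: add_nonneg_pos)
      have "0 \<le> 2 * t * a + t\<^sup>2 * (D - 1)" using quad[of t] by (simp add: D_def)
      also have "\<dots> = - a\<^sup>2 / D - a\<^sup>2 / D\<^sup>2"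
        using D unfolding t_def D_def[symmetric] by (simp add: field_simps power2_eq_square)
      also have "\<dots> < 0" using D \<open>a \<noteq> 0\<close>
        by (smt (verit) divide_pos_pos zero_less_power2 minus_divide_left)
      finally show False by simp
    qed
    then show ?thesis by (simp add: a_def)
  qed
  have "l h = ip h g" if h: "h \<in> H" for h
  proof (rule complex_eqI[OF re[OF h]])
    \<comment> \<open>The real part of \<open>l\<close> at \<open>-\<i> * h\<close> is the imaginary
      part of \<open>l h\<close>, so the real identity gives the complex one.\<close>
    have "Re (l (\<lambda>x. -\<i> * h x)) = Re (ip (\<lambda>x. -\<i> * h x) g)" by (rule re[OF scale[OF h]])
    then show "Im (l h) = Im (ip h g)" unfolding lscale[OF h] L2_inner_scale_left by simp
  qed
  with g show ?thesis by blast
qed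

text \<open>\<open>orthogonal_projection\<close> is a definite description, so both existence and
  uniqueness are required. The projection is the Riesz representative of the functional h ->
  \<open>ip h f\<close>.\<close>

lemma projection:
  assumes "f \<in> L2 M"
  shows "\<exists>!g. g \<in> H \<and> (\<forall>h\<in>H. ip (\<lambda>x. f x - g x) h = 0)"
proof -
  have "\<exists>g\<in>H. \<forall>h\<in>H. ip h f = ip h g"
    by (rule Riesz[of _ "nm f"])
      (auto simp: L2_inner_add_left L2_inner_scale_left assms intro: order_trans[OF L2_Cauchy_Schwarz])
  then obtain g where g: "g \<in> H" "\<And>h. h \<in> H \<Longrightarrow> ip h f = ip h g" by blast
  have iff: "ip (\<lambda>x. f x - k x) h = 0 \<longleftrightarrow> ip h f = ip h k" if "k \<in> H" "h \<in> H" for k h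
  proof -
    have "ip (\<lambda>x. f x - k x) h = cnj (ip h f) - cnj (ip h k)"
      using that by (simp add: L2_inner_diff_left assms L2_inner_cnj)
    then show ?thesis by simp
  qed
  show ?thesis
  proof (rule ex1I[of _ g])
    show "g \<in> H \<and> (\<forall>h\<in>H. ip (\<lambda>x. f x - g x) h = 0)" using g iff by auto
    fix k assume k: "k \<in> H \<and> (\<forall>h\<in>H. ip (\<lambda>x. f x - k x) h = 0)"
    show "k = g"
      by (rule eq_of_inner) (use k g iff in auto)
  qed
qed

abbreviation proj where "proj \<equiv> orthogonal_projection M H"

lemma proj_props:
  assumes "f \<in> L2 M"
  shows proj_in: "proj f \<in> H" and proj_orth: "h \<in> H \<Longrightarrow> ip (\<lambda>x. f x - proj f x) h = 0"
  using theI'[OF projection[OF assms]] unfolding orthogonal_projection_def by auto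

lemma proj_inner: "f \<in> L2 M \<Longrightarrow> h \<in> H \<Longrightarrow> ip (proj f) h = ip f h"
  using proj_orth[of f h] proj_in[of f] by (simp add: L2_inner_diff_left)

lemma proj_norm:
  assumes "f \<in> L2 M" shows "nm (proj f) \<le> nm f"
proof -
  have "ip (proj f) (proj f) = ip f (proj f)" using proj_inner assms proj_in by blast
  then have "(nm (proj f))\<^sup>2 = cmod (ip f (proj f))"
    unfolding L2_inner_self by (metis abs_power2 norm_of_real)
  also have "\<dots> \<le> nm f * nm (proj f)" by (intro L2_Cauchy_Schwarz assms inL2 proj_in)
  finally show ?thesis unfolding power2_eq_square
    by (metis L2_norm_nonneg mult_right_le_imp_le order_le_less)
qed

text \<open>In the usual notation \<open>kern w z\<close> is K(z, w): the index is the point at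
  which functions are evaluated.\<close>

definition kern :: "'a \<Rightarrow> 'a \<Rightarrow> complex" where
  "kern w = (SOME k. k \<in> H \<and> (\<forall>f\<in>H. f w = ip f k))"

lemma kern: "kern w \<in> H \<and> (\<forall>f\<in>H. f w = ip f (kern w))"
proof -
  obtain C where "\<forall>f\<in>H. cmod (f w) \<le> C * nm f" using eval by blast
  then have "\<exists>k\<in>H. \<forall>f\<in>H. f w = ip f k"
    by (intro Riesz[of "\<lambda>f. f w" C]) auto
  then have "\<exists>k. k \<in> H \<and> (\<forall>f\<in>H. f w = ip f k)" by blast
  then show ?thesis unfolding kern_def by (rule someI_ex)
qed

lemma kern_in [simp]: "kern w \<in> H" using kern by blast
lemma reproducing: "f \<in> H \<Longrightarrow> ip f (kern w) = f w" using kern by metis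

lemma kern_cnj: "cnj (kern w z) = kern z w"
  by (metis L2_inner_cnj kern_in reproducing)

text \<open>The linear span of the kernels, generated inductively so that identities between
  additive and (conjugate) homogeneous maps follow by induction from the case of a single
  kernel.\<close>

inductive_set kspan :: "('a \<Rightarrow> complex) set" where
  base: "kern w \<in> kspan"
| sum: "f \<in> kspan \<Longrightarrow> g \<in> kspan \<Longrightarrow> (\<lambda>x. f x + g x) \<in> kspan"
| mult: "f \<in> kspan \<Longrightarrow> (\<lambda>x. c * f x) \<in> kspan"

lemma kspan_H: "f \<in> kspan \<Longrightarrow> f \<in> H"
  by (induction rule: kspan.induct) (auto intro: add scale)

text \<open>The closure \<open>G\<close> of the span is again a space of the same kind, so
  \<open>f\<close> can be projected onto it. The error is orthogonal to every kernel, which means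
  that it vanishes at every point.\<close>

lemma kspan_dense:
  assumes f: "f \<in> H"
  shows "\<exists>s. (\<forall>n. s n \<in> kspan) \<and> (\<lambda>n. nm (\<lambda>x. s n x - f x)) \<longlonglongrightarrow> 0"
proof -
  define G where "G = {f \<in> H. \<exists>s. (\<forall>n. s n \<in> kspan) \<and> (\<lambda>n. nm (\<lambda>x. s n x - f x)) \<longlonglongrightarrow> 0}"
  have GH: "G \<subseteq> H" by (auto simp: G_def)
  have base: "f \<in> G" if "f \<in> kspan" for f
    unfolding G_def using that kspan_H by (auto intro!: exI[of _ "\<lambda>n. f"])
  interpret G: function_hilbert M G
  proof
    show "G \<subseteq> L2 M" using GH by auto
    have "(\<lambda>x. 0 * kern undefined x) \<in> kspan" by (intro kspan.intros)
    then show "(\<lambda>x. 0) \<in> G" using base by simp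
    show "(\<lambda>x. f x + g x) \<in> G" if f: "f \<in> G" and g: "g \<in> G" for f g
    proof -
      obtain s where s: "\<And>n. s n \<in> kspan" "(\<lambda>n. nm (\<lambda>x. s n x - f x)) \<longlonglongrightarrow> 0" using f by (auto simp: G_def)
      obtain t where t: "\<And>n. t n \<in> kspan" "(\<lambda>n. nm (\<lambda>x. t n x - g x)) \<longlonglongrightarrow> 0" using g by (auto simp: G_def)
      have fg: "f \<in> L2 M" "g \<in> L2 M" "\<And>n. s n \<in> L2 M" "\<And>n. t n \<in> L2 M"
        using f g GH s t kspan_H by auto
      have "(\<lambda>n. nm (\<lambda>x. (s n x + t n x) - (f x + g x))) \<longlonglongrightarrow> 0"
      proof (rule tendsto_sandwich[OF _ _ tendsto_const])
        show "(\<lambda>n. nm (\<lambda>x. s n x - f x) + nm (\<lambda>x. t n x - g x)) \<longlonglongrightarrow> 0"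
          using tendsto_add[OF s(2) t(2)] by simp
        have "(\<lambda>x. (s n x + t n x) - (f x + g x)) = (\<lambda>x. (s n x - f x) + (t n x - g x))" for n
          by auto
        then show "\<forall>\<^sub>F n in sequentially. nm (\<lambda>x. (s n x + t n x) - (f x + g x)) \<le> nm (\<lambda>x. s n x - f x) + nm (\<lambda>x. t n x - g x)"
          using L2_norm_triangle[OF L2_diff[OF fg(3,1)] L2_diff[OF fg(4,2)]] by simp
      qed simp
      moreover have "(\<lambda>x. s n x + t n x) \<in> kspan" for n by (intro kspan.intros s t)
      ultimately show ?thesis using f g add by (auto simp: G_def intro!: exI[of _ "\<lambda>n x. s n x + t n x"])
    qed
    show "(\<lambda>x. c * f x) \<in> G" if f: "f \<in> G" for c f
    proof -
      obtain s where s: "\<And>n. s n \<in> kspan" "(\<lambda>n. nm (\<lambda>x. s n x - f x)) \<longlonglongrightarrow> 0" using f by (auto simp: G_def)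
      have "nm (\<lambda>x. c * s n x - c * f x) = cmod c * nm (\<lambda>x. s n x - f x)" for n
        using L2_norm_scale[of M c "\<lambda>x. s n x - f x"] by (simp add: right_diff_distrib)
      then have "(\<lambda>n. nm (\<lambda>x. c * s n x - c * f x)) \<longlonglongrightarrow> 0"
        using tendsto_mult_left[OF s(2), of "cmod c"] by simp
      moreover have "(\<lambda>x. c * s n x) \<in> kspan" for n by (intro kspan.intros s)
      ultimately show ?thesis using f scale by (auto simp: G_def intro!: exI[of _ "\<lambda>n x. c * s n x"])
    qed
    show "\<exists>C. \<forall>f\<in>G. cmod (f x) \<le> C * nm f" for x using eval[of x] GH by blast
    fix s :: "nat \<Rightarrow> 'a \<Rightarrow> complex"
    assume s: "\<And>n. s n \<in> G"
      and c: "\<And>e. e > 0 \<Longrightarrow> \<exists>N. \<forall>m\<ge>N. \<forall>n\<ge>N. nm (\<lambda>x. s m x - s n x) < e"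
    have sH: "s n \<in> H" for n using s GH by auto
    obtain g where g: "g \<in> H" and lim: "(\<lambda>n. nm (\<lambda>x. s n x - g x)) \<longlonglongrightarrow> 0"
      using complete[OF sH c] by blast
    \<comment> \<open>Diagonal choice: each member of the sequence in \<open>G\<close> is replaced
      by an element of the span within 1/(n + 1), so that the same limit is approximated from the
      span.\<close>
    have "\<exists>t\<in>kspan. nm (\<lambda>x. t x - s n x) < 1 / real (Suc n)" for n
    proof -
      obtain t where t: "\<And>k. t k \<in> kspan" "(\<lambda>k. nm (\<lambda>x. t k x - s n x)) \<longlonglongrightarrow> 0"
        using s[of n] by (auto simp: G_def)
      have "\<forall>\<^sub>F k in sequentially. nm (\<lambda>x. t k x - s n x) < 1 / real (Suc n)"
        using t(2) by (rule order_tendstoD) simp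
      then obtain k where "nm (\<lambda>x. t k x - s n x) < 1 / real (Suc n)"
        by (meson eventually_happens trivial_limit_sequentially)
      then show ?thesis using t(1) by blast
    qed
    then obtain t where t: "\<And>n. t n \<in> kspan" "\<And>n. nm (\<lambda>x. t n x - s n x) < 1 / real (Suc n)" by metis
    have "(\<lambda>n. nm (\<lambda>x. t n x - s n x)) \<longlonglongrightarrow> 0"
    proof (rule tendsto_sandwich[OF _ _ tendsto_const])
      show "(\<lambda>n. 1 / real (Suc n)) \<longlonglongrightarrow> 0"
        using LIMSEQ_inverse_real_of_nat by (simp add: inverse_eq_divide)
      show "\<forall>\<^sub>F n in sequentially. nm (\<lambda>x. t n x - s n x) \<le> 1 / real (Suc n)"
        by (intro always_eventually allI less_imp_le t(2))
    qed simp
    then have "(\<lambda>n. nm (\<lambda>x. t n x - g x)) \<longlonglongrightarrow> 0"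
      by (rule L2_norm_diff_tendsto_trans[rotated 3]) (use t kspan_H sH g lim in auto)
    then have "g \<in> G" using g t(1) by (auto simp: G_def)
    then show "\<exists>g\<in>G. (\<lambda>n. nm (\<lambda>x. s n x - g x)) \<longlonglongrightarrow> 0" using lim by blast
  qed
  have fL: "f \<in> L2 M" using f by simp
  have gG: "G.proj f \<in> G" using G.proj_in[OF fL] .
  have gH: "G.proj f \<in> H" using gG GH by auto
  have "f x = G.proj f x" for x
    by (metis G.proj_inner base f fL gH kspan.base reproducing)
  then have "f = G.proj f" by auto
  then have "f \<in> G" using gG by simp
  then show ?thesis by (auto simp: G_def)
qed

abbreviation bops where "bops \<equiv> bounded_operators M H"

lemma bopsD:
  assumes "T \<in> bops"
  shows bops_in: "f \<in> H \<Longrightarrow> T f \<in> H"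
    and bops_add: "f \<in> H \<Longrightarrow> g \<in> H \<Longrightarrow> T (\<lambda>x. f x + g x) = (\<lambda>x. T f x + T g x)"
    and bops_scale: "f \<in> H \<Longrightarrow> T (\<lambda>x. c * f x) = (\<lambda>x. c * T f x)"
    and bops_ext: "T \<in> extensional H"
  using assms by (auto simp: bounded_operators_def PiE_def)

lemma bops_bound:
  assumes "T \<in> bops"
  obtains C where "C \<ge> 0" "\<And>f. f \<in> H \<Longrightarrow> nm (T f) \<le> C * nm f"
proof -
  obtain C where C: "\<forall>f\<in>H. nm (T f) \<le> C * nm f"
    using assms by (auto simp: bounded_operators_def)
  have "nm (T f) \<le> max C 0 * nm f" if "f \<in> H" for f
    using C that by (meson L2_norm_nonneg max.cobounded1 mult_right_mono order_trans)
  then show ?thesis using that[of "max C 0"] by auto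
qed

lemma bops_diff:
  assumes "T \<in> bops" "f \<in> H" "g \<in> H"
  shows "T (\<lambda>x. f x - g x) = (\<lambda>x. T f x - T g x)"
  using bops_add[OF assms(1,2) scale[OF assms(3), of "-1"]] bops_scale[OF assms(1,3), of "-1"]
  by simp

lemma bopsI:
  assumes "T \<in> extensional H" "\<And>f. f \<in> H \<Longrightarrow> T f \<in> H"
    and "\<And>f g. f \<in> H \<Longrightarrow> g \<in> H \<Longrightarrow> T (\<lambda>x. f x + g x) = (\<lambda>x. T f x + T g x)"
    and "\<And>c f. f \<in> H \<Longrightarrow> T (\<lambda>x. c * f x) = (\<lambda>x. c * T f x)"
    and "\<And>f. f \<in> H \<Longrightarrow> nm (T f) \<le> C * nm f"
  shows "T \<in> bops"
  unfolding bounded_operators_def PiE_def using assms by (simp add: Pi_iff) blast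

lemma bops_tendsto:
  assumes T: "T \<in> bops" and s: "\<And>n. s n \<in> H" and f: "f \<in> H"
    and lim: "(\<lambda>n. nm (\<lambda>x. s n x - f x)) \<longlonglongrightarrow> 0"
  shows "(\<lambda>n. nm (\<lambda>x. T (s n) x - T f x)) \<longlonglongrightarrow> 0"
proof -
  obtain C where C: "\<And>f. f \<in> H \<Longrightarrow> nm (T f) \<le> C * nm f" using bops_bound[OF T] by blast
  show ?thesis
  proof (rule tendsto_sandwich[OF _ _ tendsto_const])
    show "(\<lambda>n. C * nm (\<lambda>x. s n x - f x)) \<longlonglongrightarrow> 0" using tendsto_mult_left[OF lim, of C] by simp
    show "\<forall>\<^sub>F n in sequentially. nm (\<lambda>x. T (s n) x - T f x) \<le> C * nm (\<lambda>x. s n x - f x)"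
      using C[OF diff[OF s f]] by (simp add: bops_diff[OF T s f])
  qed simp
qed

text \<open>\<open>S g\<close> is the Riesz representative of f -> \<open>ip (T f) g\<close>;
  linearity and the bound for \<open>S\<close> come from uniqueness of representatives and
  Cauchy-Schwarz.\<close>

lemma adjoint_exists:
  assumes T: "T \<in> bops"
  shows "\<exists>S\<in>bops. is_adjoint M H T S"
proof -
  obtain C where C0: "C \<ge> 0" and C: "\<And>f. f \<in> H \<Longrightarrow> nm (T f) \<le> C * nm f"
    using bops_bound[OF T] by blast
  have CS: "cmod (ip (T f) g) \<le> (C * nm f) * nm g" if "f \<in> H" "g \<in> H" for f g
  proof -
    have "cmod (ip (T f) g) \<le> nm (T f) * nm g"
      by (intro L2_Cauchy_Schwarz inL2 bops_in[OF T] that)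
    also have "\<dots> \<le> (C * nm f) * nm g" by (intro mult_right_mono C that) simp
    finally show ?thesis .
  qed
  have "\<exists>k\<in>H. \<forall>f\<in>H. ip (T f) g = ip f k" if g: "g \<in> H" for g
  proof (rule Riesz[of _ "C * nm g"])
    show "ip (T (\<lambda>x. f x + h x)) g = ip (T f) g + ip (T h) g" if "f \<in> H" "h \<in> H" for f h
      using that g by (simp add: bops_add[OF T] L2_inner_add_left bops_in[OF T])
    show "ip (T (\<lambda>x. c * f x)) g = c * ip (T f) g" if "f \<in> H" for c f
      using that g by (simp add: bops_scale[OF T] L2_inner_scale_left)
    show "cmod (ip (T f) g) \<le> C * nm g * nm f" if "f \<in> H" for f
      using CS[OF that g] by (simp add: mult_ac)
  qed
  then obtain S where S: "\<And>g. g \<in> H \<Longrightarrow> S g \<in> H" "\<And>f g. f \<in> H \<Longrightarrow> g \<in> H \<Longrightarrow> ip (T f) g = ip f (S g)"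
    by metis
  define S' where "S' = restrict S H"
  have S': "\<And>g. g \<in> H \<Longrightarrow> S' g \<in> H" "\<And>f g. f \<in> H \<Longrightarrow> g \<in> H \<Longrightarrow> ip (T f) g = ip f (S' g)"
    using S by (auto simp: S'_def)
  have "S' \<in> bops"
  proof (rule bopsI[of _ C])
    show "S' \<in> extensional H" by (simp add: S'_def)
    show "S' (\<lambda>x. f x + g x) = (\<lambda>x. S' f x + S' g x)" if "f \<in> H" "g \<in> H" for f g
      by (rule eq_of_inner) (use that S' add in \<open>auto simp: L2_inner_add_right bops_in[OF T] simp flip: S'(2)\<close>)
    show "S' (\<lambda>x. c * f x) = (\<lambda>x. c * S' f x)" if "f \<in> H" for c f
      by (rule eq_of_inner) (use that S' scale in \<open>auto simp: L2_inner_scale_right simp flip: S'(2)\<close>)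
    show "nm (S' g) \<le> C * nm g" if g: "g \<in> H" for g
    proof -
      have "ip (T (S' g)) g = ip (S' g) (S' g)" using S' g by blast
      then have "(nm (S' g))\<^sup>2 = cmod (ip (T (S' g)) g)"
        by (simp only: L2_inner_self norm_of_real abs_power2)
      also have "\<dots> \<le> (C * nm g) * nm (S' g)" using CS[OF S'(1)[OF g] g] by (simp add: mult_ac)
      finally show ?thesis unfolding power2_eq_square
        by (metis C0 L2_norm_nonneg mult_nonneg_nonneg mult_right_le_imp_le order_le_less)
    qed
  qed (use S' in auto)
  then show ?thesis using S'(2) by (auto simp: is_adjoint_def)
qed

text \<open>The kernels span a dense subspace, and boundedness together with point evaluations
  carries the equality to limits.\<close>

lemma bops_eqI:
  assumes S: "S \<in> bops" and T: "T \<in> bops" and eq: "\<And>w. S (kern w) = T (kern w)"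
  shows "S = T"
proof (rule extensionalityI[OF bops_ext[OF S] bops_ext[OF T]])
  fix f assume f: "f \<in> H"
  have k: "S g = T g" if "g \<in> kspan" for g
    using that by (induction rule: kspan.induct)
      (simp_all add: eq bops_add[OF S] bops_add[OF T] bops_scale[OF S] bops_scale[OF T] kspan_H)
  obtain s where s: "\<And>n. s n \<in> kspan" "(\<lambda>n. nm (\<lambda>x. s n x - f x)) \<longlonglongrightarrow> 0"
    using kspan_dense[OF f] by blast
  note sH = kspan_H[OF s(1)]
  have "S f x = T f x" for x
  proof (rule LIMSEQ_unique)
    show "(\<lambda>n. S (s n) x) \<longlonglongrightarrow> S f x"
      by (rule pointwise_limit) (use bops_in[OF S] sH f bops_tendsto[OF S sH f s(2)] in auto)
    show "(\<lambda>n. S (s n) x) \<longlonglongrightarrow> T f x" unfolding k[OF s(1)]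
      by (rule pointwise_limit) (use bops_in[OF T] sH f bops_tendsto[OF T sH f s(2)] in auto)
  qed
  then show "S f = T f" by auto
qed

lemma compose_bops:
  assumes "S \<in> bops" "T \<in> bops" shows "compose H S T \<in> bops"
proof -
  obtain C where C: "C \<ge> 0" "\<And>f. f \<in> H \<Longrightarrow> nm (S f) \<le> C * nm f" using bops_bound[OF assms(1)] by blast
  obtain D where D: "\<And>f. f \<in> H \<Longrightarrow> nm (T f) \<le> D * nm f" using bops_bound[OF assms(2)] by blast
  have "nm (S (T f)) \<le> (C * D) * nm f" if "f \<in> H" for f
    using C(2)[OF bops_in[OF assms(2) that]] mult_left_mono[OF D[OF that] C(1)] by (simp add: mult.assoc)
  then show ?thesis
    by (intro bopsI[of _ "C * D"])
      (auto simp: compose_def add scale bops_in[OF assms(1)] bops_in[OF assms(2)] bops_add[OF assms(1)]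
        bops_add[OF assms(2)] bops_scale[OF assms(1)] bops_scale[OF assms(2)])
qed

end

section \<open>Commutants and the criterion for their commutativity\<close>

context function_hilbert
begin

definition commutant :: "(('a \<Rightarrow> complex) \<Rightarrow> 'a \<Rightarrow> complex) set \<Rightarrow> (('a \<Rightarrow> complex) \<Rightarrow> 'a \<Rightarrow> complex) set" where
  "commutant \<U> = {T \<in> bops. \<forall>U\<in>\<U>. \<forall>f\<in>H. T (U f) = U (T f)}"

lemma restrict_bops: "(\<lambda>f\<in>H. f) \<in> bops"
  by (rule bopsI[of _ 1]) (auto simp: add scale)

text \<open>The adjoint of \<open>U\<close> is required in the family only up to a scalar, because
  the operators to which this is applied are multiples of unitaries. Such a scalar cancels in the
  commutation relation.\<close>

lemma commutant_cstar:
  assumes UH: "\<And>U f. U \<in> \<U> \<Longrightarrow> f \<in> H \<Longrightarrow> U f \<in> H"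
    and Uadd: "\<And>U f g. U \<in> \<U> \<Longrightarrow> U (\<lambda>x. f x + g x) = (\<lambda>x. U f x + U g x)"
    and Uscale: "\<And>U c f. U \<in> \<U> \<Longrightarrow> U (\<lambda>x. c * f x) = (\<lambda>x. c * U f x)"
    and Ubound: "\<And>U. U \<in> \<U> \<Longrightarrow> \<exists>C. \<forall>f\<in>H. nm (U f) \<le> C * nm f"
    and Uadj: "\<And>U. U \<in> \<U> \<Longrightarrow> \<exists>U'\<in>\<U>. \<exists>a. \<forall>f\<in>H. \<forall>g\<in>H. ip (U f) g = a * ip f (U' g)"
  shows "cstar_subalgebra M H (commutant \<U>)"
proof -
  have U0: "U (\<lambda>x. 0) = (\<lambda>x. 0)" if "U \<in> \<U>" for U
    using Uscale[OF that, of 0 "\<lambda>x. 0"] by simp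
  have c1: "commutant \<U> \<subseteq> bops" by (auto simp: commutant_def)
  have c2: "(\<lambda>f\<in>H. \<lambda>x. 0) \<in> commutant \<U>"
    unfolding commutant_def by (auto intro!: bopsI[of _ 0] simp: add scale zero UH U0)
  have c3: "(\<lambda>f\<in>H. \<lambda>x. S f x + T f x) \<in> commutant \<U>" if "S \<in> commutant \<U>" "T \<in> commutant \<U>" for S T
  proof -
    have S: "S \<in> bops" and T: "T \<in> bops" using that by (auto simp: commutant_def)
    obtain C where C: "\<And>f. f \<in> H \<Longrightarrow> nm (S f) \<le> C * nm f" using bops_bound[OF S] by blast
    obtain D where D: "\<And>f. f \<in> H \<Longrightarrow> nm (T f) \<le> D * nm f" using bops_bound[OF T] by blast
    have "nm (\<lambda>x. S f x + T f x) \<le> (C + D) * nm f" if "f \<in> H" for f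
      using L2_norm_triangle[OF inL2[OF bops_in[OF S that]] inL2[OF bops_in[OF T that]]] C[OF that] D[OF that]
      by (simp add: distrib_right)
    then have "(\<lambda>f\<in>H. \<lambda>x. S f x + T f x) \<in> bops"
      by (intro bopsI[of _ "C + D"])
        (auto simp: add scale bops_in[OF S] bops_in[OF T] bops_add[OF S] bops_add[OF T] bops_scale[OF S] bops_scale[OF T]
          distrib_left)
    then show ?thesis using that by (auto simp: commutant_def UH Uadd)
  qed
  have c4: "(\<lambda>f\<in>H. \<lambda>x. c * T f x) \<in> commutant \<U>" if "T \<in> commutant \<U>" for c T
  proof -
    have T: "T \<in> bops" using that by (auto simp: commutant_def)
    obtain D where D: "\<And>f. f \<in> H \<Longrightarrow> nm (T f) \<le> D * nm f" using bops_bound[OF T] by blast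
    have "nm (\<lambda>x. c * T f x) \<le> (cmod c * D) * nm f" if "f \<in> H" for f
      using mult_left_mono[OF D[OF that], of "cmod c"] by (simp add: L2_norm_scale mult.assoc)
    then have "(\<lambda>f\<in>H. \<lambda>x. c * T f x) \<in> bops"
      by (intro bopsI[of _ "cmod c * D"])
        (auto simp: add scale bops_in[OF T] bops_add[OF T] bops_scale[OF T] distrib_left)
    then show ?thesis using that by (auto simp: commutant_def UH Uscale)
  qed
  have c5: "compose H S T \<in> commutant \<U>" if "S \<in> commutant \<U>" "T \<in> commutant \<U>" for S T
    using that compose_bops[of S T] bops_in[of T] by (auto simp: commutant_def compose_def UH)
  have c6: "S \<in> commutant \<U>" if T: "T \<in> commutant \<U>" and S: "S \<in> bops" and adj: "is_adjoint M H T S" for S T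
  proof -
    have Tb: "T \<in> bops" using T by (auto simp: commutant_def)
    have "S (U g) = U (S g)" if U: "U \<in> \<U>" and g: "g \<in> H" for U g
    proof (rule eq_of_inner)
      obtain U' a where U': "U' \<in> \<U>" and a: "\<And>f g. f \<in> H \<Longrightarrow> g \<in> H \<Longrightarrow> ip (U f) g = a * ip f (U' g)"
        using Uadj[OF U] by blast
      have a': "ip g (U f) = cnj a * ip (U' g) f" if "f \<in> H" "g \<in> H" for f g
        by (metis L2_inner_cnj a complex_cnj_mult that)
      fix f assume f: "f \<in> H"
      have "ip f (S (U g)) = ip (T f) (U g)" using adj f g UH U by (simp add: is_adjoint_def)
      also have "\<dots> = cnj a * ip (T (U' f)) g"
        using a' f g bops_in[OF Tb] T U' by (simp add: commutant_def)
      also have "\<dots> = cnj a * ip (U' f) (S g)" using adj f g UH U' by (simp add: is_adjoint_def)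
      also have "\<dots> = ip f (U (S g))" using a' f g bops_in[OF S] by simp
      finally show "ip f (S (U g)) = ip f (U (S g))" .
    qed (use UH bops_in[OF S] that in auto)
    then show ?thesis using S by (simp add: commutant_def)
  qed
  have c7: "T \<in> commutant \<U>"
    if T: "T \<in> bops" and approx: "\<forall>e>0. \<exists>S\<in>commutant \<U>. \<forall>f\<in>H. nm (\<lambda>x. T f x - S f x) \<le> e * nm f" for T
  proof -
    have "T (U f) = U (T f)" if U: "U \<in> \<U>" and f: "f \<in> H" for U f
    proof -
      obtain C0 where C0: "\<forall>f\<in>H. nm (U f) \<le> C0 * nm f" using Ubound[OF U] by blast
      define C where "C = max C0 0"
      have C: "nm (U f) \<le> C * nm f" if "f \<in> H" for f
        using C0 that unfolding C_def by (meson L2_norm_nonneg max.cobounded1 mult_right_mono order_trans)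
      have C_nn: "C \<ge> 0" by (simp add: C_def)
      have in1: "T (U f) \<in> H" "U (T f) \<in> H" using UH bops_in[OF T] U f by auto
      \<comment> \<open>If \<open>S\<close> commutes with \<open>U\<close> and is within
        \<open>e\<close> of \<open>T\<close>, replacing \<open>T\<close> by \<open>S\<close> costs
        at most \<open>e * C * nm f\<close> on each side, where \<open>C\<close> bounds
        \<open>U\<close>.\<close>
      have "nm (\<lambda>x. T (U f) x - U (T f) x) \<le> e * (2 * C * nm f)" if "e > 0" for e
      proof -
        obtain S where S: "S \<in> commutant \<U>" and SB: "\<And>f. f \<in> H \<Longrightarrow> nm (\<lambda>x. T f x - S f x) \<le> e * nm f"
          using approx \<open>e > 0\<close> by blast
        have Sb: "S \<in> bops" and SU: "S (U f) = U (S f)" using S U f by (auto simp: commutant_def)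
        have d: "(\<lambda>x. T f x - S f x) \<in> H" using diff bops_in Sb T f by blast
        have Ud: "U (\<lambda>x. T f x - S f x) = (\<lambda>x. U (T f) x - U (S f) x)"
          using Uadd[OF U, of "T f" "\<lambda>x. -1 * S f x"] Uscale[OF U, of "-1" "S f"] by simp
        have "nm (\<lambda>x. T (U f) x - U (T f) x) \<le> nm (\<lambda>x. T (U f) x - S (U f) x) + nm (\<lambda>x. S (U f) x - U (T f) x)"
          by (rule L2_norm_triangle_diff) (use UH bops_in[OF T] bops_in[OF Sb] U f in auto)
        also have "nm (\<lambda>x. S (U f) x - U (T f) x) = nm (U (\<lambda>x. T f x - S f x))"
          unfolding Ud SU by (rule L2_norm_minus_commute)
        also have "nm (\<lambda>x. T (U f) x - S (U f) x) \<le> e * nm (U f)" by (rule SB[OF UH[OF U f]])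
        also have "\<dots> \<le> e * (C * nm f)" using C[OF f] \<open>e > 0\<close> by (intro mult_left_mono) auto
        also have "nm (U (\<lambda>x. T f x - S f x)) \<le> C * nm (\<lambda>x. T f x - S f x)" by (rule C[OF d])
        also have "\<dots> \<le> C * (e * nm f)" by (intro mult_left_mono SB f C_nn)
        finally show ?thesis by (simp add: mult_ac)
      qed
      note small = this
      have "nm (\<lambda>x. T (U f) x - U (T f) x) = 0"
      proof (rule ccontr)
        assume "nm (\<lambda>x. T (U f) x - U (T f) x) \<noteq> 0"
        then have pos: "nm (\<lambda>x. T (U f) x - U (T f) x) > 0" by (simp add: order_less_le)
        define K where "K = 2 * C * nm f + 1"
        have K: "K > 0" using C_nn by (simp add: K_def add_nonneg_pos)
        define e where "e = nm (\<lambda>x. T (U f) x - U (T f) x) / K"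
        have "e > 0" using pos K by (simp add: e_def)
        have "nm (\<lambda>x. T (U f) x - U (T f) x) \<le> e * (2 * C * nm f)" by (rule small[OF \<open>e > 0\<close>])
        also have "\<dots> < e * K" using \<open>e > 0\<close> by (simp add: K_def)
        also have "\<dots> = nm (\<lambda>x. T (U f) x - U (T f) x)" using K by (simp add: e_def)
        finally show False by simp
      qed
      from norm_zero_imp[OF diff[OF in1] this] show ?thesis by (auto simp: fun_eq_iff)
    qed
    then show ?thesis using T by (simp add: commutant_def)
  qed
  show ?thesis unfolding cstar_subalgebra_def
    by (intro conjI ballI allI impI)
      (rule c1 | rule c2 | rule c3, assumption+ | rule c4, assumption | rule c5, assumption+
        | rule c6, assumption+ | rule c7, assumption+)+
qed

text \<open>The antiunitary \<open>J\<close> satisfies \<open>T J = J T\<^sup>*\<close> for all \<open>T\<close> in the algebra, whence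
  \<open>S T J = J (T S)\<^sup>* = T S J\<close>.\<close>

lemma commute_of_symmetric_kernels:
  fixes \<sigma> :: "'a \<Rightarrow> 'a" and m :: "'a \<Rightarrow> complex"
  assumes vanish: "\<And>f x. f \<in> H \<Longrightarrow> x \<notin> D \<Longrightarrow> f x = 0"
    and A: "\<A> \<subseteq> bops" "(\<lambda>f\<in>H. f) \<in> \<A>"
    and Acomp: "\<And>S T. S \<in> \<A> \<Longrightarrow> T \<in> \<A> \<Longrightarrow> compose H S T \<in> \<A>"
    and Aadj: "\<And>S T. T \<in> \<A> \<Longrightarrow> S \<in> bops \<Longrightarrow> is_adjoint M H T S \<Longrightarrow> S \<in> \<A>"
    and \<sigma>: "\<And>z. z \<in> D \<Longrightarrow> \<sigma> z \<in> D" "\<And>z. z \<in> D \<Longrightarrow> \<sigma> (\<sigma> z) = z"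
    and m: "\<And>z. z \<in> D \<Longrightarrow> m z \<noteq> 0"
    and sym: "\<And>T z w. T \<in> \<A> \<Longrightarrow> z \<in> D \<Longrightarrow> w \<in> D \<Longrightarrow>
       T (kern w) z = m z * cnj (m w) * T (kern (\<sigma> z)) (\<sigma> w)"
    and ST: "S \<in> \<A>" "T \<in> \<A>"
  shows "compose H S T = compose H T S"
proof -
  \<comment> \<open>\<open>J f\<close> is at first only a function. That \<open>J\<close> maps into
    \<open>H\<close> is shown on kernels, then on their span, and finally on all of \<open>H\<close>
    by isometry and pointwise limits.\<close>
  define J where "J f = (\<lambda>z. if z \<in> D then m z * cnj (f (\<sigma> z)) else 0)" for f :: "'a \<Rightarrow> complex"
  have Jadd: "J (\<lambda>x. f x + g x) = (\<lambda>x. J f x + J g x)" for f g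
    by (auto simp: J_def algebra_simps)
  have Jscale: "J (\<lambda>x. c * f x) = (\<lambda>x. cnj c * J f x)" for c f
    by (auto simp: J_def algebra_simps)
  have J0: "J (\<lambda>x. 0) = (\<lambda>x. 0)" by (auto simp: J_def)
  have kern0: "kern v = (\<lambda>x. 0)" if "v \<notin> D" for v
    using kern_cnj[of v] vanish[OF kern_in that] by (metis complex_cnj_zero_iff)
  have Jkern: "J (kern v) = (\<lambda>x. (1 / cnj (m (\<sigma> v))) * kern (\<sigma> v) x)" if v: "v \<in> D" for v
  proof
    fix z
    show "J (kern v) z = (1 / cnj (m (\<sigma> v))) * kern (\<sigma> v) z"
    proof (cases "z \<in> D")
      case True
      \<comment> \<open>The kernel symmetry applied to the identity operator: up to a constant,
        \<open>J\<close> sends the kernel at \<open>v\<close> to the kernel at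
        \<open>\<sigma> v\<close>.\<close>
      have "kern (\<sigma> v) z = m z * cnj (m (\<sigma> v)) * kern (\<sigma> z) v"
        using sym[OF A(2) True \<sigma>(1)[OF v]] \<sigma> v by simp
      then show ?thesis using True m[OF \<sigma>(1)[OF v]] by (simp add: J_def kern_cnj)
    qed (simp add: J_def vanish)
  qed
  have Jspan: "J f \<in> H" if "f \<in> kspan" for f
    using that
  proof (induction rule: kspan.induct)
    case (base w)
    show ?case
    proof (cases "w \<in> D")
      case True
      then show ?thesis unfolding Jkern[OF True] by (intro scale kern_in)
    next
      case False
      show ?thesis unfolding kern0[OF False] J0 by (rule zero)
    qed
  qed (simp_all add: Jadd Jscale add scale)
  \<comment> \<open>On kernels this is the symmetry hypothesis \<open>sym\<close>. Both sides are
    linear in \<open>g\<close> and conjugate linear in \<open>f\<close>, so it extends to the span;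
    with \<open>T\<close> the identity it says that \<open>J\<close> is antiunitary.\<close>
  have key: "ip (T (J f)) (J g) = ip (T g) f" if "T \<in> \<A>" "f \<in> kspan" "g \<in> kspan" for T f g
  proof -
    have T: "T \<in> bops" using that A by auto
    have T0: "T (\<lambda>x. 0) = (\<lambda>x. 0)" using bops_scale[OF T zero, of 0] by simp
    have base: "ip (T (J (kern w))) (J (kern z)) = ip (T (kern z)) (kern w)" for w z
    proof (cases "w \<in> D \<and> z \<in> D")
      case True
      then have w: "w \<in> D" and z: "z \<in> D" by auto
      have "ip (T (J (kern w))) (J (kern z))
          = (1 / cnj (m (\<sigma> w))) * (1 / m (\<sigma> z)) * T (kern (\<sigma> w)) (\<sigma> z)"
        unfolding Jkern[OF w] Jkern[OF z] bops_scale[OF T kern_in]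
          L2_inner_scale_left L2_inner_scale_right by (simp add: reproducing bops_in[OF T])
      also have "\<dots> = T (kern z) w"
        using sym[OF \<open>T \<in> \<A>\<close> \<sigma>(1)[OF z] \<sigma>(1)[OF w]] m \<sigma> z w by simp
      also have "\<dots> = ip (T (kern z)) (kern w)" by (simp add: reproducing bops_in[OF T])
      finally show ?thesis .
    next
      case False
      then show ?thesis using kern0[of w] kern0[of z] by (auto simp: T0 J0)
    qed
    note TH = bops_in[OF T] and k = kspan_H
    have step: "ip (T (J (kern w))) (J g) = ip (T g) (kern w)" if "g \<in> kspan" for w g
      using that
    proof (induction rule: kspan.induct)
      case (sum f g)
      then show ?case
        by (simp add: Jadd bops_add[OF T] L2_inner_add_left L2_inner_add_right TH k Jspan kspan.base)
    next
      case (mult f c)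
      then show ?case by (simp add: Jscale bops_scale[OF T] L2_inner_scale_left L2_inner_scale_right TH k Jspan)
    qed (rule base)
    show ?thesis using \<open>f \<in> kspan\<close>
    proof (induction rule: kspan.induct)
      case (sum f1 f2)
      then show ?case using that(3)
        by (simp add: Jadd bops_add[OF T] L2_inner_add_left L2_inner_add_right TH k Jspan)
    next
      case (mult f c)
      then show ?case using that(3)
        by (simp add: Jscale bops_scale[OF T] L2_inner_scale_left L2_inner_scale_right TH k Jspan)
    qed (rule step[OF that(3)])
  qed
  have Jnorm: "nm (J f) = nm f" if "f \<in> kspan" for f
  proof -
    have "ip (J f) (J f) = ip f f" using key[OF A(2) that that] by (simp add: Jspan kspan_H that)
    then have "(nm (J f))\<^sup>2 = (nm f)\<^sup>2" unfolding L2_inner_self of_real_eq_iff .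
    then show ?thesis by simp
  qed
  have Jdiff: "J (\<lambda>x. f x - g x) = (\<lambda>x. J f x - J g x)" for f g
    by (auto simp: J_def algebra_simps)
  have Jlim: "J f \<in> H \<and> (\<lambda>n. nm (\<lambda>x. J (s n) x - J f x)) \<longlonglongrightarrow> 0"
    if f: "f \<in> H" and s: "\<And>n. s n \<in> kspan" and lim: "(\<lambda>n. nm (\<lambda>x. s n x - f x)) \<longlonglongrightarrow> 0" for f s
  proof -
    \<comment> \<open>\<open>J\<close> is isometric on the span, so the images again form a Cauchy
      sequence; its limit is identified with \<open>J f\<close> by comparing values at each
      point.\<close>
    have isom: "nm (\<lambda>x. J (s p) x - J (s n) x) = nm (\<lambda>x. s p x - s n x)" for p n
      using Jnorm[OF kspan.sum[OF s[of p] kspan.mult[OF s[of n], of "-1"]]] by (simp add: Jdiff)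
    have "\<exists>N. \<forall>p\<ge>N. \<forall>n\<ge>N. nm (\<lambda>x. J (s p) x - J (s n) x) < e" if "e > 0" for e
    proof -
      have "\<forall>\<^sub>F n in sequentially. nm (\<lambda>x. s n x - f x) < e / 2"
        using lim by (rule order_tendstoD) (use \<open>e > 0\<close> in simp)
      then obtain N where N: "\<And>n. n \<ge> N \<Longrightarrow> nm (\<lambda>x. s n x - f x) < e / 2"
        by (auto simp: eventually_sequentially)
      have "nm (\<lambda>x. J (s p) x - J (s n) x) < e" if "p \<ge> N" "n \<ge> N" for p n
      proof -
        have "nm (\<lambda>x. s p x - s n x) \<le> nm (\<lambda>x. s p x - f x) + nm (\<lambda>x. f x - s n x)"
          by (rule L2_norm_triangle_diff) (use s kspan_H f in auto)
        then show ?thesis using N[OF that(1)] N[OF that(2)] L2_norm_minus_commute[of M f "s n"] isom by simp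
      qed
      then show ?thesis by blast
    qed
    from complete[OF Jspan[OF s] this] obtain g
      where g: "g \<in> H" "(\<lambda>n. nm (\<lambda>x. J (s n) x - g x)) \<longlonglongrightarrow> 0" by metis
    have "J f x = g x" for x
    proof (rule LIMSEQ_unique)
      show "(\<lambda>n. J (s n) x) \<longlonglongrightarrow> g x" by (rule pointwise_limit[OF Jspan[OF s] g])
      have "(\<lambda>n. s n (\<sigma> x)) \<longlonglongrightarrow> f (\<sigma> x)" by (rule pointwise_limit[OF kspan_H[OF s] f lim])
      then have "(\<lambda>n. m x * cnj (s n (\<sigma> x))) \<longlonglongrightarrow> m x * cnj (f (\<sigma> x))" by (intro tendsto_intros)
      then show "(\<lambda>n. J (s n) x) \<longlonglongrightarrow> J f x" by (simp add: J_def)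
    qed
    then have "J f = g" by auto
    then show ?thesis using g by simp
  qed
  have JH: "J f \<in> H" if "f \<in> H" for f
    using kspan_dense[OF that] Jlim[OF that] by blast
  have keyH: "ip (T (J f)) (J g) = ip (T g) f" if TA: "T \<in> \<A>" and f: "f \<in> H" and g: "g \<in> H" for T f g
  proof -
    have T: "T \<in> bops" using TA A by auto
    obtain s where s: "\<And>n. s n \<in> kspan" "(\<lambda>n. nm (\<lambda>x. s n x - f x)) \<longlonglongrightarrow> 0" using kspan_dense[OF f] by blast
    obtain t where t: "\<And>n. t n \<in> kspan" "(\<lambda>n. nm (\<lambda>x. t n x - g x)) \<longlonglongrightarrow> 0" using kspan_dense[OF g] by blast
    note sH = kspan_H[OF s(1)] and tH = kspan_H[OF t(1)]
    note J1 = Jlim[OF f s(1) s(2), THEN conjunct2] and J2 = Jlim[OF g t(1) t(2), THEN conjunct2]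
    have "(\<lambda>n. ip (T (J (s n))) (J (t n))) \<longlonglongrightarrow> ip (T (J f)) (J g)"
      using bops_tendsto[OF T Jspan[OF s(1)] JH[OF f] J1] J2
      by (intro L2_inner_tendsto) (simp_all add: bops_in[OF T] JH f g sH tH)
    moreover have "(\<lambda>n. ip (T (t n)) (s n)) \<longlonglongrightarrow> ip (T g) f"
      using bops_tendsto[OF T tH g t(2)] s(2)
      by (intro L2_inner_tendsto) (simp_all add: bops_in[OF T] f g sH tH)
    then have "(\<lambda>n. ip (T (J (s n))) (J (t n))) \<longlonglongrightarrow> ip (T g) f"
      by (simp add: key[OF TA s(1) t(1)])
    ultimately show ?thesis by (rule LIMSEQ_unique)
  qed
  have TJ: "T (J f) = J (T' f)"
    if TA: "T \<in> \<A>" and T': "T' \<in> bops" "is_adjoint M H T T'" and f: "f \<in> H" for T T' f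
  proof
    have T: "T \<in> bops" using TA A by auto
    fix u
    show "T (J f) u = J (T' f) u"
    proof (cases "u \<in> D")
      case True
      have eq: "ip (T (J f)) (J g) = ip (J (T' f)) (J g)" if g: "g \<in> H" for g
      proof -
        have "ip (T (J f)) (J g) = ip (T g) f" by (rule keyH[OF TA f g])
        also have "\<dots> = ip g (T' f)" using T'(2) f g by (simp add: is_adjoint_def)
        also have "\<dots> = ip (J (T' f)) (J g)"
          using keyH[OF A(2) bops_in[OF T'(1) f] g] by (simp add: g JH bops_in[OF T'(1) f])
        finally show ?thesis .
      qed
      \<comment> \<open>A multiple of the kernel at \<open>u\<close> lies in the range of
        \<open>J\<close>, so testing against the range of \<open>J\<close> recovers the value at
        \<open>u\<close>.\<close>
      have Ju: "J (kern (\<sigma> u)) = (\<lambda>x. (1 / cnj (m u)) * kern u x)"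
        using Jkern[OF \<sigma>(1)[OF True]] \<sigma>(2)[OF True] by simp
      have "(1 / m u) * T (J f) u = (1 / m u) * J (T' f) u"
        using eq[OF kern_in[of "\<sigma> u"]] unfolding Ju L2_inner_scale_right
        by (simp add: reproducing bops_in[OF T] bops_in[OF T'(1)] JH f)
      then show ?thesis using m[OF True] by simp
    qed (simp add: vanish JH bops_in[OF T] bops_in[OF T'(1)] f)
  qed
  have Sb: "S \<in> bops" and Tb: "T \<in> bops" using ST A by auto
  obtain S' where S': "S' \<in> bops" "is_adjoint M H S S'" using adjoint_exists[OF Sb] by blast
  obtain T' where T': "T' \<in> bops" "is_adjoint M H T T'" using adjoint_exists[OF Tb] by blast
  have adj: "is_adjoint M H (compose H T S) (compose H S' T')"
    using S' T' by (simp add: is_adjoint_def compose_def bops_in[OF Sb] bops_in[OF T'(1)])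
  have comm: "S (T (J f)) = T (S (J f))" if f: "f \<in> H" for f
  proof -
    have "S (T (J f)) = J (S' (T' f))"
      using TJ[OF ST(2) T' f] TJ[OF ST(1) S' bops_in[OF T'(1) f]] by simp
    also have "\<dots> = T (S (J f))"
      using TJ[OF Acomp[OF ST(2,1)] compose_bops[OF S'(1) T'(1)] adj f] f JH by (simp add: compose_def)
    finally show ?thesis .
  qed
  show ?thesis
  proof (rule bops_eqI)
    fix w
    show "compose H S T (kern w) = compose H T S (kern w)"
    proof (cases "w \<in> D")
      case True
      have "(\<lambda>x. cnj (m w) * J (kern (\<sigma> w)) x) = kern w"
        using Jkern[OF \<sigma>(1)[OF True]] \<sigma>(2)[OF True] m[OF True] by (auto simp: fun_eq_iff)
      then have "kern w = J (\<lambda>x. m w * kern (\<sigma> w) x)" by (simp add: Jscale)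
      then show ?thesis using comm[OF scale[OF kern_in[of "\<sigma> w"], of "m w"]] by (simp add: compose_def)
    next
      case False
      have "T (\<lambda>x. 0) = (\<lambda>x. 0)" if "T \<in> bops" for T using bops_scale[OF that zero, of 0] by simp
      then show ?thesis using Sb Tb by (simp add: kern0[OF False] compose_def zero)
    qed
  qed (intro compose_bops Sb Tb)+
qed

end

section \<open>Matrices as a complex vector space\<close>

text \<open>Has the shape in which \<open>holomorphic_symm\<close> expresses complex linearity of
  the derivative, so the two unfold to the same term.\<close>

definition cmul :: "complex \<Rightarrow> complex^'n^'m \<Rightarrow> complex^'n^'m" where
  "cmul c V = (\<chi> i j. c * V $ i $ j)"

lemma cmul_nth [simp]: "cmul c V $ i $ j = c * V $ i $ j"
  by (simp add: cmul_def)

lemma mat_eqI: "(\<And>i j. A $ i $ j = B $ i $ j) \<Longrightarrow> A = B"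
  by (simp add: vec_eq_iff)

lemma cmul_add: "cmul (a + b) V = cmul a V + cmul b V" "cmul a (V + W) = cmul a V + cmul a W"
  by (auto intro!: mat_eqI simp: algebra_simps)

lemma cmul_cmul [simp]: "cmul a (cmul b V) = cmul (a * b) V"
  by (auto intro!: mat_eqI)

lemma cmul_one [simp]: "cmul 1 V = V" and cmul_zero [simp]: "cmul 0 V = 0" "cmul a 0 = 0"
  by (auto intro!: mat_eqI)

lemma norm_cmul: "norm (cmul c V) = cmod c * norm V"
proof -
  have "norm ((cmul c V) $ i) = cmod c * norm (V $ i)" for i
    unfolding norm_vec_def cmul_nth by (simp add: norm_mult L2_set_right_distrib)
  then show ?thesis unfolding norm_vec_def[of "cmul c V"] norm_vec_def[of V]
    by (simp add: L2_set_right_distrib)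
qed

lemma bounded_linear_cmul_left: "bounded_linear (\<lambda>c. cmul c V)"
  by (intro bounded_linear_intro[of _ "norm V"])
    (auto simp: cmul_add norm_cmul intro!: mat_eqI)

lemma bounded_linear_cmul_right: "bounded_linear (cmul c)"
  by (intro bounded_linear_intro[of _ "cmod c"])
    (auto simp: cmul_add norm_cmul intro!: mat_eqI)

lemma continuous_on_matrix_entries:
  fixes f :: "'a::topological_space \<Rightarrow> 'b::real_normed_vector^'n^'m"
  assumes "\<And>i j. continuous_on S (\<lambda>x. f x $ i $ j)"
  shows "continuous_on S f"
proof -
  have "continuous_on S (\<lambda>x. \<chi> i j. f x $ i $ j)"
    by (intro continuous_on_vec_lambda assms)
  then show ?thesis by simp
qed

lemma cmod_entry_le_norm: "cmod (Z $ i $ j) \<le> norm (Z :: complex^'n^'m)"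
  using Finite_Cartesian_Product.norm_nth_le[of "Z $ i" j] Finite_Cartesian_Product.norm_nth_le[of Z i] by linarith

lemma matrix_norm_le_sum: "norm (Z :: complex^'n^'m) \<le> (\<Sum>i\<in>UNIV. \<Sum>j\<in>UNIV. cmod (Z $ i $ j))"
proof -
  have "norm Z \<le> (\<Sum>i\<in>UNIV. norm (Z $ i))" unfolding norm_vec_def by (rule L2_set_le_sum) simp
  also have "\<dots> \<le> (\<Sum>i\<in>UNIV. \<Sum>j\<in>UNIV. cmod (Z $ i $ j))"
    by (rule sum_mono) (simp add: norm_vec_def L2_set_le_sum)
  finally show ?thesis .
qed

lemma Symm_complex_iff: "Z \<in> Symm_complex \<longleftrightarrow> (\<forall>i j. Z $ i $ j = Z $ j $ i)"
  by (auto simp: Symm_complex_def transpose_def vec_eq_iff)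

lemma Symm_add: "V \<in> Symm_complex \<Longrightarrow> W \<in> Symm_complex \<Longrightarrow> V + W \<in> Symm_complex"
  and Symm_diff: "V \<in> Symm_complex \<Longrightarrow> W \<in> Symm_complex \<Longrightarrow> V - W \<in> Symm_complex"
  and Symm_minus: "V \<in> Symm_complex \<Longrightarrow> - V \<in> Symm_complex"
  and Symm_scaleR: "V \<in> Symm_complex \<Longrightarrow> r *\<^sub>R V \<in> Symm_complex"
  and Symm_cmul: "V \<in> Symm_complex \<Longrightarrow> cmul c V \<in> Symm_complex"
  and Symm_zero: "0 \<in> Symm_complex"
  by (simp_all add: Symm_complex_iff)

lemma sum_closed_Symm: "(\<And>b. b \<in> B \<Longrightarrow> f b \<in> Symm_complex) \<Longrightarrow> sum f B \<in> Symm_complex"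
  by (induction B rule: infinite_finite_induct) (auto simp: Symm_zero Symm_add)

lemma closed_Symm: "closed (Symm_complex :: (complex^'n^'n) set)"
proof -
  have "Symm_complex = (\<Inter>i j. {Z :: complex^'n^'n. Z $ i $ j = Z $ j $ i})"
    by (auto simp: Symm_complex_iff)
  also have "closed \<dots>"
    by (intro closed_INT ballI closed_Collect_eq continuous_intros)
  finally show ?thesis .
qed

section \<open>Lebesgue measure on symmetric matrices\<close>

text \<open>The value depends only on the unordered pair of indices, so as a set
  \<open>symm_basis\<close> contains each basis matrix once although it is indexed by ordered
  pairs.\<close>

definition symm_elem :: "'n \<Rightarrow> 'n \<Rightarrow> complex \<Rightarrow> complex^'n^'n" where
  "symm_elem i j c = (\<chi> k l. if {k, l} = {i, j} then c else 0)"

lemma symm_basis_alt: "symm_basis = (\<lambda>(i, j, c). symm_elem i j c) ` (UNIV \<times> UNIV \<times> {1, \<i>})"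
  unfolding symm_basis_def symm_elem_def by force

lemma finite_symm_basis [simp]: "finite (symm_basis :: (complex^'n^'n) set)"
  unfolding symm_basis_alt by simp

lemma symm_elem_basis: "symm_elem i j 1 \<in> symm_basis" "symm_elem i j \<i> \<in> symm_basis"
  unfolding symm_basis_def symm_elem_def by auto

lemma symm_basis_Symm: "b \<in> symm_basis \<Longrightarrow> b \<in> Symm_complex"
  unfolding symm_basis_alt Symm_complex_iff by (auto simp: symm_elem_def insert_commute)

definition symm_coords :: "(complex^'n^'n \<Rightarrow> real) \<Rightarrow> complex^'n^'n" where
  "symm_coords x = (\<Sum>b\<in>symm_basis. x b *\<^sub>R b)"

lemma symm_coords_Symm: "symm_coords x \<in> Symm_complex"
proof -
  have "x b *\<^sub>R b \<in> Symm_complex" if "b \<in> symm_basis" for b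
    using that symm_basis_Symm Symm_scaleR by blast
  then show ?thesis unfolding symm_coords_def
    by (rule sum_closed_Symm)
qed

lemma symm_coords_entry:
  "symm_coords x $ i $ j = of_real (x (symm_elem i j 1)) + \<i> * of_real (x (symm_elem i j \<i>))"
proof -
  have ne: "symm_elem i j 1 \<noteq> symm_elem i j \<i>"
    by (auto simp: symm_elem_def vec_eq_iff complex_eq_iff)
  have "symm_coords x $ i $ j = (\<Sum>b\<in>symm_basis. x b *\<^sub>R (b $ i $ j))"
    by (simp add: symm_coords_def)
  also have "\<dots> = (\<Sum>b\<in>{symm_elem i j 1, symm_elem i j \<i>}. x b *\<^sub>R (b $ i $ j))"
  proof (rule sum.mono_neutral_right)
    show "{symm_elem i j 1, symm_elem i j \<i>} \<subseteq> symm_basis" by (auto simp: symm_elem_basis)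
    have "symm_elem k l c $ i $ j = 0" if "symm_elem k l c \<notin> {symm_elem i j 1, symm_elem i j \<i>}" "c \<in> {1, \<i>}" for k l c
    proof -
      have "{i, j} \<noteq> {k, l}"
      proof
        assume "{i, j} = {k, l}"
        then have "symm_elem k l c = symm_elem i j c" by (simp add: symm_elem_def)
        then show False using that by auto
      qed
      then show ?thesis by (simp add: symm_elem_def)
    qed
    then show "\<forall>b\<in>symm_basis - {symm_elem i j 1, symm_elem i j \<i>}. x b *\<^sub>R (b $ i $ j) = 0"
      by (auto simp: symm_basis_alt)
  qed simp
  also have "\<dots> = of_real (x (symm_elem i j 1)) + \<i> * of_real (x (symm_elem i j \<i>))"
    using ne by (simp add: scaleR_conv_of_real) (simp add: symm_elem_def)
  finally show ?thesis .
qed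

lemma symm_coords_surj:
  assumes "S \<in> Symm_complex"
  obtains s where "symm_coords s = S"
proof -
  \<comment> \<open>The double sum meets every off-diagonal basis matrix twice, hence the weight 1/2
    there.\<close>
  define w :: "'a \<Rightarrow> 'a \<Rightarrow> real" where "w i j = (if i = j then 1 else 1/2)" for i j
  define T where "T = (\<Sum>i\<in>UNIV. \<Sum>j\<in>UNIV. (w i j * Re (S $ i $ j)) *\<^sub>R symm_elem i j 1
                              + (w i j * Im (S $ i $ j)) *\<^sub>R symm_elem i j \<i>)"
  have mem: "symm_elem i j 1 \<in> span symm_basis" "symm_elem i j \<i> \<in> span symm_basis" for i j :: 'a
    by (auto intro: span_base simp: symm_elem_basis)
  have "T \<in> span symm_basis"
    unfolding T_def by (intro span_sum span_add span_scale mem)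
  moreover have "T = S"
  proof (rule mat_eqI)
    fix k l
    have e: "w i j * Re (S $ i $ j) * Re (if {k, l} = {i, j} then 1 else 0) = 0" if "(i, j) \<notin> {(k, l), (l, k)}" for i j
      using that by (auto simp: doubleton_eq_iff)
    define g where "g i j = (if {k, l} = {i, j} then complex_of_real (w i j) * S $ i $ j else 0)" for i j
    have "T $ k $ l = (\<Sum>i\<in>UNIV. \<Sum>j\<in>UNIV. g i j)"
      unfolding T_def g_def symm_elem_def
      by (auto simp: complex_eq_iff intro!: sum.cong)
    also have "\<dots> = (\<Sum>p\<in>UNIV. g (fst p) (snd p))"
      by (simp add: sum.cartesian_product UNIV_Times_UNIV case_prod_beta)
    also have "\<dots> = (\<Sum>p\<in>{(k, l), (l, k)}. g (fst p) (snd p))"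
      by (rule sum.mono_neutral_right) (auto simp: g_def doubleton_eq_iff)
    also have "\<dots> = S $ k $ l"
      using assms by (cases "k = l") (auto simp: g_def w_def Symm_complex_iff insert_commute)
    finally show "T $ k $ l = S $ k $ l" .
  qed
  ultimately have "S \<in> span symm_basis" by simp
  then obtain u where "S = (\<Sum>v\<in>symm_basis. u v *\<^sub>R v)"
    by (auto simp: span_finite)
  then show ?thesis using that[of u] by (simp add: symm_coords_def)
qed

abbreviation symm_prod :: "(complex^'n^'n \<Rightarrow> real) measure" where
  "symm_prod \<equiv> Pi\<^sub>M symm_basis (\<lambda>_. lborel)"

lemma measurable_symm_coords [measurable]: "symm_coords \<in> symm_prod \<rightarrow>\<^sub>M borel"
  unfolding symm_coords_def[abs_def] by measurable

lemma lebesgue_symm_alt: "lebesgue_symm = distr symm_prod borel symm_coords"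
  unfolding lebesgue_symm_def symm_coords_def[abs_def] ..

lemma sets_lebesgue_symm [simp, measurable_cong]: "sets lebesgue_symm = sets borel"
  and space_lebesgue_symm [simp]: "space lebesgue_symm = UNIV"
  by (simp_all add: lebesgue_symm_def)

lemma AE_lebesgue_symm: "AE Z in lebesgue_symm. Z \<in> Symm_complex"
proof -
  have "Measurable.pred borel (\<lambda>Z :: complex^'n^'n. Z \<in> Symm_complex)"
    using closed_Symm borel_closed by (simp add: pred_def)
  then show ?thesis
    unfolding lebesgue_symm_alt by (subst AE_distr_iff) (auto simp: symm_coords_Symm pred_def)
qed

text \<open>A cube in the coordinates of \<open>symm_basis\<close>. Its measure is known exactly, so
  it normalises Haar constants and, by comparison with balls, controls their measure from both
  sides.\<close>

definition entry_box :: "real \<Rightarrow> (complex^'n^'n) set" where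
  "entry_box t = {Z. \<forall>i j. \<bar>Re (Z $ i $ j)\<bar> \<le> t \<and> \<bar>Im (Z $ i $ j)\<bar> \<le> t}"

lemma entry_box_borel [measurable]: "entry_box t \<in> sets borel"
proof -
  have "entry_box t = (\<Inter>i j. {Z :: complex^'a^'a. \<bar>Re (Z $ i $ j)\<bar> \<le> t} \<inter> {Z. \<bar>Im (Z $ i $ j)\<bar> \<le> t})"
    by (auto simp: entry_box_def)
  also have "closed \<dots>"
    by (intro closed_INT ballI closed_Int closed_Collect_le continuous_intros)
  finally have "closed (entry_box t :: (complex^'a^'a) set)" .
  then show ?thesis by simp
qed

interpretation lborel_prod: product_sigma_finite "\<lambda>_ :: complex^'n^'n. lborel :: real measure"
  by standard

lemma emeasure_entry_box:
  assumes "t \<ge> 0"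
  shows "emeasure lebesgue_symm (entry_box t :: (complex^'n^'n) set) = ennreal ((2 * t) ^ card (symm_basis :: (complex^'n^'n) set))"
proof -
  have "symm_coords -` (entry_box t :: (complex^'n^'n) set) \<inter> space symm_prod = (\<Pi>\<^sub>E b\<in>symm_basis. {-t..t})"
  proof (intro set_eqI iffI)
    fix x :: "complex^'n^'n \<Rightarrow> real"
    assume x: "x \<in> symm_coords -` (entry_box t) \<inter> space symm_prod"
    have "x b \<in> {-t..t}" if b: "b \<in> symm_basis" for b
    proof -
      obtain i j c where "b = symm_elem i j c" "c = 1 \<or> c = \<i>" using b by (auto simp: symm_basis_alt)
      moreover have "\<bar>Re (symm_coords x $ i $ j)\<bar> \<le> t" "\<bar>Im (symm_coords x $ i $ j)\<bar> \<le> t" using x by (auto simp: entry_box_def)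
      ultimately show ?thesis unfolding symm_coords_entry by auto
    qed
    then show "x \<in> (\<Pi>\<^sub>E b\<in>symm_basis. {-t..t})" using x by (auto simp: space_PiM)
  next
    fix x :: "complex^'n^'n \<Rightarrow> real"
    assume x: "x \<in> (\<Pi>\<^sub>E b\<in>symm_basis. {-t..t})"
    have "x (symm_elem i j 1) \<in> {-t..t}" "x (symm_elem i j \<i>) \<in> {-t..t}" for i j
      using x by (auto intro!: PiE_mem[OF x] simp: symm_elem_basis simp del: atLeastAtMost_iff)
    then have "symm_coords x \<in> entry_box t"
      by (auto simp: entry_box_def symm_coords_entry abs_le_iff minus_le_iff)
    then show "x \<in> symm_coords -` (entry_box t) \<inter> space symm_prod" using x by (auto simp: space_PiM)
  qed
  then have "emeasure lebesgue_symm (entry_box t :: (complex^'n^'n) set)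
      = emeasure symm_prod (\<Pi>\<^sub>E b\<in>(symm_basis :: (complex^'n^'n) set). {-t..t})"
    unfolding lebesgue_symm_alt by (simp add: emeasure_distr)
  also have "\<dots> = (\<Prod>b\<in>(symm_basis :: (complex^'n^'n) set). emeasure lborel {-t..t})"
    by (rule lborel_prod.emeasure_PiM) auto
  also have "\<dots> = ennreal ((2 * t) ^ card (symm_basis :: (complex^'n^'n) set))"
    using assms by (simp add: ennreal_power)
  finally show ?thesis .
qed

lemma cball_subset_entry_box: "cball 0 r \<subseteq> entry_box r"
proof
  fix Z :: "complex^'n^'n" assume "Z \<in> cball 0 r"
  then have "cmod (Z $ i $ j) \<le> r" for i j using cmod_entry_le_norm[of Z i j] by simp
  then show "Z \<in> entry_box r" unfolding entry_box_def
    using abs_Re_le_cmod abs_Im_le_cmod order_trans by blast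
qed

lemma entry_box_subset_cball:
  fixes Z :: "complex^'n^'n"
  assumes "Z \<in> entry_box t"
  shows "norm Z \<le> (real CARD('n))\<^sup>2 * (2 * t)"
proof -
  have "cmod (Z $ i $ j) \<le> 2 * t" for i j
    using assms cmod_le[of "Z $ i $ j"] unfolding entry_box_def by (smt (verit) mem_Collect_eq)
  then have "(\<Sum>i\<in>UNIV. \<Sum>j\<in>UNIV. cmod (Z $ i $ j)) \<le> (\<Sum>i\<in>(UNIV :: 'n set). \<Sum>j\<in>(UNIV :: 'n set). 2 * t)"
    by (intro sum_mono)
  then show ?thesis using matrix_norm_le_sum[of Z] by (simp add: power2_eq_square mult.assoc)
qed

lemma emeasure_bounded:
  fixes A :: "(complex^'n^'n) set"
  assumes "bounded A"
  shows "emeasure lebesgue_symm A < \<infinity>"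
proof -
  obtain r where r: "A \<subseteq> cball 0 r" "r > 0"
    using bounded_subset_ballD[OF assms, of 0] ball_subset_cball by blast
  have "emeasure lebesgue_symm A \<le> emeasure lebesgue_symm (entry_box r :: (complex^'n^'n) set)"
    by (rule emeasure_mono) (use r cball_subset_entry_box in auto)
  also have "\<dots> < \<infinity>" using r by (simp add: emeasure_entry_box)
  finally show ?thesis .
qed

lemma symm_prod_translate:
  fixes s :: "complex^'n^'n \<Rightarrow> real"
  shows "distr symm_prod symm_prod (\<lambda>x. \<lambda>b\<in>symm_basis. x b + s b) = symm_prod"
proof (rule lborel_prod.PiM_eqI)
  fix A :: "complex^'n^'n \<Rightarrow> real set"
  assume A: "\<And>b. b \<in> symm_basis \<Longrightarrow> A b \<in> sets lborel"
  have inv: "emeasure lborel {r. r + c \<in> B} = emeasure lborel B" if "B \<in> sets lborel" for B and c :: real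
  proof -
    have "emeasure (distr lborel borel ((+) c)) B = emeasure lborel {r. r + c \<in> B}"
      using that by (subst emeasure_distr) (auto simp: add.commute vimage_def)
    then show ?thesis by (simp add: lborel_distr_plus)
  qed
  have meas: "{r. r + s b \<in> A b} \<in> sets lborel" if "b \<in> symm_basis" for b
  proof -
    have "(\<lambda>r. r + s b) -` A b \<inter> space lborel \<in> sets lborel"
      by (rule measurable_sets[of _ _ lborel]) (use A[OF that] in auto)
    then show ?thesis by (simp add: vimage_def)
  qed
  have "(\<lambda>x. \<lambda>b\<in>symm_basis. x b + s b) -` Pi\<^sub>E symm_basis A \<inter> space symm_prod
      = (\<Pi>\<^sub>E b\<in>symm_basis. {r. r + s b \<in> A b})"
    by (auto simp: space_PiM PiE_iff)
  then have "emeasure (distr symm_prod symm_prod (\<lambda>x. \<lambda>b\<in>symm_basis. x b + s b)) (Pi\<^sub>E symm_basis A)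
      = emeasure symm_prod (\<Pi>\<^sub>E b\<in>symm_basis. {r. r + s b \<in> A b})"
    using A by (subst emeasure_distr) (auto intro!: sets_PiM_I_finite)
  also have "\<dots> = (\<Prod>b\<in>symm_basis. emeasure lborel {r. r + s b \<in> A b})"
    by (rule lborel_prod.emeasure_PiM) (use meas in auto)
  also have "\<dots> = (\<Prod>b\<in>symm_basis. emeasure lborel (A b))"
    by (intro prod.cong refl inv A)
  finally show "emeasure (distr symm_prod symm_prod (\<lambda>x. \<lambda>b\<in>symm_basis. x b + s b)) (Pi\<^sub>E symm_basis A)
    = (\<Prod>b\<in>symm_basis. emeasure lborel (A b))" .
qed simp_all

text \<open>In coordinates, adding \<open>S\<close> adds a constant to each real variable, so the
  claim reduces to translation invariance of the product measure.\<close>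

lemma nn_integral_translate:
  fixes f :: "complex^'n^'n \<Rightarrow> ennreal"
  assumes S: "S \<in> Symm_complex" and f[measurable]: "f \<in> borel_measurable borel"
  shows "(\<integral>\<^sup>+ Z. f (Z + S) \<partial>lebesgue_symm) = (\<integral>\<^sup>+ Z. f Z \<partial>lebesgue_symm)"
proof -
  obtain s where s: "symm_coords s = S" using symm_coords_surj[OF S] .
  define T where "T = (\<lambda>x. \<lambda>b\<in>symm_basis. x b + s b)"
  have T[measurable]: "T \<in> symm_prod \<rightarrow>\<^sub>M symm_prod" unfolding T_def by measurable
  have sum: "symm_coords (T x) = symm_coords x + S" for x
    unfolding symm_coords_def T_def s[symmetric]
    by (simp add: scaleR_add_left sum.distrib)
  have "(\<integral>\<^sup>+ Z. f (Z + S) \<partial>lebesgue_symm) = (\<integral>\<^sup>+ x. f (symm_coords x + S) \<partial>symm_prod)"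
    unfolding lebesgue_symm_alt by (subst nn_integral_distr) auto
  also have "\<dots> = (\<integral>\<^sup>+ x. f (symm_coords (T x)) \<partial>symm_prod)" by (simp add: sum)
  also have "\<dots> = (\<integral>\<^sup>+ x. f (symm_coords x) \<partial>distr symm_prod symm_prod T)"
    by (subst nn_integral_distr) auto
  also have "\<dots> = (\<integral>\<^sup>+ Z. f Z \<partial>lebesgue_symm)"
    unfolding T_def symm_prod_translate lebesgue_symm_alt by (subst nn_integral_distr) auto
  finally show ?thesis .
qed

interpretation lebesgue_symm: sigma_finite_measure "lebesgue_symm :: (complex^'n^'n) measure"
proof
  let ?A = "range (\<lambda>n. entry_box (real n) :: (complex^'n^'n) set)"
  have "Z \<in> \<Union>?A" for Z :: "complex^'n^'n"
  proof -
    obtain n where "norm Z \<le> real n" using real_arch_simple by blast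
    then have "Z \<in> entry_box (real n)" using cball_subset_entry_box by fastforce
    then show ?thesis by auto
  qed
  then have "\<Union>?A = space (lebesgue_symm :: (complex^'n^'n) measure)" by auto
  then show "\<exists>A :: (complex^'n^'n) set set. countable A \<and> A \<subseteq> sets lebesgue_symm \<and> \<Union> A = space lebesgue_symm \<and>
      (\<forall>a\<in>A. emeasure lebesgue_symm a \<noteq> \<infinity>)"
    by (intro exI[of _ ?A]) (auto simp: emeasure_entry_box)
qed

interpretation lebesgue_symm2: pair_sigma_finite "lebesgue_symm :: (complex^'n^'n) measure" "lebesgue_symm :: (complex^'n^'n) measure" ..

text \<open>Uniqueness of Haar measure by Tonelli: substitute \<open>y \<mapsto> y + A x\<close>, then \<open>x \<mapsto> x - A' y\<close>, then \<open>y \<mapsto> y + A x\<close>.\<close>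

lemma haar_product:
  fixes f g :: "complex^'n^'n \<Rightarrow> ennreal" and A A' :: "complex^'n^'n \<Rightarrow> complex^'n^'n"
  assumes A[measurable]: "A \<in> borel \<rightarrow>\<^sub>M borel" and add: "\<And>x y. A (x + y) = A x + A y"
    and AS: "\<And>x. x \<in> Symm_complex \<Longrightarrow> A x \<in> Symm_complex"
    and A'S: "\<And>x. x \<in> Symm_complex \<Longrightarrow> A' x \<in> Symm_complex"
    and inv: "\<And>x. x \<in> Symm_complex \<Longrightarrow> A (A' x) = x"
    and f[measurable]: "f \<in> borel_measurable borel" and g[measurable]: "g \<in> borel_measurable borel"
  shows "(\<integral>\<^sup>+ x. f (A x) \<partial>lebesgue_symm) * (\<integral>\<^sup>+ y. g y \<partial>lebesgue_symm)
       = (\<integral>\<^sup>+ x. g (A x) \<partial>lebesgue_symm) * (\<integral>\<^sup>+ y. f (- y) \<partial>lebesgue_symm)"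
proof -
  let ?L = "lebesgue_symm :: (complex^'n^'n) measure"
  have neg: "A (- x) = - A x" for x
    using add[of x "-x"] add[of 0 0] by (simp add: eq_neg_iff_add_eq_0 add.commute)
  have "(\<integral>\<^sup>+ x. f (A x) \<partial>?L) * (\<integral>\<^sup>+ y. g y \<partial>?L) = (\<integral>\<^sup>+ x. f (A x) * (\<integral>\<^sup>+ y. g y \<partial>?L) \<partial>?L)"
    by (simp add: nn_integral_multc)
  also have "\<dots> = (\<integral>\<^sup>+ x. (\<integral>\<^sup>+ y. f (A x) * g (y + A x) \<partial>?L) \<partial>?L)"
  proof (rule nn_integral_cong_AE, rule AE_mp[OF AE_lebesgue_symm], intro AE_I2 impI)
    fix x :: "complex^'n^'n" assume "x \<in> Symm_complex"
    then show "f (A x) * (\<integral>\<^sup>+ y. g y \<partial>?L) = (\<integral>\<^sup>+ y. f (A x) * g (y + A x) \<partial>?L)"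
      by (simp add: nn_integral_cmult nn_integral_translate[OF AS])
  qed
  also have "\<dots> = (\<integral>\<^sup>+ y. (\<integral>\<^sup>+ x. f (A x) * g (y + A x) \<partial>?L) \<partial>?L)"
    by (rule lebesgue_symm2.Fubini') measurable
  also have "\<dots> = (\<integral>\<^sup>+ y. (\<integral>\<^sup>+ x. f (A x - y) * g (A x) \<partial>?L) \<partial>?L)"
  proof (rule nn_integral_cong_AE, rule AE_mp[OF AE_lebesgue_symm], intro AE_I2 impI)
    fix y :: "complex^'n^'n" assume y: "y \<in> Symm_complex"
    have "(\<integral>\<^sup>+ x. f (A x) * g (y + A x) \<partial>?L) = (\<integral>\<^sup>+ x. f (A (x + - A' y)) * g (y + A (x + - A' y)) \<partial>?L)"
      by (rule nn_integral_translate[OF Symm_minus[OF A'S[OF y]], symmetric]) measurable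
    then show "(\<integral>\<^sup>+ x. f (A x) * g (y + A x) \<partial>?L) = (\<integral>\<^sup>+ x. f (A x - y) * g (A x) \<partial>?L)"
      by (simp only: add neg inv[OF y]) simp
  qed
  also have "\<dots> = (\<integral>\<^sup>+ x. (\<integral>\<^sup>+ y. f (A x - y) * g (A x) \<partial>?L) \<partial>?L)"
    by (rule lebesgue_symm2.Fubini'[symmetric]) measurable
  also have "\<dots> = (\<integral>\<^sup>+ x. g (A x) * (\<integral>\<^sup>+ y. f (- y) \<partial>?L) \<partial>?L)"
  proof (rule nn_integral_cong_AE, rule AE_mp[OF AE_lebesgue_symm], intro AE_I2 impI)
    fix x :: "complex^'n^'n" assume x: "x \<in> Symm_complex"
    have "(\<integral>\<^sup>+ y. f (- y) \<partial>?L) = (\<integral>\<^sup>+ y. f (- (y + - A x)) \<partial>?L)"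
      by (rule nn_integral_translate[OF Symm_minus[OF AS[OF x]], symmetric]) measurable
    then show "(\<integral>\<^sup>+ y. f (A x - y) * g (A x) \<partial>?L) = g (A x) * (\<integral>\<^sup>+ y. f (- y) \<partial>?L)"
      by (simp add: nn_integral_multc mult.commute[of "g (A x)"])
  qed
  also have "\<dots> = (\<integral>\<^sup>+ x. g (A x) \<partial>?L) * (\<integral>\<^sup>+ y. f (- y) \<partial>?L)"
    by (simp add: nn_integral_multc)
  finally show ?thesis .
qed

text \<open>The case of \<open>haar_product\<close> in which \<open>A\<close> is the identity and
  \<open>g\<close> the indicator of a box; the measure of the box is positive and finite and
  cancels.\<close>

lemma nn_integral_uminus:
  fixes f :: "complex^'n^'n \<Rightarrow> ennreal"
  assumes f[measurable]: "f \<in> borel_measurable borel"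
  shows "(\<integral>\<^sup>+ y. f (- y) \<partial>lebesgue_symm) = (\<integral>\<^sup>+ y. f y \<partial>lebesgue_symm)"
proof -
  have "(\<integral>\<^sup>+ x. indicator (entry_box 1) x \<partial>(lebesgue_symm :: (complex^'n^'n) measure))
      = ennreal (2 ^ card (symm_basis :: (complex^'n^'n) set))" (is "?I = ennreal ?c")
    by (simp add: emeasure_entry_box)
  moreover have "(\<integral>\<^sup>+ x. f x \<partial>lebesgue_symm) * ?I = ?I * (\<integral>\<^sup>+ y. f (- y) \<partial>lebesgue_symm)"
    using haar_product[of "\<lambda>x. x" "\<lambda>x. x" f "indicator (entry_box 1)"] by simp
  ultimately have "(\<integral>\<^sup>+ x. f x \<partial>lebesgue_symm) * ennreal ?c = (\<integral>\<^sup>+ y. f (- y) \<partial>lebesgue_symm) * ennreal ?c"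
    by (simp add: mult.commute)
  moreover have "0 < ennreal ?c" "ennreal ?c < top" by simp_all
  ultimately show ?thesis by (metis ennreal_mult_divide_eq less_irrefl)
qed

text \<open>Taking a box indicator for \<open>g\<close> in \<open>haar_product\<close> identifies
  the constant as the ratio of the measures of the preimage of the box and of the box. The inverse
  map has a constant of its own, and this excludes the values 0 and infinity.\<close>

lemma haar_scaling:
  fixes A A' :: "complex^'n^'n \<Rightarrow> complex^'n^'n"
  assumes A[measurable]: "A \<in> borel \<rightarrow>\<^sub>M borel" and add: "\<And>x y. A (x + y) = A x + A y"
    and A'[measurable]: "A' \<in> borel \<rightarrow>\<^sub>M borel" and add': "\<And>x y. A' (x + y) = A' x + A' y"
    and AS: "\<And>x. x \<in> Symm_complex \<Longrightarrow> A x \<in> Symm_complex"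
    and A'S: "\<And>x. x \<in> Symm_complex \<Longrightarrow> A' x \<in> Symm_complex"
    and inv: "\<And>x. x \<in> Symm_complex \<Longrightarrow> A (A' x) = x"
    and inv': "\<And>x. x \<in> Symm_complex \<Longrightarrow> A' (A x) = x"
  shows "\<exists>d>0. \<forall>f\<in>borel_measurable borel. (\<integral>\<^sup>+ x. f (A x) \<partial>lebesgue_symm) = ennreal d * (\<integral>\<^sup>+ x. f x \<partial>lebesgue_symm)"
proof -
  let ?L = "lebesgue_symm :: (complex^'n^'n) measure"
  let ?c = "ennreal (2 ^ card (symm_basis :: (complex^'n^'n) set))"
  let ?ind = "indicator (entry_box 1) :: complex^'n^'n \<Rightarrow> ennreal"
  have c: "(\<integral>\<^sup>+ x. ?ind x \<partial>?L) = ?c" by (simp add: emeasure_entry_box)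
  have c0: "0 < ?c" "?c < top" by simp_all
  have *: "(\<integral>\<^sup>+ x. f (B x) \<partial>?L) = ((\<integral>\<^sup>+ x. ?ind (B x) \<partial>?L) / ?c) * (\<integral>\<^sup>+ x. f x \<partial>?L)"
    if "B \<in> borel \<rightarrow>\<^sub>M borel" "\<And>x y. B (x + y) = B x + B y" "\<And>x. x \<in> Symm_complex \<Longrightarrow> B x \<in> Symm_complex"
       "\<And>x. x \<in> Symm_complex \<Longrightarrow> B' x \<in> Symm_complex" "\<And>x. x \<in> Symm_complex \<Longrightarrow> B (B' x) = x"
       "f \<in> borel_measurable borel" for B B' f
  proof -
    have "(\<integral>\<^sup>+ x. f (B x) \<partial>?L) * ?c = (\<integral>\<^sup>+ x. ?ind (B x) \<partial>?L) * (\<integral>\<^sup>+ x. f x \<partial>?L)"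
      using haar_product[of B B' f ?ind] that unfolding c by (simp add: nn_integral_uminus)
    then have "(\<integral>\<^sup>+ x. f (B x) \<partial>?L) = ((\<integral>\<^sup>+ x. ?ind (B x) \<partial>?L) * (\<integral>\<^sup>+ x. f x \<partial>?L)) / ?c"
      using c0 by (metis ennreal_mult_divide_eq less_irrefl)
    then show ?thesis by (simp add: ennreal_times_divide mult.commute)
  qed
  define d d' where "d = (\<integral>\<^sup>+ x. ?ind (A x) \<partial>?L) / ?c" and "d' = (\<integral>\<^sup>+ x. ?ind (A' x) \<partial>?L) / ?c"
  have d: "(\<integral>\<^sup>+ x. f (A x) \<partial>?L) = d * (\<integral>\<^sup>+ x. f x \<partial>?L)" if "f \<in> borel_measurable borel" for f
    unfolding d_def by (rule *[OF A add AS A'S inv that])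
  have d': "(\<integral>\<^sup>+ x. f (A' x) \<partial>?L) = d' * (\<integral>\<^sup>+ x. f x \<partial>?L)" if "f \<in> borel_measurable borel" for f
    unfolding d'_def by (rule *[OF A' add' A'S AS inv' that])
  \<comment> \<open>Applying \<open>A\<close> and then its inverse gives
    \<open>d * (d' * ?c) = ?c\<close> with \<open>?c\<close> positive and finite, so
    \<open>d\<close> is neither 0 nor infinite.\<close>
  have "?c = (\<integral>\<^sup>+ x. ?ind (A' (A x)) \<partial>?L)"
    unfolding c[symmetric]
    by (rule nn_integral_cong_AE, rule AE_mp[OF AE_lebesgue_symm]) (auto simp: inv')
  also have "\<dots> = d * (d' * ?c)" using d[of "\<lambda>x. ?ind (A' x)"] d'[of ?ind] by (simp add: c)
  finally have eq: "?c = d * (d' * ?c)" .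
  have d0: "d \<noteq> 0"
  proof
    assume "d = 0" then show False using eq c0 by simp
  qed
  have dtop: "d \<noteq> top"
  proof
    assume "d = top"
    then have "?c = (if d' * ?c = 0 then 0 else top)" using eq by (simp only: ennreal_top_mult)
    then show False using c0 by (metis less_irrefl)
  qed
  obtain r where r: "d = ennreal r" "r \<ge> 0" using dtop by (cases d) auto
  then have "r > 0" using d0 by (cases "r = 0") auto
  then show ?thesis using d r by blast
qed

lemma emeasure_ball_pos:
  assumes p: "p \<in> Symm_complex" and r: "r > 0"
  shows "0 < emeasure lebesgue_symm (ball (p :: complex^'n^'n) r)"
proof -
  have B: "ball p r \<in> sets borel" by simp
  have "emeasure lebesgue_symm (ball p r) = (\<integral>\<^sup>+ Z. indicator (ball p r) Z \<partial>lebesgue_symm)"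
    by simp
  also have "\<dots> = (\<integral>\<^sup>+ Z. indicator (ball p r) (Z + p) \<partial>lebesgue_symm)"
    by (rule nn_integral_translate[OF p, symmetric]) (rule borel_measurable_indicator[OF B])
  also have "\<dots> = (\<integral>\<^sup>+ Z. indicator (ball (0 :: complex^'n^'n) r) Z \<partial>lebesgue_symm)"
    by (intro nn_integral_cong) (auto simp: indicator_def dist_norm)
  also have "\<dots> = emeasure lebesgue_symm (ball (0 :: complex^'n^'n) r)" by simp
  finally have e: "emeasure lebesgue_symm (ball p r) = emeasure lebesgue_symm (ball (0 :: complex^'n^'n) r)" .
  \<comment> \<open>The factor in \<open>entry_box_subset_cball\<close>: a box of half-width
    \<open>t\<close> has radius at most \<open>K * t\<close>.\<close>
  define K where "K = (real CARD('n))\<^sup>2 * 2"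
  have K: "K > 0" by (simp add: K_def)
  define t where "t = r / (2 * K)"
  have t: "t > 0" using K r by (simp add: t_def)
  have "entry_box t \<subseteq> ball (0 :: complex^'n^'n) r"
  proof
    fix Z :: "complex^'n^'n" assume "Z \<in> entry_box t"
    then have "norm Z \<le> K * t" using entry_box_subset_cball[of Z t] by (simp add: K_def mult_ac)
    also have "\<dots> < r" using K r by (simp add: t_def)
    finally show "Z \<in> ball 0 r" by simp
  qed
  then have "emeasure lebesgue_symm (entry_box t :: (complex^'n^'n) set) \<le> emeasure lebesgue_symm (ball (0 :: complex^'n^'n) r)"
    by (intro emeasure_mono) auto
  moreover have "0 < emeasure lebesgue_symm (entry_box t :: (complex^'n^'n) set)"
    using t by (simp add: emeasure_entry_box)
  ultimately show ?thesis unfolding e by (rule less_le_trans[rotated])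
qed

text \<open>Openness relative to the symmetric matrices, phrased with symmetric increments, since a
  ball in the space of all matrices is never contained in \<open>D\<close> for n > 1.\<close>

definition rel_open :: "(complex^'n^'n) set \<Rightarrow> bool" where
  "rel_open D \<longleftrightarrow> D \<subseteq> Symm_complex \<and>
     (\<forall>p\<in>D. \<exists>r>0. \<forall>V\<in>Symm_complex. norm V < r \<longrightarrow> p + V \<in> D)"

lemma rel_openE:
  assumes "rel_open D" "p \<in> D"
  obtains r where "r > 0" "\<And>V. V \<in> Symm_complex \<Longrightarrow> norm V < r \<Longrightarrow> p + V \<in> D"
  using assms unfolding rel_open_def by blast

lemma rel_open_subset: "rel_open D \<Longrightarrow> p \<in> D \<Longrightarrow> p \<in> Symm_complex"
  by (auto simp: rel_open_def)

lemma rel_open_eq_open_Int: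
  assumes "rel_open D"
  obtains U where "open U" "D = Symm_complex \<inter> U"
proof -
  obtain r where r: "\<And>p. p \<in> D \<Longrightarrow> r p > 0" "\<And>p V. p \<in> D \<Longrightarrow> V \<in> Symm_complex \<Longrightarrow> norm V < r p \<Longrightarrow> p + V \<in> D"
    using assms unfolding rel_open_def by metis
  have "D = Symm_complex \<inter> (\<Union>p\<in>D. ball p (r p))"
  proof (intro equalityI subsetI)
    fix Z assume "Z \<in> Symm_complex \<inter> (\<Union>p\<in>D. ball p (r p))"
    then obtain p where p: "p \<in> D" "dist p Z < r p" "Z \<in> Symm_complex" by auto
    then have "p + (Z - p) \<in> D"
      using rel_open_subset[OF assms p(1)]
      by (intro r Symm_diff) (auto simp: dist_norm norm_minus_commute)
    then show "Z \<in> D" by simp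
  next
    fix Z assume "Z \<in> D"
    then show "Z \<in> Symm_complex \<inter> (\<Union>p\<in>D. ball p (r p))"
      using r(1) rel_open_subset[OF assms] by (intro IntI UN_I[of Z]) auto
  qed
  then show ?thesis by (rule that[rotated]) (intro open_UN ballI open_ball)
qed

lemma rel_open_borel:
  assumes "rel_open D" shows "D \<in> sets borel"
proof -
  obtain U where "open U" "D = Symm_complex \<inter> U" using rel_open_eq_open_Int[OF assms] .
  then show ?thesis using sets.Int[OF borel_closed[OF closed_Symm] borel_open[OF \<open>open U\<close>]] by simp
qed

section \<open>Holomorphic functions on relatively open sets of symmetric matrices\<close>

lemma holomorphic_symmD:
  assumes "holomorphic_symm f D" "Z \<in> D"
  obtains f' where "(f has_derivative f') (at Z within D)" "\<And>c V. f' (cmul c V) = c * f' V"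
  using assms unfolding holomorphic_symm_def cmul_def by blast

lemma holomorphic_symmI:
  assumes "\<And>Z. Z \<in> D \<Longrightarrow> \<exists>f'. (f has_derivative f') (at Z within D) \<and> (\<forall>c V. f' (cmul c V) = c * f' V)"
  shows "holomorphic_symm f D"
  using assms unfolding holomorphic_symm_def cmul_def by blast

lemma holomorphic_symm_continuous: "holomorphic_symm f D \<Longrightarrow> continuous_on D f"
  unfolding continuous_on_eq_continuous_within
  by (meson holomorphic_symmD has_derivative_continuous)

lemma holomorphic_symm_cong:
  assumes "\<And>Z. Z \<in> D \<Longrightarrow> f Z = g Z" shows "holomorphic_symm f D = holomorphic_symm g D"
proof -
  have "(f has_derivative f') (at Z within D) = (g has_derivative f') (at Z within D)" if "Z \<in> D" for f' Z
    using has_derivative_transform[OF that, of f g f'] has_derivative_transform[OF that, of g f f'] assms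
    by auto
  then show ?thesis unfolding holomorphic_symm_def by simp
qed

lemma holomorphic_symm_const: "holomorphic_symm (\<lambda>Z. c) D"
  by (rule holomorphic_symmI, rule exI[of _ "\<lambda>_. 0"]) auto

lemma holomorphic_symm_entry: "holomorphic_symm (\<lambda>Z. Z $ i $ j) D"
proof (rule holomorphic_symmI, rule exI[of _ "\<lambda>Z. Z $ i $ j"], intro conjI allI)
  have "bounded_linear (\<lambda>Z :: complex^'a^'a. Z $ i $ j)"
    using bounded_linear_compose[OF bounded_linear_vec_nth bounded_linear_vec_nth] .
  then show "((\<lambda>Z. Z $ i $ j) has_derivative (\<lambda>Z. Z $ i $ j)) (at Z within D)" for Z
    by (rule bounded_linear_imp_has_derivative)
qed simp

lemma holomorphic_symm_add:
  assumes "holomorphic_symm f D" "holomorphic_symm g D"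
  shows "holomorphic_symm (\<lambda>Z. f Z + g Z) D"
proof (rule holomorphic_symmI)
  fix Z assume "Z \<in> D"
  obtain f' where f': "(f has_derivative f') (at Z within D)" "\<And>c V. f' (cmul c V) = c * f' V"
    using holomorphic_symmD[OF assms(1) \<open>Z \<in> D\<close>] by blast
  obtain g' where g': "(g has_derivative g') (at Z within D)" "\<And>c V. g' (cmul c V) = c * g' V"
    using holomorphic_symmD[OF assms(2) \<open>Z \<in> D\<close>] by blast
  show "\<exists>k. ((\<lambda>Z. f Z + g Z) has_derivative k) (at Z within D) \<and> (\<forall>c V. k (cmul c V) = c * k V)"
    by (rule exI[of _ "\<lambda>V. f' V + g' V"]) (auto intro!: derivative_intros f' g' simp: f'(2) g'(2) algebra_simps)
qed

lemma holomorphic_symm_mult: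
  assumes "holomorphic_symm f D" "holomorphic_symm g D"
  shows "holomorphic_symm (\<lambda>Z. f Z * g Z) D"
proof (rule holomorphic_symmI)
  fix Z assume "Z \<in> D"
  obtain f' where f': "(f has_derivative f') (at Z within D)" "\<And>c V. f' (cmul c V) = c * f' V"
    using holomorphic_symmD[OF assms(1) \<open>Z \<in> D\<close>] by blast
  obtain g' where g': "(g has_derivative g') (at Z within D)" "\<And>c V. g' (cmul c V) = c * g' V"
    using holomorphic_symmD[OF assms(2) \<open>Z \<in> D\<close>] by blast
  show "\<exists>k. ((\<lambda>Z. f Z * g Z) has_derivative k) (at Z within D) \<and> (\<forall>c V. k (cmul c V) = c * k V)"
    by (rule exI[of _ "\<lambda>V. f Z * g' V + f' V * g Z"])
      (auto intro!: has_derivative_mult f' g' simp: f'(2) g'(2) algebra_simps)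
qed

lemma holomorphic_symm_scale: "holomorphic_symm f D \<Longrightarrow> holomorphic_symm (\<lambda>Z. c * f Z) D"
  by (intro holomorphic_symm_mult holomorphic_symm_const)

lemma holomorphic_symm_diff:
  assumes "holomorphic_symm f D" "holomorphic_symm g D"
  shows "holomorphic_symm (\<lambda>Z. f Z - g Z) D"
  using holomorphic_symm_add[OF assms(1) holomorphic_symm_scale[OF assms(2), of "-1"]] by simp

lemma holomorphic_symm_sum:
  "(\<And>i. i \<in> I \<Longrightarrow> holomorphic_symm (f i) D) \<Longrightarrow> holomorphic_symm (\<lambda>Z. \<Sum>i\<in>I. f i Z) D"
  by (induction I rule: infinite_finite_induct) (auto intro: holomorphic_symm_const holomorphic_symm_add)

lemma holomorphic_symm_prod:
  "(\<And>i. i \<in> I \<Longrightarrow> holomorphic_symm (f i) D) \<Longrightarrow> holomorphic_symm (\<lambda>Z. \<Prod>i\<in>I. f i Z) D"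
  by (induction I rule: infinite_finite_induct) (auto intro: holomorphic_symm_const holomorphic_symm_mult)

lemma holomorphic_symm_compose:
  assumes f: "holomorphic_symm f D"
    and g: "\<And>Z. Z \<in> D \<Longrightarrow> (g has_field_derivative g' (f Z)) (at (f Z))"
  shows "holomorphic_symm (\<lambda>Z. g (f Z)) D"
proof (rule holomorphic_symmI)
  fix Z assume Z: "Z \<in> D"
  obtain f' where f': "(f has_derivative f') (at Z within D)" "\<And>c V. f' (cmul c V) = c * f' V"
    using holomorphic_symmD[OF f Z] by blast
  have "((\<lambda>Z. g (f Z)) has_derivative (\<lambda>V. g' (f Z) * f' V)) (at Z within D)"
    using has_derivative_compose[OF f'(1) g[OF Z, unfolded has_field_derivative_def]] .
  then show "\<exists>k. ((\<lambda>Z. g (f Z)) has_derivative k) (at Z within D) \<and> (\<forall>c V. k (cmul c V) = c * k V)"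
    using f'(2) by (intro exI[of _ "\<lambda>V. g' (f Z) * f' V"]) auto
qed

lemma holomorphic_symm_inverse:
  assumes "holomorphic_symm f D" "\<And>Z. Z \<in> D \<Longrightarrow> f Z \<noteq> 0"
  shows "holomorphic_symm (\<lambda>Z. inverse (f Z)) D"
  by (rule holomorphic_symm_compose[OF assms(1), where g' = "\<lambda>x. - (inverse x ^ Suc (Suc 0))"])
    (rule DERIV_inverse, rule assms(2))

lemma holomorphic_symm_divide:
  assumes "holomorphic_symm f D" "holomorphic_symm g D" "\<And>Z. Z \<in> D \<Longrightarrow> g Z \<noteq> 0"
  shows "holomorphic_symm (\<lambda>Z. f Z / g Z) D"
  unfolding divide_inverse by (intro holomorphic_symm_mult holomorphic_symm_inverse assms)

lemma holomorphic_symm_det: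
  assumes "\<And>i j. holomorphic_symm (\<lambda>Z. A Z $ i $ j) D"
  shows "holomorphic_symm (\<lambda>Z. det (A Z :: complex^'m^'m)) D"
  unfolding det_def by (intro holomorphic_symm_sum holomorphic_symm_mult holomorphic_symm_const holomorphic_symm_prod assms)

text \<open>A matrix is the sum of its entries times matrix units, which writes \<open>f\<close> as
  a finite sum of bounded linear images of scalar functions.\<close>

lemma has_derivative_matrix:
  fixes f :: "'a::real_normed_vector \<Rightarrow> complex^'n^'m"
  assumes "\<And>i j. ((\<lambda>x. f x $ i $ j) has_derivative (\<lambda>h. f' h $ i $ j)) F"
  shows "(f has_derivative f') F"
proof -
  define u :: "'m \<Rightarrow> 'n \<Rightarrow> complex^'n^'m" where "u i j = (\<chi> k l. if k = i \<and> l = j then 1 else 0)" for i j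
  have e: "(\<Sum>i\<in>UNIV. \<Sum>j\<in>UNIV. cmul (Z $ i $ j) (u i j)) = Z" for Z :: "complex^'n^'m"
  proof (rule mat_eqI)
    fix k l
    have "(\<Sum>i\<in>UNIV. \<Sum>j\<in>UNIV. cmul (Z $ i $ j) (u i j)) $ k $ l
        = (\<Sum>i\<in>UNIV. \<Sum>j\<in>UNIV. if i = k then (if j = l then Z $ i $ j else 0) else 0)"
      by (auto simp: u_def intro!: sum.cong)
    also have "\<dots> = (\<Sum>i\<in>UNIV. if i = k then (\<Sum>j\<in>UNIV. if j = l then Z $ i $ j else 0) else 0)"
      by (intro sum.cong) auto
    also have "\<dots> = Z $ k $ l" by simp
    finally show "(\<Sum>i\<in>UNIV. \<Sum>j\<in>UNIV. cmul (Z $ i $ j) (u i j)) $ k $ l = Z $ k $ l" .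
  qed
  have "((\<lambda>x. \<Sum>i\<in>UNIV. \<Sum>j\<in>UNIV. cmul (f x $ i $ j) (u i j)) has_derivative
         (\<lambda>h. \<Sum>i\<in>UNIV. \<Sum>j\<in>UNIV. cmul (f' h $ i $ j) (u i j))) F"
    by (intro has_derivative_sum bounded_linear.has_derivative[OF bounded_linear_cmul_left] assms)
  then show ?thesis by (simp add: e)
qed

lemma holomorphic_symm_chain:
  fixes t :: "complex^'n^'n \<Rightarrow> complex^'n^'n"
  assumes f: "holomorphic_symm f E" and t: "\<And>i j. holomorphic_symm (\<lambda>Z. t Z $ i $ j) D"
    and tD: "\<And>Z. Z \<in> D \<Longrightarrow> t Z \<in> E"
  shows "holomorphic_symm (\<lambda>Z. f (t Z)) D"
proof (rule holomorphic_symmI)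
  fix Z assume Z: "Z \<in> D"
  obtain f' where f': "(f has_derivative f') (at (t Z) within E)" "\<And>c V. f' (cmul c V) = c * f' V"
    using holomorphic_symmD[OF f tD[OF Z]] by blast
  have "\<forall>i j. \<exists>g. ((\<lambda>Z. t Z $ i $ j) has_derivative g) (at Z within D) \<and> (\<forall>c V. g (cmul c V) = c * g V)"
    using t Z unfolding holomorphic_symm_def cmul_def by blast
  then obtain t' where t': "\<And>i j. ((\<lambda>Z. t Z $ i $ j) has_derivative t' i j) (at Z within D)"
     "\<And>i j c V. t' i j (cmul c V) = c * t' i j V"
    unfolding choice_iff by blast
  define T where "T V = (\<chi> i j. t' i j V)" for V
  have T: "(t has_derivative T) (at Z within D)"
    by (rule has_derivative_matrix) (simp add: T_def t')
  have "(f has_derivative f') (at (t Z) within t ` D)"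
    using f'(1) by (rule has_derivative_subset) (use tD in auto)
  from diff_chain_within[OF T this]
  have "((\<lambda>Z. f (t Z)) has_derivative (\<lambda>V. f' (T V))) (at Z within D)" by (simp add: o_def)
  moreover have "T (cmul c V) = cmul c (T V)" for c V by (rule mat_eqI) (simp add: T_def t')
  ultimately show "\<exists>k. ((\<lambda>Z. f (t Z)) has_derivative k) (at Z within D) \<and> (\<forall>c V. k (cmul c V) = c * k V)"
    using f'(2) by auto
qed

lemma cnj_mat_nth [simp]: "cnj_mat Z $ i $ j = cnj (Z $ i $ j)"
  by (simp add: cnj_mat_def)

lemma bounded_linear_cnj_mat: "bounded_linear (cnj_mat :: complex^'n^'n \<Rightarrow> _)"
proof (rule bounded_linear_intro)
  fix Z :: "complex^'n^'n"
  have "norm (cnj_mat Z $ i) = norm (Z $ i)" for i unfolding norm_vec_def by simp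
  then show "norm (cnj_mat Z) \<le> norm Z * 1" unfolding norm_vec_def[of Z] norm_vec_def[of "cnj_mat Z"] by simp
qed (auto intro!: mat_eqI)

text \<open>Two conjugations cancel: W -> \<open>cnj (f (cnj_mat W))\<close> is holomorphic, and it
  is composed with the holomorphic map Z -> \<open>cnj_mat (t Z)\<close>. This handles composition
  with the anti-holomorphic involutions.\<close>

lemma holomorphic_symm_cnj_chain:
  fixes t :: "complex^'n^'n \<Rightarrow> complex^'n^'n"
  assumes f: "holomorphic_symm f E" and t: "\<And>i j. holomorphic_symm (\<lambda>Z. cnj (t Z $ i $ j)) D"
    and tD: "\<And>Z. Z \<in> D \<Longrightarrow> t Z \<in> E"
  shows "holomorphic_symm (\<lambda>Z. cnj (f (t Z))) D"
proof -
  have "holomorphic_symm (\<lambda>W. cnj (f (cnj_mat W))) (cnj_mat -` E)"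
  proof (rule holomorphic_symmI)
    fix Z assume Z: "Z \<in> cnj_mat -` E"
    obtain f' where f': "(f has_derivative f') (at (cnj_mat Z) within E)" "\<And>c V. f' (cmul c V) = c * f' V"
      using holomorphic_symmD[OF f] Z by (metis vimageD)
    have T: "(cnj_mat has_derivative cnj_mat) (at Z within cnj_mat -` E)"
      by (rule bounded_linear_imp_has_derivative[OF bounded_linear_cnj_mat])
    have "(f has_derivative f') (at (cnj_mat Z) within cnj_mat ` (cnj_mat -` E))"
      using f'(1) by (rule has_derivative_subset) auto
    from bounded_linear.has_derivative[OF bounded_linear_cnj diff_chain_within[OF T this]]
    have "((\<lambda>W. cnj (f (cnj_mat W))) has_derivative (\<lambda>V. cnj (f' (cnj_mat V)))) (at Z within cnj_mat -` E)"
      by (simp add: o_def)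
    moreover have "cnj_mat (cmul c V) = cmul (cnj c) (cnj_mat V)" for c and V :: "complex^'n^'n"
      by (rule mat_eqI) simp
    ultimately show "\<exists>k. ((\<lambda>W. cnj (f (cnj_mat W))) has_derivative k) (at Z within cnj_mat -` E) \<and>
        (\<forall>c V. k (cmul c V) = c * k V)"
      using f'(2) by (intro exI[of _ "\<lambda>V. cnj (f' (cnj_mat V))"]) simp
  qed
  moreover have cc: "cnj_mat (cnj_mat W) = W" for W :: "complex^'n^'n" by (rule mat_eqI) simp
  ultimately show ?thesis
    using holomorphic_symm_chain[of "\<lambda>W. cnj (f (cnj_mat W))" "cnj_mat -` E" "\<lambda>Z. cnj_mat (t Z)" D] t tD
    by (simp add: cc)
qed

text \<open>Cauchy estimates, the identity theorem and the mean value property are all imported from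
  one variable through such complex lines.\<close>

lemma holomorphic_symm_line:
  assumes f: "holomorphic_symm f D" and D: "\<And>a. a \<in> A \<Longrightarrow> z + cmul a V \<in> D" and A: "open A"
  shows "(\<lambda>a. f (z + cmul a V)) holomorphic_on A"
proof -
  have "\<exists>g'. ((\<lambda>a. f (z + cmul a V)) has_field_derivative g') (at a)" if a: "a \<in> A" for a
  proof -
    obtain f' where f': "(f has_derivative f') (at (z + cmul a V) within D)" "\<And>c V. f' (cmul c V) = c * f' V"
      using holomorphic_symmD[OF f D[OF a]] by blast
    have T: "((\<lambda>a. z + cmul a V) has_derivative (\<lambda>h. cmul h V)) (at a within A)"
      using has_derivative_add[OF has_derivative_const[of z] bounded_linear_imp_has_derivative[OF bounded_linear_cmul_left[of V]]]
      by simp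
    have "(f has_derivative f') (at (z + cmul a V) within (\<lambda>a. z + cmul a V) ` A)"
      using f'(1) by (rule has_derivative_subset) (use D in auto)
    from diff_chain_within[OF T this]
    have "((\<lambda>a. f (z + cmul a V)) has_derivative (\<lambda>h. f' V * h)) (at a within A)"
      by (simp add: o_def f'(2) mult.commute)
    then have "((\<lambda>a. f (z + cmul a V)) has_field_derivative f' V) (at a within A)"
      by (simp add: has_field_derivative_def)
    then show ?thesis using at_within_open[OF a A] by metis
  qed
  then show ?thesis unfolding holomorphic_on_open[OF A] by blast
qed

text \<open>Cauchy's inequality on the complex line through \<open>p\<close> in direction
  \<open>V\<close>.\<close>

lemma holomorphic_symm_derivative_bound:
  assumes f: "holomorphic_symm f D" and f': "(f has_derivative f') (at p within D)" "\<And>c V. f' (cmul c V) = c * f' V"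
    and r: "r > 0" "\<And>V. V \<in> Symm_complex \<Longrightarrow> norm V < r \<Longrightarrow> p + V \<in> D"
    and B: "\<And>V. V \<in> Symm_complex \<Longrightarrow> norm V < r \<Longrightarrow> cmod (f (p + V)) \<le> B"
    and V: "V \<in> Symm_complex"
  shows "cmod (f' V) \<le> 2 * B / r * norm V"
proof (cases "V = 0")
  case True
  then show ?thesis using f'(2)[of 0 V] by simp
next
  case False
  \<comment> \<open>The line stays within distance \<open>r\<close> of \<open>p\<close> on the disc
    of radius \<open>2 * s\<close>; half of that radius leaves room for the closed disc in Cauchy's
    inequality.\<close>
  define s where "s = r / (2 * norm V)"
  have s: "s > 0" using False r by (simp add: s_def)
  have small: "norm (cmul a V) < r" if "cmod a < 2 * s" for a
    using that False by (simp add: norm_cmul s_def field_simps)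
  have hol: "(\<lambda>a. f (p + cmul a V)) holomorphic_on ball 0 (2 * s)"
    by (rule holomorphic_symm_line[OF f]) (auto intro!: r Symm_cmul V small)
  have at0: "at (0 :: complex) within ball 0 (2 * s) = at 0"
    by (rule at_within_open) (use s in auto)
  have T: "((\<lambda>a. p + cmul a V) has_derivative (\<lambda>h. cmul h V)) (at 0 within ball 0 (2 * s))"
    using has_derivative_add[OF has_derivative_const[of p] bounded_linear_imp_has_derivative[OF bounded_linear_cmul_left[of V]]]
    by simp
  have "(f has_derivative f') (at (p + cmul 0 V) within (\<lambda>a. p + cmul a V) ` ball 0 (2 * s))"
    by (rule has_derivative_subset[of _ _ _ D]) (use f' in \<open>auto intro!: r Symm_cmul V small\<close>)
  from diff_chain_within[OF T this]
  have "((\<lambda>a. f (p + cmul a V)) has_derivative (\<lambda>h. f' V * h)) (at 0 within ball 0 (2 * s))"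
    by (simp add: o_def f'(2) mult.commute[of _ "f' V"])
  then have "((\<lambda>a. f (p + cmul a V)) has_field_derivative f' V) (at 0 within ball 0 (2 * s))"
    by (simp add: has_field_derivative_def)
  then have der: "deriv (\<lambda>a. f (p + cmul a V)) 0 = f' V"
    unfolding at0 by (rule DERIV_imp_deriv)
  have "norm ((deriv ^^ 1) (\<lambda>a. f (p + cmul a V)) 0) \<le> fact 1 * B / s ^ 1"
  proof (rule Cauchy_inequality)
    show "(\<lambda>a. f (p + cmul a V)) holomorphic_on ball 0 s"
      using hol by (rule holomorphic_on_subset) (use s in auto)
    show "continuous_on (cball 0 s) (\<lambda>a. f (p + cmul a V))"
      by (rule holomorphic_on_imp_continuous_on, rule holomorphic_on_subset[OF hol]) (use s in auto)
    show "norm (f (p + cmul x V)) \<le> B" if "norm (0 - x) = s" for x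
      using that s by (intro B Symm_cmul V small) auto
  qed (rule s)
  then show ?thesis using False r unfolding der[symmetric] by (simp add: s_def field_simps)
qed

text \<open>Identity theorem on the complex line joining \<open>p\<close> to \<open>z\<close>.
  Convexity of \<open>D\<close> makes the slice of \<open>D\<close> by this line convex, hence
  connected.\<close>

lemma holomorphic_symm_eq_zero:
  assumes f: "holomorphic_symm f D" and D: "rel_open D" "convex D" and p: "p \<in> D"
    and r: "r > 0" "\<And>V. V \<in> Symm_complex \<Longrightarrow> norm V < r \<Longrightarrow> f (p + V) = 0"
    and z: "z \<in> D"
  shows "f z = 0"
proof -
  define W where "W = z - p"
  have W: "W \<in> Symm_complex" unfolding W_def by (intro Symm_diff rel_open_subset[OF D(1)] p z)
  \<comment> \<open>The parameter 0 corresponds to \<open>p\<close> and 1 to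
    \<open>z\<close>.\<close>
  define A where "A = {a. p + cmul a W \<in> D}"
  have A_Symm: "p + cmul a W \<in> Symm_complex" for a
    by (intro Symm_add Symm_cmul W rel_open_subset[OF D(1) p])
  obtain U where U: "open U" "D = Symm_complex \<inter> U" using rel_open_eq_open_Int[OF D(1)] .
  have cont: "continuous_on UNIV (\<lambda>a. p + cmul a W)"
    by (intro continuous_intros linear_continuous_on bounded_linear_cmul_left)
  have "A = (\<lambda>a. p + cmul a W) -` U" using A_Symm by (auto simp: A_def U(2))
  then have openA: "open A" using open_vimage[OF U(1) cont] by simp
  have "convex A"
  proof (rule convexI)
    fix x y :: complex and u v :: real
    assume "x \<in> A" "y \<in> A" and uv: "0 \<le> u" "0 \<le> v" "u + v = 1"
    then have "u *\<^sub>R (p + cmul x W) + v *\<^sub>R (p + cmul y W) \<in> D"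
      using D(2) by (auto simp: A_def intro: convexD)
    also have "u *\<^sub>R (p + cmul x W) + v *\<^sub>R (p + cmul y W) = (u + v) *\<^sub>R p + cmul (u *\<^sub>R x + v *\<^sub>R y) W"
      by (rule mat_eqI) (simp add: algebra_simps scaleR_add_left scaleR_add_right)
    finally show "u *\<^sub>R x + v *\<^sub>R y \<in> A" using uv by (simp add: A_def)
  qed
  then have conn: "connected A" by (rule convex_connected)
  define e where "e = r / (norm W + 1)"
  have e: "e > 0" using r by (simp add: e_def add_nonneg_pos)
  have small: "norm (cmul a W) < r" if "cmod a < e" for a
  proof -
    have "cmod a * norm W \<le> cmod a * (norm W + 1)" by (simp add: mult_left_mono)
    also have "\<dots> < e * (norm W + 1)" using that by (intro mult_strict_right_mono) (auto simp: add_nonneg_pos)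
    also have "\<dots> = r" by (simp add: e_def add_nonneg_eq_0_iff)
    finally show ?thesis by (simp add: norm_cmul)
  qed
  have "(\<lambda>a. f (p + cmul a W)) 1 = 0"
  proof (rule analytic_continuation[where f = "\<lambda>a. f (p + cmul a W)" and w = 1 and U = "ball 0 e \<inter> A" and \<xi> = 0])
    show "(\<lambda>a. f (p + cmul a W)) holomorphic_on A"
      by (rule holomorphic_symm_line[OF f _ openA]) (simp add: A_def)
    have "0 \<in> interior (ball 0 e \<inter> A)"
      using e p openA by (subst interior_open) (auto simp: A_def)
    then show "0 islimpt (ball 0 e \<inter> A)" by (rule interior_limit_point)
    show "f (p + cmul a W) = 0" if "a \<in> ball 0 e \<inter> A" for a
      using that by (intro r Symm_cmul W small) auto
  qed (use openA conn p z in \<open>auto simp: A_def W_def\<close>)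
  then show ?thesis by (simp add: W_def)
qed

section \<open>Sesqui-holomorphic functions are determined by the diagonal\<close>

text \<open>Every point of the smaller disc has a closed disc of radius \<open>r\<close> inside the
  larger one, so Cauchy's inequality bounds the derivative by \<open>B / r\<close>.\<close>

lemma bounded_holomorphic_Lipschitz:
  fixes a :: complex
  assumes g: "g holomorphic_on ball a (2 * r)" and r: "r > 0"
    and B: "\<And>x. x \<in> ball a (2 * r) \<Longrightarrow> cmod (g x) \<le> B"
    and x: "x \<in> ball a r" and y: "y \<in> ball a r"
  shows "cmod (g x - g y) \<le> B / r * cmod (x - y)"
proof (rule field_differentiable_bound[of "ball a r" g "deriv g"])
  fix z assume z: "z \<in> ball a r"
  have sub: "cball z r \<subseteq> ball a (2 * r)"
  proof
    fix w assume "w \<in> cball z r"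
    then show "w \<in> ball a (2 * r)" using z dist_triangle[of a w z] by simp
  qed
  then have hol: "g holomorphic_on cball z r" by (rule holomorphic_on_subset[OF g])
  have "z \<in> ball a (2 * r)" using z r by simp
  then show "(g has_field_derivative deriv g z) (at z within ball a r)"
    using holomorphic_derivI[OF g] by (meson has_field_derivative_at_within open_ball)
  have "norm ((deriv ^^ 1) g z) \<le> fact 1 * B / r ^ 1"
  proof (rule Cauchy_inequality)
    show "g holomorphic_on ball z r" using hol ball_subset_cball by (rule holomorphic_on_subset)
    show "continuous_on (cball z r) g" using hol by (rule holomorphic_on_imp_continuous_on)
    show "norm (g w) \<le> B" if "norm (z - w) = r" for w
      using sub that by (intro B) (auto simp: dist_norm)
  qed (rule r)
  then show "cmod (deriv g z) \<le> B / r" by simp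
qed (use x y in auto)

text \<open>Boundedness replaces the joint continuity assumption of Osgood's lemma.\<close>

lemma separately_holomorphic_diagonal:
  fixes G :: "complex \<Rightarrow> complex \<Rightarrow> complex"
  assumes h1: "\<And>b. b \<in> ball 0 R \<Longrightarrow> (\<lambda>a. G a b) holomorphic_on ball 0 R"
    and h2: "\<And>a. a \<in> ball 0 R \<Longrightarrow> G a holomorphic_on ball 0 R"
    and B: "\<And>a b. a \<in> ball 0 R \<Longrightarrow> b \<in> ball 0 R \<Longrightarrow> cmod (G a b) \<le> B"
  shows "(\<lambda>a. G a a) holomorphic_on ball 0 R"
proof -
  have "\<exists>d. ((\<lambda>a. G a a) has_field_derivative d) (at a)" if a: "a \<in> ball 0 R" for a
  proof -
    define r where "r = (R - cmod a) / 2"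
    have r: "r > 0" using a by (simp add: r_def)
    have sub: "ball a (2 * r) \<subseteq> ball 0 R"
    proof
      fix x assume "x \<in> ball a (2 * r)"
      then show "x \<in> ball 0 R" using norm_triangle_ineq[of a "x - a"] by (simp add: r_def dist_norm norm_minus_commute)
    qed
    obtain d1 where d1: "((\<lambda>x. G x a) has_field_derivative d1) (at a)"
      using h1[OF a] a holomorphic_derivI open_ball by blast
    obtain d2 where d2: "(G a has_field_derivative d2) (at a)"
      using h2[OF a] a holomorphic_derivI open_ball by blast
    define K where "K = B / r / r"
    \<comment> \<open>The mixed second difference is bounded by applying the Lipschitz estimate
      first in the second variable and then, to the difference \<open>k\<close>, in the first. Being
      quadratic in \<open>h\<close>, it disappears from the difference quotient.\<close>
    have main: "cmod ((G (a + h) (a + h) - G (a + h) a) - (G a (a + h) - G a a)) \<le> K * cmod h * cmod h"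
      if h: "cmod h < r" for h
    proof -
      define k where "k x = G x (a + h) - G x a" for x
      have ah: "a + h \<in> ball a r" using h by (simp add: dist_norm)
      have aa: "a \<in> ball a r" using r by simp
      have in0: "a + h \<in> ball 0 R" "a \<in> ball 0 R" using ah aa sub r a by (auto simp: subset_iff)
      have kB: "cmod (k x) \<le> B / r * cmod h" if "x \<in> ball a (2 * r)" for x
      proof -
        have "cmod (G x (a + h) - G x a) \<le> B / r * cmod ((a + h) - a)"
        proof (rule bounded_holomorphic_Lipschitz[OF _ r _ ah aa])
          show "G x holomorphic_on ball a (2 * r)"
            using that sub by (intro holomorphic_on_subset[OF h2]) auto
          show "cmod (G x y) \<le> B" if "y \<in> ball a (2 * r)" for y
            using \<open>x \<in> _\<close> that sub by (intro B) blast+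
        qed
        then show ?thesis by (simp add: k_def)
      qed
      have "cmod (k (a + h) - k a) \<le> (B / r * cmod h) / r * cmod ((a + h) - a)"
      proof (rule bounded_holomorphic_Lipschitz[OF _ r kB ah aa])
        show "k holomorphic_on ball a (2 * r)"
          unfolding k_def using sub in0 by (intro holomorphic_on_diff holomorphic_on_subset[OF h1])
      qed
      then show ?thesis by (simp add: k_def K_def field_simps)
    qed
    have "((\<lambda>h. ((G (a + h) (a + h) - G (a + h) a) - (G a (a + h) - G a a)) / h) \<longlongrightarrow> 0) (at 0)"
    proof (rule Lim_null_comparison)
      show "\<forall>\<^sub>F h in at 0. norm (((G (a + h) (a + h) - G (a + h) a) - (G a (a + h) - G a a)) / h) \<le> K * cmod h"
        unfolding eventually_at
      proof (intro exI[of _ r] conjI ballI impI r)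
        fix h :: complex assume "h \<noteq> 0 \<and> dist h 0 < r"
        then show "norm (((G (a + h) (a + h) - G (a + h) a) - (G a (a + h) - G a a)) / h) \<le> K * cmod h"
          using main[of h] by (simp add: norm_divide divide_le_eq)
      qed
      have "((\<lambda>h. K * cmod h) \<longlongrightarrow> K * cmod 0) (at (0::complex))" by (intro tendsto_intros)
      then show "((\<lambda>h. K * cmod h) \<longlongrightarrow> 0) (at (0::complex))" by simp
    qed
    moreover have "((\<lambda>h. (G (a + h) a - G a a) / h) \<longlongrightarrow> d1) (at 0)" using d1 by (simp add: DERIV_def)
    moreover have "((\<lambda>h. (G a (a + h) - G a a) / h) \<longlongrightarrow> d2) (at 0)" using d2 by (simp add: DERIV_def)
    ultimately have "((\<lambda>h. ((G (a + h) (a + h) - G (a + h) a) - (G a (a + h) - G a a)) / h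
        + (G (a + h) a - G a a) / h + (G a (a + h) - G a a) / h) \<longlongrightarrow> 0 + d1 + d2) (at 0)"
      by (intro tendsto_add)
    moreover have "((G (a + h) (a + h) - G (a + h) a) - (G a (a + h) - G a a)) / h
        + (G (a + h) a - G a a) / h + (G a (a + h) - G a a) / h = (G (a + h) (a + h) - G a a) / h" for h
      by (simp add: diff_divide_distrib)
    ultimately have "((\<lambda>a. G a a) has_field_derivative (0 + d1 + d2)) (at a)"
      unfolding DERIV_def by simp
    then show ?thesis by blast
  qed
  then show ?thesis unfolding holomorphic_on_open[OF open_ball] by blast
qed

text \<open>Conjugating the parameter in the second argument turns a sesqui-holomorphic function
  into a holomorphic function of one variable. At real parameters both arguments move in the same
  way, so for \<open>z = w\<close> they stay on the diagonal.\<close>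

lemma sesqui_holomorphic_line:
  assumes h1: "\<And>w. w \<in> D \<Longrightarrow> holomorphic_symm (\<lambda>z. F z w) D"
    and h2: "\<And>z. z \<in> D \<Longrightarrow> holomorphic_symm (\<lambda>w. cnj (F z w)) D"
    and z: "\<And>a. a \<in> ball 0 R \<Longrightarrow> z + cmul a V \<in> D" and w: "\<And>a. a \<in> ball 0 R \<Longrightarrow> w + cmul a V \<in> D"
    and B: "\<And>a b. a \<in> ball 0 R \<Longrightarrow> b \<in> ball 0 R \<Longrightarrow> cmod (F (z + cmul a V) (w + cmul b V)) \<le> B"
  shows "(\<lambda>a. F (z + cmul a V) (w + cmul (cnj a) V)) holomorphic_on ball 0 R"
proof (rule separately_holomorphic_diagonal[where G = "\<lambda>a b. F (z + cmul a V) (w + cmul (cnj b) V)"])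
  show "(\<lambda>a. F (z + cmul a V) (w + cmul (cnj b) V)) holomorphic_on ball 0 R" if "b \<in> ball 0 R" for b
    by (rule holomorphic_symm_line[OF h1]) (use that z w in auto)
  show "(\<lambda>b. F (z + cmul a V) (w + cmul (cnj b) V)) holomorphic_on ball 0 R" if "a \<in> ball 0 R" for a
  proof -
    have "(\<lambda>b. cnj (F (z + cmul a V) (w + cmul b V))) holomorphic_on ball 0 R"
      by (rule holomorphic_symm_line[OF h2]) (use that z w in auto)
    moreover have "cnj ` ball 0 R = ball 0 R"
    proof (intro equalityI subsetI)
      fix x :: complex assume "x \<in> ball 0 R"
      then show "x \<in> cnj ` ball 0 R" by (intro image_eqI[of _ _ "cnj x"]) auto
    qed auto
    ultimately have "(cnj \<circ> (\<lambda>b. cnj (F (z + cmul a V) (w + cmul b V))) \<circ> cnj) holomorphic_on ball 0 R"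
      by (intro holomorphic_on_compose_cnj_cnj) auto
    then show ?thesis by (simp add: o_def)
  qed
  show "cmod (F (z + cmul a V) (w + cmul (cnj b) V)) \<le> B" if "a \<in> ball 0 R" "b \<in> ball 0 R" for a b
    using B[of a "cnj b"] that by simp
qed

lemma holomorphic_zero_on_reals:
  assumes f: "f holomorphic_on ball 0 R" and R: "R > 0"
    and zero: "\<And>t::real. \<bar>t\<bar> < R \<Longrightarrow> f (of_real t) = 0" and a: "a \<in> ball 0 R"
  shows "f a = 0"
proof (rule analytic_continuation[OF f open_ball connected_ball])
  show "complex_of_real ` {-R<..<R} \<subseteq> ball 0 R" by auto
  show "0 islimpt complex_of_real ` {-R<..<R}"
    unfolding islimpt_approachable
  proof (intro allI impI)
    fix e :: real assume e: "e > 0"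
    define t where "t = min e R / 2"
    have "0 < t" "t < R" "t < e" using e R by (auto simp: t_def)
    then show "\<exists>x'\<in>complex_of_real ` {-R<..<R}. x' \<noteq> 0 \<and> dist x' 0 < e"
      by (intro bexI[of _ "of_real t"]) auto
  qed
qed (use R zero a in auto)

text \<open>Polarisation by analytic continuation: the pair \<open>(p + S, p)\<close> is reached
  from diagonal pairs by letting a real parameter become imaginary. This gives vanishing of
  \<open>F\<close> in its first argument near the second one, and the identity theorem spreads it
  over \<open>D\<close>.\<close>

lemma sesqui_holomorphic_zero:
  assumes h1: "\<And>w. w \<in> D \<Longrightarrow> holomorphic_symm (\<lambda>z. F z w) D"
    and h2: "\<And>z. z \<in> D \<Longrightarrow> holomorphic_symm (\<lambda>w. cnj (F z w)) D"
    and B: "\<And>p. p \<in> D \<Longrightarrow> \<exists>r>0. \<exists>B. \<forall>z\<in>D. \<forall>w\<in>D. dist z p < r \<longrightarrow> dist w p < r \<longrightarrow> cmod (F z w) \<le> B"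
    and diag: "\<And>z. z \<in> D \<Longrightarrow> F z z = 0"
    and D: "rel_open D" "convex D"
    and zw: "z \<in> D" "w \<in> D"
  shows "F z w = 0"
proof -
  have local: "\<exists>r>0. \<forall>S\<in>Symm_complex. norm S < r \<longrightarrow> F (p + S) p = 0" if p: "p \<in> D" for p
  proof -
    obtain r1 where r1: "r1 > 0" "\<And>V. V \<in> Symm_complex \<Longrightarrow> norm V < r1 \<Longrightarrow> p + V \<in> D"
      using rel_openE[OF D(1) p] by blast
    obtain r2 M where r2: "r2 > 0" "\<And>z w. z \<in> D \<Longrightarrow> w \<in> D \<Longrightarrow> dist z p < r2 \<Longrightarrow> dist w p < r2 \<Longrightarrow> cmod (F z w) \<le> M"
      using B[OF p] by blast
    define r where "r = min r1 r2"
    have r: "r > 0" "r \<le> r1" "r \<le> r2" using r1 r2 by (auto simp: r_def)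
    have "F (p + S) p = 0" if S: "S \<in> Symm_complex" "norm S < r / 4" for S
    proof -
      \<comment> \<open>Solves X + iY = S and X - iY = 0, so that below \<open>P 1 \<i>\<close> is
        \<open>p + S\<close> and \<open>P 1 (cnj \<i>)\<close> is \<open>p\<close>.\<close>
      define X Y where "X = cmul (1/2) S" and "Y = cmul (- \<i> / 2) S"
      have XY: "X \<in> Symm_complex" "Y \<in> Symm_complex" by (auto simp: X_def Y_def intro: Symm_cmul S)
      have sm: "norm (cmul a X + cmul b Y) < r" if "cmod a < 2" "cmod b < 2" for a b
      proof -
        have "norm (cmul a X + cmul b Y) \<le> cmod a * norm X + cmod b * norm Y"
          using norm_triangle_ineq[of "cmul a X" "cmul b Y"] by (simp add: norm_cmul)
        also have "\<dots> = (cmod a + cmod b) / 2 * norm S" by (simp add: X_def Y_def norm_cmul norm_divide algebra_simps)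
        also have "\<dots> \<le> 2 * norm S" using that by (intro mult_right_mono) auto
        also have "\<dots> < r" using S r by simp
        finally show ?thesis .
      qed
      define P where "P a b = p + cmul a X + cmul b Y" for a b
      have PD: "P a b \<in> D" "dist (P a b) p < r" if "cmod a < 2" "cmod b < 2" for a b
        using sm[OF that] r1(2)[of "cmul a X + cmul b Y"] r that XY
        by (auto simp: P_def dist_norm add.assoc intro!: Symm_add Symm_cmul)
      have bd: "cmod (F (P a b) (P a' b')) \<le> M" if "cmod a < 2" "cmod b < 2" "cmod a' < 2" "cmod b' < 2" for a b a' b'
        by (rule r2(2)) (use that PD[of a b] PD[of a' b'] r in auto)
      have step1: "F (P a (of_real t)) (P (cnj a) (of_real t)) = 0" if "cmod a < 2" "\<bar>t\<bar> < 2" for a t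
      proof -
        have sw: "P a b = (p + cmul b Y) + cmul a X" for a b by (simp add: P_def)
        have "(\<lambda>a. F ((p + cmul (of_real t) Y) + cmul a X) ((p + cmul (of_real t) Y) + cmul (cnj a) X)) holomorphic_on ball 0 2"
          by (rule sesqui_holomorphic_line[OF h1 h2, where B = M])
            (use that bd[of _ "of_real t" _ "of_real t"] PD[of _ "of_real t"] in \<open>auto simp flip: sw\<close>)
        from holomorphic_zero_on_reals[OF this, of a] show ?thesis
          using that diag PD(1)[of "of_real _" "of_real t"] by (simp flip: sw)
      qed
      have sw: "P a b = (p + cmul a X) + cmul b Y" for a b by (simp add: P_def)
      have "(\<lambda>b. F ((p + cmul 1 X) + cmul b Y) ((p + cmul 1 X) + cmul (cnj b) Y)) holomorphic_on ball 0 2"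
        by (rule sesqui_holomorphic_line[OF h1 h2, where B = M])
          (use bd[of 1 _ 1] PD[of 1] in \<open>auto simp flip: sw simp del: cmul_one\<close>)
      \<comment> \<open>For real \<open>b\<close> both arguments equal \<open>P 1 b\<close>; the
        disc of radius 2 contains the imaginary unit.\<close>
      from holomorphic_zero_on_reals[OF this, of \<i>]
      have "F (P 1 \<i>) (P 1 (cnj \<i>)) = 0"
        using step1[of 1] by (simp flip: sw del: cmul_one)
      moreover have "P 1 \<i> = p + S" "P 1 (cnj \<i>) = p"
        by (auto intro!: mat_eqI simp: P_def X_def Y_def)
      ultimately show ?thesis by simp
    qed
    then show ?thesis using r by (intro exI[of _ "r/4"]) auto
  qed
  obtain r where "r > 0" "\<forall>S\<in>Symm_complex. norm S < r \<longrightarrow> F (w + S) w = 0" using local[OF zw(2)] by blast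
  then show ?thesis by (intro holomorphic_symm_eq_zero[OF h1[OF zw(2)] D zw(2) _ _ zw(1)]) auto
qed

section \<open>Mean value inequality and locally uniform limits\<close>

lemma mean_value_le:
  assumes g: "g holomorphic_on ball 0 R" and R: "R > 1"
  shows "ennreal (cmod (g 0)) \<le> (\<integral>\<^sup>+ t. indicator {0..1} t * ennreal (cmod (g (exp (2 * of_real pi * \<i> * of_real t)))) \<partial>lborel)"
proof -
  define e where "e t = exp (2 * of_real pi * \<i> * of_real t)" for t :: real
  have norm_e: "cmod (e t) = 1" for t by (simp add: e_def)
  have sub: "cball 0 1 \<subseteq> ball 0 R" using R by auto
  have "((\<lambda>u. g u / (u - 0)) has_contour_integral (2 * of_real pi * \<i> * g 0)) (circlepath 0 1)"
    by (rule Cauchy_integral_circlepath_simple) (use g sub in \<open>auto intro: holomorphic_on_subset\<close>)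
  then have "((\<lambda>t. g (circlepath 0 1 t) / (circlepath 0 1 t) * vector_derivative (circlepath 0 1) (at t within {0..1}))
      has_integral (2 * of_real pi * \<i> * g 0)) {0..1}"
    by (simp add: has_contour_integral_def)
  then have "((\<lambda>t. (2 * of_real pi * \<i>) * g (e t)) has_integral ((2 * of_real pi * \<i>) * g 0)) {0..1}"
  proof (rule has_integral_eq[rotated])
    fix t :: real assume "t \<in> {0..1}"
    then have v: "vector_derivative (circlepath 0 1) (at t within {0..1}) = 2 * pi * \<i> * e t"
      by (simp add: vector_derivative_circlepath01 e_def)
    have c: "circlepath 0 1 t = e t" by (simp add: circlepath e_def)
    show "g (circlepath 0 1 t) / circlepath 0 1 t * vector_derivative (circlepath 0 1) (at t within {0..1})
        = 2 * of_real pi * \<i> * g (e t)"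
      unfolding v c by (simp add: e_def)
  qed
  from has_integral_mult_right[OF this, of "1 / (2 * of_real pi * \<i>)"]
  have hi: "((\<lambda>t. g (e t)) has_integral g 0) {0..1}" by simp
  have "continuous_on (ball 0 R) g" using g by (rule holomorphic_on_imp_continuous_on)
  then have cont: "continuous_on {0..1} (\<lambda>t. g (e t))"
  proof (rule continuous_on_compose2)
    show "continuous_on {0..1} e" unfolding e_def by (intro continuous_intros)
    show "e ` {0..1} \<subseteq> ball 0 R" using norm_e R by auto
  qed
  have int: "set_integrable lborel {0..1} (\<lambda>t. g (e t))" by (rule borel_integrable_atLeastAtMost'[OF cont])
  have "g 0 = (LINT t:{0..1}|lborel. g (e t))"
    using set_borel_integral_eq_integral(2)[OF int] hi by (simp add: integral_unique)
  also have "ennreal (cmod \<dots>) \<le> (\<integral>\<^sup>+ t. ennreal (norm (indicator {0..1} t *\<^sub>R g (e t))) \<partial>lborel)"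
    unfolding set_lebesgue_integral_def by (rule integral_norm_bound_ennreal) (use int in \<open>simp add: set_integrable_def\<close>)
  also have "\<dots> = (\<integral>\<^sup>+ t. indicator {0..1} t * ennreal (cmod (g (e t))) \<partial>lborel)"
    by (intro nn_integral_cong) (auto simp: indicator_def)
  finally show ?thesis by (simp add: e_def)
qed

lemma ball_borel [measurable]: "ball p r \<in> sets borel"
  by simp

lemma measurable_cmul [measurable]: "cmul c \<in> borel \<rightarrow>\<^sub>M borel"
  by (intro borel_measurable_continuous_onI linear_continuous_on bounded_linear_cmul_right)

text \<open>\<open>haar_scaling\<close> supplies some constant. A ball around 0 is rotation
  invariant with positive finite measure, so the constant is 1.\<close>

lemma nn_integral_rotate:
  fixes f :: "complex^'n^'n \<Rightarrow> ennreal"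
  assumes u: "cmod u = 1" and f: "f \<in> borel_measurable borel"
  shows "(\<integral>\<^sup>+ V. f (cmul u V) \<partial>lebesgue_symm) = (\<integral>\<^sup>+ V. f V \<partial>lebesgue_symm)"
proof -
  have uu: "u * cnj u = 1" using complex_norm_square[of u] u by simp
  obtain d where d: "d > 0" "\<And>f :: complex^'n^'n \<Rightarrow> ennreal. f \<in> borel_measurable borel \<Longrightarrow>
      (\<integral>\<^sup>+ x. f (cmul u x) \<partial>lebesgue_symm) = ennreal d * (\<integral>\<^sup>+ x. f x \<partial>lebesgue_symm)"
    using haar_scaling[of "cmul u :: complex^'n^'n \<Rightarrow> _" "cmul (cnj u)"] uu
    by (auto simp: cmul_add Symm_cmul mult.commute)
  define B where "B = emeasure lebesgue_symm (ball (0 :: complex^'n^'n) 1)"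
  have "(\<integral>\<^sup>+ x. indicator (ball (0 :: complex^'n^'n) 1) (cmul u x) \<partial>lebesgue_symm) = B"
  proof -
    have "(\<integral>\<^sup>+ x. indicator (ball (0 :: complex^'n^'n) 1) (cmul u x) \<partial>lebesgue_symm)
       = (\<integral>\<^sup>+ x. indicator (ball (0 :: complex^'n^'n) 1) x \<partial>lebesgue_symm)"
      using u by (intro nn_integral_cong) (auto simp: indicator_def norm_cmul)
    then show ?thesis by (simp add: B_def)
  qed
  moreover have "(\<integral>\<^sup>+ x. indicator (ball (0 :: complex^'n^'n) 1) (cmul u x) \<partial>lebesgue_symm) = ennreal d * B"
    by (subst d(2)) (simp_all add: B_def borel_measurable_indicator)
  ultimately have "B = ennreal d * B" by simp
  moreover have "B > 0" "B < \<infinity>"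
    unfolding B_def by (simp_all add: emeasure_ball_pos Symm_zero emeasure_bounded del: infinity_ennreal_def)
  ultimately have "ennreal d = 1"
    by (metis ennreal_mult_divide_eq infinity_ennreal_def less_irrefl mult.left_neutral)
  then show ?thesis using d(2)[OF f] by simp
qed

text \<open>The one-variable mean value inequality on the circle through \<open>V\<close> is
  integrated over all \<open>V\<close> in the ball. After exchanging the integrals, rotation
  invariance makes the inner integral independent of the circle parameter.\<close>

lemma sub_mean_value:
  fixes f :: "complex^'n^'n \<Rightarrow> complex"
  assumes f: "holomorphic_symm f D" and D: "rel_open D" and p: "p \<in> D"
    and r: "r > 0" "\<And>V. V \<in> Symm_complex \<Longrightarrow> norm V < r \<Longrightarrow> p + V \<in> D"
  shows "ennreal ((cmod (f p))\<^sup>2) * emeasure lebesgue_symm (ball (0 :: complex^'n^'n) r)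
     \<le> (\<integral>\<^sup>+ Z. indicator (ball p r \<inter> D) Z * ennreal ((cmod (f Z))\<^sup>2) \<partial>lebesgue_symm)"
proof -
  let ?L = "lebesgue_symm :: (complex^'n^'n) measure"
  let ?B = "ball (0 :: complex^'n^'n) r"
  define e where "e t = exp (2 * of_real pi * \<i> * of_real t)" for t :: real
  have norm_e: "cmod (e t) = 1" for t by (simp add: e_def)
  define F where "F Z = indicator D Z * ennreal ((cmod (f Z))\<^sup>2)" for Z
  have F[measurable]: "F \<in> borel_measurable borel"
  proof -
    have "(\<lambda>Z. indicator D Z *\<^sub>R f Z) \<in> borel_measurable borel"
      by (rule borel_measurable_continuous_on_indicator[OF rel_open_borel[OF D] holomorphic_symm_continuous[OF f]])
    then have "(\<lambda>Z. ennreal ((cmod (indicator D Z *\<^sub>R f Z))\<^sup>2)) \<in> borel_measurable borel" by measurable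
    also have "(\<lambda>Z. ennreal ((cmod (indicator D Z *\<^sub>R f Z))\<^sup>2)) = F"
      by (auto simp: F_def indicator_def fun_eq_iff)
    finally show ?thesis .
  qed
  have cont: "continuous_on UNIV (\<lambda>x :: (complex^'n^'n) \<times> real. p + cmul (e (snd x)) (fst x))"
    unfolding e_def
    by (intro continuous_on_add continuous_on_const continuous_on_matrix_entries, unfold cmul_nth)
      (intro continuous_intros)
  have pm: "(\<lambda>x. p + cmul (e (snd x)) (fst x)) \<in> (?L \<Otimes>\<^sub>M lborel) \<rightarrow>\<^sub>M borel"
  proof -
    have "sets (?L \<Otimes>\<^sub>M lborel) = sets (borel :: ((complex^'n^'n) \<times> real) measure)"
      by (subst borel_prod[symmetric]) (intro sets_pair_measure_cong; simp)
    then show ?thesis using borel_measurable_continuous_onI[OF cont] by (simp cong: measurable_cong_sets)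
  qed
  have e_meas: "(\<lambda>V. p + cmul (e t) V) \<in> borel \<rightarrow>\<^sub>M borel" for t by measurable
  have FF: "(\<lambda>x. indicator ?B (fst x) * (indicator {0..1} (snd x) * F (p + cmul (e (snd x)) (fst x))))
      \<in> borel_measurable (?L \<Otimes>\<^sub>M lborel)"
  proof (intro borel_measurable_times_ennreal measurable_compose[OF pm F])
    show "(\<lambda>x. indicator ?B (fst x)) \<in> borel_measurable (?L \<Otimes>\<^sub>M (lborel :: real measure))"
      by (rule measurable_compose[OF measurable_fst]) (simp add: borel_measurable_indicator)
    show "(\<lambda>x. indicator {0..1} (snd x)) \<in> borel_measurable (?L \<Otimes>\<^sub>M (lborel :: real measure))"
      by (rule measurable_compose[OF measurable_snd borel_measurable_indicator]) simp
  qed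
  interpret P: pair_sigma_finite ?L "lborel :: real measure" ..
  have "ennreal ((cmod (f p))\<^sup>2) * emeasure ?L ?B = (\<integral>\<^sup>+ V. indicator ?B V * ennreal ((cmod (f p))\<^sup>2) \<partial>?L)"
    by (simp add: nn_integral_multc mult.commute)
  also have "\<dots> \<le> (\<integral>\<^sup>+ V. (\<integral>\<^sup>+ t. indicator ?B V * (indicator {0..1} t * F (p + cmul (e t) V)) \<partial>lborel) \<partial>?L)"
  proof (rule nn_integral_mono_AE, rule AE_mp[OF AE_lebesgue_symm], intro AE_I2 impI)
    fix V :: "complex^'n^'n" assume V: "V \<in> Symm_complex"
    show "indicator ?B V * ennreal ((cmod (f p))\<^sup>2) \<le> (\<integral>\<^sup>+ t. indicator ?B V * (indicator {0..1} t * F (p + cmul (e t) V)) \<partial>lborel)"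
    proof (cases "V \<in> ?B")
      case True
      \<comment> \<open>The line in direction \<open>V\<close> may be followed up to parameter
        \<open>r / norm V\<close>, which exceeds 1 inside the ball; for \<open>V = 0\<close> the
        function is constant and any radius above 1 serves.\<close>
      define R where "R = (if V = 0 then 2 else r / norm V)"
      have R: "R > 1" using True by (simp add: R_def)
      have inD: "p + cmul a V \<in> D" if "cmod a < R" for a
      proof (rule r(2)[OF Symm_cmul[OF V]])
        show "norm (cmul a V) < r"
          using that r(1) by (cases "V = 0") (auto simp: R_def norm_cmul field_simps)
      qed
      \<comment> \<open>The square is holomorphic too, and its modulus is the integrand of the L2
        norm.\<close>
      have "(\<lambda>a. (f (p + cmul a V))\<^sup>2) holomorphic_on ball 0 R"
        by (intro holomorphic_intros holomorphic_symm_line[OF f]) (auto intro: inD)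
      from mean_value_le[OF this R]
      have "ennreal ((cmod (f p))\<^sup>2) \<le> (\<integral>\<^sup>+ t. indicator {0..1} t * ennreal ((cmod (f (p + cmul (e t) V)))\<^sup>2) \<partial>lborel)"
        by (simp add: e_def norm_power)
      also have "\<dots> = (\<integral>\<^sup>+ t. indicator {0..1} t * F (p + cmul (e t) V) \<partial>lborel)"
        using inD norm_e R by (intro nn_integral_cong) (auto simp: F_def)
      finally show ?thesis using True by simp
    qed simp
  qed
  also have "\<dots> = (\<integral>\<^sup>+ t. (\<integral>\<^sup>+ V. indicator ?B V * (indicator {0..1} t * F (p + cmul (e t) V)) \<partial>?L) \<partial>lborel)"
    using P.Fubini'[of "\<lambda>V t. indicator ?B V * (indicator {0..1} t * F (p + cmul (e t) V))"] FF
    by (simp add: case_prod_beta')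
  also have "\<dots> = (\<integral>\<^sup>+ t. indicator {0..1} t * (\<integral>\<^sup>+ V. indicator ?B V * F (p + V) \<partial>?L) \<partial>(lborel :: real measure))"
  proof (rule nn_integral_cong)
    fix t :: real
    have Fm: "(\<lambda>V. F (p + V)) \<in> borel_measurable borel" by measurable
    have "(\<integral>\<^sup>+ V. indicator ?B V * (indicator {0..1} t * F (p + cmul (e t) V)) \<partial>?L)
       = (\<integral>\<^sup>+ V. indicator {0..1} t * (indicator ?B (cmul (e t) V) * F (p + cmul (e t) V)) \<partial>?L)"
      by (intro nn_integral_cong) (auto simp: indicator_def norm_cmul norm_e)
    also have "\<dots> = indicator {0..1} t * (\<integral>\<^sup>+ V. indicator ?B (cmul (e t) V) * F (p + cmul (e t) V) \<partial>?L)"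
      by (rule nn_integral_cmult) measurable
    also have "(\<integral>\<^sup>+ V. indicator ?B (cmul (e t) V) * F (p + cmul (e t) V) \<partial>?L) = (\<integral>\<^sup>+ V. indicator ?B V * F (p + V) \<partial>?L)"
      by (rule nn_integral_rotate[OF norm_e, of "\<lambda>V. indicator ?B V * F (p + V)"]) measurable
    finally show "(\<integral>\<^sup>+ V. indicator ?B V * (indicator {0..1} t * F (p + cmul (e t) V)) \<partial>?L)
       = indicator {0..1} t * (\<integral>\<^sup>+ V. indicator ?B V * F (p + V) \<partial>?L)" .
  qed
  also have "\<dots> = (\<integral>\<^sup>+ V. indicator ?B V * F (p + V) \<partial>?L)"
    by (simp add: nn_integral_multc)
  also have "\<dots> = (\<integral>\<^sup>+ V. (\<lambda>Z. indicator ?B (Z - p) * F Z) (V + p) \<partial>?L)"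
    by (simp add: add.commute)
  also have "\<dots> = (\<integral>\<^sup>+ Z. indicator ?B (Z - p) * F Z \<partial>?L)"
    by (rule nn_integral_translate[OF rel_open_subset[OF D p]]) measurable
  also have "\<dots> = (\<integral>\<^sup>+ Z. indicator (ball p r \<inter> D) Z * ennreal ((cmod (f Z))\<^sup>2) \<partial>?L)"
    by (intro nn_integral_cong) (auto simp: F_def indicator_def dist_norm norm_minus_commute)
  finally show ?thesis .
qed

text \<open>Derivatives within \<open>D\<close> are determined on symmetric directions only.
  Composing with this projection fixes their values on the other directions, so that the derivatives
  of a convergent sequence can converge as maps on all matrices.\<close>

definition symm_part :: "complex^'n^'n \<Rightarrow> complex^'n^'n" where
  "symm_part V = (\<chi> i j. (V $ i $ j + V $ j $ i) / 2)"

lemma symm_part_nth: "symm_part V $ i $ j = (V $ i $ j + V $ j $ i) / 2"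
  by (simp add: symm_part_def)

lemma symm_part_Symm: "symm_part V \<in> Symm_complex"
  by (simp add: Symm_complex_iff symm_part_nth add.commute)

lemma symm_part_id: "V \<in> Symm_complex \<Longrightarrow> symm_part V = V"
  by (rule mat_eqI) (auto simp: Symm_complex_iff symm_part_nth)

lemma bounded_linear_symm_part: "bounded_linear (symm_part :: complex^'n^'n \<Rightarrow> _)"
proof -
  have "linear (symm_part :: complex^'n^'n \<Rightarrow> _)"
    by (intro linearI mat_eqI) (auto simp: symm_part_nth complex_eq_iff field_simps)
  then show ?thesis by (rule linear_conv_bounded_linear[THEN iffD1])
qed

lemma symm_part_cmul: "symm_part (cmul c V) = cmul c (symm_part V)"
  by (rule mat_eqI) (simp add: symm_part_nth field_simps)

lemma has_derivative_symm_part: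
  assumes "(f has_derivative f') (at x within D)" "x \<in> D" "D \<subseteq> Symm_complex"
  shows "(f has_derivative (\<lambda>V. f' (symm_part V))) (at x within D)"
proof -
  have e: "symm_part y = y" if "y \<in> D" for y using that assms(3) symm_part_id by blast
  have "symm_part ` D = D" using e by force
  then have "(f has_derivative f') (at (symm_part x) within symm_part ` D)" using assms e by simp
  from diff_chain_within[OF bounded_linear_imp_has_derivative[OF bounded_linear_symm_part] this]
  have "((\<lambda>y. f (symm_part y)) has_derivative (\<lambda>V. f' (symm_part V))) (at x within D)"
    by (simp add: o_def)
  then show ?thesis by (rule has_derivative_transform[OF assms(2), rotated]) (simp add: e)
qed

text \<open>Cauchy estimates make the derivatives uniformly Cauchy near each point, so
  differentiation passes to the limit; complex linearity of the derivative passes to the limit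
  pointwise.\<close>

lemma holomorphic_symm_limit:
  fixes s :: "nat \<Rightarrow> complex^'n^'n \<Rightarrow> complex"
  assumes D: "rel_open D" "convex D" and s: "\<And>n. holomorphic_symm (s n) D"
    and lim: "\<And>z. z \<in> D \<Longrightarrow> (\<lambda>n. s n z) \<longlonglongrightarrow> g z"
    and Cauchy: "\<And>p. p \<in> D \<Longrightarrow> \<exists>r>0. \<forall>e>0. \<exists>N. \<forall>m\<ge>N. \<forall>n\<ge>N. \<forall>z\<in>D. dist z p < r \<longrightarrow> cmod (s m z - s n z) \<le> e"
  shows "holomorphic_symm g D"
proof (rule holomorphic_symmI)
  fix p assume p: "p \<in> D"
  obtain r1 where r1: "r1 > 0" "\<And>V. V \<in> Symm_complex \<Longrightarrow> norm V < r1 \<Longrightarrow> p + V \<in> D"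
    using rel_openE[OF D(1) p] by blast
  obtain r2 where r2: "r2 > 0" "\<forall>e>0. \<exists>N. \<forall>m\<ge>N. \<forall>n\<ge>N. \<forall>z\<in>D. dist z p < r2 \<longrightarrow> cmod (s m z - s n z) \<le> e"
    using Cauchy[OF p] by blast
  \<comment> \<open>Half the radius: a ball of radius \<open>r\<close> around any point of
    \<open>U\<close> still lies where both \<open>D\<close> and the uniform estimate are
    available.\<close>
  define r where "r = min r1 r2 / 2"
  have r: "r > 0" "2 * r \<le> r1" "2 * r \<le> r2" using r1 r2 by (auto simp: r_def)
  define U where "U = D \<inter> ball p r"
  have pU: "p \<in> U" using p r by (simp add: U_def)
  have convU: "convex U" unfolding U_def by (intro convex_Int D convex_ball)
  have near: "x + V \<in> D" "dist (x + V) p < r2" if "x \<in> U" "V \<in> Symm_complex" "norm V < r" for x V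
  proof -
    have xp: "x - p \<in> Symm_complex" "norm (x - p) < r"
      using that(1) rel_open_subset[OF D(1)] p by (auto simp: U_def dist_norm norm_minus_commute intro!: Symm_diff)
    have *: "norm ((x - p) + V) < 2 * r" using norm_triangle_ineq[of "x - p" V] xp that by linarith
    then have "p + ((x - p) + V) \<in> D" using r by (intro r1 Symm_add xp that) simp
    then show "x + V \<in> D" by simp
    show "dist (x + V) p < r2" using * r by (simp add: dist_norm algebra_simps)
  qed
  have "\<forall>n x. \<exists>d. x \<in> D \<longrightarrow> (s n has_derivative d) (at x within D) \<and> (\<forall>c V. d (cmul c V) = c * d V)"
    using s unfolding holomorphic_symm_def cmul_def by blast
  then obtain d where d: "\<And>n x. x \<in> D \<Longrightarrow> (s n has_derivative d n x) (at x within D)"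
     "\<And>n x c V. x \<in> D \<Longrightarrow> d n x (cmul c V) = c * d n x V"
    unfolding choice_iff by blast
  obtain K where K: "K > 0" "\<And>V :: complex^'n^'n. norm (symm_part V) \<le> norm V * K"
    using bounded_linear.pos_bounded[OF bounded_linear_symm_part] by blast
  define d' where "d' n x V = d n x (symm_part V)" for n x V
  have d': "(s n has_derivative d' n x) (at x within U)" if "x \<in> U" for n x
  proof -
    have "(s n has_derivative (\<lambda>V. d n x (symm_part V))) (at x within D)"
      using that D(1) by (intro has_derivative_symm_part d) (auto simp: U_def rel_open_def)
    then show ?thesis unfolding d'_def by (rule has_derivative_subset) (simp add: U_def)
  qed
  have diffbound: "cmod (d' m x V - d' n x V) \<le> 2 * e / r * (norm V * K)"
    if x: "x \<in> U" and e: "\<And>z. z \<in> D \<Longrightarrow> dist z p < r2 \<Longrightarrow> cmod (s m z - s n z) \<le> e" for m n x V e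
  proof -
    have xD: "x \<in> D" using x by (simp add: U_def)
    have e0: "e \<ge> 0" by (rule order_trans[OF norm_ge_zero e[OF p]]) (simp add: r2(1))
    have "cmod ((\<lambda>V. d m x V - d n x V) (symm_part V)) \<le> 2 * e / r * norm (symm_part V)"
    proof (rule holomorphic_symm_derivative_bound[where f = "\<lambda>z. s m z - s n z" and D = D])
      show "holomorphic_symm (\<lambda>z. s m z - s n z) D" by (intro holomorphic_symm_diff s)
      show "((\<lambda>z. s m z - s n z) has_derivative (\<lambda>V. d m x V - d n x V)) (at x within D)"
        by (intro has_derivative_diff d xD)
    qed (use near[OF x] e r in \<open>auto simp: d(2)[OF xD] right_diff_distrib symm_part_Symm\<close>)
    also have "\<dots> \<le> 2 * e / r * (norm V * K)" using r e0 by (intro mult_left_mono K) auto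
    finally show ?thesis by (simp add: d'_def)
  qed
  have unif: "\<exists>N. \<forall>m\<ge>N. \<forall>n\<ge>N. \<forall>x\<in>U. \<forall>V. cmod (d' m x V - d' n x V) \<le> e * norm V" if e: "e > 0" for e
  proof -
    define e' where "e' = e * r / (2 * K)"
    have "e' > 0" using e r K by (simp add: e'_def)
    then obtain N where N: "\<And>m n z. m \<ge> N \<Longrightarrow> n \<ge> N \<Longrightarrow> z \<in> D \<Longrightarrow> dist z p < r2 \<Longrightarrow> cmod (s m z - s n z) \<le> e'"
      using r2(2) by meson
    have "cmod (d' m x V - d' n x V) \<le> e * norm V" if "m \<ge> N" "n \<ge> N" "x \<in> U" for m n x V
      using diffbound[OF that(3) N[OF that(1,2)], of V] r K by (simp add: e'_def field_simps)
    then show ?thesis by blast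
  qed
  define g' where "g' x V = lim (\<lambda>n. d' n x V)" for x V
  have g': "(\<lambda>n. d' n x V) \<longlonglongrightarrow> g' x V" if x: "x \<in> U" for x V
  proof -
    have "Cauchy (\<lambda>n. d' n x V)"
    proof (rule CauchyI)
      fix e :: real assume e: "e > 0"
      define e' where "e' = e / (norm V + 1)"
      have nV: "norm V + 1 > 0" by (simp add: add_nonneg_pos)
      have "e' > 0" using e nV by (simp add: e'_def)
      then obtain N where N: "\<And>m n. m \<ge> N \<Longrightarrow> n \<ge> N \<Longrightarrow> cmod (d' m x V - d' n x V) \<le> e' * norm V"
        using unif x by meson
      have "e' * norm V < e" using e nV by (simp add: e'_def field_simps)
      then show "\<exists>N. \<forall>m\<ge>N. \<forall>n\<ge>N. norm (d' m x V - d' n x V) < e" using N by (meson le_less_trans)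
    qed
    then show ?thesis unfolding g'_def by (simp add: Cauchy_convergent_iff convergent_LIMSEQ_iff)
  qed
  have "\<exists>G. \<forall>x\<in>U. (\<lambda>n. s n x) \<longlonglongrightarrow> G x \<and> (G has_derivative g' x) (at x within U)"
  proof (rule has_derivative_sequence[OF convU d' _ pU lim[OF p]])
    fix e :: real assume "e > 0"
    then obtain N where N: "\<And>m n x V. m \<ge> N \<Longrightarrow> n \<ge> N \<Longrightarrow> x \<in> U \<Longrightarrow> cmod (d' m x V - d' n x V) \<le> e * norm V"
      using unif by meson
    have "norm (d' n x V - g' x V) \<le> e * norm V" if "n \<ge> N" "x \<in> U" for n x V
    proof (rule tendsto_upperbound)
      show "(\<lambda>m. norm (d' n x V - d' m x V)) \<longlonglongrightarrow> norm (d' n x V - g' x V)"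
        by (intro tendsto_intros g' that)
      show "\<forall>\<^sub>F m in sequentially. norm (d' n x V - d' m x V) \<le> e * norm V"
        unfolding eventually_sequentially using N[OF that(1) _ that(2)] by blast
    qed simp
    then show "\<forall>\<^sub>F n in sequentially. \<forall>x\<in>U. \<forall>h. norm (d' n x h - g' x h) \<le> e * norm h"
      unfolding eventually_sequentially by blast
  qed
  then obtain G where G: "\<And>x. x \<in> U \<Longrightarrow> (\<lambda>n. s n x) \<longlonglongrightarrow> G x" "(G has_derivative g' p) (at p within U)"
    using pU by blast
  have "G x = g x" if "x \<in> U" for x
    using LIMSEQ_unique[OF G(1)[OF that] lim] that by (simp add: U_def)
  then have "(g has_derivative g' p) (at p within U)"
    by (intro has_derivative_transform[OF pU _ G(2)]) simp
  moreover have "at p within U = at p within D"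
    by (rule at_within_nhd[of _ "ball p r"]) (use r in \<open>auto simp: U_def\<close>)
  moreover have "g' p (cmul c V) = c * g' p V" for c V
  proof (rule LIMSEQ_unique[OF g'[OF pU]])
    have "d' n p (cmul c V) = c * d' n p V" for n using d(2)[OF p] by (simp add: d'_def symm_part_cmul)
    then show "(\<lambda>n. d' n p (cmul c V)) \<longlonglongrightarrow> c * g' p V" using tendsto_mult_left[OF g'[OF pU, of V], of c] by simp
  qed
  ultimately show "\<exists>f'. (g has_derivative f') (at p within D) \<and> (\<forall>c V. f' (cmul c V) = c * f' V)" by auto
qed

section \<open>Weighted Bergman spaces\<close>

text \<open>Common frame for both domains: \<open>k\<close> becomes the inverse of the total mass on
  \<open>D_III\<close> and the free positive constant on \<open>Siegel\<close>.\<close>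

locale weighted_bergman =
  fixes D :: "(complex^'n^'n) set" and w :: "complex^'n^'n \<Rightarrow> real" and k :: ennreal
    and M :: "(complex^'n^'n) measure"
  assumes relopen: "rel_open D" and conv: "convex D"
    and w_cont: "continuous_on D w" and w_pos: "\<And>Z. Z \<in> D \<Longrightarrow> 0 < w Z"
    and k: "0 < k" "k < top"
    and M_eq: "M = scale_measure k (density (restrict_space lebesgue_symm D) (\<lambda>Z. ennreal (w Z)))"
begin

abbreviation L where "L \<equiv> lebesgue_symm :: (complex^'n^'n) measure"
abbreviation H where "H \<equiv> bergman_space D M"

lemma D_borel [measurable]: "D \<in> sets borel" by (rule rel_open_borel[OF relopen])

lemma sets_M: "sets M = sets (restrict_space borel D)" and space_M: "space M = D"
proof -
  show "sets M = sets (restrict_space borel D)"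
    unfolding M_eq by (simp add: sets_restrict_space)
  show "space M = D" unfolding M_eq by (simp add: space_scale_measure space_restrict_space)
qed

lemma w_measurable: "w \<in> borel_measurable (restrict_space borel D)"
  by (rule borel_measurable_continuous_on_restrict[OF w_cont])

lemma measurable_extend:
  fixes f :: "complex^'n^'n \<Rightarrow> ennreal"
  assumes "f \<in> borel_measurable M"
  shows "(\<lambda>Z. indicator D Z * (ennreal (w Z) * f Z)) \<in> borel_measurable borel"
proof -
  have "f \<in> borel_measurable (restrict_space borel D)"
    using assms measurable_cong_sets[OF sets_M refl] by blast
  then have "(\<lambda>Z. ennreal (w Z) * f Z) \<in> borel_measurable (restrict_space borel D)"
    using w_measurable by measurable
  then have "(\<lambda>Z. ennreal (w Z) * f Z * indicator D Z) \<in> borel_measurable borel"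
    by (subst (asm) borel_measurable_restrict_space_iff_ennreal) auto
  then show ?thesis by (simp add: mult.commute)
qed

lemma nn_integral_M:
  assumes f: "f \<in> borel_measurable M"
  shows "(\<integral>\<^sup>+ Z. f Z \<partial>M) = k * (\<integral>\<^sup>+ Z. indicator D Z * (ennreal (w Z) * f Z) \<partial>L)"
proof -
  have s: "sets (restrict_space L D) = sets (restrict_space borel D)" by (simp add: sets_restrict_space)
  have f': "f \<in> borel_measurable (restrict_space L D)"
    using f measurable_cong_sets[OF sets_M refl] measurable_cong_sets[OF s refl] by blast
  have w': "w \<in> borel_measurable (restrict_space L D)"
    using w_measurable measurable_cong_sets[OF s refl] by blast
  have "(\<integral>\<^sup>+ Z. f Z \<partial>M) = k * (\<integral>\<^sup>+ Z. f Z \<partial>density (restrict_space L D) (\<lambda>Z. ennreal (w Z)))"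
    unfolding M_eq by (rule nn_integral_scale_measure) (use f' in simp)
  also have "(\<integral>\<^sup>+ Z. f Z \<partial>density (restrict_space L D) (\<lambda>Z. ennreal (w Z))) = (\<integral>\<^sup>+ Z. ennreal (w Z) * f Z \<partial>restrict_space L D)"
    by (rule nn_integral_density) (use f' w' in measurable)
  also have "\<dots> = (\<integral>\<^sup>+ Z. indicator D Z * (ennreal (w Z) * f Z) \<partial>L)"
    by (subst nn_integral_restrict_space) (auto simp: mult.commute)
  finally show ?thesis .
qed

lemma AE_M:
  assumes "AE Z in restrict_space L D. P Z"
  shows "AE Z in M. P Z"
proof -
  have s: "sets (restrict_space L D) = sets (restrict_space borel D)" by (simp add: sets_restrict_space)
  have w': "(\<lambda>Z. ennreal (w Z)) \<in> borel_measurable (restrict_space L D)"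
    using w_measurable measurable_cong_sets[OF s refl] by (metis (no_types) measurable_ennreal measurable_compose)
  have "AE Z in density (restrict_space L D) (\<lambda>Z. ennreal (w Z)). P Z"
    unfolding AE_density[OF w'] using assms by auto
  then obtain N where N: "{Z \<in> space M. \<not> P Z} \<subseteq> N" "N \<in> null_sets (density (restrict_space L D) (\<lambda>Z. ennreal (w Z)))"
    by (auto simp: eventually_ae_filter space_M space_restrict_space)
  then have "N \<in> null_sets M" unfolding M_eq by (simp add: null_sets_def)
  with N(1) show ?thesis by (auto simp: eventually_ae_filter)
qed

lemma bergman_measurable:
  assumes "continuous_on D f"
  shows "f \<in> borel_measurable M"
  using borel_measurable_continuous_on_restrict[OF assms] measurable_cong_sets[OF sets_M refl] by blast

lemma nm_sq: "f \<in> L2 M \<Longrightarrow> ennreal ((L2_norm M f)\<^sup>2) = (\<integral>\<^sup>+ Z. ennreal ((cmod (f Z))\<^sup>2) \<partial>M)"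
  unfolding L2_norm_sq by (rule nn_integral_eq_integral[symmetric]) (auto simp: L2_integrable)

lemma
  assumes "f \<in> H"
  shows H_L2: "f \<in> L2 M" and H_hol: "holomorphic_symm f D" and H_vanish: "Z \<notin> D \<Longrightarrow> f Z = 0"
  using assms by (auto simp: bergman_space_def)

text \<open>The continuous positive weight has a positive minimum on a compact neighbourhood, so the
  unweighted mean value inequality bounds point values by the weighted norm, uniformly near
  \<open>p\<close>.\<close>

lemma local_bound:
  assumes p: "p \<in> D"
  shows "\<exists>r>0. \<exists>C\<ge>0. \<forall>z\<in>D. dist z p < r \<longrightarrow> (\<forall>f\<in>H. cmod (f z) \<le> C * L2_norm M f)"
proof -
  obtain r0 where r0: "r0 > 0" "\<And>V. V \<in> Symm_complex \<Longrightarrow> norm V < r0 \<Longrightarrow> p + V \<in> D"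
    using rel_openE[OF relopen p] by blast
  define K where "K = cball p (r0 / 2) \<inter> Symm_complex"
  have pS: "p \<in> Symm_complex" using rel_open_subset[OF relopen p] .
  have KD: "K \<subseteq> D"
  proof
    fix Z assume "Z \<in> K"
    then have "p + (Z - p) \<in> D"
      using r0(1) by (intro r0(2) Symm_diff pS) (auto simp: K_def dist_norm norm_minus_commute)
    then show "Z \<in> D" by simp
  qed
  have "compact K" unfolding K_def by (intro compact_Int_closed compact_cball closed_Symm)
  moreover have "p \<in> K" using pS r0(1) by (simp add: K_def)
  ultimately obtain z0 where z0: "z0 \<in> K" "\<And>z. z \<in> K \<Longrightarrow> w z0 \<le> w z"
    using continuous_attains_inf[OF _ _ continuous_on_subset[OF w_cont KD]] by blast
  \<comment> \<open>A ball of radius \<open>r0 / 4\<close> around a point within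
    \<open>r0 / 4\<close> of \<open>p\<close> stays in \<open>K\<close>, whose radius is
    \<open>r0 / 2\<close>.\<close>
  define r where "r = r0 / 4"
  have r: "r > 0" using r0 by (simp add: r_def)
  define E where "E = emeasure L (ball (0 :: complex^'n^'n) r)"
  have E: "0 < E" "E < top" unfolding E_def using emeasure_ball_pos[OF Symm_zero r] emeasure_bounded[OF bounded_ball]
    by auto
  define c where "c = enn2real (ennreal (w z0) * E * k)"
  have w0: "w z0 > 0" using w_pos z0 KD by auto
  have ck: "ennreal c = ennreal (w z0) * E * k"
    unfolding c_def using E k by (intro ennreal_enn2real) (simp add: ennreal_mult_less_top)
  have "ennreal (w z0) * E * k > 0" using E k w0 by (simp add: ennreal_zero_less_mult_iff)
  then have c: "c > 0" using ck by (metis ennreal_0 ennreal_less_zero_iff linorder_not_less)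
  have main: "cmod (f z) \<le> (1 / sqrt c) * L2_norm M f" if z: "z \<in> D" "dist z p < r" and f: "f \<in> H" for z f
  proof -
    have zS: "z \<in> Symm_complex" using rel_open_subset[OF relopen z(1)] .
    have inK: "Z \<in> K" if "Z \<in> ball z r" "Z \<in> Symm_complex" for Z
    proof -
      have "dist p Z \<le> dist p z + dist z Z" by (rule dist_triangle)
      then have "dist p Z \<le> r0 / 2" using that z(2) by (simp add: dist_commute r_def)
      then show ?thesis using that by (simp add: K_def)
    qed
    have zV: "z + V \<in> D" if "V \<in> Symm_complex" "norm V < r" for V
    proof -
      have "z + V \<in> K" by (rule inK) (use that in \<open>auto simp: dist_norm Symm_add zS\<close>)
      then show ?thesis using KD by auto
    qed
    have fm: "(\<lambda>Z. ennreal ((cmod (f Z))\<^sup>2)) \<in> borel_measurable M"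
      using H_L2[OF f] by (auto simp: L2_def)
    have "ennreal ((cmod (f z))\<^sup>2) * ennreal c = (k * ennreal (w z0)) * (ennreal ((cmod (f z))\<^sup>2) * E)"
      by (simp add: ck mult_ac)
    also have "\<dots> \<le> (k * ennreal (w z0)) * (\<integral>\<^sup>+ Z. indicator (ball z r \<inter> D) Z * ennreal ((cmod (f Z))\<^sup>2) \<partial>L)"
      unfolding E_def by (intro mult_left_mono sub_mean_value[OF H_hol[OF f] relopen z(1) r zV]) auto
    also have "\<dots> = k * (ennreal (w z0) * (\<integral>\<^sup>+ Z. indicator (ball z r \<inter> D) Z * ennreal ((cmod (f Z))\<^sup>2) \<partial>L))"
      by (simp add: mult.assoc)
    also have "\<dots> = k * (\<integral>\<^sup>+ Z. ennreal (w z0) * (indicator (ball z r \<inter> D) Z * ennreal ((cmod (f Z))\<^sup>2)) \<partial>L)"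
    proof -
      have "(\<lambda>Z. indicator D Z *\<^sub>R f Z) \<in> borel_measurable borel"
        by (rule borel_measurable_continuous_on_indicator[OF D_borel holomorphic_symm_continuous[OF H_hol[OF f]]])
      then have "(\<lambda>Z. indicator (ball z r) Z * ennreal ((cmod (indicator D Z *\<^sub>R f Z))\<^sup>2)) \<in> borel_measurable L" by measurable
      also have "(\<lambda>Z. indicator (ball z r) Z * ennreal ((cmod (indicator D Z *\<^sub>R f Z))\<^sup>2)) = (\<lambda>Z. indicator (ball z r \<inter> D) Z * ennreal ((cmod (f Z))\<^sup>2))"
        by (auto simp: indicator_def fun_eq_iff)
      finally show ?thesis by (subst nn_integral_cmult) auto
    qed
    also have "\<dots> \<le> k * (\<integral>\<^sup>+ Z. indicator D Z * (ennreal (w Z) * ennreal ((cmod (f Z))\<^sup>2)) \<partial>L)"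
    proof (intro mult_left_mono nn_integral_mono)
      fix Z
      show "ennreal (w z0) * (indicator (ball z r \<inter> D) Z * ennreal ((cmod (f Z))\<^sup>2)) \<le> indicator D Z * (ennreal (w Z) * ennreal ((cmod (f Z))\<^sup>2))"
      proof (cases "Z \<in> ball z r \<inter> D")
        case True
        then have "w z0 \<le> w Z" using inK z0(2) rel_open_subset[OF relopen] by blast
        then show ?thesis using True by (simp add: mult_right_mono ennreal_leI)
      qed simp
    qed simp
    also have "\<dots> = (\<integral>\<^sup>+ Z. ennreal ((cmod (f Z))\<^sup>2) \<partial>M)" by (rule nn_integral_M[OF fm, symmetric])
    also have "\<dots> = ennreal ((L2_norm M f)\<^sup>2)" by (rule nm_sq[OF H_L2[OF f], symmetric])
    finally have "ennreal ((cmod (f z))\<^sup>2 * c) \<le> ennreal ((L2_norm M f)\<^sup>2)" using c by (simp add: ennreal_mult)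
    then have "(cmod (f z))\<^sup>2 * c \<le> (L2_norm M f)\<^sup>2" by simp
    then have "(cmod (f z) * sqrt c)\<^sup>2 \<le> (L2_norm M f)\<^sup>2" using c by (simp add: power_mult_distrib)
    then have "cmod (f z) * sqrt c \<le> L2_norm M f" by (rule power2_le_imp_le) simp
    then show ?thesis using c by (simp add: field_simps)
  qed
  show ?thesis
    by (rule exI[of _ r], intro conjI r, rule exI[of _ "1 / sqrt c"]) (use c main in auto)
qed

text \<open>Fatou's lemma: a pointwise limit inherits the Cauchy bound of the sequence.\<close>

lemma L2_limit:
  assumes s: "\<And>n. s n \<in> L2 M" and g: "g \<in> borel_measurable M" and lim: "\<And>x. x \<in> D \<Longrightarrow> (\<lambda>n. s n x) \<longlonglongrightarrow> g x"
    and cau: "\<And>m. m \<ge> N \<Longrightarrow> L2_norm M (\<lambda>x. s n x - s m x) \<le> e"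
  shows "(\<lambda>x. s n x - g x) \<in> L2 M \<and> L2_norm M (\<lambda>x. s n x - g x) \<le> e"
proof -
  have e0: "e \<ge> 0" using cau[of N] L2_norm_nonneg order_trans by blast
  have dm: "(\<lambda>x. ennreal ((cmod (s n x - s m x))\<^sup>2)) \<in> borel_measurable M" for m
    using s[of n] s[of m] L2_measurable by measurable
  have "(\<integral>\<^sup>+ x. ennreal ((cmod (s n x - g x))\<^sup>2) \<partial>M) = (\<integral>\<^sup>+ x. liminf (\<lambda>m. ennreal ((cmod (s n x - s m x))\<^sup>2)) \<partial>M)"
  proof (rule nn_integral_cong)
    fix x assume "x \<in> space M"
    then have "(\<lambda>m. ennreal ((cmod (s n x - s m x))\<^sup>2)) \<longlonglongrightarrow> ennreal ((cmod (s n x - g x))\<^sup>2)"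
      by (intro tendsto_intros lim) (simp_all add: space_M)
    then show "ennreal ((cmod (s n x - g x))\<^sup>2) = liminf (\<lambda>m. ennreal ((cmod (s n x - s m x))\<^sup>2))"
      by (intro lim_imp_Liminf[symmetric]) auto
  qed
  also have "\<dots> \<le> liminf (\<lambda>m. (\<integral>\<^sup>+ x. ennreal ((cmod (s n x - s m x))\<^sup>2) \<partial>M))"
    by (rule nn_integral_liminf[OF dm])
  also have "\<dots> \<le> liminf (\<lambda>m. ennreal (e\<^sup>2))"
  proof (rule Liminf_mono)
    show "\<forall>\<^sub>F m in sequentially. (\<integral>\<^sup>+ x. ennreal ((cmod (s n x - s m x))\<^sup>2) \<partial>M) \<le> ennreal (e\<^sup>2)"
      unfolding eventually_sequentially
    proof (intro exI allI impI)
      fix m assume "m \<ge> N"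
      then have "(L2_norm M (\<lambda>x. s n x - s m x))\<^sup>2 \<le> e\<^sup>2" by (intro power_mono cau) auto
      then show "(\<integral>\<^sup>+ x. ennreal ((cmod (s n x - s m x))\<^sup>2) \<partial>M) \<le> ennreal (e\<^sup>2)"
        by (subst nm_sq[OF L2_diff[OF s s], symmetric]) (rule ennreal_leI)
    qed
  qed
  also have "\<dots> = ennreal (e\<^sup>2)" by (simp add: Liminf_const)
  finally have le: "(\<integral>\<^sup>+ x. ennreal ((cmod (s n x - g x))\<^sup>2) \<partial>M) \<le> ennreal (e\<^sup>2)" .
  have meas: "(\<lambda>x. s n x - g x) \<in> borel_measurable M" using L2_measurable[OF s[of n]] g by measurable
  have "integrable M (\<lambda>x. (cmod (s n x - g x))\<^sup>2)"
  proof (rule integrableI_bounded)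
    show "(\<lambda>x. (cmod (s n x - g x))\<^sup>2) \<in> borel_measurable M" using meas by measurable
    show "(\<integral>\<^sup>+ x. ennreal (norm ((cmod (s n x - g x))\<^sup>2)) \<partial>M) < \<infinity>"
      using le by (simp add: le_less_trans)
  qed
  then have L2: "(\<lambda>x. s n x - g x) \<in> L2 M" using meas by (simp add: L2_def)
  have "ennreal ((L2_norm M (\<lambda>x. s n x - g x))\<^sup>2) \<le> ennreal (e\<^sup>2)" using le nm_sq[OF L2] by simp
  then have "(L2_norm M (\<lambda>x. s n x - g x))\<^sup>2 \<le> e\<^sup>2" by simp
  then have "L2_norm M (\<lambda>x. s n x - g x) \<le> e" using e0 by (rule power2_le_imp_le)
  then show ?thesis using L2 by simp
qed

lemma H_diff: "f \<in> H \<Longrightarrow> g \<in> H \<Longrightarrow> (\<lambda>x. f x - g x) \<in> H"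
  by (auto simp: bergman_space_def L2_diff holomorphic_symm_diff)

text \<open>By \<open>local_bound\<close> an L2 Cauchy sequence is locally uniformly Cauchy, so its
  pointwise limit is holomorphic; \<open>L2_limit\<close> then gives membership and convergence in
  norm.\<close>

lemma bergman_complete:
  assumes s: "\<And>n. s n \<in> H"
    and cau: "\<And>e. e > 0 \<Longrightarrow> \<exists>N. \<forall>m\<ge>N. \<forall>n\<ge>N. L2_norm M (\<lambda>x. s m x - s n x) < e"
  shows "\<exists>g\<in>H. (\<lambda>n. L2_norm M (\<lambda>x. s n x - g x)) \<longlonglongrightarrow> 0"
proof -
  have unif: "\<exists>r>0. \<forall>e>0. \<exists>N. \<forall>m\<ge>N. \<forall>n\<ge>N. \<forall>z\<in>D. dist z p < r \<longrightarrow> cmod (s m z - s n z) \<le> e" if p: "p \<in> D" for p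
  proof -
    obtain r C where r: "r > 0" "C \<ge> 0" and C: "\<And>z f. z \<in> D \<Longrightarrow> dist z p < r \<Longrightarrow> f \<in> H \<Longrightarrow> cmod (f z) \<le> C * L2_norm M f"
      using local_bound[OF p] by blast
    have "\<exists>N. \<forall>m\<ge>N. \<forall>n\<ge>N. \<forall>z\<in>D. dist z p < r \<longrightarrow> cmod (s m z - s n z) \<le> e" if e: "e > 0" for e
    proof -
      obtain N where N: "\<forall>m\<ge>N. \<forall>n\<ge>N. L2_norm M (\<lambda>x. s m x - s n x) < e / (C + 1)"
        using cau[of "e / (C + 1)"] e r by auto
      have "cmod (s m z - s n z) \<le> e" if "m \<ge> N" "n \<ge> N" "z \<in> D" "dist z p < r" for m n z
      proof -
        have "cmod (s m z - s n z) \<le> C * L2_norm M (\<lambda>x. s m x - s n x)"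
          using C[OF that(3,4) H_diff[OF s s]] .
        also have "\<dots> \<le> C * (e / (C + 1))" using N that r by (intro mult_left_mono) (auto intro: less_imp_le)
        also have "\<dots> \<le> e" using e r by (simp add: field_simps)
        finally show ?thesis .
      qed
      then show ?thesis by blast
    qed
    then show ?thesis using r by blast
  qed
  define g where "g z = (if z \<in> D then lim (\<lambda>n. s n z) else 0)" for z
  have lim: "(\<lambda>n. s n z) \<longlonglongrightarrow> g z" if z: "z \<in> D" for z
  proof -
    obtain r where r: "r > 0" "\<forall>e>0. \<exists>N. \<forall>m\<ge>N. \<forall>n\<ge>N. \<forall>z'\<in>D. dist z' z < r \<longrightarrow> cmod (s m z' - s n z') \<le> e"
      using unif[OF z] by blast
    have "Cauchy (\<lambda>n. s n z)"
    proof (rule CauchyI)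
      fix e :: real assume e: "e > 0"
      then have "e / 2 > 0" by simp
      then obtain N where N: "\<forall>m\<ge>N. \<forall>n\<ge>N. \<forall>z'\<in>D. dist z' z < r \<longrightarrow> cmod (s m z' - s n z') \<le> e / 2"
        using r(2) by blast
      have "norm (s m z - s n z) < e" if "m \<ge> N" "n \<ge> N" for m n
      proof -
        have "cmod (s m z - s n z) \<le> e / 2" using N that z r(1) by simp
        then show ?thesis using e by linarith
      qed
      then show "\<exists>N. \<forall>m\<ge>N. \<forall>n\<ge>N. norm (s m z - s n z) < e" by blast
    qed
    then show ?thesis unfolding g_def using z by (simp add: Cauchy_convergent_iff convergent_LIMSEQ_iff)
  qed
  have hol: "holomorphic_symm g D"
    by (rule holomorphic_symm_limit[OF relopen conv H_hol[OF s] lim unif])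
  have gm: "g \<in> borel_measurable M" by (rule bergman_measurable[OF holomorphic_symm_continuous[OF hol]])
  have small: "\<exists>N. \<forall>n\<ge>N. (\<lambda>x. s n x - g x) \<in> L2 M \<and> L2_norm M (\<lambda>x. s n x - g x) \<le> e" if e: "e > 0" for e
  proof -
    obtain N where N: "\<forall>m\<ge>N. \<forall>n\<ge>N. L2_norm M (\<lambda>x. s m x - s n x) < e" using cau[OF e] by blast
    have "(\<lambda>x. s n x - g x) \<in> L2 M \<and> L2_norm M (\<lambda>x. s n x - g x) \<le> e" if "n \<ge> N" for n
      by (rule L2_limit[OF H_L2[OF s] gm lim, of N]) (use N that in \<open>auto simp: less_imp_le\<close>)
    then show ?thesis by blast
  qed
  obtain N where "(\<lambda>x. s N x - g x) \<in> L2 M" using small[of 1] by auto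
  then have "(\<lambda>x. s N x - (s N x - g x)) \<in> L2 M" by (rule L2_diff[OF H_L2[OF s]])
  then have gL2: "g \<in> L2 M" by simp
  have gH: "g \<in> H" unfolding bergman_space_def using gL2 hol by (simp add: g_def)
  have "(\<lambda>n. L2_norm M (\<lambda>x. s n x - g x)) \<longlonglongrightarrow> 0"
  proof (rule LIMSEQ_I)
    fix e :: real assume e: "e > 0"
    then obtain N where N: "\<And>n. n \<ge> N \<Longrightarrow> L2_norm M (\<lambda>x. s n x - g x) \<le> e / 2" using small[of "e/2"] by auto
    have "norm (L2_norm M (\<lambda>x. s n x - g x) - 0) < e" if "n \<ge> N" for n using N[OF that] e by simp
    then show "\<exists>no. \<forall>n\<ge>no. norm (L2_norm M (\<lambda>x. s n x - g x) - 0) < e" by blast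
  qed
  then show ?thesis using gH by blast
qed

sublocale function_hilbert M H
proof
  show "H \<subseteq> L2 M" by (auto simp: bergman_space_def)
  show "(\<lambda>x. 0) \<in> H" by (simp add: bergman_space_def holomorphic_symm_const)
  show "(\<lambda>x. f x + g x) \<in> H" if "f \<in> H" "g \<in> H" for f g
    using that by (simp add: bergman_space_def L2_add holomorphic_symm_add)
  show "(\<lambda>x. c * f x) \<in> H" if "f \<in> H" for c f
    using that by (simp add: bergman_space_def L2_scale holomorphic_symm_scale)
  show "\<exists>C. \<forall>f\<in>H. cmod (f x) \<le> C * L2_norm M f" for x
  proof (cases "x \<in> D")
    case True
    then obtain r C where "r > 0" "\<forall>z\<in>D. dist z x < r \<longrightarrow> (\<forall>f\<in>H. cmod (f z) \<le> C * L2_norm M f)"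
      using local_bound[OF True] by blast
    then show ?thesis using True by (intro exI[of _ C]) auto
  next
    case False
    then show ?thesis by (intro exI[of _ 0]) (simp add: H_vanish)
  qed
qed (rule bergman_complete)

end

section \<open>Automorphisms acting on a weighted Bergman space\<close>

context weighted_bergman
begin

definition act :: "(complex^'n^'n \<Rightarrow> complex^'n^'n) \<Rightarrow> (complex^'n^'n \<Rightarrow> complex) \<Rightarrow> complex^'n^'n \<Rightarrow> complex" where
  "act h f = (\<lambda>Z. if Z \<in> D then f (h Z) else 0)"

text \<open>The constant multiplies the integral of \<open>f\<close> when \<open>f\<close> is
  composed with \<open>h\<close>, so \<open>act h\<close> is the square root of \<open>c\<close>
  times an isometry.\<close>

definition scaling :: "(complex^'n^'n \<Rightarrow> complex^'n^'n) \<Rightarrow> real \<Rightarrow> bool" where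
  "scaling h c \<longleftrightarrow> c > 0 \<and> (\<forall>f\<in>borel_measurable M. (\<integral>\<^sup>+ Z. f (h Z) \<partial>M) = ennreal c * (\<integral>\<^sup>+ Z. f Z \<partial>M))"

text \<open>Closure under inverses is what produces adjoints: the adjoint of \<open>act h\<close> is
  a multiple of \<open>act h'\<close>.\<close>

definition action_group :: "(complex^'n^'n \<Rightarrow> complex^'n^'n) set \<Rightarrow> bool" where
  "action_group G \<longleftrightarrow> (\<forall>h\<in>G. (\<forall>Z\<in>D. h Z \<in> D) \<and> (\<forall>i j. holomorphic_symm (\<lambda>Z. h Z $ i $ j) D) \<and>
     (\<exists>c. scaling h c) \<and> (\<exists>h'\<in>G. \<forall>Z\<in>D. h (h' Z) = Z \<and> h' (h Z) = Z))"

lemma measurable_M_map: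
  assumes "\<And>Z. Z \<in> D \<Longrightarrow> h Z \<in> D" "\<And>i j. holomorphic_symm (\<lambda>Z. h Z $ i $ j) D"
  shows "h \<in> M \<rightarrow>\<^sub>M M"
proof -
  have "continuous_on D h" by (intro continuous_on_matrix_entries holomorphic_symm_continuous assms)
  then have "h \<in> restrict_space borel D \<rightarrow>\<^sub>M borel" by (rule borel_measurable_continuous_on_restrict)
  then have "h \<in> restrict_space borel D \<rightarrow>\<^sub>M restrict_space borel D"
    using assms by (intro measurable_restrict_space2) (auto simp: space_restrict_space)
  then show ?thesis using measurable_cong_sets[OF sets_M sets_M] by blast
qed

text \<open>Composition with \<open>h\<close> contributes the Lebesgue factor \<open>d\<close>, and
  replacing the weight at \<open>Z\<close> by the weight at \<open>h Z\<close> costs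
  \<open>1 / q\<close>. The hypothesis \<open>iff\<close> makes the indicator of \<open>D\<close>
  invariant on symmetric matrices.\<close>

lemma scalingI:
  assumes h: "\<And>Z. Z \<in> D \<Longrightarrow> h Z \<in> D" "\<And>i j. holomorphic_symm (\<lambda>Z. h Z $ i $ j) D"
    and iff: "\<And>Z. Z \<in> Symm_complex \<Longrightarrow> h Z \<in> D \<Longrightarrow> Z \<in> D"
    and wq: "\<And>Z. Z \<in> D \<Longrightarrow> w (h Z) = q * w Z" and q: "q > 0" and d: "d > 0"
    and hb: "h \<in> borel \<rightarrow>\<^sub>M borel"
    and Ld: "\<And>f :: complex^'n^'n \<Rightarrow> ennreal. f \<in> borel_measurable borel \<Longrightarrow> (\<integral>\<^sup>+ Z. f (h Z) \<partial>L) = ennreal d * (\<integral>\<^sup>+ Z. f Z \<partial>L)"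
  shows "scaling h (d / q)"
  unfolding scaling_def
proof (intro conjI ballI)
  show "0 < d / q" using d q by simp
  fix f :: "complex^'n^'n \<Rightarrow> ennreal" assume f: "f \<in> borel_measurable M"
  define F where "F Z = indicator D Z * (ennreal (w Z) * f Z)" for Z
  have F: "F \<in> borel_measurable borel" unfolding F_def by (rule measurable_extend[OF f])
  have Fh: "(\<lambda>Z. F (h Z)) \<in> borel_measurable L" using measurable_compose[OF hb F] by simp
  have "(\<integral>\<^sup>+ Z. f (h Z) \<partial>M) = k * (\<integral>\<^sup>+ Z. indicator D Z * (ennreal (w Z) * f (h Z)) \<partial>L)"
    by (rule nn_integral_M) (rule measurable_compose[OF measurable_M_map[OF h] f])
  also have "(\<integral>\<^sup>+ Z. indicator D Z * (ennreal (w Z) * f (h Z)) \<partial>L) = (\<integral>\<^sup>+ Z. ennreal (1 / q) * F (h Z) \<partial>L)"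
  proof (rule nn_integral_cong_AE, rule AE_mp[OF AE_lebesgue_symm], intro AE_I2 impI)
    fix Z :: "complex^'n^'n" assume Z: "Z \<in> Symm_complex"
    show "indicator D Z * (ennreal (w Z) * f (h Z)) = ennreal (1 / q) * F (h Z)"
    proof (cases "Z \<in> D")
      case True
      have "ennreal (1 / q) * ennreal (w (h Z)) = ennreal (w Z)"
        using q w_pos[OF True] by (subst ennreal_mult[symmetric]) (auto simp: wq[OF True])
      then show ?thesis using True h(1) by (simp add: F_def mult.assoc[symmetric])
    next
      case False
      then have "h Z \<notin> D" using iff[OF Z] by blast
      then show ?thesis using False by (simp add: F_def)
    qed
  qed
  also have "\<dots> = ennreal (1 / q) * (\<integral>\<^sup>+ Z. F (h Z) \<partial>L)" by (rule nn_integral_cmult[OF Fh])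
  also have "\<dots> = ennreal (1 / q) * (ennreal d * (\<integral>\<^sup>+ Z. F Z \<partial>L))" by (simp only: Ld[OF F])
  also have "\<dots> = ennreal (d / q) * (\<integral>\<^sup>+ Z. F Z \<partial>L)"
    using q d by (simp add: mult.assoc[symmetric] ennreal_mult[symmetric])
  also have "k * (ennreal (d / q) * (\<integral>\<^sup>+ Z. F Z \<partial>L)) = ennreal (d / q) * (\<integral>\<^sup>+ Z. f Z \<partial>M)"
    unfolding F_def nn_integral_M[OF f] by (simp add: mult_ac)
  finally show "(\<integral>\<^sup>+ Z. f (h Z) \<partial>M) = ennreal (d / q) * (\<integral>\<^sup>+ Z. f Z \<partial>M)" .
qed

lemma scalingD:
  assumes "scaling h c" "f \<in> borel_measurable M"
  shows "(\<integral>\<^sup>+ Z. f (h Z) \<partial>M) = ennreal c * (\<integral>\<^sup>+ Z. f Z \<partial>M)"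
  using assms unfolding scaling_def by simp

text \<open>Turns the rule for nonnegative integrals into an equality of measures, from which
  Bochner integrals and null sets are handled as well.\<close>

lemma distr_scaling:
  assumes h: "h \<in> M \<rightarrow>\<^sub>M M" and c: "scaling h c"
  shows "distr M M h = density M (\<lambda>_. ennreal c)"
proof (rule measure_eqI)
  fix A assume "A \<in> sets (distr M M h)"
  then have A: "A \<in> sets M" by simp
  have "emeasure (distr M M h) A = (\<integral>\<^sup>+ Z. indicator A Z \<partial>distr M M h)" using A by simp
  also have "\<dots> = (\<integral>\<^sup>+ Z. indicator A (h Z) \<partial>M)" by (rule nn_integral_distr[OF h]) (use A in simp)
  also have "\<dots> = ennreal c * emeasure M A" using c A unfolding scaling_def by simp
  also have "\<dots> = emeasure (density M (\<lambda>_. ennreal c)) A" using A by (simp add: emeasure_density nn_integral_cmult_indicator)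
  finally show "emeasure (distr M M h) A = emeasure (density M (\<lambda>_. ennreal c)) A" .
qed simp

lemma integral_scaling:
  fixes f :: "complex^'n^'n \<Rightarrow> complex"
  assumes h: "h \<in> M \<rightarrow>\<^sub>M M" and c: "scaling h c" and f: "f \<in> borel_measurable M"
  shows "(LINT Z|M. f (h Z)) = of_real c * (LINT Z|M. f Z)"
proof -
  have c0: "c \<ge> 0" using c by (simp add: scaling_def)
  have "(LINT Z|M. f (h Z)) = (LINT Z|distr M M h. f Z)" by (rule integral_distr[OF h f, symmetric])
  also have "\<dots> = (LINT Z|M. c *\<^sub>R f Z)"
    unfolding distr_scaling[OF h c] by (rule integral_density) (use f c0 in auto)
  also have "\<dots> = of_real c * (LINT Z|M. f Z)" by (simp add: scaleR_conv_of_real)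
  finally show ?thesis .
qed

context
  fixes h :: "complex^'n^'n \<Rightarrow> complex^'n^'n" and c :: real
  assumes hD: "\<And>Z. Z \<in> D \<Longrightarrow> h Z \<in> D" and hhol: "\<And>i j. holomorphic_symm (\<lambda>Z. h Z $ i $ j) D"
    and hc: "scaling h c"
begin

lemma h_meas: "h \<in> M \<rightarrow>\<^sub>M M" by (rule measurable_M_map[OF hD hhol])

lemma act_measurable:
  assumes "f \<in> borel_measurable M" shows "act h f \<in> borel_measurable M"
  using measurable_compose[OF h_meas assms]
  by (rule measurable_cong[THEN iffD1, rotated]) (simp add: act_def space_M)

lemma act_L2:
  assumes "f \<in> L2 M" shows "act h f \<in> L2 M"
proof (rule L2_I[OF act_measurable[OF L2_measurable[OF assms]]])
  have fm: "f \<in> borel_measurable M" using assms by (rule L2_measurable)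
  show "integrable M (\<lambda>x. (cmod (act h f x))\<^sup>2)"
  proof (rule integrableI_bounded)
    show "(\<lambda>x. (cmod (act h f x))\<^sup>2) \<in> borel_measurable M" using act_measurable[OF fm] by measurable
    have "(\<integral>\<^sup>+ x. ennreal (norm ((cmod (act h f x))\<^sup>2)) \<partial>M) = (\<integral>\<^sup>+ x. (\<lambda>Z. ennreal ((cmod (f Z))\<^sup>2)) (h x) \<partial>M)"
      by (intro nn_integral_cong) (simp add: act_def space_M)
    also have "\<dots> = ennreal c * (\<integral>\<^sup>+ Z. ennreal ((cmod (f Z))\<^sup>2) \<partial>M)"
    proof -
      have "(\<lambda>Z. ennreal ((cmod (f Z))\<^sup>2)) \<in> borel_measurable M" using fm by measurable
      then show ?thesis by (rule scalingD[OF hc])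
    qed
    also have "\<dots> = ennreal c * ennreal ((L2_norm M f)\<^sup>2)" by (simp only: nm_sq[OF assms])
    also have "\<dots> < \<infinity>" by (simp add: ennreal_mult_less_top)
    finally show "(\<integral>\<^sup>+ x. ennreal (norm ((cmod (act h f x))\<^sup>2)) \<partial>M) < \<infinity>" .
  qed
qed

lemma act_H: "f \<in> H \<Longrightarrow> act h f \<in> H"
proof -
  assume f: "f \<in> H"
  have "holomorphic_symm (\<lambda>Z. f (h Z)) D" by (rule holomorphic_symm_chain[OF H_hol[OF f] hhol hD])
  then have "holomorphic_symm (act h f) D"
    by (rule holomorphic_symm_cong[THEN iffD1, rotated]) (simp add: act_def)
  moreover have "\<forall>Z. Z \<notin> D \<longrightarrow> act h f Z = 0" by (simp add: act_def)
  ultimately show "act h f \<in> H"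
    unfolding bergman_space_def by (intro CollectI conjI act_L2[OF H_L2[OF f]])
qed

lemma act_inner:
  assumes f: "f \<in> borel_measurable M" and g: "g \<in> borel_measurable M"
  shows "ip (act h f) (act h g) = of_real c * ip f g"
proof -
  have "ip (act h f) (act h g) = (LINT Z|M. (\<lambda>Z. f Z * cnj (g Z)) (h Z))"
    unfolding L2_inner_def by (intro Bochner_Integration.integral_cong) (auto simp: act_def space_M)
  also have "\<dots> = of_real c * ip f g"
    unfolding L2_inner_def by (rule integral_scaling[OF h_meas hc]) (use f g in measurable)
  finally show ?thesis .
qed

lemma act_norm_sq: "f \<in> L2 M \<Longrightarrow> (nm (act h f))\<^sup>2 = c * (nm f)\<^sup>2"
  using act_inner[of f f] unfolding L2_inner_self
  by (metis L2_measurable of_real_eq_iff of_real_mult)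

lemma act_AE:
  assumes "AE Z in M. P Z" shows "AE Z in M. P (h Z)"
proof (rule AE_distrD[OF h_meas])
  show "AE Z in distr M M h. P Z"
    unfolding distr_scaling[OF h_meas hc] using assms by (subst AE_density) auto
qed

end

lemma act_inner_adj:
  assumes h: "\<And>Z. Z \<in> D \<Longrightarrow> h Z \<in> D" "\<And>i j. holomorphic_symm (\<lambda>Z. h Z $ i $ j) D" "scaling h c"
    and h': "\<And>Z. Z \<in> D \<Longrightarrow> h' Z \<in> D" "\<And>i j. holomorphic_symm (\<lambda>Z. h' Z $ i $ j) D" "scaling h' c'"
    and inv: "\<And>Z. Z \<in> D \<Longrightarrow> h' (h Z) = Z"
    and f: "f \<in> borel_measurable M" and g: "g \<in> H"
  shows "ip (act h f) g = of_real c * ip f (act h' g)"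
proof -
  have "act h (act h' g) = g"
    using h inv H_vanish[OF g] by (auto simp: act_def fun_eq_iff)
  then show ?thesis
    using act_inner[OF h f L2_measurable[OF H_L2[OF act_H[OF h' g]]]] by simp
qed

lemma act_add: "act h (\<lambda>x. f x + g x) = (\<lambda>x. act h f x + act h g x)"
  and act_scale: "act h (\<lambda>x. a * f x) = (\<lambda>x. a * act h f x)"
  by (auto simp: act_def)

lemma action_group_commutant:
  assumes G: "action_group G"
  shows "cstar_subalgebra M H (commutant (act ` G))"
proof (rule commutant_cstar)
  fix U assume "U \<in> act ` G"
  then obtain h where h: "h \<in> G" "U = act h" by blast
  obtain c where hp: "\<And>Z. Z \<in> D \<Longrightarrow> h Z \<in> D" "\<And>i j. holomorphic_symm (\<lambda>Z. h Z $ i $ j) D" "scaling h c"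
    using G h(1) unfolding action_group_def by blast
  show "U f \<in> H" if "f \<in> H" for f unfolding h(2) by (rule act_H[OF hp that])
  show "U (\<lambda>x. f x + g x) = (\<lambda>x. U f x + U g x)" for f g unfolding h(2) by (rule act_add)
  show "U (\<lambda>x. a * f x) = (\<lambda>x. a * U f x)" for a f unfolding h(2) by (rule act_scale)
  show "\<exists>C. \<forall>f\<in>H. nm (U f) \<le> C * nm f"
  proof (intro exI[of _ "sqrt c"] ballI)
    fix f assume f: "f \<in> H"
    have c: "c > 0" using hp(3) by (simp add: scaling_def)
    have "(nm (U f))\<^sup>2 = (sqrt c * nm f)\<^sup>2"
      using act_norm_sq[OF hp H_L2[OF f]] c by (simp add: h(2) power_mult_distrib)
    then have "(nm (U f))\<^sup>2 \<le> (sqrt c * nm f)\<^sup>2" by simp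
    then show "nm (U f) \<le> sqrt c * nm f" by (rule power2_le_imp_le) (use c in simp)
  qed
  obtain h' where h': "h' \<in> G" "\<And>Z. Z \<in> D \<Longrightarrow> h' (h Z) = Z" using G h(1) unfolding action_group_def by blast
  obtain c' where hp': "\<And>Z. Z \<in> D \<Longrightarrow> h' Z \<in> D" "\<And>i j. holomorphic_symm (\<lambda>Z. h' Z $ i $ j) D" "scaling h' c'"
    using G h'(1) unfolding action_group_def by blast
  show "\<exists>U'\<in>act ` G. \<exists>a. \<forall>f\<in>H. \<forall>g\<in>H. ip (U f) g = a * ip f (U' g)"
    using act_inner_adj[OF hp hp' h'(2)] h' L2_measurable[OF H_L2] unfolding h(2) by blast
qed

text \<open>In kernel notation this is K(h x, h z) = c K(x, z). It follows by testing against
  \<open>g\<close> and moving \<open>act h\<close> to the other side of the inner product.\<close>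

lemma kernel_transform:
  assumes G: "action_group G" and h: "h \<in> G" and c: "scaling h c" and z: "z \<in> D"
  shows "act h (kern (h z)) = (\<lambda>x. of_real c * kern z x)"
proof -
  have hp: "\<And>Z. Z \<in> D \<Longrightarrow> h Z \<in> D" "\<And>i j. holomorphic_symm (\<lambda>Z. h Z $ i $ j) D"
    using G h unfolding action_group_def by blast+
  obtain h' where h': "h' \<in> G" "\<And>Z. Z \<in> D \<Longrightarrow> h' (h Z) = Z" using G h(1) unfolding action_group_def by blast
  obtain c' where hp': "\<And>Z. Z \<in> D \<Longrightarrow> h' Z \<in> D" "\<And>i j. holomorphic_symm (\<lambda>Z. h' Z $ i $ j) D" "scaling h' c'"
    using G h'(1) unfolding action_group_def by blast
  show ?thesis
  proof (rule eq_of_inner_left[OF act_H[OF hp c kern_in] scale[OF kern_in]])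
    fix g assume g: "g \<in> H"
    have "ip (act h (kern (h z))) g = of_real c * ip (kern (h z)) (act h' g)"
      by (rule act_inner_adj[OF hp c hp' h'(2) L2_measurable[OF H_L2[OF kern_in]] g])
    also have "ip (kern (h z)) (act h' g) = cnj (act h' g (h z))"
      using reproducing[OF act_H[OF hp' g], of "h z"] by (metis L2_inner_cnj)
    also have "act h' g (h z) = g z" using hp z h' by (simp add: act_def)
    also have "cnj (g z) = ip (kern z) g" using reproducing[OF g, of z] by (metis L2_inner_cnj)
    finally show "ip (act h (kern (h z))) g = ip (\<lambda>x. of_real c * kern z x) g"
      by (simp add: L2_inner_scale_left)
  qed
qed

text \<open>A symbol that factors through \<mu> is almost everywhere invariant under
  \<open>h\<close>, so multiplication by it commutes with \<open>act h\<close>. The projection is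
  handled by pairing with elements of the Bergman space.\<close>

lemma toeplitz_commutant:
  fixes \<mu> :: "complex^'n^'n \<Rightarrow> 'h::topological_space"
  assumes G: "action_group G" and \<mu>: "\<And>h Z. h \<in> G \<Longrightarrow> Z \<in> D \<Longrightarrow> \<mu> (h Z) = \<mu> Z"
    and a: "a \<in> moment_symbols D \<mu>"
  shows "toeplitz D M a \<in> commutant (act ` G)"
proof -
  have aL: "a \<in> Linfty D" using a by (simp add: moment_symbols_def)
  obtain \<phi> where "AE Z in restrict_space L D. a Z = \<phi> (\<mu> Z)" using a by (auto simp: moment_symbols_def)
  then have \<phi>: "AE Z in M. a Z = \<phi> (\<mu> Z)" by (rule AE_M)
  have am: "a \<in> borel_measurable M"
  proof -
    have "a \<in> borel_measurable (restrict_space L D)" using aL by (simp add: Linfty_def)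
    moreover have "sets (restrict_space L D) = sets M" by (simp add: sets_restrict_space sets_M)
    ultimately show ?thesis using measurable_cong_sets[OF _ refl] by blast
  qed
  obtain C where "AE Z in restrict_space L D. cmod (a Z) \<le> C" using aL by (auto simp: Linfty_def)
  then have C: "AE Z in M. cmod (a Z) \<le> C" by (rule AE_M)
  define C' where "C' = max C 0"
  have C': "C' \<ge> 0" "AE Z in M. cmod (a Z) \<le> C'" using C by (auto simp: C'_def)
  have af: "(\<lambda>Z. a Z * f Z) \<in> L2 M" and afn: "nm (\<lambda>Z. a Z * f Z) \<le> C' * nm f" if f: "f \<in> L2 M" for f
  proof -
    have m: "(\<lambda>Z. a Z * f Z) \<in> borel_measurable M" using am L2_measurable[OF f] by measurable
    have le: "AE Z in M. (cmod (a Z * f Z))\<^sup>2 \<le> C'\<^sup>2 * (cmod (f Z))\<^sup>2"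
      using C'(2)
    proof (rule AE_mp, intro AE_I2 impI)
      fix Z assume "cmod (a Z) \<le> C'"
      then show "(cmod (a Z * f Z))\<^sup>2 \<le> C'\<^sup>2 * (cmod (f Z))\<^sup>2"
        by (simp add: norm_mult power_mult_distrib mult_right_mono power_mono)
    qed
    have int: "integrable M (\<lambda>Z. (cmod (a Z * f Z))\<^sup>2)"
    proof (rule Bochner_Integration.integrable_bound)
      show "integrable M (\<lambda>Z. C'\<^sup>2 * (cmod (f Z))\<^sup>2)" using L2_integrable[OF f] by simp
      show "(\<lambda>Z. (cmod (a Z * f Z))\<^sup>2) \<in> borel_measurable M" using m by measurable
      show "AE Z in M. norm ((cmod (a Z * f Z))\<^sup>2) \<le> norm (C'\<^sup>2 * (cmod (f Z))\<^sup>2)"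
        using le by (rule AE_mp) (auto intro!: AE_I2)
    qed
    then show L: "(\<lambda>Z. a Z * f Z) \<in> L2 M" using m by (simp add: L2_def)
    have "(nm (\<lambda>Z. a Z * f Z))\<^sup>2 \<le> (LINT Z|M. C'\<^sup>2 * (cmod (f Z))\<^sup>2)"
      unfolding L2_norm_sq by (rule integral_mono_AE[OF int _ le]) (use L2_integrable[OF f] in simp)
    also have "\<dots> = (C' * nm f)\<^sup>2" by (simp add: power_mult_distrib L2_norm_sq)
    finally show "nm (\<lambda>Z. a Z * f Z) \<le> C' * nm f"
      by (rule power2_le_imp_le) (use C' in simp)
  qed
  define T where "T = toeplitz D M a"
  have T: "T f = proj (\<lambda>Z. a Z * f Z)" if "f \<in> H" for f using that by (simp add: T_def toeplitz_def)
  have Tin: "T f \<in> H" if "f \<in> H" for f using that by (simp add: T proj_in af)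
  have Tip: "ip (T f) g = ip (\<lambda>Z. a Z * f Z) g" if "f \<in> H" "g \<in> H" for f g
    using that by (simp add: T proj_inner af)
  have "T \<in> bops"
  proof (rule bopsI[of _ C'])
    show "T \<in> extensional H" by (simp add: T_def toeplitz_def)
    show "T (\<lambda>x. f x + g x) = (\<lambda>x. T f x + T g x)" if "f \<in> H" "g \<in> H" for f g
    proof (rule eq_of_inner_left)
      fix h assume h: "h \<in> H"
      have "ip (T (\<lambda>x. f x + g x)) h = ip (\<lambda>Z. a Z * f Z + a Z * g Z) h"
        using Tip[OF add[OF that] h] by (simp add: distrib_left)
      also have "\<dots> = ip (\<lambda>x. T f x + T g x) h"
        using that h by (simp add: L2_inner_add_left af Tip Tin)
      finally show "ip (T (\<lambda>x. f x + g x)) h = ip (\<lambda>x. T f x + T g x) h" .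
    qed (use that Tin add in auto)
    show "T (\<lambda>x. b * f x) = (\<lambda>x. b * T f x)" if "f \<in> H" for b f
    proof (rule eq_of_inner_left)
      fix h assume h: "h \<in> H"
      have "ip (T (\<lambda>x. b * f x)) h = ip (\<lambda>Z. b * (a Z * f Z)) h"
        using Tip[OF scale[OF that] h] by (simp add: mult_ac)
      also have "\<dots> = ip (\<lambda>x. b * T f x) h"
        using that h by (simp only: L2_inner_scale_left Tip)
      finally show "ip (T (\<lambda>x. b * f x)) h = ip (\<lambda>x. b * T f x) h" .
    qed (use that Tin scale in auto)
    show "nm (T f) \<le> C' * nm f" if "f \<in> H" for f
      unfolding T[OF that] using proj_norm[OF af[OF inL2[OF that]]] afn[OF inL2[OF that]] by linarith
  qed (rule Tin)
  moreover have "T (act h f) = act h (T f)" if h: "h \<in> G" and f: "f \<in> H" for h f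
  proof -
    obtain c where hp: "\<And>Z. Z \<in> D \<Longrightarrow> h Z \<in> D" "\<And>i j. holomorphic_symm (\<lambda>Z. h Z $ i $ j) D" "scaling h c"
      using G h(1) unfolding action_group_def by blast
    obtain h' where h': "h' \<in> G" "\<And>Z. Z \<in> D \<Longrightarrow> h' (h Z) = Z" using G h(1) unfolding action_group_def by blast
    obtain c' where hp': "\<And>Z. Z \<in> D \<Longrightarrow> h' Z \<in> D" "\<And>i j. holomorphic_symm (\<lambda>Z. h' Z $ i $ j) D" "scaling h' c'"
      using G h'(1) unfolding action_group_def by blast
    have ah: "AE Z in M. a (h Z) = a Z"
    proof -
      have "AE Z in M. a (h Z) = \<phi> (\<mu> (h Z))" by (rule act_AE[OF hp \<phi>])
      moreover have "AE Z in M. \<mu> (h Z) = \<mu> Z" by (rule AE_I2) (simp add: \<mu>[OF h] space_M)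
      ultimately show ?thesis using \<phi> by (auto elim!: AE_mp)
    qed
    show ?thesis
    proof (rule eq_of_inner_left)
      show "T (act h f) \<in> H" "act h (T f) \<in> H" using act_H[OF hp] Tin f by auto
      fix g assume g: "g \<in> H"
      have afm: "(\<lambda>Z. a Z * f Z) \<in> borel_measurable M" using L2_measurable[OF af[OF inL2[OF f]]] .
      have "ip (T (act h f)) g = ip (\<lambda>Z. a Z * act h f Z) g" by (rule Tip[OF act_H[OF hp f] g])
      \<comment> \<open>The only place where invariance of the symbol enters: a(Z) may be replaced
        by a(h Z) off a null set.\<close>
      also have "\<dots> = ip (act h (\<lambda>Z. a Z * f Z)) g"
        unfolding L2_inner_def
      proof (rule integral_cong_AE)
        show "AE Z in M. a Z * act h f Z * cnj (g Z) = act h (\<lambda>Z. a Z * f Z) Z * cnj (g Z)"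
          using ah by (rule AE_mp) (auto intro!: AE_I2 simp: act_def)
        show "(\<lambda>Z. a Z * act h f Z * cnj (g Z)) \<in> borel_measurable M"
          using am L2_measurable[OF inL2[OF act_H[OF hp f]]] L2_measurable[OF inL2[OF g]] by measurable
        show "(\<lambda>Z. act h (\<lambda>Z. a Z * f Z) Z * cnj (g Z)) \<in> borel_measurable M"
          using act_measurable[OF hp afm] L2_measurable[OF inL2[OF g]] by measurable
      qed
      also have "\<dots> = of_real c * ip (\<lambda>Z. a Z * f Z) (act h' g)"
        by (rule act_inner_adj[OF hp hp' h'(2) afm g])
      also have "\<dots> = of_real c * ip (T f) (act h' g)" using Tip[OF f act_H[OF hp' g]] by simp
      also have "\<dots> = ip (act h (T f)) g"
        by (rule act_inner_adj[OF hp hp' h'(2) L2_measurable[OF inL2[OF Tin[OF f]]] g, symmetric])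
      finally show "ip (T (act h f)) g = ip (act h (T f)) g" .
    qed
  qed
  ultimately show ?thesis unfolding commutant_def T_def by auto
qed

text \<open>Shows that \<open>T (kern u) z\<close> is anti-holomorphic in \<open>u\<close>, since
  \<open>T' (kern z)\<close> belongs to the Bergman space.\<close>

lemma adjoint_kernel:
  assumes T: "T \<in> bops" and T': "T' \<in> bops" "is_adjoint M H T T'"
  shows "T (kern u) z = cnj (T' (kern z) u)"
proof -
  have "T (kern u) z = ip (T (kern u)) (kern z)" by (simp add: reproducing bops_in[OF T])
  also have "\<dots> = ip (kern u) (T' (kern z))" using T'(2) by (simp add: is_adjoint_def)
  also have "\<dots> = cnj (ip (T' (kern z)) (kern u))" by (simp add: L2_inner_cnj)
  also have "\<dots> = cnj (T' (kern z) u)" by (simp add: reproducing bops_in[OF T'(1)])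
  finally show ?thesis .
qed

text \<open>Supplies the local boundedness demanded by \<open>sesqui_holomorphic_zero\<close>. The
  norm of a kernel is bounded because its square is K(w, w), itself at most \<open>C\<close> times
  that norm.\<close>

lemma operator_kernel_bound:
  assumes T: "T \<in> bops" and p: "p \<in> D"
  shows "\<exists>r>0. \<exists>B. \<forall>z\<in>D. \<forall>w\<in>D. dist z p < r \<longrightarrow> dist w p < r \<longrightarrow> cmod (T (kern w) z) \<le> B"
proof -
  obtain r C where r: "r > 0" "C \<ge> 0"
    and C: "\<And>z f. z \<in> D \<Longrightarrow> dist z p < r \<Longrightarrow> f \<in> H \<Longrightarrow> cmod (f z) \<le> C * nm f"
    using local_bound[OF p] by blast
  obtain B where B: "B \<ge> 0" "\<And>f. f \<in> H \<Longrightarrow> nm (T f) \<le> B * nm f" using bops_bound[OF T] by blast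
  have K: "nm (kern w) \<le> C" if "w \<in> D" "dist w p < r" for w
  proof -
    have "(nm (kern w))\<^sup>2 = cmod (kern w w)"
      using reproducing[OF kern_in, of w w] unfolding L2_inner_self by (metis abs_power2 norm_of_real)
    also have "\<dots> \<le> C * nm (kern w)" using C that by simp
    finally show ?thesis unfolding power2_eq_square
      by (metis L2_norm_nonneg mult_right_le_imp_le order_le_less r(2))
  qed
  have "cmod (T (kern w) z) \<le> C * (B * C)" if "z \<in> D" "w \<in> D" "dist z p < r" "dist w p < r" for z w
  proof -
    have "cmod (T (kern w) z) \<le> C * nm (T (kern w))" by (rule C[OF that(1,3) bops_in[OF T kern_in]])
    also have "\<dots> \<le> C * (B * nm (kern w))" by (intro mult_left_mono B r kern_in)
    also have "\<dots> \<le> C * (B * C)" by (intro mult_left_mono K that B r)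
    finally show ?thesis .
  qed
  then show ?thesis using r by blast
qed

text \<open>The condition \<open>c * (cmod (m z))\<^sup>2 = 1\<close> says that the multiplier
  undoes the scaling of the automorphism carrying \<open>z\<close> to \<open>\<sigma> z\<close>.
  This is exactly what makes the kernels of \<open>T\<close> and of its reflection agree on the
  diagonal.\<close>

theorem commutative_moment_symbols:
  fixes \<mu> :: "complex^'n^'n \<Rightarrow> 'h::topological_space"
  assumes G: "action_group G" and \<mu>: "\<And>h Z. h \<in> G \<Longrightarrow> Z \<in> D \<Longrightarrow> \<mu> (h Z) = \<mu> Z"
    and \<sigma>: "\<And>z. z \<in> D \<Longrightarrow> \<sigma> z \<in> D" "\<And>z. z \<in> D \<Longrightarrow> \<sigma> (\<sigma> z) = z"
      "\<And>i j. holomorphic_symm (\<lambda>Z. cnj (\<sigma> Z $ i $ j)) D"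
    and m: "holomorphic_symm m D" "\<And>z. z \<in> D \<Longrightarrow> m z \<noteq> 0"
    and orbit: "\<And>z. z \<in> D \<Longrightarrow> \<exists>h\<in>G. \<exists>c. scaling h c \<and> \<sigma> z = h z \<and> c * (cmod (m z))\<^sup>2 = 1"
  shows "commutative_operators H (toeplitz_algebra D M (moment_symbols D \<mu>))"
proof -
  let ?A = "commutant (act ` G)"
  have A: "cstar_subalgebra M H ?A" by (rule action_group_commutant[OF G])
  have \<sigma>_cont: "continuous_on D \<sigma>"
  proof (rule continuous_on_matrix_entries)
    fix i j
    have "continuous_on D (\<lambda>Z. cnj (cnj (\<sigma> Z $ i $ j)))"
      by (intro continuous_on_cnj holomorphic_symm_continuous \<sigma>)
    then show "continuous_on D (\<lambda>Z. \<sigma> Z $ i $ j)" by simp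
  qed
  have sym: "T (kern w) z = m z * cnj (m w) * T (kern (\<sigma> z)) (\<sigma> w)"
    if TA: "T \<in> ?A" and z: "z \<in> D" and w: "w \<in> D" for T z w
  proof -
    have T: "T \<in> bops" using TA by (simp add: commutant_def)
    obtain T' where T': "T' \<in> bops" "is_adjoint M H T T'" using adjoint_exists[OF T] by blast
    note adj = adjoint_kernel[OF T T']
    have "T (kern w) z - m z * cnj (m w) * T (kern (\<sigma> z)) (\<sigma> w) = 0"
    proof (rule sesqui_holomorphic_zero[OF _ _ _ _ relopen conv z w,
          where F = "\<lambda>z w. T (kern w) z - m z * cnj (m w) * T (kern (\<sigma> z)) (\<sigma> w)"])
      fix w assume "w \<in> D"
      \<comment> \<open>The reflected kernel is rewritten through the adjoint so that
        \<open>z\<close> appears only as the argument of a Bergman function composed with \<sigma>;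
        two conjugations then make it holomorphic.\<close>
      have "holomorphic_symm (\<lambda>z. T (kern w) z - m z * cnj (m w) * cnj (T' (kern (\<sigma> w)) (\<sigma> z))) D"
        by (intro holomorphic_symm_diff holomorphic_symm_mult holomorphic_symm_const m(1)
            holomorphic_symm_cnj_chain[OF _ \<sigma>(3) \<sigma>(1)] H_hol bops_in[OF T] bops_in[OF T'(1)] kern_in)
      then show "holomorphic_symm (\<lambda>z. T (kern w) z - m z * cnj (m w) * T (kern (\<sigma> z)) (\<sigma> w)) D"
        by (simp add: adj[of "\<sigma> _"])
    next
      fix z assume "z \<in> D"
      have "holomorphic_symm (\<lambda>w. T' (kern z) w - cnj (m z) * m w * cnj (T (kern (\<sigma> z)) (\<sigma> w))) D"
        by (intro holomorphic_symm_diff holomorphic_symm_mult holomorphic_symm_const m(1)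
            holomorphic_symm_cnj_chain[OF _ \<sigma>(3) \<sigma>(1)] H_hol bops_in[OF T] bops_in[OF T'(1)] kern_in)
      then show "holomorphic_symm (\<lambda>w. cnj (T (kern w) z - m z * cnj (m w) * T (kern (\<sigma> z)) (\<sigma> w))) D"
        by (simp add: adj[of _ z])
    next
      fix p assume p: "p \<in> D"
      obtain r1 B1 where r1: "r1 > 0" "\<And>z w. z \<in> D \<Longrightarrow> w \<in> D \<Longrightarrow> dist z p < r1 \<Longrightarrow> dist w p < r1 \<Longrightarrow> cmod (T (kern w) z) \<le> B1"
        using operator_kernel_bound[OF T p] by blast
      obtain r2 B2 where r2: "r2 > 0" "\<And>z w. z \<in> D \<Longrightarrow> w \<in> D \<Longrightarrow> dist z (\<sigma> p) < r2 \<Longrightarrow> dist w (\<sigma> p) < r2 \<Longrightarrow> cmod (T (kern w) z) \<le> B2"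
        using operator_kernel_bound[OF T \<sigma>(1)[OF p]] by blast
      obtain r3 where r3: "r3 > 0" "\<And>z. z \<in> D \<Longrightarrow> dist z p < r3 \<Longrightarrow> dist (\<sigma> z) (\<sigma> p) < r2"
        using \<sigma>_cont p r2(1) unfolding continuous_on_iff by metis
      obtain r4 where r4: "r4 > 0" "\<And>z. z \<in> D \<Longrightarrow> dist z p < r4 \<Longrightarrow> dist (m z) (m p) < 1"
        using holomorphic_symm_continuous[OF m(1)] p unfolding continuous_on_iff by (metis zero_less_one)
      define r where "r = min (min r1 r3) r4"
      define b where "b = cmod (m p) + 1"
      have mb: "cmod (m z) \<le> b" if "z \<in> D" "dist z p < r" for z
        using r4(2)[OF that(1)] that(2) norm_triangle_ineq2[of "m z" "m p"] by (simp add: r_def b_def dist_norm)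
      have "cmod (T (kern w) z - m z * cnj (m w) * T (kern (\<sigma> z)) (\<sigma> w)) \<le> B1 + b * b * B2"
        if "z \<in> D" "w \<in> D" "dist z p < r" "dist w p < r" for z w
      proof -
        have 1: "cmod (T (kern w) z) \<le> B1" using that by (intro r1) (auto simp: r_def)
        have 2: "cmod (T (kern (\<sigma> z)) (\<sigma> w)) \<le> B2" using that by (intro r2 r3 \<sigma>) (auto simp: r_def)
        have "cmod (m z * cnj (m w) * T (kern (\<sigma> z)) (\<sigma> w)) = cmod (m z) * cmod (m w) * cmod (T (kern (\<sigma> z)) (\<sigma> w))"
          by (simp add: norm_mult)
        also have "\<dots> \<le> b * b * B2"
          using mb[OF that(1,3)] mb[OF that(2,4)] 2 norm_ge_zero order_trans
          by (intro mult_mono) (auto simp: b_def)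
        finally show ?thesis using 1 norm_triangle_ineq4[of "T (kern w) z" "m z * cnj (m w) * T (kern (\<sigma> z)) (\<sigma> w)"]
          by linarith
      qed
      moreover have "r > 0" using r1 r3 r4 by (simp add: r_def)
      ultimately show "\<exists>r>0. \<exists>B. \<forall>z\<in>D. \<forall>w\<in>D. dist z p < r \<longrightarrow> dist w p < r \<longrightarrow>
          cmod (T (kern w) z - m z * cnj (m w) * T (kern (\<sigma> z)) (\<sigma> w)) \<le> B" by blast
    next
      fix z assume z: "z \<in> D"
      obtain h c where h: "h \<in> G" "scaling h c" "\<sigma> z = h z" "c * (cmod (m z))\<^sup>2 = 1" using orbit[OF z] by blast
      have hz: "h z \<in> D" using \<sigma>(1)[OF z] h(3) by simp
      \<comment> \<open>Invariance on the diagonal: the operator kernel at \<open>(h z, h z)\<close>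
        is \<open>c\<close> times its value at \<open>(z, z)\<close>, because \<open>T\<close>
        commutes with \<open>act h\<close>.\<close>
      have "of_real c * T (kern z) z = T (act h (kern (h z))) z"
        unfolding kernel_transform[OF G h(1,2) z] by (simp add: bops_scale[OF T])
      also have "T (act h (kern (h z))) = act h (T (kern (h z)))" using TA h(1) by (simp add: commutant_def)
      also have "act h (T (kern (h z))) z = T (kern (h z)) (h z)" using z by (simp add: act_def)
      finally have e: "T (kern (h z)) (h z) = of_real c * T (kern z) z" by simp
      have "m z * cnj (m z) * T (kern (\<sigma> z)) (\<sigma> z) = of_real ((cmod (m z))\<^sup>2) * (of_real c * T (kern z) z)"
        by (simp only: h(3) e complex_norm_square)
      also have "\<dots> = of_real (c * (cmod (m z))\<^sup>2) * T (kern z) z" by simp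
      also have "\<dots> = T (kern z) z" by (simp only: h(4)) simp
      finally show "T (kern z) z - m z * cnj (m z) * T (kern (\<sigma> z)) (\<sigma> z) = 0" by simp
    qed
    then show ?thesis by simp
  qed
  have "toeplitz D M ` moment_symbols D \<mu> \<subseteq> ?A" 
    by (rule image_subsetI, rule toeplitz_commutant[where \<mu> = \<mu>, OF G]) (rule \<mu>)
  then have sub: "toeplitz_algebra D M (moment_symbols D \<mu>) \<subseteq> ?A"
    unfolding toeplitz_algebra_def cstar_generated_def using A by blast
  have "compose H S T = compose H T S" if "S \<in> ?A" "T \<in> ?A" for S T
  proof (rule commute_of_symmetric_kernels[where D = D and \<A> = ?A and \<sigma> = \<sigma> and m = m])
    show "f x = 0" if "f \<in> H" "x \<notin> D" for f x by (rule H_vanish[OF that])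
    show "\<sigma> z \<in> D" "\<sigma> (\<sigma> z) = z" "m z \<noteq> 0" if "z \<in> D" for z using that \<sigma> m by auto
    show "T (kern w) z = m z * cnj (m w) * T (kern (\<sigma> z)) (\<sigma> w)"
      if "T \<in> ?A" "z \<in> D" "w \<in> D" for T z w by (rule sym[OF that])
    show "S \<in> ?A" "T \<in> ?A" by (rule that)+
    show "?A \<subseteq> bops" by (auto simp: commutant_def)
    have "(\<lambda>f\<in>H. f) (act h f) = act h ((\<lambda>f\<in>H. f) f)" if "h \<in> G" "f \<in> H" for h f
    proof -
      have "act h f \<in> H" using G that act_H unfolding action_group_def by blast
      then show ?thesis using that by simp
    qed
    then show "(\<lambda>f\<in>H. f) \<in> ?A" using restrict_bops by (auto simp: commutant_def)
    show "compose H S T \<in> ?A" if "S \<in> ?A" "T \<in> ?A" for S T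
      using A that unfolding cstar_subalgebra_def by blast
    show "S \<in> ?A" if "T \<in> ?A" "S \<in> bops" "is_adjoint M H T S" for S T
      using A that unfolding cstar_subalgebra_def by blast
  qed
  then show ?thesis using sub unfolding commutative_operators_def by blast
qed

end

section \<open>Rayleigh quotients and simultaneous diagonalisation\<close>

lemma quadratic_zero:
  fixes b q :: real
  assumes "\<And>t. 0 \<le> 2 * t * b + t\<^sup>2 * q"
  shows "b = 0"
proof (rule ccontr)
  assume b: "b \<noteq> 0"
  define D where "D = \<bar>q\<bar> + 1"
  have D: "D > 0" "q < D" by (auto simp: D_def)
  have "0 \<le> 2 * (- b / D) * b + (- b / D)\<^sup>2 * q" by (rule assms)
  also have "\<dots> = (b\<^sup>2 / D\<^sup>2) * (q - 2 * D)" using D by (simp add: field_simps power2_eq_square)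
  also have "\<dots> < 0" using b D by (intro mult_pos_neg) auto
  finally show False by simp
qed

text \<open>The quotient of the two forms attains its maximum on the unit sphere of
  \<open>W\<close>, and vanishing of the first variation there is the eigenvalue equation. Stated
  for a Euclidean space, it serves real vectors as well as complex vectors seen as a real
  space.\<close>

lemma Rayleigh_maximiser:
  fixes X Y :: "'a::euclidean_space \<Rightarrow> 'a \<Rightarrow> real"
  assumes X: "bilinear X" "\<And>u v. X u v = X v u" and Y: "bilinear Y" "\<And>u v. Y u v = Y v u"
    and pos: "\<And>v. v \<noteq> 0 \<Longrightarrow> 0 < Y v v"
    and W: "subspace W" and ne: "\<exists>u\<in>W. u \<noteq> 0"
  obtains v x where "v \<in> W" "Y v v = 1" "\<forall>u\<in>W. X v u = x * Y v u"
proof -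
  note bX = X(1)[unfolded bilinear_conv_bounded_bilinear] and bY = Y(1)[unfolded bilinear_conv_bounded_bilinear]
  define K where "K = W \<inter> sphere 0 1"
  have "compact K" unfolding K_def using closed_subspace[OF W] by (intro closed_Int_compact) auto
  moreover obtain u0 where u0: "u0 \<in> W" "u0 \<noteq> 0" using ne by blast
  then have "u0 /\<^sub>R norm u0 \<in> K" by (simp add: K_def subspace_scale[OF W])
  moreover have "continuous_on K (\<lambda>v. X v v / Y v v)"
  proof (intro continuous_on_divide bounded_bilinear.continuous_on[OF bX] bounded_bilinear.continuous_on[OF bY]
        continuous_on_id ballI)
    fix v assume "v \<in> K"
    then have "v \<noteq> 0" by (auto simp: K_def)
    then show "Y v v \<noteq> 0" using pos[of v] by simp
  qed
  ultimately obtain v0 where v0: "v0 \<in> K" "\<And>u. u \<in> K \<Longrightarrow> X u u / Y u u \<le> X v0 v0 / Y v0 v0"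
    using continuous_attains_sup[of K "\<lambda>v. X v v / Y v v"] by blast
  have v0': "v0 \<in> W" "v0 \<noteq> 0" using v0(1) by (auto simp: K_def)
  define x where "x = X v0 v0 / Y v0 v0"
  have le: "X u u \<le> x * Y u u" if u: "u \<in> W" for u
  proof (cases "u = 0")
    case True
    then show ?thesis using bilinear_lzero[OF X(1)] bilinear_lzero[OF Y(1)] by simp
  next
    case False
    have "u /\<^sub>R norm u \<in> K" using u False by (simp add: K_def subspace_scale[OF W])
    then have "X (u /\<^sub>R norm u) (u /\<^sub>R norm u) / Y (u /\<^sub>R norm u) (u /\<^sub>R norm u) \<le> x"
      unfolding x_def by (rule v0(2))
    then have "X u u / Y u u \<le> x"
      using False by (simp add: bilinear_lmul[OF X(1)] bilinear_rmul[OF X(1)] bilinear_lmul[OF Y(1)] bilinear_rmul[OF Y(1)])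
    then show ?thesis using pos[OF False] by (simp add: field_simps)
  qed
  have eq: "X v0 u = x * Y v0 u" if u: "u \<in> W" for u
  proof -
    have "0 \<le> 2 * t * (x * Y v0 u - X v0 u) + t\<^sup>2 * (x * Y u u - X u u)" for t
    proof -
      have "v0 + t *\<^sub>R u \<in> W" using v0' u W by (simp add: subspace_add subspace_scale)
      from le[OF this] have "X v0 v0 + 2 * t * X v0 u + t\<^sup>2 * X u u \<le> x * (Y v0 v0 + 2 * t * Y v0 u + t\<^sup>2 * Y u u)"
        by (simp add: bilinear_ladd[OF X(1)] bilinear_radd[OF X(1)] bilinear_lmul[OF X(1)] bilinear_rmul[OF X(1)]
            bilinear_ladd[OF Y(1)] bilinear_radd[OF Y(1)] bilinear_lmul[OF Y(1)] bilinear_rmul[OF Y(1)]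
            X(2)[of u v0] Y(2)[of u v0] power2_eq_square algebra_simps)
      moreover have "x * Y v0 v0 = X v0 v0" using pos[OF v0'(2)] by (simp add: x_def)
      ultimately show ?thesis by (simp add: algebra_simps)
    qed
    then have "x * Y v0 u - X v0 u = 0" by (rule quadratic_zero)
    then show ?thesis by simp
  qed
  define s where "s = 1 / sqrt (Y v0 v0)"
  have Yp: "Y v0 v0 > 0" by (rule pos[OF v0'(2)])
  show ?thesis
  proof (rule that[of "s *\<^sub>R v0" x])
    show "s *\<^sub>R v0 \<in> W" using v0' W by (simp add: subspace_scale)
    show "Y (s *\<^sub>R v0) (s *\<^sub>R v0) = 1"
      using Yp by (simp add: bilinear_lmul[OF Y(1)] bilinear_rmul[OF Y(1)] s_def)
    show "\<forall>u\<in>W. X (s *\<^sub>R v0) u = x * Y (s *\<^sub>R v0) u"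
      by (simp add: bilinear_lmul[OF X(1)] bilinear_lmul[OF Y(1)] eq)
  qed
qed

definition diag_mat :: "('n \<Rightarrow> 'a::zero) \<Rightarrow> 'a^'n^'n" where
  "diag_mat x = (\<chi> i j. if i = j then x i else 0)"

lemma diag_mat_nth: "diag_mat x $ i $ j = (if i = j then x i else 0)"
  by (simp add: diag_mat_def)

lemma diag_mat_mult: "diag_mat x ** diag_mat y = (diag_mat (\<lambda>i. x i * y i) :: 'a::semiring_1^'n^'n)"
proof (rule mat_eqI)
  fix i j
  have "(diag_mat x ** diag_mat y :: 'a^'n^'n) $ i $ j = (\<Sum>k\<in>UNIV. if i = k then (if k = j then x i * y k else 0) else 0)"
    unfolding matrix_matrix_mult_def by (simp only: vec_lambda_beta diag_mat_nth) (rule sum.cong, auto)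
  also have "\<dots> = (if i = j then x i * y i else 0)" by simp
  finally show "(diag_mat x ** diag_mat y :: 'a^'n^'n) $ i $ j = diag_mat (\<lambda>i. x i * y i) $ i $ j" by (simp add: diag_mat_nth)
qed

lemma diag_mat_one: "diag_mat (\<lambda>i. 1) = mat 1"
  by (rule mat_eqI) (simp add: diag_mat_nth mat_def)

lemma transpose_diag_mat [simp]: "transpose (diag_mat x) = diag_mat x"
  by (rule mat_eqI) (simp add: diag_mat_nth transpose_def)

lemma det_diag_mat: "det (diag_mat x :: 'a::comm_ring_1^'n^'n) = (\<Prod>i\<in>UNIV. x i)"
  by (subst det_diagonal) (auto simp: diag_mat_nth)

lemma congruence_entry:
  fixes v :: "'n \<Rightarrow> 'a::comm_semiring_1^'n"
  defines "P \<equiv> (\<chi> a i. v i $ a)"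
  shows "(transpose P ** B ** P) $ i $ j = (\<Sum>a\<in>UNIV. v i $ a * (B *v v j) $ a)"
proof -
  have e: "(B ** P) $ a $ j = (B *v v j) $ a" for a
    by (simp add: matrix_matrix_mult_def matrix_vector_mult_def P_def)
  have "(transpose P ** (B ** P)) $ i $ j = (\<Sum>a\<in>UNIV. v i $ a * (B ** P) $ a $ j)"
    by (subst matrix_matrix_mult_def) (simp add: transpose_def P_def)
  then show ?thesis by (simp add: matrix_mul_assoc e)
qed

text \<open>A dimension count. In this lemma and the two diagonalisations,
  \<open>principal_det\<close> is a local name for a linear map, unrelated to the determinant
  introduced later.\<close>

lemma subset_kernel_nontrivial:
  fixes principal_det :: "'a::euclidean_space \<Rightarrow> 'a"
  assumes "linear principal_det" "\<not> surj principal_det"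
  obtains u where "u \<noteq> 0" "principal_det u = 0"
  using assms linear_injective_imp_surjective[of principal_det] by (metis linear_injective_0)

text \<open>Basis vectors are found one at a time as Rayleigh maximisers on the
  \<open>Y\<close>-orthogonal complement of the earlier ones. The third conjunct of the induction
  statement says that this complement is also \<open>X\<close>-orthogonal to them, so each new
  vector respects both forms.\<close>

lemma real_simultaneous_diagonalisation:
  fixes X Y :: "real^'n^'n"
  assumes X: "transpose X = X" and Y: "pos_def_real Y"
  obtains P :: "real^'n^'n" and x where "transpose P ** Y ** P = mat 1" "transpose P ** X ** P = diag_mat x"
proof -
  have Ys: "transpose Y = Y" and Yp: "\<And>v. v \<noteq> 0 \<Longrightarrow> 0 < v \<bullet> (Y *v v)" using Y by (auto simp: pos_def_real_def)
  define BX BY where "BX u v = u \<bullet> (X *v v)" and "BY u v = u \<bullet> (Y *v v)" for u v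
  have bil: "bilinear (\<lambda>u v. u \<bullet> (B *v v))" for B :: "real^'n^'n"
    by (auto simp: bilinear_def inner_add_left inner_add_right matrix_vector_right_distrib
        matrix_vector_mult_scaleR intro!: linearI)
  have sym: "u \<bullet> (B *v v) = v \<bullet> (B *v u)" if "transpose B = B" for B :: "real^'n^'n" and u v
    by (metis dot_lmul_matrix inner_commute that transpose_matrix_vector)
  note BXb = bil[of X, folded BX_def] and BYb = bil[of Y, folded BY_def]
  have BXs: "BX u v = BX v u" and BYs: "BY u v = BY v u" for u v
    using sym X Ys by (auto simp: BX_def BY_def)
  have Yp': "0 < BY v v" if "v \<noteq> 0" for v using Yp[OF that] by (simp add: BY_def)
  have main: "\<exists>v x. (\<forall>i\<in>S. \<forall>j\<in>S. BY (v i) (v j) = (if i = j then 1 else 0)) \<and>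
      (\<forall>i\<in>S. \<forall>j\<in>S. BX (v i) (v j) = (if i = j then x i else 0)) \<and>
      (\<forall>u. (\<forall>j\<in>S. BY (v j) u = 0) \<longrightarrow> (\<forall>i\<in>S. BX (v i) u = 0))" if "finite S" for S :: "'n set"
    using that
  proof (induction S rule: finite_induct)
    case (insert k S)
    then obtain v x where v: "\<And>i j. i \<in> S \<Longrightarrow> j \<in> S \<Longrightarrow> BY (v i) (v j) = (if i = j then 1 else 0)"
      "\<And>i j. i \<in> S \<Longrightarrow> j \<in> S \<Longrightarrow> BX (v i) (v j) = (if i = j then x i else 0)"
      "\<And>u i. (\<forall>j\<in>S. BY (v j) u = 0) \<Longrightarrow> i \<in> S \<Longrightarrow> BX (v i) u = 0" by blast
    define W where "W = {u. \<forall>j\<in>S. BY (v j) u = 0}"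
    have W: "subspace W"
      by (auto simp: W_def subspace_def bilinear_rzero[OF BYb] bilinear_radd[OF BYb] bilinear_rmul[OF BYb])
    \<comment> \<open>The components indexed by \<open>S\<close> are the orthogonality conditions,
      and the component at \<open>k\<close> is always 0, so the map is not onto and its nonzero
      kernel lies in \<open>W\<close>.\<close>
    define principal_det where "principal_det u = (\<chi> j. if j \<in> S then BY (v j) u else 0)" for u
    have "linear principal_det"
      by (rule linearI) (auto simp: principal_det_def vec_eq_iff bilinear_radd[OF BYb] bilinear_rmul[OF BYb])
    moreover have "\<not> surj principal_det"
    proof
      assume "surj principal_det"
      then obtain u where "principal_det u = axis k 1" by (metis surjD)
      then have "principal_det u $ k = 1" by (simp add: axis_def)
      then show False using insert(2) by (simp add: principal_det_def)
    qed
    ultimately obtain u where "u \<noteq> 0" "principal_det u = 0" by (rule subset_kernel_nontrivial)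
    then have ne: "\<exists>u\<in>W. u \<noteq> 0" by (intro bexI[of _ u]) (auto simp: W_def principal_det_def vec_eq_iff split: if_splits)
    obtain vk xk where vka: "vk \<in> W" "BY vk vk = 1" "\<forall>u\<in>W. BX vk u = xk * BY vk u"
      by (rule Rayleigh_maximiser[where X = BX and Y = BY, OF BXb BXs BYb BYs Yp' W ne])
    note vk = vka(1,2) bspec[OF vka(3)]
    define v' x' where "v' = v(k := vk)" and "x' = x(k := xk)"
    have vS: "v' i = v i" "x' i = x i" if "i \<in> S" for i using that insert(2) by (auto simp: v'_def x'_def)
    have vk': "v' k = vk" "x' k = xk" by (auto simp: v'_def x'_def)
    have o: "BY (v i) vk = 0" "BX (v i) vk = 0" "BY vk (v i) = 0" "BX vk (v i) = 0" if "i \<in> S" for i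
      using vk(1) v(3)[of vk i] that BYs BXs by (auto simp: W_def)
    show ?case
    proof (intro exI[of _ v'] exI[of _ x'] conjI ballI allI impI)
      fix i j assume "i \<in> insert k S" "j \<in> insert k S"
      then show "BY (v' i) (v' j) = (if i = j then 1 else 0)" "BX (v' i) (v' j) = (if i = j then x' i else 0)"
        using v(1,2) o vk insert(2) vk(3)[OF vk(1)] by (auto simp: vS vk')
    next
      fix u i assume u: "\<forall>j\<in>insert k S. BY (v' j) u = 0" and i: "i \<in> insert k S"
      then have "u \<in> W" "BY vk u = 0" by (auto simp: W_def vS vk')
      then show "BX (v' i) u = 0" using i vk(3) v(3)[of u i] by (auto simp: vS vk' W_def)
    qed
  qed auto
  from main[OF finite_class.finite_UNIV] obtain v :: "'n \<Rightarrow> real^'n" where "\<exists>x. (\<forall>i\<in>UNIV. \<forall>j\<in>UNIV. BY (v i) (v j) = (if i = j then 1 else 0)) \<and>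
       (\<forall>i\<in>UNIV. \<forall>j\<in>UNIV. BX (v i) (v j) = (if i = j then x i else 0)) \<and>
       (\<forall>u. (\<forall>j\<in>UNIV. BY (v j) u = 0) \<longrightarrow> (\<forall>i\<in>UNIV. BX (v i) u = 0))"
    by (rule exE)
  then obtain x where
      "(\<forall>i\<in>UNIV. \<forall>j\<in>UNIV. BY (v i) (v j) = (if i = j then 1 else 0)) \<and>
       (\<forall>i\<in>UNIV. \<forall>j\<in>UNIV. BX (v i) (v j) = (if i = j then x i else 0)) \<and>
       (\<forall>u. (\<forall>j\<in>UNIV. BY (v j) u = 0) \<longrightarrow> (\<forall>i\<in>UNIV. BX (v i) u = 0))"
    by (rule exE)
  then have v: "BY (v i) (v j) = (if i = j then 1 else 0)" "BX (v i) (v j) = (if i = j then x i else 0)" for i j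
    by simp_all
  define P :: "real^'n^'n" where "P = (\<chi> a i. v i $ a)"
  have "(transpose P ** Y ** P) $ i $ j = (if i = j then 1 else 0)" for i j
    unfolding P_def congruence_entry v(1)[symmetric] BY_def inner_vec_def by simp
  then have 1: "transpose P ** Y ** P = mat 1" by (intro mat_eqI) (simp add: mat_def)
  have "(transpose P ** X ** P) $ i $ j = (if i = j then x i else 0)" for i j
    unfolding P_def congruence_entry v(2)[symmetric] BX_def inner_vec_def by simp
  then have 2: "transpose P ** X ** P = diag_mat x" by (intro mat_eqI) (simp add: diag_mat_nth)
  show ?thesis by (rule that[OF 1 2])
qed

lemma cnj_mat_mult: "cnj_mat (A ** B) = cnj_mat A ** cnj_mat B"
  by (rule mat_eqI) (simp add: matrix_matrix_mult_def)

lemma cnj_mat_transpose: "cnj_mat (transpose A) = transpose (cnj_mat A)"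
  by (rule mat_eqI) (simp add: transpose_def)

lemma cnj_mat_cnj_mat [simp]: "cnj_mat (cnj_mat A) = A"
  by (rule mat_eqI) simp

lemma cnj_mat_one [simp]: "cnj_mat (mat 1) = mat 1"
  by (rule mat_eqI) (simp add: mat_def)

lemma matrix_mult_eq_one_commute:
  fixes A B :: "'a::field^'n^'n"
  assumes "A ** B = mat 1" shows "B ** A = mat 1"
  using assms matrix_left_right_inverse by blast

text \<open>The real inner product of \<open>\<complex>\<^sup>n\<close> is used for the Rayleigh quotient;
  multiplying by \<open>-\<i>\<close> recovers the imaginary parts.\<close>

lemma Takagi:
  fixes Z :: "complex^'n^'n"
  assumes Z: "transpose Z = Z"
  obtains U :: "complex^'n^'n" and x :: "'n \<Rightarrow> real" where "transpose (cnj_mat U) ** U = mat 1"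
    "transpose U ** Z ** U = diag_mat (\<lambda>i. complex_of_real (x i))"
proof -
  define h b where "h u v = (\<Sum>a\<in>UNIV. cnj (u $ a) * v $ a)" and "b u v = (\<Sum>a\<in>UNIV. u $ a * (Z *v v) $ a)"
    for u v :: "complex^'n"
  have hlin: "h u (v + w) = h u v + h u w" "h (v + w) u = h v u + h w u" for u v w
    by (simp_all add: h_def algebra_simps sum.distrib)
  have hscale: "h u (c *s v) = c * h u v" "h (c *s v) u = cnj c * h v u" for u v c
    by (simp_all add: h_def sum_distrib_left mult_ac)
  have bsym: "b u v = b v u" for u v
  proof -
    have "b u v = (\<Sum>a\<in>UNIV. \<Sum>c\<in>UNIV. u $ a * (Z $ a $ c * v $ c))"
      by (simp add: b_def matrix_vector_mult_def sum_distrib_left)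
    also have "\<dots> = (\<Sum>c\<in>UNIV. \<Sum>a\<in>UNIV. u $ a * (Z $ a $ c * v $ c))" by (rule sum.swap)
    also have "\<dots> = b v u"
      using Z by (auto simp: b_def matrix_vector_mult_def sum_distrib_left transpose_def vec_eq_iff mult_ac intro!: sum.cong)
    finally show ?thesis .
  qed
  have blin: "b (v + w) u = b v u + b w u" for u v w by (simp add: b_def algebra_simps sum.distrib)
  have bscale: "b (c *s v) u = c * b v u" for u v c by (simp add: b_def sum_distrib_left mult_ac)
  have hsym: "h u v = cnj (h v u)" for u v by (simp add: h_def mult.commute)
  have scaleR: "r *\<^sub>R v = complex_of_real r *s v" for r and v :: "complex^'n"
    by (simp add: vec_eq_iff scaleR_conv_of_real[where 'a = complex])
  define BX BY where "BX u v = Re (b u v)" and "BY u v = Re (h u v)" for u v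
  have BXs: "BX u v = BX v u" and BYs: "BY u v = BY v u" for u v
    using bsym[of u v] hsym[of u v] by (auto simp: BX_def BY_def)
  have lX: "linear (\<lambda>u. BX u v)" and lY: "linear (\<lambda>u. BY u v)" for v
    by (auto intro!: linearI simp: BX_def BY_def blin hlin scaleR bscale hscale)
  have "BX u = (\<lambda>v. BX v u)" "BY u = (\<lambda>v. BY v u)" for u
    by (rule ext, rule BXs, rule ext, rule BYs)
  then have "linear (BX u)" "linear (BY u)" for u using lX[of u] lY[of u] by metis+
  then have BXb: "bilinear BX" and BYb: "bilinear BY"
    unfolding bilinear_def using lX lY by blast+
  have hself: "h v v = of_real ((norm v)\<^sup>2)" for v
  proof -
    have "h v v = of_real (\<Sum>a\<in>UNIV. (cmod (v $ a))\<^sup>2)"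
      by (simp add: h_def complex_norm_square[symmetric] mult.commute flip: of_real_power)
    then show ?thesis by (simp add: norm_vec_def L2_set_def sum_nonneg)
  qed
  have Yp: "0 < BY v v" if "v \<noteq> 0" for v using that by (simp add: BY_def hself)
  have main: "\<exists>v x. (\<forall>i\<in>S. \<forall>j\<in>S. h (v i) (v j) = (if i = j then 1 else 0)) \<and>
      (\<forall>i\<in>S. \<forall>j\<in>S. b (v i) (v j) = (if i = j then complex_of_real (x i) else 0)) \<and>
      (\<forall>u. (\<forall>j\<in>S. h (v j) u = 0) \<longrightarrow> (\<forall>i\<in>S. b (v i) u = 0))" if "finite S" for S :: "'n set"
    using that
  proof (induction S rule: finite_induct)
    case (insert k S)
    then obtain v x where v: "\<And>i j. i \<in> S \<Longrightarrow> j \<in> S \<Longrightarrow> h (v i) (v j) = (if i = j then 1 else 0)"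
      "\<And>i j. i \<in> S \<Longrightarrow> j \<in> S \<Longrightarrow> b (v i) (v j) = (if i = j then complex_of_real (x i) else 0)"
      "\<And>u i. (\<forall>j\<in>S. h (v j) u = 0) \<Longrightarrow> i \<in> S \<Longrightarrow> b (v i) u = 0" by blast
    define W where "W = {u. \<forall>j\<in>S. h (v j) u = 0}"
    have h0: "h u 0 = 0" for u by (simp add: h_def)
    have W: "subspace W" by (auto simp: W_def subspace_def h0 hlin scaleR hscale)
    \<comment> \<open>The complement is closed under complex multiples, so the real eigenvalue
      equation may also be applied to the rotated vector.\<close>
    have Wi: "(- \<i>) *s u \<in> W" if "u \<in> W" for u
      unfolding W_def mem_Collect_eq
    proof
      fix j assume "j \<in> S"
      then show "h (v j) ((- \<i>) *s u) = 0" using that unfolding hscale W_def by simp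
    qed
    define principal_det where "principal_det u = (\<chi> j. if j \<in> S then h (v j) u else 0)" for u
    have "linear principal_det"
      by (rule linearI) (simp_all add: principal_det_def vec_eq_iff hlin scaleR hscale)
    moreover have "\<not> surj principal_det"
    proof
      assume "surj principal_det"
      then obtain u where "principal_det u = axis k 1" by (metis surjD)
      then have "principal_det u $ k = 1" by (simp add: axis_def)
      then show False using insert(2) by (simp add: principal_det_def)
    qed
    ultimately obtain u where "u \<noteq> 0" "principal_det u = 0" by (rule subset_kernel_nontrivial)
    then have ne: "\<exists>u\<in>W. u \<noteq> 0" by (intro bexI[of _ u]) (auto simp: W_def principal_det_def vec_eq_iff split: if_splits)
    obtain vk xk where vka: "vk \<in> W" "BY vk vk = 1" "\<forall>u\<in>W. BX vk u = xk * BY vk u"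
      by (rule Rayleigh_maximiser[where X = BX and Y = BY, OF BXb BXs BYb BYs Yp W ne])
    note vk0 = vka(1,2) bspec[OF vka(3)]
    have hk: "h vk vk = 1" using vk0(2) by (simp add: BY_def hself)
    have bk: "b vk u = of_real xk * h vk u" if "u \<in> W" for u
    proof (rule complex_eqI)
      show "Re (b vk u) = Re (of_real xk * h vk u)" using vk0(3)[OF that] by (simp add: BX_def BY_def)
      have "Re (b vk ((- \<i>) *s u)) = xk * Re (h vk ((- \<i>) *s u))"
        using vk0(3)[OF Wi[OF that]] by (simp add: BX_def BY_def)
      then show "Im (b vk u) = Im (of_real xk * h vk u)"
        unfolding hscale bsym[of vk "_ *s _"] bscale bsym[of u vk] by simp
    qed
    define v' x' where "v' = v(k := vk)" and "x' = x(k := xk)"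
    have vS: "v' i = v i" "x' i = x i" if "i \<in> S" for i using that insert(2) by (auto simp: v'_def x'_def)
    have vk': "v' k = vk" "x' k = xk" by (auto simp: v'_def x'_def)
    have o: "h (v i) vk = 0" "b (v i) vk = 0" "h vk (v i) = 0" "b vk (v i) = 0" if "i \<in> S" for i
      using vk0(1) v(3)[of vk i] that hsym[of vk "v i"] bsym[of vk "v i"] by (auto simp: W_def)
    show ?case
    proof (intro exI[of _ v'] exI[of _ x'] conjI ballI allI impI)
      fix i j assume "i \<in> insert k S" "j \<in> insert k S"
      then show "h (v' i) (v' j) = (if i = j then 1 else 0)" "b (v' i) (v' j) = (if i = j then complex_of_real (x' i) else 0)"
        using v(1,2) o hk insert(2) bk[OF vk0(1)] by (auto simp: vS vk')
    next
      fix u i assume u: "\<forall>j\<in>insert k S. h (v' j) u = 0" and i: "i \<in> insert k S"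
      then have "u \<in> W" "h vk u = 0" by (auto simp: W_def vS vk')
      then show "b (v' i) u = 0" using i bk v(3)[of u i] by (auto simp: vS vk' W_def)
    qed
  qed auto
  from main[OF finite_class.finite_UNIV] obtain v :: "'n \<Rightarrow> complex^'n" where "\<exists>x. (\<forall>i\<in>UNIV. \<forall>j\<in>UNIV. h (v i) (v j) = (if i = j then 1 else 0)) \<and>
       (\<forall>i\<in>UNIV. \<forall>j\<in>UNIV. b (v i) (v j) = (if i = j then complex_of_real (x i) else 0)) \<and>
       (\<forall>u. (\<forall>j\<in>UNIV. h (v j) u = 0) \<longrightarrow> (\<forall>i\<in>UNIV. b (v i) u = 0))"
    by (rule exE)
  then obtain x where
      "(\<forall>i\<in>UNIV. \<forall>j\<in>UNIV. h (v i) (v j) = (if i = j then 1 else 0)) \<and>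
       (\<forall>i\<in>UNIV. \<forall>j\<in>UNIV. b (v i) (v j) = (if i = j then complex_of_real (x i) else 0)) \<and>
       (\<forall>u. (\<forall>j\<in>UNIV. h (v j) u = 0) \<longrightarrow> (\<forall>i\<in>UNIV. b (v i) u = 0))"
    by (rule exE)
  then have v: "h (v i) (v j) = (if i = j then 1 else 0)"
      "b (v i) (v j) = (if i = j then complex_of_real (x i) else 0)" for i j
    by simp_all
  define U where "U = (\<chi> a i. v i $ a)"
  have "(transpose (cnj_mat U) ** U) $ i $ j = (if i = j then 1 else 0)" for i j
    unfolding v(1)[symmetric] h_def by (simp add: matrix_matrix_mult_def transpose_def U_def)
  then have 1: "transpose (cnj_mat U) ** U = mat 1" by (intro mat_eqI) (simp add: mat_def)
  have "(transpose U ** Z ** U) $ i $ j = (if i = j then complex_of_real (x i) else 0)" for i j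
    unfolding U_def congruence_entry v(2)[symmetric] b_def by simp
  then have 2: "transpose U ** Z ** U = diag_mat (\<lambda>i. complex_of_real (x i))" by (intro mat_eqI) (simp add: diag_mat_nth)
  show ?thesis by (rule that[OF 1 2])
qed

text \<open>The Takagi form of \<open>Z\<close> is real, hence it is also the form of the conjugate
  matrix under the conjugate of \<open>U\<close>. Undoing one reduction after the other gives
  \<open>V = U ** transpose U\<close>.\<close>

lemma conjugate_unitary_congruence:
  fixes Z :: "complex^'n^'n"
  assumes Z: "transpose Z = Z"
  obtains V where "V ** transpose (cnj_mat V) = mat 1" "V ** Z ** transpose V = cnj_mat Z"
proof -
  obtain U :: "complex^'n^'n" and x :: "'n \<Rightarrow> real" where U: "transpose (cnj_mat U) ** U = mat 1" and x: "transpose U ** Z ** U = diag_mat (\<lambda>i. complex_of_real (x i))"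
    by (rule Takagi[OF Z])
  let ?S = "diag_mat (\<lambda>i. complex_of_real (x i)) :: complex^'n^'n"
  have U': "U ** transpose (cnj_mat U) = mat 1" by (rule matrix_mult_eq_one_commute[OF U])
  have Uc: "cnj_mat U ** transpose U = mat 1"
    using arg_cong[OF U', of cnj_mat] by (simp add: cnj_mat_mult cnj_mat_transpose)
  have Uc': "transpose U ** cnj_mat U = mat 1" by (rule matrix_mult_eq_one_commute[OF Uc])
  have Sc: "cnj_mat ?S = ?S" by (rule mat_eqI) (simp add: diag_mat_nth)
  define V where "V = U ** transpose U"
  have "V ** transpose (cnj_mat V) = U ** (transpose U ** cnj_mat U) ** transpose (cnj_mat U)"
    by (simp add: V_def cnj_mat_mult cnj_mat_transpose matrix_transpose_mul matrix_mul_assoc)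
  then have 1: "V ** transpose (cnj_mat V) = mat 1" by (simp add: Uc' U')
  have "V ** Z ** transpose V = U ** (transpose U ** Z ** U) ** transpose U"
    by (simp add: V_def matrix_transpose_mul matrix_mul_assoc)
  also have "\<dots> = U ** cnj_mat (transpose U ** Z ** U) ** transpose U" by (simp only: x Sc)
  also have "\<dots> = (U ** transpose (cnj_mat U)) ** cnj_mat Z ** (cnj_mat U ** transpose U)"
    by (simp add: cnj_mat_mult cnj_mat_transpose matrix_mul_assoc)
  also have "\<dots> = cnj_mat Z" by (simp add: U' Uc)
  finally show ?thesis using that 1 by blast
qed

section \<open>Geometry of the two domains\<close>

lemma norm_matrix_vector_le:
  fixes A :: "'a::real_normed_field^'n^'m"
  shows "norm (A *v v) \<le> norm A * norm v"
proof -
  have "norm ((A *v v) $ i) \<le> norm (A $ i) * norm v" for i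
  proof -
    have "norm ((A *v v) $ i) \<le> (\<Sum>j\<in>UNIV. norm (A $ i $ j * v $ j))"
      unfolding matrix_vector_mult_def by (simp add: norm_sum)
    also have "\<dots> \<le> L2_set (\<lambda>j. norm (A $ i $ j)) UNIV * L2_set (\<lambda>j. norm (v $ j)) UNIV"
      using L2_set_mult_ineq[of "\<lambda>j. norm (A $ i $ j)" "\<lambda>j. norm (v $ j)" UNIV] by (simp add: norm_mult)
    finally show ?thesis by (simp add: norm_vec_def)
  qed
  then have "norm (A *v v) \<le> L2_set (\<lambda>i. norm (A $ i) * norm v) UNIV"
    unfolding norm_vec_def[of "A *v v"] by (intro L2_set_mono) auto
  also have "\<dots> = norm A * norm v" by (simp add: norm_vec_def[of A] L2_set_left_distrib)
  finally show ?thesis .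
qed

definition hinner :: "complex^'n \<Rightarrow> complex^'n \<Rightarrow> complex" where
  "hinner u v = (\<Sum>i\<in>UNIV. cnj (u $ i) * v $ i)"

lemma hinner_self: "hinner v v = of_real ((norm v)\<^sup>2)"
proof -
  have "hinner v v = of_real (\<Sum>a\<in>UNIV. (cmod (v $ a))\<^sup>2)"
    by (simp add: hinner_def complex_norm_square[symmetric] mult.commute flip: of_real_power)
  then show ?thesis by (simp add: norm_vec_def L2_set_def sum_nonneg)
qed

lemma hinner_adjoint: "hinner u (A *v v) = hinner (transpose (cnj_mat A) *v u) v"
proof -
  have "hinner u (A *v v) = (\<Sum>i\<in>UNIV. \<Sum>j\<in>UNIV. cnj (u $ i) * (A $ i $ j * v $ j))"
    by (simp add: hinner_def matrix_vector_mult_def sum_distrib_left)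
  also have "\<dots> = (\<Sum>j\<in>UNIV. \<Sum>i\<in>UNIV. cnj (u $ i) * (A $ i $ j * v $ j))" by (rule sum.swap)
  also have "\<dots> = hinner (transpose (cnj_mat A) *v u) v"
    by (simp add: hinner_def matrix_vector_mult_def transpose_def sum_distrib_left sum_distrib_right mult_ac)
  finally show ?thesis .
qed

lemma hinner_diff: "hinner u (v - w) = hinner u v - hinner u w"
  by (simp add: hinner_def right_diff_distrib sum_subtractf)

lemma isometry_norm:
  assumes "transpose (cnj_mat A) ** A = mat 1"
  shows "norm (A *v v) = norm v"
proof -
  have "complex_of_real ((norm (A *v v))\<^sup>2) = hinner ((transpose (cnj_mat A) ** A) *v v) v"
    by (simp only: hinner_self[symmetric] hinner_adjoint[of "A *v v"] matrix_vector_mul_assoc)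
  also have "\<dots> = of_real ((norm v)\<^sup>2)" by (simp add: assms hinner_self)
  finally have "(norm (A *v v))\<^sup>2 = (norm v)\<^sup>2" by (simp only: of_real_eq_iff)
  then show ?thesis by simp
qed

lemma Symm_transpose: "Z \<in> Symm_complex \<longleftrightarrow> transpose Z = Z"
  by (simp add: Symm_complex_def)

lemma contraction_form:
  assumes "Z \<in> Symm_complex"
  shows "hinner v ((mat 1 - Z ** cnj_mat Z) *v v) = of_real ((norm v)\<^sup>2 - (norm (cnj_mat Z *v v))\<^sup>2)"
proof -
  have "hinner v ((mat 1 - Z ** cnj_mat Z) *v v) = hinner v v - hinner v (Z *v (cnj_mat Z *v v))"
    by (simp add: matrix_vector_mult_diff_rdistrib hinner_diff matrix_vector_mul_assoc)
  also have "hinner v (Z *v (cnj_mat Z *v v)) = hinner (cnj_mat Z *v v) (cnj_mat Z *v v)"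
    using assms by (subst hinner_adjoint) (simp add: Symm_transpose flip: cnj_mat_transpose)
  finally show ?thesis by (simp add: hinner_self)
qed

lemma transpose_diff: "transpose (A - B) = transpose A - transpose B"
  by (rule mat_eqI) (simp add: transpose_def)

lemma cnj_mat_diff: "cnj_mat (A - B) = cnj_mat A - cnj_mat B"
  by (rule mat_eqI) simp

lemma contraction_Hermitian:
  assumes "Z \<in> Symm_complex"
  shows "transpose (cnj_mat (mat 1 - Z ** cnj_mat Z)) = mat 1 - Z ** cnj_mat Z"
  using assms by (simp add: cnj_mat_diff transpose_diff cnj_mat_mult matrix_transpose_mul Symm_transpose flip: cnj_mat_transpose)

text \<open>By symmetry the adjoint of \<open>Z\<close> is \<open>cnj_mat Z\<close>, so the
  Hermitian form of \<open>mat 1 - Z ** cnj_mat Z\<close> is a difference of squared norms.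
  \<open>D_III\<close> becomes an open operator-norm ball, from which convexity and openness are
  read off.\<close>

lemma D_III_iff: "Z \<in> D_III \<longleftrightarrow> Z \<in> Symm_complex \<and> (\<forall>v. v \<noteq> 0 \<longrightarrow> norm (cnj_mat Z *v v) < norm v)"
proof -
  have "0 < Re (hinner v ((mat 1 - Z ** cnj_mat Z) *v v)) \<longleftrightarrow> norm (cnj_mat Z *v v) < norm v"
    if "Z \<in> Symm_complex" for v
  proof -
    have "0 < Re (hinner v ((mat 1 - Z ** cnj_mat Z) *v v)) \<longleftrightarrow> (norm (cnj_mat Z *v v))\<^sup>2 < (norm v)\<^sup>2"
      unfolding contraction_form[OF that] by simp
    then show ?thesis by (meson norm_ge_zero power2_less_imp_less power_strict_mono pos2)
  qed
  then show ?thesis unfolding D_III_def pos_def_complex_def mem_Collect_eq hinner_def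
    using contraction_Hermitian by blast
qed

lemma D_III_le: "Z \<in> D_III \<Longrightarrow> norm (cnj_mat Z *v v) \<le> norm v"
  unfolding D_III_iff by (cases "v = 0") (auto simp: less_imp_le)

lemma cnj_mat_add: "cnj_mat (A + B) = cnj_mat A + cnj_mat B"
  and cnj_mat_scaleR: "cnj_mat (r *\<^sub>R A) = r *\<^sub>R cnj_mat A"
  by (auto intro!: mat_eqI)

lemma norm_cnj_mat: "norm (cnj_mat (A :: complex^'n^'n)) = norm A"
proof -
  have "norm (cnj_mat A $ i) = norm (A $ i)" for i unfolding norm_vec_def by simp
  then show ?thesis unfolding norm_vec_def[of A] norm_vec_def[of "cnj_mat A"] by simp
qed

lemma scaleR_matrix_vector: "(r *\<^sub>R A) *v v = r *\<^sub>R (A *v v)" for A :: "complex^'n^'m"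
  by (simp add: matrix_vector_mult_def vec_eq_iff scaleR_right.sum)

lemma D_III_convex: "convex (D_III :: (complex^'n^'n) set)"
proof (rule convexI)
  fix Z W :: "complex^'n^'n" and s t :: real
  assume Z: "Z \<in> D_III" and W: "W \<in> D_III" and st: "0 \<le> s" "0 \<le> t" "s + t = 1"
  have "norm (cnj_mat (s *\<^sub>R Z + t *\<^sub>R W) *v v) < norm v" if v: "v \<noteq> 0" for v
  proof -
    have "cnj_mat (s *\<^sub>R Z + t *\<^sub>R W) *v v = s *\<^sub>R (cnj_mat Z *v v) + t *\<^sub>R (cnj_mat W *v v)"
      by (simp add: cnj_mat_add cnj_mat_scaleR matrix_vector_mult_add_rdistrib scaleR_matrix_vector)
    then have "norm (cnj_mat (s *\<^sub>R Z + t *\<^sub>R W) *v v) \<le> s * norm (cnj_mat Z *v v) + t * norm (cnj_mat W *v v)"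
      using norm_triangle_ineq[of "s *\<^sub>R (cnj_mat Z *v v)" "t *\<^sub>R (cnj_mat W *v v)"] st by simp
    also have "\<dots> < norm v"
    proof (rule convex_bound_lt)
      show "norm (cnj_mat Z *v v) < norm v" "norm (cnj_mat W *v v) < norm v" using Z W v by (auto simp: D_III_iff)
    qed (use st in auto)
    finally show ?thesis .
  qed
  then show "s *\<^sub>R Z + t *\<^sub>R W \<in> D_III"
    using Z W by (simp add: D_III_iff Symm_add Symm_scaleR)
qed

lemma sphere_nonempty: "sphere 0 1 \<noteq> ({} :: (('a::euclidean_space)^'n) set)"
  by (metis (no_types) norm_Basis nonempty_Basis ex_in_conv mem_sphere_0 empty_iff)

lemma D_III_rel_open: "rel_open (D_III :: (complex^'n^'n) set)"
  unfolding rel_open_def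
proof (intro conjI ballI)
  show "D_III \<subseteq> (Symm_complex :: (complex^'n^'n) set)" by (auto simp: D_III_def)
  fix Z :: "complex^'n^'n" assume Z: "Z \<in> D_III"
  have "continuous_on (sphere 0 1) (\<lambda>v. norm (cnj_mat Z *v v))"
    by (intro continuous_intros)
  then obtain v0 where v0: "v0 \<in> sphere 0 1" "\<And>v. v \<in> sphere 0 1 \<Longrightarrow> norm (cnj_mat Z *v v) \<le> norm (cnj_mat Z *v v0)"
    using continuous_attains_sup[OF compact_sphere sphere_nonempty] by blast
  \<comment> \<open>By compactness of the sphere, the gap between 1 and the operator norm of
    \<open>cnj_mat Z\<close> is attained and positive; perturbations smaller than this gap stay in
    the domain.\<close>
  define r where "r = 1 - norm (cnj_mat Z *v v0)"
  have "v0 \<noteq> 0" using v0(1) by auto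
  then have "norm (cnj_mat Z *v v0) < norm v0" using Z by (simp add: D_III_iff)
  then have r: "r > 0" using v0(1) by (simp add: r_def)
  have le: "norm (cnj_mat Z *v v) \<le> (1 - r) * norm v" for v
  proof (cases "v = 0")
    case False
    have "norm (cnj_mat Z *v (v /\<^sub>R norm v)) \<le> 1 - r" using v0(2)[of "v /\<^sub>R norm v"] False by (simp add: r_def)
    also have "cnj_mat Z *v (v /\<^sub>R norm v) = (cnj_mat Z *v v) /\<^sub>R norm v"
      by (simp add: matrix_vector_mult_def vec_eq_iff scaleR_right.sum)
    finally show ?thesis using False by (simp add: field_simps)
  qed simp
  show "\<exists>r>0. \<forall>V\<in>Symm_complex. norm V < r \<longrightarrow> Z + V \<in> D_III"
  proof (intro exI[of _ r] conjI r ballI impI)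
    fix V :: "complex^'n^'n" assume V: "V \<in> Symm_complex" "norm V < r"
    have "norm (cnj_mat (Z + V) *v v) < norm v" if v: "v \<noteq> 0" for v
    proof -
      have "norm (cnj_mat (Z + V) *v v) \<le> norm (cnj_mat Z *v v) + norm (cnj_mat V *v v)"
        using norm_triangle_ineq[of "cnj_mat Z *v v" "cnj_mat V *v v"] by (simp add: cnj_mat_add matrix_vector_mult_add_rdistrib)
      also have "\<dots> \<le> (1 - r) * norm v + norm V * norm v"
        using le[of v] norm_matrix_vector_le[of "cnj_mat V" v] by (simp add: norm_cnj_mat)
      also have "\<dots> < (1 - r) * norm v + r * norm v" using V v by simp
      also have "\<dots> = norm v" by (simp add: algebra_simps)
      finally show ?thesis .
    qed
    then show "Z + V \<in> D_III" using Z V by (simp add: D_III_iff Symm_add)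
  qed
qed

lemma D_III_zero: "(0 :: complex^'n^'n) \<in> D_III"
proof -
  have "cnj_mat 0 = (0 :: complex^'n^'n)" by (rule mat_eqI) simp
  moreover have "(0 :: complex^'n^'n) *v v = 0" for v by (simp add: matrix_vector_mult_def vec_eq_iff)
  ultimately show ?thesis by (simp add: D_III_iff Symm_zero)
qed

lemma D_III_entry:
  assumes "Z \<in> D_III" shows "cmod (Z $ i $ j) \<le> 1"
proof -
  have "cmod ((cnj_mat Z *v axis j 1) $ i) \<le> norm (cnj_mat Z *v axis j 1)"
    by (rule Finite_Cartesian_Product.norm_nth_le)
  also have "\<dots> \<le> 1" using D_III_le[OF assms, of "axis j 1"] by simp
  also have "(cnj_mat Z *v axis j 1) $ i = cnj (Z $ i $ j)"
    by (simp add: matrix_vector_mult_def axis_def if_distrib cong: if_cong)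
  finally show ?thesis by simp
qed

lemma D_III_bounded: "bounded (D_III :: (complex^'n^'n) set)"
proof -
  have "norm Z \<le> (\<Sum>i\<in>(UNIV :: 'n set). \<Sum>j\<in>(UNIV :: 'n set). 1)" if "Z \<in> D_III" for Z :: "complex^'n^'n"
    using matrix_norm_le_sum[of Z] D_III_entry[OF that] by (meson order_trans sum_mono)
  then show ?thesis by (auto simp: bounded_iff)
qed

lemma unitary_D_III:
  fixes V Z :: "complex^'n^'n"
  assumes V: "V ** transpose (cnj_mat V) = mat 1" and Z: "Z \<in> D_III"
  shows "V ** Z ** transpose V \<in> D_III"
proof -
  have V': "transpose (cnj_mat V) ** V = mat 1" by (rule matrix_mult_eq_one_commute[OF V])
  have n1: "norm (cnj_mat V *v x) = norm x" for x
    using arg_cong[OF V', of cnj_mat] by (intro isometry_norm) (simp add: cnj_mat_mult cnj_mat_transpose)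
  have n2: "norm (transpose (cnj_mat V) *v x) = norm x" for x
    using V by (intro isometry_norm) (simp add: cnj_mat_transpose)
  have Vx: "transpose (cnj_mat V) *v x \<noteq> 0" if "x \<noteq> 0" for x using n2[of x] that by (metis norm_eq_zero)
  have "norm (cnj_mat (V ** Z ** transpose V) *v x) < norm x" if x: "x \<noteq> 0" for x
  proof -
    have "cnj_mat (V ** Z ** transpose V) *v x = cnj_mat V *v (cnj_mat Z *v (transpose (cnj_mat V) *v x))"
      by (simp only: cnj_mat_mult cnj_mat_transpose matrix_vector_mul_assoc matrix_mul_assoc)
    then have "norm (cnj_mat (V ** Z ** transpose V) *v x) = norm (cnj_mat Z *v (transpose (cnj_mat V) *v x))"
      by (simp add: n1)
    also have "\<dots> < norm (transpose (cnj_mat V) *v x)" using Z Vx[OF x] by (simp add: D_III_iff)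
    finally show ?thesis by (simp only: n2)
  qed
  moreover have "V ** Z ** transpose V \<in> Symm_complex"
    using Z by (simp add: D_III_iff Symm_transpose matrix_transpose_mul matrix_mul_assoc)
  ultimately show ?thesis by (simp add: D_III_iff)
qed

lemma det_cnj_mat: "det (cnj_mat A) = cnj (det A)"
  by (simp add: det_def)

lemma det_nonzero_of_kernel:
  fixes A :: "'a::field^'n^'n"
  assumes "\<And>x. A *v x = 0 \<Longrightarrow> x = 0" shows "det A \<noteq> 0"
  using assms by (metis invertible_det_nz invertible_left_inverse matrix_left_invertible_ker)

text \<open>A real nonvanishing determinant keeps its sign along a path, by the intermediate value
  theorem; used with a segment in each of the two domains.\<close>

lemma det_positive_path:
  fixes A :: "real \<Rightarrow> complex^'n^'n"
  assumes cont: "\<And>i j. continuous_on {0..1} (\<lambda>t. A t $ i $ j)"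
    and real: "\<And>t. t \<in> {0..1} \<Longrightarrow> Im (det (A t)) = 0" and nz: "\<And>t. t \<in> {0..1} \<Longrightarrow> det (A t) \<noteq> 0"
    and start: "Re (det (A 0)) > 0"
  shows "Re (det (A 1)) > 0"
proof (rule ccontr)
  assume "\<not> Re (det (A 1)) > 0"
  moreover have "continuous_on {0..1} (\<lambda>t. Re (det (A t)))"
    unfolding det_def by (intro continuous_intros cont)
  ultimately obtain t where "0 \<le> t" "t \<le> 1" "Re (det (A t)) = 0"
    using IVT2'[of "\<lambda>t. Re (det (A t))" 1 0 0] start by auto
  then show False using real[of t] nz[of t] by (simp add: complex_eq_iff)
qed

text \<open>The segment from 0 to \<open>Z\<close> stays in the convex domain. The matrix is
  Hermitian there, so its determinant is real, and it is injective because \<open>Z\<close>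
  contracts strictly.\<close>

lemma D_III_det:
  fixes Z :: "complex^'n^'n"
  assumes Z: "Z \<in> D_III"
  shows "0 < Re (det (mat 1 - Z ** cnj_mat Z))" "Im (det (mat 1 - Z ** cnj_mat Z)) = 0"
proof -
  have ZS: "Z \<in> Symm_complex" using Z by (simp add: D_III_iff)
  have tZ: "t *\<^sub>R Z \<in> D_III" if "t \<in> {0..1}" for t
    using convexD_alt[OF D_III_convex D_III_zero Z, of t] that by simp
  have herm: "Im (det (mat 1 - W ** cnj_mat W)) = 0" if "W \<in> Symm_complex" for W :: "complex^'n^'n"
    using arg_cong[OF contraction_Hermitian[OF that], of det] by (simp add: det_transpose det_cnj_mat complex_eq_iff)
  have nz: "det (mat 1 - W ** cnj_mat W) \<noteq> 0" if "W \<in> D_III" for W :: "complex^'n^'n"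
  proof (rule det_nonzero_of_kernel)
    fix x assume x: "(mat 1 - W ** cnj_mat W) *v x = 0"
    have "hinner x 0 = 0" by (simp add: hinner_def)
    then have "(norm x)\<^sup>2 - (norm (cnj_mat W *v x))\<^sup>2 = 0"
      using contraction_form[of W x] that x by (simp only: D_III_iff) (metis of_real_eq_0_iff)
    then have "norm x = norm (cnj_mat W *v x)" by simp
    then show "x = 0" using that unfolding D_III_iff by force
  qed
  show "Im (det (mat 1 - Z ** cnj_mat Z)) = 0" by (rule herm[OF ZS])
  have "0 < Re (det (mat 1 - (1 *\<^sub>R Z) ** cnj_mat (1 *\<^sub>R Z)))"
  proof (rule det_positive_path[where A = "\<lambda>t. mat 1 - (t *\<^sub>R Z) ** cnj_mat (t *\<^sub>R Z)"])
    fix i j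
    have "(mat 1 - (t *\<^sub>R Z) ** cnj_mat (t *\<^sub>R Z)) $ i $ j = mat 1 $ i $ j - of_real (t * t) * (Z ** cnj_mat Z) $ i $ j" for t
      by (simp add: matrix_matrix_mult_def sum_distrib_left scaleR_conv_of_real[where 'a = complex] mult_ac)
    then show "continuous_on {0..1} (\<lambda>t. (mat 1 - (t *\<^sub>R Z) ** cnj_mat (t *\<^sub>R Z)) $ i $ j)"
      by (auto intro!: continuous_intros)
    show "0 < Re (det (mat 1 - (0 *\<^sub>R Z) ** cnj_mat (0 *\<^sub>R Z)))" by (simp add: matrix_matrix_mult_def zero_vec_def[symmetric])
  qed (use tZ herm nz in \<open>auto simp: D_III_iff\<close>)
  then show "0 < Re (det (mat 1 - Z ** cnj_mat Z))" by simp
qed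

lemma matrix_inv_eqI:
  fixes A B :: "'a::field^'n^'n"
  assumes "A ** B = mat 1" shows "matrix_inv A = B"
proof -
  have BA: "B ** A = mat 1" by (rule matrix_mult_eq_one_commute[OF assms])
  have "\<exists>C. A ** C = mat 1 \<and> C ** A = mat 1" using assms BA by blast
  then have "A ** matrix_inv A = mat 1" unfolding matrix_inv_def by (rule someI2_ex) simp
  then have "B ** (A ** matrix_inv A) = B" by simp
  then show ?thesis by (simp add: matrix_mul_assoc BA)
qed

lemma matrix_inv_det:
  fixes A :: "'a::field^'n^'n"
  assumes "det A \<noteq> 0" shows "A ** matrix_inv A = mat 1"
proof -
  obtain B where "A ** B = mat 1" using assms invertible_det_nz invertible_right_inverse by blast
  then show ?thesis using matrix_inv_eqI by metis
qed

lemma matrix_diff_ldistrib: "A ** (B - C) = A ** B - A ** (C :: 'a::ring_1^'n^'m)"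
  and matrix_diff_rdistrib: "(B - C) ** A = B ** A - (C :: 'a::ring_1^'n^'m) ** A"
  by (auto intro!: mat_eqI simp: matrix_matrix_mult_def algebra_simps sum_subtractf)

lemma unitary_contraction:
  fixes V Z :: "complex^'n^'n"
  assumes V: "V ** transpose (cnj_mat V) = mat 1"
  shows "mat 1 - (V ** Z ** transpose V) ** cnj_mat (V ** Z ** transpose V)
       = V ** (mat 1 - Z ** cnj_mat Z) ** transpose (cnj_mat V)"
proof -
  have V': "transpose V ** cnj_mat V = mat 1"
    using arg_cong[OF matrix_mult_eq_one_commute[OF V], of cnj_mat] by (simp add: cnj_mat_mult cnj_mat_transpose)
  have "(V ** Z ** transpose V) ** cnj_mat (V ** Z ** transpose V)
      = V ** Z ** (transpose V ** cnj_mat V) ** cnj_mat Z ** transpose (cnj_mat V)"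
    by (simp add: cnj_mat_mult cnj_mat_transpose matrix_mul_assoc)
  then have "(V ** Z ** transpose V) ** cnj_mat (V ** Z ** transpose V) = V ** (Z ** cnj_mat Z) ** transpose (cnj_mat V)"
    by (simp add: V' matrix_mul_assoc)
  then show ?thesis
    by (simp add: V matrix_diff_ldistrib matrix_diff_rdistrib)
qed

lemma unitary_det:
  fixes V Z :: "complex^'n^'n"
  assumes V: "V ** transpose (cnj_mat V) = mat 1"
  shows "det (mat 1 - (V ** Z ** transpose V) ** cnj_mat (V ** Z ** transpose V)) = det (mat 1 - Z ** cnj_mat Z)"
proof -
  have "det V * det (transpose (cnj_mat V)) = 1" using arg_cong[OF V, of det] by (simp add: det_mul)
  then show ?thesis unfolding unitary_contraction[OF V] by (simp add: det_mul mult_ac)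
qed

text \<open>The matrix under the trace changes by a unitary conjugation, and so does its
  inverse.\<close>

lemma mu_T_unitary:
  fixes V Z :: "complex^'n^'n"
  assumes V: "V ** transpose (cnj_mat V) = mat 1" and Z: "Z \<in> D_III"
  shows "mu_T (V ** Z ** transpose V) = mu_T Z"
proof -
  let ?B = "mat 1 - Z ** cnj_mat Z"
  have V': "transpose (cnj_mat V) ** V = mat 1" by (rule matrix_mult_eq_one_commute[OF V])
  have "det ?B \<noteq> 0" using D_III_det[OF Z] by auto
  then have B: "?B ** matrix_inv ?B = mat 1" by (rule matrix_inv_det)
  have "(V ** ?B ** transpose (cnj_mat V)) ** (V ** matrix_inv ?B ** transpose (cnj_mat V))
      = V ** ?B ** (transpose (cnj_mat V) ** V) ** matrix_inv ?B ** transpose (cnj_mat V)"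
    by (simp only: matrix_mul_assoc)
  also have "\<dots> = V ** (?B ** matrix_inv ?B) ** transpose (cnj_mat V)" by (simp add: V' matrix_mul_assoc)
  also have "\<dots> = mat 1" by (simp add: B V)
  finally have "matrix_inv (V ** ?B ** transpose (cnj_mat V)) = V ** matrix_inv ?B ** transpose (cnj_mat V)"
    by (rule matrix_inv_eqI)
  then have "trace (matrix_inv (V ** ?B ** transpose (cnj_mat V))) = trace ((transpose (cnj_mat V) ** V) ** matrix_inv ?B)"
    by (metis matrix_mul_assoc trace_mul_sym)
  then show ?thesis unfolding mu_T_def unitary_contraction[OF V] by (simp add: V')
qed

section \<open>The Siegel domain\<close>

definition cmat :: "real^'n^'m \<Rightarrow> complex^'n^'m" where
  "cmat A = (\<chi> i j. of_real (A $ i $ j))"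

lemma cmat_nth [simp]: "cmat A $ i $ j = of_real (A $ i $ j)"
  by (simp add: cmat_def)

lemma Re_mat_nth [simp]: "Re_mat Z $ i $ j = Re (Z $ i $ j)" and Im_mat_nth [simp]: "Im_mat Z $ i $ j = Im (Z $ i $ j)"
  by (simp_all add: Re_mat_def Im_mat_def)

lemma cmat_mult: "cmat (A ** B) = cmat A ** cmat B"
  by (rule mat_eqI) (simp add: matrix_matrix_mult_def)

lemma cmat_transpose: "cmat (transpose A) = transpose (cmat A)"
  by (rule mat_eqI) (simp add: transpose_def)

lemma cmat_one [simp]: "cmat (mat 1) = mat 1"
  by (rule mat_eqI) (simp add: mat_def)

lemma cnj_cmat [simp]: "cnj_mat (cmat A) = cmat A"
  by (rule mat_eqI) simp

lemma det_cmat: "det (cmat A) = of_real (det A)"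
  by (simp add: det_def)

lemma Im_mat_congruence: "Im_mat (cmat A ** Z ** cmat B) = A ** Im_mat Z ** B"
  and Re_mat_congruence: "Re_mat (cmat A ** Z ** cmat B) = A ** Re_mat Z ** B"
  by (auto intro!: mat_eqI simp: matrix_matrix_mult_def)

lemma Siegel_iff: "Z \<in> Siegel \<longleftrightarrow> Z \<in> Symm_complex \<and> (\<forall>v. v \<noteq> 0 \<longrightarrow> 0 < v \<bullet> (Im_mat Z *v v))"
proof -
  have "transpose (Im_mat Z) = Im_mat Z" if "Z \<in> Symm_complex"
    using that by (auto intro!: mat_eqI simp: transpose_def Symm_complex_iff)
  then show ?thesis by (auto simp: Siegel_def pos_def_real_def)
qed

lemma Im_mat_add: "Im_mat (Z + W) = Im_mat Z + Im_mat W" and Im_mat_scaleR: "Im_mat (r *\<^sub>R Z) = r *\<^sub>R Im_mat Z"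
  by (auto intro!: mat_eqI)

lemma scaleR_matrix_vector_real: "(r *\<^sub>R A) *v v = r *\<^sub>R (A *v v)" for A :: "real^'n^'m"
  by (simp add: matrix_vector_mult_def vec_eq_iff sum_distrib_left mult_ac)

lemma Siegel_convex: "convex (Siegel :: (complex^'n^'n) set)"
proof (rule convexI)
  fix Z W :: "complex^'n^'n" and s t :: real
  assume Z: "Z \<in> Siegel" and W: "W \<in> Siegel" and st: "0 \<le> s" "0 \<le> t" "s + t = 1"
  have "0 < v \<bullet> (Im_mat (s *\<^sub>R Z + t *\<^sub>R W) *v v)" if v: "v \<noteq> 0" for v
  proof -
    have p: "0 < v \<bullet> (Im_mat Z *v v)" "0 < v \<bullet> (Im_mat W *v v)" using Z W v by (auto simp: Siegel_iff)
    have "v \<bullet> (Im_mat (s *\<^sub>R Z + t *\<^sub>R W) *v v) = s * (v \<bullet> (Im_mat Z *v v)) + t * (v \<bullet> (Im_mat W *v v))"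
      by (simp add: Im_mat_add Im_mat_scaleR matrix_vector_mult_add_rdistrib scaleR_matrix_vector_real inner_add_right)
    moreover have "s > 0 \<or> t > 0" using st by auto
    ultimately show ?thesis using st p by (auto intro: add_pos_nonneg add_nonneg_pos)
  qed
  then show "s *\<^sub>R Z + t *\<^sub>R W \<in> Siegel"
    using Z W by (simp add: Siegel_iff Symm_add Symm_scaleR)
qed

lemma norm_Im_mat_le: "norm (Im_mat (V :: complex^'n^'n)) \<le> norm V"
proof -
  have "norm (Im_mat V $ i) \<le> norm (V $ i)" for i
    unfolding norm_vec_def by (intro L2_set_mono) (auto simp: abs_Im_le_cmod)
  then show ?thesis unfolding norm_vec_def[of "Im_mat V"] norm_vec_def[of V] by (intro L2_set_mono) auto
qed

lemma Siegel_rel_open: "rel_open (Siegel :: (complex^'n^'n) set)"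
  unfolding rel_open_def
proof (intro conjI ballI)
  show "Siegel \<subseteq> (Symm_complex :: (complex^'n^'n) set)" by (auto simp: Siegel_def)
  fix Z :: "complex^'n^'n" assume Z: "Z \<in> Siegel"
  have "continuous_on (sphere 0 1) (\<lambda>v. v \<bullet> (Im_mat Z *v v))" by (intro continuous_intros)
  then obtain v0 where v0: "v0 \<in> sphere 0 1" "\<And>v. v \<in> sphere 0 1 \<Longrightarrow> v0 \<bullet> (Im_mat Z *v v0) \<le> v \<bullet> (Im_mat Z *v v)"
    using continuous_attains_inf[OF compact_sphere sphere_nonempty] by blast
  define r where "r = v0 \<bullet> (Im_mat Z *v v0)"
  have "v0 \<noteq> 0" using v0(1) by auto
  then have r: "r > 0" using Z by (simp add: Siegel_iff r_def)
  have le: "r * (norm v)\<^sup>2 \<le> v \<bullet> (Im_mat Z *v v)" for v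
  proof (cases "v = 0")
    case False
    have "r \<le> (v /\<^sub>R norm v) \<bullet> (Im_mat Z *v (v /\<^sub>R norm v))" using v0(2)[of "v /\<^sub>R norm v"] False by (simp add: r_def)
    also have "\<dots> = (v \<bullet> (Im_mat Z *v v)) / (norm v)\<^sup>2"
      by (simp add: matrix_vector_mult_scaleR power2_eq_square divide_inverse)
    finally show ?thesis using False by (simp add: field_simps)
  qed simp
  show "\<exists>r>0. \<forall>V\<in>Symm_complex. norm V < r \<longrightarrow> Z + V \<in> Siegel"
  proof (intro exI[of _ r] conjI r ballI impI)
    fix V :: "complex^'n^'n" assume V: "V \<in> Symm_complex" "norm V < r"
    have "0 < v \<bullet> (Im_mat (Z + V) *v v)" if v: "v \<noteq> 0" for v
    proof -
      have "\<bar>v \<bullet> (Im_mat V *v v)\<bar> \<le> norm v * norm (Im_mat V *v v)" by (rule Cauchy_Schwarz_ineq2)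
      also have "\<dots> \<le> norm v * (norm (Im_mat V) * norm v)" by (intro mult_left_mono norm_matrix_vector_le) simp
      also have "\<dots> \<le> norm V * (norm v)\<^sup>2"
        using mult_right_mono[OF norm_Im_mat_le[of V], of "norm v * norm v"] by (simp add: power2_eq_square mult_ac)
      also have "\<dots> < r * (norm v)\<^sup>2" using V v by simp
      also have "\<dots> \<le> v \<bullet> (Im_mat Z *v v)" by (rule le)
      finally show ?thesis by (simp add: Im_mat_add matrix_vector_mult_add_rdistrib inner_add_right)
    qed
    then show "Z + V \<in> Siegel" using Z V by (simp add: Siegel_iff Symm_add)
  qed
qed

text \<open>The contributions of the real part of \<open>Z\<close> cancel in pairs by symmetry,
  leaving the imaginary form on the real and imaginary parts of \<open>x\<close>.\<close>

lemma Siegel_Im_form: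
  assumes "Z \<in> Symm_complex"
  shows "Im (hinner x (Z *v x)) = (\<chi> i. Re (x $ i)) \<bullet> (Im_mat Z *v (\<chi> i. Re (x $ i))) + (\<chi> i. Im (x $ i)) \<bullet> (Im_mat Z *v (\<chi> i. Im (x $ i)))"
proof -
  have anti: "(\<Sum>i\<in>UNIV. \<Sum>j\<in>UNIV. Re (x $ i) * (Re (Z $ i $ j) * Im (x $ j)))
     = (\<Sum>i\<in>UNIV. \<Sum>j\<in>UNIV. Im (x $ i) * (Re (Z $ i $ j) * Re (x $ j)))"
  proof -
    have "(\<Sum>i\<in>UNIV. \<Sum>j\<in>UNIV. Re (x $ i) * (Re (Z $ i $ j) * Im (x $ j)))
      = (\<Sum>j\<in>UNIV. \<Sum>i\<in>UNIV. Re (x $ i) * (Re (Z $ i $ j) * Im (x $ j)))" by (rule sum.swap)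
    also have "\<dots> = (\<Sum>j\<in>UNIV. \<Sum>i\<in>UNIV. Im (x $ j) * (Re (Z $ j $ i) * Re (x $ i)))"
      using assms by (intro sum.cong refl) (simp add: Symm_complex_iff mult_ac)
    finally show ?thesis .
  qed
  have "Im (hinner x (Z *v x)) = (\<Sum>i\<in>UNIV. \<Sum>j\<in>UNIV. Im (cnj (x $ i) * (Z $ i $ j * x $ j)))"
    by (simp only: hinner_def matrix_vector_mult_def vec_lambda_beta sum_distrib_left Im_sum)
  also have "\<dots> = (\<Sum>i\<in>UNIV. \<Sum>j\<in>UNIV. Re (x $ i) * (Im (Z $ i $ j) * Re (x $ j)) + Im (x $ i) * (Im (Z $ i $ j) * Im (x $ j))
       + (Re (x $ i) * (Re (Z $ i $ j) * Im (x $ j)) - Im (x $ i) * (Re (Z $ i $ j) * Re (x $ j))))"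
    by (intro sum.cong refl) (simp add: algebra_simps)
  also have "\<dots> = (\<Sum>i\<in>UNIV. \<Sum>j\<in>UNIV. Re (x $ i) * (Im (Z $ i $ j) * Re (x $ j))) + (\<Sum>i\<in>UNIV. \<Sum>j\<in>UNIV. Im (x $ i) * (Im (Z $ i $ j) * Im (x $ j)))"
    using anti by (simp only: sum.distrib sum_subtractf)
  finally show ?thesis
    by (simp add: inner_vec_def matrix_vector_mult_def sum_distrib_left)
qed

lemma Siegel_Im_pos:
  assumes Z: "Z \<in> Siegel" and x: "x \<noteq> 0"
  shows "0 < Im (hinner x (Z *v x))"
proof -
  have nn: "0 \<le> v \<bullet> (Im_mat Z *v v)" for v using Z unfolding Siegel_iff by (cases "v = 0") (auto simp: less_imp_le)
  have "(\<chi> i. Re (x $ i)) \<noteq> 0 \<or> (\<chi> i. Im (x $ i)) \<noteq> 0" using x by (auto simp: vec_eq_iff complex_eq_iff)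
  then show ?thesis using Z nn unfolding Siegel_Im_form[OF Z[unfolded Siegel_iff, THEN conjunct1]] Siegel_iff
    by (auto intro: add_pos_nonneg add_nonneg_pos)
qed

lemma Siegel_det_nonzero: "Z \<in> Siegel \<Longrightarrow> det Z \<noteq> 0"
proof (rule det_nonzero_of_kernel)
  fix x assume Z: "Z \<in> Siegel" "Z *v x = 0"
  have "hinner x 0 = 0" by (simp add: hinner_def)
  then show "x = 0" using Siegel_Im_pos[OF Z(1), of x] Z(2) by auto
qed

lemma Siegel_congruence:
  fixes A :: "real^'n^'n"
  assumes A: "det A \<noteq> 0" and Z: "Z \<in> Siegel"
  shows "cmat A ** Z ** transpose (cmat A) \<in> Siegel"
proof -
  have "v \<bullet> (A ** Im_mat Z ** transpose A *v v) > 0" if "v \<noteq> 0" for v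
  proof -
    have "transpose A *v v \<noteq> 0"
    proof
      assume "transpose A *v v = 0"
      moreover obtain B where "B ** transpose A = mat 1"
        using A by (metis det_transpose invertible_det_nz invertible_left_inverse)
      ultimately have "v = 0" by (metis matrix_vector_mul_assoc matrix_vector_mul_lid matrix_vector_mult_0_right)
      then show False using that by simp
    qed
    then have "0 < (transpose A *v v) \<bullet> (Im_mat Z *v (transpose A *v v))" using Z unfolding Siegel_iff by blast
    also have "\<dots> = v \<bullet> (A ** Im_mat Z ** transpose A *v v)"
    proof -
      have "(transpose A *v v) \<bullet> u = v \<bullet> (A *v u)" for u by (simp add: dot_lmul_matrix)
      then show ?thesis by (simp only: matrix_vector_mul_assoc matrix_mul_assoc)
    qed
    finally show ?thesis .
  qed
  moreover have "cmat A ** Z ** transpose (cmat A) \<in> Symm_complex"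
    using Z by (simp add: Siegel_iff Symm_transpose matrix_transpose_mul matrix_mul_assoc)
  ultimately show ?thesis
    unfolding Siegel_iff cmat_transpose[symmetric] Im_mat_congruence by blast
qed

text \<open>After simultaneous diagonalisation \<open>Z\<close> becomes the diagonal matrix of the
  numbers x + i, and the inverse of its conjugate that of the numbers (x + i)/(x^2 + 1), a positive
  rescaling of each coordinate.\<close>

lemma Siegel_inverse_orbit:
  fixes Z :: "complex^'n^'n"
  assumes Z: "Z \<in> Siegel"
  obtains A :: "real^'n^'n" where "det A \<noteq> 0" "cmat A ** Z ** transpose (cmat A) = matrix_inv (cnj_mat Z)"
    "\<bar>det A\<bar> * cmod (det Z) = 1"
proof -
  have ZS: "Z \<in> Symm_complex" and Y: "pos_def_real (Im_mat Z)" using Z by (auto simp: Siegel_def)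
  have X: "transpose (Re_mat Z) = Re_mat Z"
    using ZS by (auto intro!: mat_eqI simp: transpose_def Symm_complex_iff)
  obtain P :: "real^'n^'n" and x where P: "transpose P ** Im_mat Z ** P = mat 1" "transpose P ** Re_mat Z ** P = diag_mat x"
    by (rule real_simultaneous_diagonalisation[OF X Y])
  define C where "C = cmat P"
  have PZ: "transpose C ** Z ** C = diag_mat (\<lambda>i. Complex (x i) 1)"
  proof (rule mat_eqI)
    fix i j
    have "Re_mat (transpose C ** Z ** C) = diag_mat x" "Im_mat (transpose C ** Z ** C) = mat 1"
      by (simp_all add: C_def flip: cmat_transpose P) (simp_all add: Re_mat_congruence Im_mat_congruence)
    then have "Re ((transpose C ** Z ** C) $ i $ j) = diag_mat x $ i $ j" "Im ((transpose C ** Z ** C) $ i $ j) = mat 1 $ i $ j"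
      by (metis Re_mat_nth, metis Im_mat_nth)
    then show "(transpose C ** Z ** C) $ i $ j = diag_mat (\<lambda>i. Complex (x i) 1) $ i $ j"
      by (simp add: complex_eq_iff diag_mat_nth mat_def)
  qed
  have PZc: "transpose C ** cnj_mat Z ** C = diag_mat (\<lambda>i. Complex (x i) (-1))"
  proof -
    have "transpose C ** cnj_mat Z ** C = cnj_mat (transpose C ** Z ** C)"
      by (simp add: cnj_mat_mult cnj_mat_transpose C_def)
    also have "\<dots> = diag_mat (\<lambda>i. Complex (x i) (-1))"
      unfolding PZ by (rule mat_eqI) (simp add: diag_mat_nth complex_eq_iff)
    finally show ?thesis .
  qed
  \<comment> \<open>The inverse of \<open>transpose C\<close>, read off from the normalisation of
    the imaginary part.\<close>
  define Q where "Q = cmat (Im_mat Z ** P)"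
  have "transpose C ** Q = mat 1"
    using arg_cong[OF P(1), of cmat] by (simp add: C_def Q_def cmat_mult cmat_transpose matrix_mul_assoc)
  then have QC: "Q ** transpose C = mat 1" by (rule matrix_mult_eq_one_commute)
  \<comment> \<open>A congruence applies the factor twice, so the square root of 1/(x^2 + 1) is
    needed.\<close>
  define s where "s i = 1 / sqrt ((x i)\<^sup>2 + 1)" for i
  define A where "A = P ** diag_mat s ** transpose P"
  have s2: "(s i)\<^sup>2 = 1 / ((x i)\<^sup>2 + 1)" for i
    by (simp add: s_def power_divide add_nonneg_pos add_nonneg_nonneg)
  have cd: "cmat (diag_mat s) = diag_mat (\<lambda>i. complex_of_real (s i))" by (rule mat_eqI) (simp add: diag_mat_nth)
  have cA: "cmat A = C ** diag_mat (\<lambda>i. complex_of_real (s i)) ** transpose C"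
    by (simp add: A_def C_def cmat_mult cmat_transpose cd)
  have At: "transpose (cmat A) = cmat A" by (simp add: cA matrix_transpose_mul matrix_mul_assoc)
  have e: "cmat A ** Z ** transpose (cmat A) = C ** diag_mat (\<lambda>i. Complex (x i) 1 / ((x i)\<^sup>2 + 1)) ** transpose C"
  proof -
    have "cmat A ** Z ** cmat A = C ** (diag_mat (\<lambda>i. complex_of_real (s i)) ** (transpose C ** Z ** C) ** diag_mat (\<lambda>i. complex_of_real (s i))) ** transpose C"
      by (simp add: cA matrix_mul_assoc)
    also have "diag_mat (\<lambda>i. complex_of_real (s i)) ** (transpose C ** Z ** C) ** diag_mat (\<lambda>i. complex_of_real (s i))
       = diag_mat (\<lambda>i. of_real ((s i)\<^sup>2) * Complex (x i) 1)"
      unfolding PZ by (simp add: diag_mat_mult power2_eq_square mult_ac)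
    also have "\<dots> = diag_mat (\<lambda>i. Complex (x i) 1 / ((x i)\<^sup>2 + 1))"
      by (intro arg_cong[of _ _ diag_mat] ext) (simp add: s2)
    finally show ?thesis by (simp add: At)
  qed
  have "cnj_mat Z ** (C ** diag_mat (\<lambda>i. Complex (x i) 1 / ((x i)\<^sup>2 + 1)) ** transpose C)
      = (Q ** transpose C) ** cnj_mat Z ** (C ** diag_mat (\<lambda>i. Complex (x i) 1 / ((x i)\<^sup>2 + 1)) ** transpose C)"
    by (simp add: QC)
  also have "\<dots> = Q ** ((transpose C ** cnj_mat Z ** C) ** diag_mat (\<lambda>i. Complex (x i) 1 / ((x i)\<^sup>2 + 1))) ** transpose C"
    by (simp only: matrix_mul_assoc)
  also have "(transpose C ** cnj_mat Z ** C) ** diag_mat (\<lambda>i. Complex (x i) 1 / ((x i)\<^sup>2 + 1)) = mat 1"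
  proof -
    have "Complex a (-1) * (Complex a 1 / (of_real (a\<^sup>2) + 1)) = 1" for a
    proof -
      have "Complex a (-1) * Complex a 1 = of_real (a\<^sup>2) + 1" by (simp add: complex_eq_iff power2_eq_square)
      moreover have "complex_of_real (a\<^sup>2) + 1 \<noteq> 0"
      proof -
        have "complex_of_real (a\<^sup>2) + 1 = of_real (a\<^sup>2 + 1)" by simp
        moreover have "a\<^sup>2 + 1 \<noteq> 0" using zero_le_power2[of a] by linarith
        ultimately show ?thesis by (metis of_real_eq_0_iff)
      qed
      ultimately show ?thesis by simp
    qed
    then show ?thesis unfolding PZc by (simp add: diag_mat_mult diag_mat_one[symmetric])
  qed
  finally have inv: "cnj_mat Z ** (cmat A ** Z ** transpose (cmat A)) = mat 1" by (simp add: e QC)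
  \<comment> \<open>Taking determinants gives (det A)^2 |det Z|^2 = 1, the relation on which the
    choice of the multiplier rests.\<close>
  have "det (cnj_mat Z ** (cmat A ** Z ** transpose (cmat A))) = 1" unfolding inv by simp
  then have "cnj (det Z) * (of_real (det A) * det Z * of_real (det A)) = 1"
    by (simp add: det_mul det_cnj_mat det_cmat det_transpose)
  then have "cmod (cnj (det Z) * (of_real (det A) * det Z * of_real (det A))) = 1" by simp
  then have "(\<bar>det A\<bar> * cmod (det Z))\<^sup>2 = 1" by (simp add: norm_mult power2_eq_square mult_ac)
  then have 3: "\<bar>det A\<bar> * cmod (det Z) = 1" by (simp add: power2_eq_1_iff) (smt (verit) mult_nonneg_nonneg norm_ge_zero)
  then have "det A \<noteq> 0" by auto
  then show ?thesis using that matrix_inv_eqI[OF inv] 3 by metis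
qed

text \<open>By Cramer's rule the ratio of consecutive minors is the inverse of a diagonal entry of the
  inverse matrix, so \<open>-\<i>\<close> times it has positive real part and admits a logarithm.\<close>

definition minor_mat :: "'n set \<Rightarrow> complex^'n^'n \<Rightarrow> complex^'n^'n" where
  "minor_mat S Z = (\<chi> i j. if i \<in> S \<and> j \<in> S then Z $ i $ j else if i = j then \<i> else 0)"

text \<open>The diagonal entries \<open>\<i>\<close> outside \<open>S\<close> make the imaginary
  part the identity there, so its form at \<open>v\<close> is that of \<open>Z\<close> on the
  restriction \<open>a\<close> of \<open>v\<close> to \<open>S\<close> plus the squares of the
  remaining coordinates.\<close>

lemma minor_mat_Siegel:
  assumes Z: "Z \<in> Siegel" shows "minor_mat S Z \<in> Siegel"
proof -
  have "0 < v \<bullet> (Im_mat (minor_mat S Z) *v v)" if v: "v \<noteq> 0" for v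
  proof -
    define a where "a = (\<chi> i. if i \<in> S then v $ i else 0)"
    have "(Im_mat (minor_mat S Z) *v v) $ i = (if i \<in> S then (Im_mat Z *v a) $ i else v $ i)" for i
    proof (cases "i \<in> S")
      case True
      then show ?thesis
        by (simp add: matrix_vector_mult_def minor_mat_def a_def) (intro sum.cong, auto)
    next
      case False
      have "(Im_mat (minor_mat S Z) *v v) $ i = (\<Sum>j\<in>UNIV. if i = j then v $ j else 0)"
        unfolding matrix_vector_mult_def vec_lambda_beta
        by (intro sum.cong) (use False in \<open>auto simp: minor_mat_def\<close>)
      then show ?thesis using False by simp
    qed
    then have "v \<bullet> (Im_mat (minor_mat S Z) *v v) = (\<Sum>i\<in>UNIV. a $ i * (Im_mat Z *v a) $ i + (if i \<in> S then 0 else (v $ i)\<^sup>2))"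
      unfolding inner_vec_def by (intro sum.cong refl) (auto simp: a_def power2_eq_square)
    also have "\<dots> = a \<bullet> (Im_mat Z *v a) + (\<Sum>i\<in>UNIV. if i \<in> S then 0 else (v $ i)\<^sup>2)"
      by (simp add: inner_vec_def sum.distrib)
    finally have eq: "v \<bullet> (Im_mat (minor_mat S Z) *v v) = a \<bullet> (Im_mat Z *v a) + (\<Sum>i\<in>UNIV. if i \<in> S then 0 else (v $ i)\<^sup>2)" .
    have nn: "0 \<le> (\<Sum>i\<in>UNIV. if i \<in> S then 0 else (v $ i)\<^sup>2)" by (intro sum_nonneg) auto
    show ?thesis
    proof (cases "a = 0")
      case False
      then have "0 < a \<bullet> (Im_mat Z *v a)" using Z by (simp add: Siegel_iff)
      then show ?thesis using eq nn by linarith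
    next
      case True
      obtain k where k: "v $ k \<noteq> 0" using v by (auto simp: vec_eq_iff)
      have "a $ k = 0" using True by simp
      then have "k \<notin> S" using k by (auto simp: a_def split: if_splits)
      then have "0 < (\<Sum>i\<in>UNIV. if i \<in> S then 0 else (v $ i)\<^sup>2)"
        using k by (intro sum_pos2[of _ k]) auto
      then show ?thesis using eq True by simp
    qed
  qed
  moreover have "minor_mat S Z \<in> Symm_complex" using Z by (auto simp: Siegel_iff Symm_complex_iff minor_mat_def)
  ultimately show ?thesis by (simp add: Siegel_iff)
qed

lemma minor_ratio:
  fixes Z :: "complex^'n^'n"
  assumes Z: "Z \<in> Siegel" and k: "k \<notin> S"
  shows "0 < Re (det (minor_mat (insert k S) Z) / det (minor_mat S Z))"
proof -
  define M where "M = minor_mat (insert k S) Z"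
  have M: "M \<in> Siegel" unfolding M_def by (rule minor_mat_Siegel[OF Z])
  have dM: "det M \<noteq> 0" by (rule Siegel_det_nonzero[OF M])
  define N where "N = minor_mat S Z"
  define x where "x = matrix_inv M *v axis k 1"
  have Mx: "M *v x = axis k 1" by (simp add: x_def matrix_vector_mul_assoc matrix_inv_det[OF dM])
  define B where "B = (\<chi> i j. if j = k then (M *v x) $ i else M $ i $ j)"
  have xk: "x $ k * det M = det B" unfolding B_def by (rule cramer_lemma[symmetric])
  \<comment> \<open>The \<open>k\<close>-th column of \<open>B\<close> is a unit vector, so \<open>B\<close> factors through the matrix \<open>N'\<close> with a unit cross at \<open>k\<close>.\<close>
  define N' where "N' = (\<chi> i j. if i = k \<and> j = k then 1 else N $ i $ j)"
  define b where "b = row k B"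
  define R where "R = (\<chi> i. if i = k then (\<Sum>j\<in>UNIV. b $ j *s row j (mat 1)) else row i (mat 1 :: complex^'n^'n))"
  have Bnth: "B $ i $ j = (if j = k then axis k 1 $ i else M $ i $ j)" for i j by (simp add: B_def Mx)
  have bk: "b $ k = 1" by (simp add: b_def row_def B_def Mx axis_def)
  have "det R = b $ k * det (mat 1 :: complex^'n^'n)" unfolding R_def by (rule cramer_lemma_transpose)
  then have dR: "det R = 1" by (simp add: bk)
  have Rnth: "R $ i $ j = (if i = k then b $ j else if i = j then 1 else 0)" for i j
  proof (cases "i = k")
    case True
    then show ?thesis by (simp add: R_def row_def mat_def if_distrib cong: if_cong)
  qed (simp add: R_def row_def mat_def)
  have "B = N' ** R"
  proof (rule mat_eqI)
    fix i j
    show "B $ i $ j = (N' ** R) $ i $ j"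
    proof (cases "i = k")
      case True
      have "(N' ** R) $ i $ j = (\<Sum>l\<in>UNIV. if l = k then b $ j else 0)"
        unfolding matrix_matrix_mult_def vec_lambda_beta Rnth
        using True k by (intro sum.cong refl) (auto simp: N'_def N_def minor_mat_def)
      then show ?thesis using True by (simp add: b_def row_def)
    next
      case False
      have "(N' ** R) $ i $ j = (\<Sum>l\<in>UNIV. if l = j then N' $ i $ j else 0)"
        unfolding matrix_matrix_mult_def vec_lambda_beta Rnth
        using False k by (intro sum.cong refl) (auto simp: N'_def N_def minor_mat_def bk)
      then show ?thesis using False k unfolding Bnth by (auto simp: axis_def M_def N'_def N_def minor_mat_def)
    qed
  qed
  then have dB: "det B = det N'" by (simp add: det_mul dR)
  \<comment> \<open>\<open>N\<close> carries the entry \<open>\<i>\<close> at position (k, k) where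
    the unit cross of \<open>N'\<close> carries 1, hence one factor \<open>\<i>\<close> in the
    determinant.\<close>
  have "N = diag_mat (\<lambda>j. if j = k then \<i> else 1) ** N'"
  proof (rule mat_eqI)
    fix i j
    have "(diag_mat (\<lambda>j. if j = k then \<i> else 1) ** N') $ i $ j = (\<Sum>l\<in>UNIV. if l = i then (if i = k then \<i> else 1) * N' $ i $ j else 0)"
      unfolding matrix_matrix_mult_def vec_lambda_beta by (intro sum.cong refl) (auto simp: diag_mat_nth)
    then show "N $ i $ j = (diag_mat (\<lambda>j. if j = k then \<i> else 1) ** N') $ i $ j"
      using k by (auto simp: N'_def N_def minor_mat_def)
  qed
  then have dN: "det N = \<i> * det N'" by (simp add: det_mul det_diag_mat prod.delta)
  have xne: "x \<noteq> 0"
  proof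
    assume "x = 0"
    then have "axis k 1 $ k = (0 :: complex)" using Mx by simp
    then show False by (simp add: axis_def)
  qed
  \<comment> \<open>Positivity of the imaginary form at \<open>x\<close> makes the imaginary part of
    \<open>x $ k\<close> negative, that is, \<open>\<i> * x $ k\<close> has positive real part; the
    ratio of the minors is the inverse of that number.\<close>
  have "hinner x (M *v x) = cnj (x $ k)" unfolding Mx by (simp add: hinner_def axis_def if_distrib cong: if_cong)
  then have im: "Im (x $ k) < 0" using Siegel_Im_pos[OF M xne] by simp
  then have x0: "x $ k \<noteq> 0" by auto
  have "det N = \<i> * (x $ k * det M)" by (simp add: dN dB[symmetric] xk)
  then have "det M / det N = inverse (\<i> * x $ k)" using dM x0 by (simp add: field_simps)
  moreover have "Re (inverse (\<i> * x $ k)) > 0"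
    using im x0 by (simp add: complex_eq_iff add_nonneg_pos sum_power2_gt_zero_iff divide_neg_pos)
  ultimately show ?thesis by (simp add: M_def N_def)
qed

text \<open>A real power of the determinant needs a holomorphic branch. The determinant telescopes
  into ratios of successive minors, each with positive real part and hence a principal logarithm.
  The starting minor is a power of \<open>\<i>\<close> and has modulus 1.\<close>

lemma holomorphic_symm_det_power:
  fixes kappa :: real
  shows "\<exists>m. holomorphic_symm m (Siegel :: (complex^'n^'n) set) \<and>
     (\<forall>Z\<in>Siegel. m Z \<noteq> 0 \<and> cmod (m Z) = cmod (det Z) powr kappa)"
proof -
  have "\<exists>m. holomorphic_symm m (Siegel :: (complex^'n^'n) set) \<and>
     (\<forall>Z\<in>Siegel. m Z \<noteq> 0 \<and> cmod (m Z) = cmod (det (minor_mat S Z)) powr kappa)" if "finite S" for S :: "'n set"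
    using that
  proof (induction S rule: finite_induct)
    case empty
    have "minor_mat {} Z = diag_mat (\<lambda>_. \<i>)" for Z :: "complex^'n^'n"
      by (rule mat_eqI) (simp add: minor_mat_def diag_mat_nth)
    then show ?case by (intro exI[of _ "\<lambda>_. 1"]) (auto simp: holomorphic_symm_const det_diag_mat norm_power)
  next
    case (insert k S)
    then obtain m where m: "holomorphic_symm m (Siegel :: (complex^'n^'n) set)"
      "\<And>Z. Z \<in> Siegel \<Longrightarrow> m Z \<noteq> 0" "\<And>Z. Z \<in> Siegel \<Longrightarrow> cmod (m Z) = cmod (det (minor_mat S Z)) powr kappa" by blast
    define q where "q Z = det (minor_mat (insert k S) Z) / det (minor_mat S Z)" for Z :: "complex^'n^'n"
    have ent: "holomorphic_symm (\<lambda>Z. minor_mat T Z $ i $ j) (Siegel :: (complex^'n^'n) set)" for T i j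
      by (cases "i \<in> T \<and> j \<in> T"; cases "i = j")
        (auto simp: minor_mat_def holomorphic_symm_const holomorphic_symm_entry)
    have nz: "det (minor_mat T Z) \<noteq> 0" if "Z \<in> Siegel" for T Z by (intro Siegel_det_nonzero minor_mat_Siegel that)
    have qh: "holomorphic_symm q Siegel"
      unfolding q_def by (intro holomorphic_symm_divide holomorphic_symm_det ent nz)
    have qp: "0 < Re (q Z)" if "Z \<in> Siegel" for Z unfolding q_def by (rule minor_ratio[OF that insert(2)])
    define m' where "m' Z = m Z * exp (of_real kappa * Ln (q Z))" for Z :: "complex^'n^'n"
    have "holomorphic_symm (\<lambda>Z. exp (of_real kappa * Ln (q Z))) Siegel"
    proof (rule holomorphic_symm_compose[OF qh])
      fix Z :: "complex^'n^'n" assume "Z \<in> Siegel"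
      then have "q Z \<notin> \<real>\<^sub>\<le>\<^sub>0" using qp[of Z] by (auto simp: complex_nonpos_Reals_iff)
      then show "((\<lambda>x. exp (of_real kappa * Ln x)) has_field_derivative
          (\<lambda>x. exp (of_real kappa * Ln x) * (of_real kappa * inverse x)) (q Z)) (at (q Z))"
        by (auto intro!: derivative_eq_intros)
    qed
    then have "holomorphic_symm m' Siegel" unfolding m'_def by (intro holomorphic_symm_mult m)
    moreover have "m' Z \<noteq> 0 \<and> cmod (m' Z) = cmod (det (minor_mat (insert k S) Z)) powr kappa" if Z: "Z \<in> Siegel" for Z
    proof
      show "m' Z \<noteq> 0" using m(2)[OF Z] by (simp add: m'_def)
      have q0: "q Z \<noteq> 0" using qp[OF Z] by auto
      have "cmod (exp (of_real kappa * Ln (q Z))) = cmod (q Z) powr kappa"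
        using q0 by (simp add: powr_def)
      then have "cmod (m' Z) = (cmod (det (minor_mat S Z)) * cmod (q Z)) powr kappa"
        by (simp add: m'_def norm_mult m(3)[OF Z] powr_mult)
      also have "cmod (det (minor_mat S Z)) * cmod (q Z) = cmod (det (minor_mat (insert k S) Z))"
        using nz[OF Z, of S] by (simp add: q_def norm_divide)
      finally show "cmod (m' Z) = cmod (det (minor_mat (insert k S) Z)) powr kappa" .
    qed
    ultimately show ?case by blast
  qed
  from this[of UNIV] show ?thesis by (simp add: minor_mat_def)
qed

section \<open>Scaling of Lebesgue measure under real congruences\<close>

definition congr :: "real^'n^'n \<Rightarrow> complex^'n^'n \<Rightarrow> complex^'n^'n" where
  "congr A Z = cmat A ** Z ** transpose (cmat A)"

lemma congr_mult: "congr (A ** B) Z = congr A (congr B Z)"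
  by (simp add: congr_def cmat_mult matrix_transpose_mul matrix_mul_assoc)

lemma congr_one [simp]: "congr (mat 1) Z = Z"
  by (simp add: congr_def)

lemma congr_Symm: "Z \<in> Symm_complex \<Longrightarrow> congr A Z \<in> Symm_complex"
  by (simp add: congr_def Symm_transpose matrix_transpose_mul matrix_mul_assoc)

lemma matrix_congruence_nth: "(A ** Z ** B) $ i $ j = (\<Sum>k\<in>UNIV. \<Sum>l\<in>UNIV. A $ i $ l * Z $ l $ k * B $ k $ j)"
  by (simp add: matrix_matrix_mult_def sum_distrib_right)

lemma matrix_add_rdistrib: "(B + C) ** A = B ** A + (C :: 'a::semiring_1^'n^'m) ** A"
  by (rule mat_eqI) (simp add: matrix_matrix_mult_def algebra_simps sum.distrib)

lemma continuous_congruence: "continuous_on UNIV (\<lambda>Z :: complex^'n^'n. A ** Z ** B)"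
  by (intro continuous_on_matrix_entries, unfold matrix_congruence_nth) (intro continuous_intros)

lemma congr_measurable [measurable]: "congr A \<in> borel \<rightarrow>\<^sub>M borel"
  unfolding congr_def[abs_def] by (intro borel_measurable_continuous_onI continuous_congruence)

definition scales_lebesgue :: "(complex^'n^'n \<Rightarrow> complex^'n^'n) \<Rightarrow> real \<Rightarrow> bool" where
  "scales_lebesgue h d \<longleftrightarrow> d > 0 \<and> (\<forall>f\<in>borel_measurable borel.
     (\<integral>\<^sup>+ Z. f (h Z) \<partial>lebesgue_symm) = ennreal d * (\<integral>\<^sup>+ Z. f Z \<partial>lebesgue_symm))"

lemma scales_lebesgueD:
  "scales_lebesgue h d \<Longrightarrow> f \<in> borel_measurable borel \<Longrightarrow> (\<integral>\<^sup>+ Z. f (h Z) \<partial>lebesgue_symm) = ennreal d * (\<integral>\<^sup>+ Z. f Z \<partial>lebesgue_symm)"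
  by (simp add: scales_lebesgue_def)

lemma scales_lebesgue_compose:
  assumes "scales_lebesgue g d" "scales_lebesgue h e" "g \<in> borel \<rightarrow>\<^sub>M borel"
  shows "scales_lebesgue (\<lambda>Z. g (h Z)) (d * e)"
  unfolding scales_lebesgue_def
proof (intro conjI ballI)
  show "d * e > 0" using assms by (simp add: scales_lebesgue_def)
  fix f :: "complex^'a^'a \<Rightarrow> ennreal" assume f: "f \<in> borel_measurable borel"
  have "(\<integral>\<^sup>+ Z. f (g (h Z)) \<partial>lebesgue_symm) = ennreal e * (ennreal d * (\<integral>\<^sup>+ Z. f Z \<partial>lebesgue_symm))"
    using scales_lebesgueD[OF assms(2) measurable_compose[OF assms(3) f]] scales_lebesgueD[OF assms(1) f] by simp
  then show "(\<integral>\<^sup>+ Z. f (g (h Z)) \<partial>lebesgue_symm) = ennreal (d * e) * (\<integral>\<^sup>+ Z. f Z \<partial>lebesgue_symm)"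
    using assms by (simp add: scales_lebesgue_def ennreal_mult mult_ac)
qed

lemma scales_lebesgue_invariant_set:
  fixes B C :: "(complex^'n^'n) set"
  assumes d: "scales_lebesgue h d" and B: "B \<in> sets borel" "C \<in> sets borel"
    and inv: "\<And>Z. Z \<in> Symm_complex \<Longrightarrow> h Z \<in> B \<longleftrightarrow> Z \<in> C"
  shows "emeasure lebesgue_symm C = ennreal d * emeasure lebesgue_symm B"
proof -
  have "(\<integral>\<^sup>+ Z. indicator B (h Z) \<partial>lebesgue_symm) = (\<integral>\<^sup>+ Z. indicator C Z \<partial>lebesgue_symm)"
    by (rule nn_integral_cong_AE, rule AE_mp[OF AE_lebesgue_symm]) (auto simp: indicator_def inv)
  then show ?thesis using scales_lebesgueD[OF d, of "indicator B"] B by (simp add: borel_measurable_indicator)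
qed

lemma scales_lebesgue_unique:
  assumes "scales_lebesgue h d" "scales_lebesgue h e" shows "d = e"
proof -
  let ?B = "entry_box 1 :: (complex^'a^'a) set"
  have "ennreal d * emeasure lebesgue_symm ?B = ennreal e * emeasure lebesgue_symm ?B"
    using scales_lebesgueD[OF assms(1), of "indicator ?B"] scales_lebesgueD[OF assms(2), of "indicator ?B"]
    by (simp add: borel_measurable_indicator)
  then have "ennreal (d * 2 ^ card (symm_basis :: (complex^'a^'a) set)) = ennreal (e * 2 ^ card (symm_basis :: (complex^'a^'a) set))"
    using assms by (simp add: emeasure_entry_box ennreal_mult scales_lebesgue_def)
  then show ?thesis using assms by (simp add: scales_lebesgue_def)
qed

text \<open>Comparing measures of an invariant set of positive finite measure lets the factor
  cancel.\<close>

lemma scales_lebesgue_invariant_eq_one: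
  fixes B :: "(complex^'n^'n) set"
  assumes d: "scales_lebesgue h d" and B: "B \<in> sets borel" and inv: "\<And>Z. Z \<in> Symm_complex \<Longrightarrow> h Z \<in> B \<longleftrightarrow> Z \<in> B"
    and fin: "0 < emeasure lebesgue_symm B" "emeasure lebesgue_symm B < top"
  shows "d = 1"
proof -
  define b where "b = emeasure lebesgue_symm B"
  have "b = ennreal d * b" unfolding b_def by (rule scales_lebesgue_invariant_set[OF d B B inv])
  moreover have "0 < b" "b < top" using fin by (auto simp: b_def)
  ultimately have "ennreal d = 1"
    by (metis ennreal_mult_divide_eq less_irrefl mult.left_neutral)
  then show ?thesis using d by (simp add: scales_lebesgue_def)
qed

lemma D_III_emeasure: "0 < emeasure lebesgue_symm (D_III :: (complex^'n^'n) set)" "emeasure lebesgue_symm (D_III :: (complex^'n^'n) set) < top"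
proof -
  show "emeasure lebesgue_symm (D_III :: (complex^'n^'n) set) < top"
    using emeasure_bounded[OF D_III_bounded] by simp
  obtain r where r: "r > 0" "\<And>V :: complex^'n^'n. V \<in> Symm_complex \<Longrightarrow> norm V < r \<Longrightarrow> 0 + V \<in> D_III"
    using rel_openE[OF D_III_rel_open D_III_zero] by blast
  have "0 < emeasure lebesgue_symm (ball (0 :: complex^'n^'n) r)" by (rule emeasure_ball_pos[OF Symm_zero r(1)])
  also have "\<dots> \<le> emeasure lebesgue_symm (D_III :: (complex^'n^'n) set)"
    by (rule emeasure_mono_AE, rule AE_mp[OF AE_lebesgue_symm]) (use r in \<open>auto simp: rel_open_borel[OF D_III_rel_open]\<close>)
  finally show "0 < emeasure lebesgue_symm (D_III :: (complex^'n^'n) set)" .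
qed

text \<open>\<open>D_III\<close> itself is the invariant set of positive finite measure that forces
  the Haar constant to be 1.\<close>

lemma unitary_scales_lebesgue:
  fixes V :: "complex^'n^'n"
  assumes V: "V ** transpose (cnj_mat V) = mat 1"
  shows "scales_lebesgue (\<lambda>Z. V ** Z ** transpose V) 1"
proof -
  define W where "W = transpose (cnj_mat V)"
  have VW: "V ** W = mat 1" "W ** V = mat 1" using V matrix_mult_eq_one_commute[OF V] by (auto simp: W_def)
  then have VWt: "transpose W ** transpose V = mat 1" "transpose V ** transpose W = mat 1"
    by (metis matrix_transpose_mul transpose_mat)+
  have W: "W ** transpose (cnj_mat W) = mat 1" using VW by (simp add: W_def cnj_mat_transpose)
  let ?f = "\<lambda>Z :: complex^'n^'n. V ** Z ** transpose V" and ?g = "\<lambda>Z :: complex^'n^'n. W ** Z ** transpose W"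
  have fg: "?f (?g Z) = Z" "?g (?f Z) = Z" for Z
  proof -
    have "?f (?g Z) = (V ** W) ** Z ** (transpose W ** transpose V)" "?g (?f Z) = (W ** V) ** Z ** (transpose V ** transpose W)"
      by (simp_all only: matrix_mul_assoc)
    then show "?f (?g Z) = Z" "?g (?f Z) = Z" by (simp_all add: VW VWt)
  qed
  have S: "B ** Z ** transpose B \<in> Symm_complex" if "Z \<in> Symm_complex" for B Z :: "complex^'n^'n"
    using that by (simp add: Symm_transpose matrix_transpose_mul matrix_mul_assoc)
  have "\<exists>d>0. \<forall>f\<in>borel_measurable borel. (\<integral>\<^sup>+ x. f (?f x) \<partial>lebesgue_symm) = ennreal d * (\<integral>\<^sup>+ x. f x \<partial>lebesgue_symm)"
    by (rule haar_scaling[where A' = ?g])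
      (auto simp: fg S matrix_add_ldistrib matrix_add_rdistrib intro!: borel_measurable_continuous_onI continuous_congruence)
  then obtain d where d: "scales_lebesgue ?f d" unfolding scales_lebesgue_def by blast
  have "d = 1"
  proof (rule scales_lebesgue_invariant_eq_one[OF d rel_open_borel[OF D_III_rel_open] _ D_III_emeasure])
    fix Z :: "complex^'n^'n"
    show "?f Z \<in> D_III \<longleftrightarrow> Z \<in> D_III"
      using unitary_D_III[OF V, of Z] unitary_D_III[OF W, of "?f Z"] fg by auto
  qed
  then show ?thesis using d by simp
qed

lemma congr_scales_lebesgue_exists:
  fixes A :: "real^'n^'n"
  assumes "det A \<noteq> 0"
  shows "\<exists>d. scales_lebesgue (congr A) d"
proof -
  have AB: "A ** matrix_inv A = mat 1" by (rule matrix_inv_det[OF assms])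
  then have BA: "matrix_inv A ** A = mat 1" by (rule matrix_mult_eq_one_commute)
  have i: "congr A (congr (matrix_inv A) Z) = Z" "congr (matrix_inv A) (congr A Z) = Z" for Z
    by (simp_all flip: congr_mult add: AB BA)
  have "\<exists>d>0. \<forall>f\<in>borel_measurable borel. (\<integral>\<^sup>+ x. f (congr A x) \<partial>lebesgue_symm) = ennreal d * (\<integral>\<^sup>+ x. f x \<partial>lebesgue_symm)"
    by (rule haar_scaling[where A' = "congr (matrix_inv A)"])
      (auto simp: i congr_Symm, auto simp: congr_def matrix_add_ldistrib matrix_add_rdistrib)
  then show ?thesis unfolding scales_lebesgue_def by blast
qed

text \<open>A number rather than a relation, so that A -> \<open>congr_factor A\<close> can be
  treated as a homomorphism from invertible matrices to positive reals and evaluated on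
  generators.\<close>

definition congr_factor :: "real^'n^'n \<Rightarrow> real" where
  "congr_factor A = (THE d. scales_lebesgue (congr A) d)"

lemma congr_factor: "det A \<noteq> 0 \<Longrightarrow> scales_lebesgue (congr A) (congr_factor A)"
  unfolding congr_factor_def
  by (rule theI') (metis congr_scales_lebesgue_exists scales_lebesgue_unique)

lemma congr_factor_eqI: "scales_lebesgue (congr A) d \<Longrightarrow> congr_factor A = d"
  unfolding congr_factor_def by (metis scales_lebesgue_unique the_equality)

lemma congr_factor_mult:
  assumes "det A \<noteq> 0" "det B \<noteq> 0"
  shows "congr_factor (A ** B) = congr_factor A * congr_factor B"
  using scales_lebesgue_compose[OF congr_factor[OF assms(1)] congr_factor[OF assms(2)] congr_measurable]
  by (intro congr_factor_eqI) (simp add: congr_mult[abs_def])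

lemma congr_factor_orthogonal:
  assumes "transpose Q ** Q = mat 1"
  shows "congr_factor Q = 1" "det Q \<noteq> 0"
proof -
  have "Q ** transpose Q = mat 1" by (rule matrix_mult_eq_one_commute[OF assms])
  then have "cmat Q ** transpose (cnj_mat (cmat Q)) = mat 1"
    by (simp flip: cmat_transpose cmat_mult)
  then show "congr_factor Q = 1"
    using unitary_scales_lebesgue[of "cmat Q"] by (intro congr_factor_eqI) (simp add: congr_def[abs_def])
  show "det Q \<noteq> 0" using arg_cong[OF assms, of det] by (auto simp: det_mul)
qed

lemma congr_factor_one: "congr_factor (mat 1) = 1"
  by (rule congr_factor_orthogonal) simp

text \<open>The congruence multiplies \<open>Z\<close> by \<open>t\<^sup>2\<close>, so it maps the
  unit box to the box of half-width \<open>t\<^sup>2\<close>; the measures of the two boxes give the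
  factor.\<close>

lemma congr_factor_scalar:
  fixes t :: real
  assumes t: "t > 0"
  shows "congr_factor (diag_mat (\<lambda>_. t) :: real^'n^'n) = (1 / t\<^sup>2) ^ card (symm_basis :: (complex^'n^'n) set)"
proof -
  let ?A = "diag_mat (\<lambda>_. t) :: real^'n^'n" and ?N = "card (symm_basis :: (complex^'n^'n) set)"
  have dA: "det ?A \<noteq> 0" using t by (simp add: det_diag_mat)
  have cd: "cmat ?A = diag_mat (\<lambda>_. complex_of_real t)" by (rule mat_eqI) (simp add: diag_mat_nth)
  have e: "congr ?A Z $ i $ j = of_real (t\<^sup>2) * Z $ i $ j" for Z i j
  proof -
    have "congr ?A Z $ i $ j = (\<Sum>k\<in>UNIV. \<Sum>l\<in>UNIV. if l = i then (if k = j then of_real (t\<^sup>2) * Z $ i $ j else 0) else 0)"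
      unfolding congr_def cd transpose_diag_mat matrix_congruence_nth
      by (intro sum.cong refl) (auto simp: diag_mat_nth power2_eq_square)
    also have "\<dots> = of_real (t\<^sup>2) * Z $ i $ j" by simp
    finally show ?thesis .
  qed
  have "emeasure lebesgue_symm (entry_box 1 :: (complex^'n^'n) set) = ennreal (congr_factor ?A) * emeasure lebesgue_symm (entry_box (t\<^sup>2) :: (complex^'n^'n) set)"
  proof (rule scales_lebesgue_invariant_set[OF congr_factor[OF dA]])
    fix Z :: "complex^'n^'n"
    have "\<bar>t\<^sup>2 * a\<bar> \<le> t\<^sup>2 \<longleftrightarrow> \<bar>a\<bar> \<le> 1" for a
      using t by (simp add: abs_mult mult_le_cancel_left1)
    then show "congr ?A Z \<in> entry_box (t\<^sup>2) \<longleftrightarrow> Z \<in> entry_box 1" by (simp add: entry_box_def e)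
  qed auto
  moreover have c: "congr_factor ?A > 0" using congr_factor[OF dA] by (simp add: scales_lebesgue_def)
  ultimately have "ennreal (2 ^ ?N) = ennreal (congr_factor ?A * (2 * t\<^sup>2) ^ ?N)"
    by (simp add: emeasure_entry_box ennreal_mult)
  then have "2 ^ ?N = congr_factor ?A * (2 * t\<^sup>2) ^ ?N" using c by (simp add: ennreal_inj)
  then have "congr_factor ?A = 2 ^ ?N / (2 * t\<^sup>2) ^ ?N" using t by (simp add: field_simps)
  also have "\<dots> = (2 / (2 * t\<^sup>2)) ^ ?N" by (simp only: power_divide)
  finally show ?thesis by simp
qed

definition coord_scale :: "'n \<Rightarrow> real \<Rightarrow> real^'n^'n" where
  "coord_scale i t = diag_mat (\<lambda>j. if j = i then t else 1)"

lemma det_diag_nonzero: "(\<And>i. x i \<noteq> 0) \<Longrightarrow> det (diag_mat x :: real^'n^'n) \<noteq> 0"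
  by (simp add: det_diag_mat)

text \<open>The two scalings are conjugate under the permutation matrix of a transposition, which is
  orthogonal and has factor 1.\<close>

lemma congr_factor_coord_scale_eq:
  fixes i j :: "'n::finite"
  assumes t: "t > 0"
  shows "congr_factor (coord_scale i t) = congr_factor (coord_scale j t)"
proof -
  define p where "p = Transposition.transpose i j"
  have pp: "p (p k) = k" for k by (simp add: p_def)
  define Q where "Q = (\<chi> k l. if l = p k then 1 else (0 :: real))"
  have Qnth: "Q $ k $ l = (if l = p k then 1 else 0)" for k l by (simp add: Q_def)
  have "(k = p l) = (l = p k)" for k l by (metis pp)
  then have Qt: "transpose Q = Q"
    by (intro mat_eqI) (simp only: transpose_def Q_def vec_lambda_beta)
  have QB: "(Q ** B) $ k $ l = B $ p k $ l" for B :: "real^'n^'n" and k l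
  proof -
    have "(Q ** B) $ k $ l = (\<Sum>m\<in>UNIV. if m = p k then B $ m $ l else 0)"
      unfolding matrix_matrix_mult_def vec_lambda_beta by (intro sum.cong refl) (simp add: Q_def)
    then show ?thesis by simp
  qed
  have BQ: "(B ** Q) $ k $ l = B $ k $ p l" for B :: "real^'n^'n" and k l
  proof -
    have "(B ** Q) $ k $ l = (\<Sum>m\<in>UNIV. if m = p l then B $ k $ m else 0)"
      unfolding matrix_matrix_mult_def vec_lambda_beta by (intro sum.cong refl) (auto simp: Q_def pp)
    then show ?thesis by simp
  qed
  have QQ: "transpose Q ** Q = mat 1"
    unfolding Qt by (rule mat_eqI) (auto simp: QB Qnth mat_def pp)
  have nz: "det (coord_scale k t) \<noteq> 0" for k :: 'n
    unfolding coord_scale_def by (rule det_diag_nonzero) (use t in auto)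
  have "Q ** coord_scale i t ** Q = coord_scale j t"
    by (rule mat_eqI) (auto simp: QB BQ coord_scale_def diag_mat_nth p_def transpose_def Transposition.transpose_def)
  moreover have "det (Q ** coord_scale i t) \<noteq> 0" using nz congr_factor_orthogonal(2)[OF QQ] by (simp add: det_mul)
  ultimately show ?thesis
    using congr_factor_orthogonal[OF QQ] nz by (metis congr_factor_mult mult.left_neutral mult.right_neutral)
qed

lemma congr_factor_diag:
  fixes x :: "'n::finite \<Rightarrow> real"
  assumes x: "\<And>i. x i > 0"
  shows "congr_factor (diag_mat x) = (\<Prod>i\<in>UNIV. congr_factor (coord_scale i (x i)))"
proof -
  have "congr_factor (diag_mat (\<lambda>i. if i \<in> S then x i else 1)) = (\<Prod>i\<in>S. congr_factor (coord_scale i (x i)))"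
    if "finite S" for S :: "'n set"
    using that
  proof (induction S rule: finite_induct)
    case empty
    then show ?case by (simp add: diag_mat_one congr_factor_one)
  next
    case (insert k S)
    have "diag_mat (\<lambda>i. if i \<in> insert k S then x i else 1) = coord_scale k (x k) ** diag_mat (\<lambda>i. if i \<in> S then x i else 1)"
      unfolding coord_scale_def diag_mat_mult using insert(2) by (intro arg_cong[of _ _ diag_mat]) auto
    moreover have "det (coord_scale k (x k)) \<noteq> 0"
      unfolding coord_scale_def by (rule det_diag_nonzero) (use x[of k] in auto)
    moreover have "det (diag_mat (\<lambda>i. if i \<in> S then x i else 1) :: real^'n^'n) \<noteq> 0"
      by (rule det_diag_nonzero) (use x in \<open>simp add: less_imp_neq[symmetric]\<close>)
    ultimately show ?case using insert by (simp add: congr_factor_mult)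
  qed
  from this[of UNIV] show ?thesis by simp
qed

text \<open>A singular value decomposition reduces the homomorphism to diagonal matrices, and these
  to single coordinate scalings. The cardinality of \<open>symm_basis\<close> is the real dimension
  n(n + 1), so the exponent is -2(n + 1) in disguise.\<close>

lemma congr_factor_eq:
  fixes A :: "real^'n^'n"
  assumes A: "det A \<noteq> 0"
  shows "congr_factor A = \<bar>det A\<bar> powr (- 2 * real (card (symm_basis :: (complex^'n^'n) set)) / real CARD('n))"
proof -
  define N where "N = card (symm_basis :: (complex^'n^'n) set)"
  define a where "a = - 2 * real N / real CARD('n)"
  have unit: "congr_factor (coord_scale i t) = t powr a" if t: "t > 0" for i :: 'n and t
  proof -
    define g where "g = congr_factor (coord_scale i t)"
    have "det (coord_scale i t) \<noteq> 0"
      unfolding coord_scale_def by (rule det_diag_nonzero) (use t in auto)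
    then have g: "g > 0" unfolding g_def using congr_factor[of "coord_scale i t"] by (simp add: scales_lebesgue_def)
    \<comment> \<open>All n coordinate scalings by \<open>t\<close> have the same factor, and
      together they make up the scalar matrix whose factor is known.\<close>
    have "g ^ CARD('n) = congr_factor (diag_mat (\<lambda>_. t) :: real^'n^'n)"
    proof -
      have "congr_factor (coord_scale k t) = g" for k :: 'n unfolding g_def by (rule congr_factor_coord_scale_eq[OF t])
      then show ?thesis by (simp add: congr_factor_diag[of "\<lambda>_. t", OF t])
    qed
    also have "\<dots> = (1 / t\<^sup>2) ^ N" unfolding N_def by (rule congr_factor_scalar[OF t])
    also have "\<dots> = t powr (- 2 * real N)"
    proof -
      have "t powr (- 2 * real N) = inverse (t powr real (2 * N))" by (simp flip: powr_minus)
      also have "t powr real (2 * N) = t ^ (2 * N)" by (rule powr_realpow[OF t])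
      finally show ?thesis by (simp add: power_divide power_mult inverse_eq_divide)
    qed
    finally have "g powr real CARD('n) = t powr (- 2 * real N)" using g by (simp add: powr_realpow)
    then have "(g powr real CARD('n)) powr (1 / real CARD('n)) = t powr a" by (simp add: powr_powr a_def)
    then show ?thesis using g by (simp add: powr_powr g_def)
  qed
  have prodp: "(\<Prod>i\<in>S. x i powr a) = (\<Prod>i\<in>S. x i) powr a" if "finite S" "\<And>i. x i > 0" for S and x :: "'n \<Rightarrow> real"
    using that by (induction S rule: finite_induct) (auto simp: powr_mult prod_nonneg less_imp_le)
  have X: "transpose (transpose A ** A) = transpose A ** A" by (simp add: matrix_transpose_mul)
  have Y: "pos_def_real (mat 1 :: real^'n^'n)" by (simp add: pos_def_real_def)
  \<comment> \<open>With the identity as second form this is the spectral theorem for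
    \<open>transpose A ** A\<close>; the square roots of \<open>x\<close> are the singular values of
    \<open>A\<close>.\<close>
  obtain P :: "real^'n^'n" and x where P0: "transpose P ** mat 1 ** P = mat 1" and Px: "transpose P ** (transpose A ** A) ** P = diag_mat x"
    by (rule real_simultaneous_diagonalisation[OF X Y])
  have P: "transpose P ** P = mat 1" using P0 by simp
  have P': "P ** transpose P = mat 1" by (rule matrix_mult_eq_one_commute[OF P])
  have dP: "det P * det P = 1" using arg_cong[OF P, of det] by (simp add: det_mul)
  have xnn: "x i \<ge> 0" for i
  proof -
    have "diag_mat x = transpose (A ** P) ** (A ** P)" by (simp add: Px[symmetric] matrix_transpose_mul matrix_mul_assoc)
    then have "diag_mat x $ i $ i = (\<Sum>k\<in>UNIV. (A ** P) $ k $ i * (A ** P) $ k $ i)"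
    proof -
      have "(transpose B ** B) $ i $ i = (\<Sum>k\<in>UNIV. B $ k $ i * B $ k $ i)" for B :: "real^'n^'n"
        by (simp add: matrix_matrix_mult_def transpose_def)
      then show ?thesis using \<open>diag_mat x = _\<close> by simp
    qed
    then show ?thesis by (simp add: diag_mat_nth sum_nonneg)
  qed
  have "(\<Prod>i\<in>UNIV. x i) = (det P * det P) * (det A)\<^sup>2"
    using arg_cong[OF Px, of det] by (simp add: det_mul det_diag_mat power2_eq_square mult_ac)
  then have px: "(\<Prod>i\<in>UNIV. x i) = (det A)\<^sup>2" by (simp add: dP)
  then have "(\<Prod>i\<in>UNIV. x i) \<noteq> 0" using A by simp
  then have x: "x i > 0" for i using xnn[of i] by (auto simp: less_le)
  define s where "s i = sqrt (x i)" for i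
  have s: "s i > 0" "s i * s i = x i" for i using x[of i] by (auto simp: s_def)
  have sn: "s i \<noteq> 0" for i using s(1)[of i] by simp
  define Q where "Q = A ** P ** diag_mat (\<lambda>i. 1 / s i)"
  have "transpose Q ** Q = diag_mat (\<lambda>i. 1 / s i) ** (transpose P ** (transpose A ** A) ** P) ** diag_mat (\<lambda>i. 1 / s i)"
    by (simp add: Q_def matrix_transpose_mul matrix_mul_assoc)
  also have "\<dots> = mat 1"
    unfolding Px diag_mat_mult diag_mat_one[symmetric]
    by (intro arg_cong[of _ _ diag_mat] ext) (simp add: s(2)[symmetric] sn)
  finally have Q: "transpose Q ** Q = mat 1" .
  have "Q ** diag_mat s ** transpose P = A ** P ** (diag_mat (\<lambda>i. 1 / s i) ** diag_mat s) ** transpose P"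
    by (simp add: Q_def matrix_mul_assoc)
  also have "diag_mat (\<lambda>i. 1 / s i) ** diag_mat s = (mat 1 :: real^'n^'n)"
    unfolding diag_mat_mult diag_mat_one[symmetric]
    by (intro arg_cong[of _ _ diag_mat] ext) (simp add: sn)
  also have "A ** P ** mat 1 ** transpose P = A" by (simp add: P' flip: matrix_mul_assoc)
  finally have fact: "A = Q ** diag_mat s ** transpose P" by simp
  have ds: "det (diag_mat s :: real^'n^'n) \<noteq> 0" by (rule det_diag_nonzero) (rule sn)
  have Pt: "transpose (transpose P) ** transpose P = mat 1" by (simp add: P')
  have "congr_factor A = congr_factor (diag_mat s :: real^'n^'n)"
    unfolding fact using congr_factor_orthogonal[OF Q] congr_factor_orthogonal[OF Pt] ds
    by (simp add: congr_factor_mult det_mul)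
  also have "\<dots> = (\<Prod>i\<in>UNIV. s i) powr a"
    using s(1) by (simp add: congr_factor_diag unit prodp)
  also have "(\<Prod>i\<in>UNIV. s i) = \<bar>det A\<bar>"
  proof -
    have "(\<Prod>i\<in>UNIV. s i)\<^sup>2 = (\<Prod>i\<in>UNIV. s i * s i)" by (simp add: prod.distrib power2_eq_square)
    also have "\<dots> = (det A)\<^sup>2" by (simp add: s(2) px)
    finally have "(\<Prod>i\<in>UNIV. s i)\<^sup>2 = (det A)\<^sup>2" .
    moreover have "(\<Prod>i\<in>UNIV. s i) \<ge> 0" using s(1) by (intro prod_nonneg) (auto simp: less_imp_le)
    ultimately show ?thesis by (metis abs_of_nonneg power2_eq_iff abs_minus)
  qed
  finally show ?thesis by (simp add: a_def N_def)
qed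

section \<open>Finiteness of the weighted measure on the bounded domain\<close>

text \<open>Adds multiples of row \<open>k\<close> to all other rows in one step, as multiplication
  by a single elementary matrix \<open>E\<close>.\<close>

lemma det_add_row_multiples:
  fixes d :: "'n \<Rightarrow> 'a::field^'n" and r :: "'a^'n"
  shows "det (\<chi> i. if i = k then r else d i + c i *s r) = det (\<chi> i. if i = k then r else d i)"
proof -
  define X where "X = (\<chi> i. if i = k then r else d i)"
  define x where "x = (\<chi> i. if i = k then 1 else c i)"
  \<comment> \<open>The identity with its column \<open>k\<close> replaced by \<open>x\<close>;
    Cramer's lemma gives its determinant as the entry \<open>x $ k\<close>, which is 1.\<close>
  define E where "E = (\<chi> i j. if j = k then (mat 1 *v x) $ i else (mat 1 :: 'a^'n^'n) $ i $ j)"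
  have "det E = x $ k * det (mat 1 :: 'a^'n^'n)" unfolding E_def by (rule cramer_lemma)
  then have dE: "det E = 1" by (simp add: x_def)
  have Enth: "E $ i $ j = (if j = k then x $ i else if i = j then 1 else 0)" for i j
    unfolding E_def matrix_vector_mul_lid by (simp add: mat_def)
  have "(\<chi> i. if i = k then r else d i + c i *s r) = E ** X"
  proof (rule mat_eqI)
    fix i j
    have "(E ** X) $ i $ j = (\<Sum>l\<in>UNIV. (if l = k then x $ i * r $ j else 0) + (if l = i then (if i = k then 0 else d i $ j) else 0))"
      unfolding matrix_matrix_mult_def vec_lambda_beta
      by (intro sum.cong refl) (auto simp: Enth X_def)
    also have "\<dots> = x $ i * r $ j + (if i = k then 0 else d i $ j)" by (simp add: sum.distrib)
    finally show "(\<chi> i. if i = k then r else d i + c i *s r) $ i $ j = (E ** X) $ i $ j"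
      by (auto simp: x_def)
  qed
  then show ?thesis by (simp add: det_mul dE X_def)
qed

lemma det_unit_row:
  fixes X :: "'a::field^'n^'n"
  shows "det (\<chi> i. if i = k then axis k 1 else X $ i)
       = det (\<chi> i j. if i = k \<or> j = k then (if i = j then 1 else 0) else X $ i $ j)"
proof -
  have "(\<chi> i. if i = k then axis k 1 else X $ i)
     = (\<chi> i. if i = k then axis k 1 else (\<chi> j. if j = k then 0 else X $ i $ j) + X $ i $ k *s axis k 1)"
    by (rule mat_eqI) (auto simp: axis_def)
  also have "det \<dots> = det (\<chi> i. if i = k then axis k 1 else (\<chi> j. if j = k then 0 else X $ i $ j))"
    by (rule det_add_row_multiples)
  also have "(\<chi> i. if i = k then axis k 1 else (\<chi> j. if j = k then 0 else X $ i $ j))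
     = (\<chi> i j. if i = k \<or> j = k then (if i = j then 1 else 0) else X $ i $ j)"
    by (rule mat_eqI) (auto simp: axis_def)
  finally show ?thesis .
qed

lemma det_row_affine:
  fixes a b :: "'a::field^'n" and c :: "'n \<Rightarrow> 'a^'n"
  shows "det (\<chi> i. if i = k then a + u *s b else c i)
       = det (\<chi> i. if i = k then a else c i) + u * det (\<chi> i. if i = k then b else c i)"
  unfolding det_row_add[of k "\<lambda>_. a" "\<lambda>_. u *s b" c] det_row_mul[of k u "\<lambda>_. b" c] ..

lemma det_column_affine:
  fixes p q :: "'a::field^'n" and X :: "'a^'n^'n"
  shows "det (\<chi> i j. if j = k then p $ i + u * q $ i else X $ i $ j)
       = det (\<chi> i j. if j = k then p $ i else X $ i $ j) + u * det (\<chi> i j. if j = k then q $ i else X $ i $ j)"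
proof -
  have t: "det (\<chi> i j. if j = k then v $ i else X $ i $ j) = det (\<chi> i. if i = k then v else column i X)" for v
  proof -
    have tt: "transpose (\<chi> i j. if j = k then v $ i else X $ i $ j) = (\<chi> i. if i = k then v else column i X)"
      by (rule mat_eqI) (simp add: transpose_def column_def)
    show ?thesis using arg_cong[OF tt, of det] unfolding det_transpose .
  qed
  show ?thesis using det_row_affine[of k p u q "\<lambda>i. column i X"]
    unfolding t[symmetric] by (simp cong: if_cong)
qed

text \<open>Padding with zeros keeps the matrix size fixed. Outside \<open>S\<close> the matrix
  \<open>mat 1 - W ** cnj_mat W\<close> of such a block \<open>W\<close> is the identity, so its
  full determinant is that of the smaller block.\<close>

definition principal_block :: "'n set \<Rightarrow> complex^'n^'n \<Rightarrow> complex^'n^'n" where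
  "principal_block S Z = (\<chi> i j. if i \<in> S \<and> j \<in> S then Z $ i $ j else 0)"

definition principal_det :: "'n set \<Rightarrow> complex^'n^'n \<Rightarrow> real" where
  "principal_det S Z = Re (det (mat 1 - principal_block S Z ** cnj_mat (principal_block S Z)))"

definition diag_unit :: "'n \<Rightarrow> complex \<Rightarrow> complex^'n^'n" where
  "diag_unit k z = (\<chi> i j. if i = k \<and> j = k then z else 0)"

lemma principal_block_nth: "principal_block S Z $ i $ j = (if i \<in> S \<and> j \<in> S then Z $ i $ j else 0)"
  by (simp add: principal_block_def)

lemma diag_unit_nth: "diag_unit k z $ i $ j = (if i = k \<and> j = k then z else 0)"
  by (simp add: diag_unit_def)

text \<open>In the diagonal entry the determinant is affine in z and in its conjugate separately.
  Row operations show that the coefficient of |z|^2 is minus the determinant for the smaller index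
  set, the fact that drives the induction on \<open>S\<close>.\<close>

lemma principal_det_quadratic:
  fixes Z :: "complex^'n^'n"
  assumes k: "k \<notin> S"
  obtains C b where "\<And>z. principal_det (insert k S) (Z + diag_unit k z) = C + Re (b * z) - principal_det S Z * (cmod z)\<^sup>2"
proof -
  \<comment> \<open>The block without its diagonal entry at \<open>k\<close>, so that the whole
    dependence on that entry becomes explicit.\<close>
  define W where "W = principal_block (insert k S) (\<chi> i j. if i = k \<and> j = k then 0 else Z $ i $ j)"
  define G where "G = W ** cnj_mat W"
  have Wkk: "W $ k $ k = 0" by (simp add: W_def principal_block_nth)
  have zr: "principal_block (insert k S) (Z + diag_unit k z) = W + diag_unit k (Z $ k $ k + z)" for z
    by (rule mat_eqI) (auto simp: W_def principal_block_nth diag_unit_nth)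
  define c where "c u i = (\<chi> j. (if i = j then 1 else 0) - G $ i $ j - (if j = k then u * W $ i $ k else 0))" for u :: complex and i
  define r0 where "r0 = (\<chi> j. (if k = j then 1 else 0) - G $ k $ j)"
  define r1 where "r1 u = (\<chi> j. - cnj (W $ k $ j) - (if j = k then u else 0))" for u :: complex
  define d where "d i = (\<chi> j. (if i = j then 1 else 0) - G $ i $ j + W $ i $ k * cnj (W $ k $ j))" for i
  \<comment> \<open>Row \<open>k\<close> is affine in z, while the other rows contain only the
    conjugate of z, in column \<open>k\<close>.\<close>
  have M: "mat 1 - (W + diag_unit k z) ** cnj_mat (W + diag_unit k z) = (\<chi> i. if i = k then r0 + z *s r1 (cnj z) else c (cnj z) i)" for z
  proof (rule mat_eqI)
    fix i j
    have "((W + diag_unit k z) ** cnj_mat (W + diag_unit k z)) $ i $ j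
        = (\<Sum>l\<in>UNIV. W $ i $ l * cnj (W $ l $ j) + (if l = k then W $ i $ k * (if j = k then cnj z else 0)
            + (if i = k then z else 0) * cnj (W $ k $ j) + (if i = k then z else 0) * (if j = k then cnj z else 0) else 0))"
      unfolding matrix_matrix_mult_def vec_lambda_beta
      by (intro sum.cong refl) (auto simp: diag_unit_nth algebra_simps)
    also have "\<dots> = G $ i $ j + (W $ i $ k * (if j = k then cnj z else 0)
            + (if i = k then z else 0) * cnj (W $ k $ j) + (if i = k then z else 0) * (if j = k then cnj z else 0))"
      by (simp add: sum.distrib G_def matrix_matrix_mult_def)
    finally have e: "((W + diag_unit k z) ** cnj_mat (W + diag_unit k z)) $ i $ j = \<dots>" .
    show "(mat 1 - (W + diag_unit k z) ** cnj_mat (W + diag_unit k z)) $ i $ j = (\<chi> i. if i = k then r0 + z *s r1 (cnj z) else c (cnj z) i) $ i $ j"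
      unfolding vector_minus_component e
      by (auto simp: r0_def r1_def c_def mat_def Wkk algebra_simps)
  qed
  define A where "A = det (mat 1 - principal_block S Z ** cnj_mat (principal_block S Z))"
  define \<beta> where "\<beta> = det (\<chi> i. if i = k then (\<chi> j. - cnj (W $ k $ j)) else d i)"
  have D1: "det (\<chi> i. if i = k then r1 u else c u i) = \<beta> - u * A" for u
  proof -
    \<comment> \<open>Subtracting multiples of row \<open>k\<close> removes \<open>u\<close> from
      all other rows, leaving it in row \<open>k\<close> alone.\<close>
    have "(\<chi> i. if i = k then r1 u else c u i) = (\<chi> i. if i = k then r1 u else d i + W $ i $ k *s r1 u)"
      by (rule mat_eqI) (auto simp: r1_def c_def d_def algebra_simps)
    then have "det (\<chi> i. if i = k then r1 u else c u i) = det (\<chi> i. if i = k then r1 u else d i)"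
      by (simp only: det_add_row_multiples)
    also have "(\<chi> i. if i = k then r1 u else d i) = (\<chi> i. if i = k then (\<chi> j. - cnj (W $ k $ j)) + (- u) *s axis k 1 else d i)"
      by (rule mat_eqI) (auto simp: r1_def axis_def)
    also have "det \<dots> = \<beta> + (- u) * det (\<chi> i. if i = k then axis k 1 else d i)"
      unfolding \<beta>_def by (rule det_row_affine)
    \<comment> \<open>The extra term in \<open>d i\<close> cancels the contribution of index
      \<open>k\<close> to \<open>G\<close>, so that only the block over \<open>S\<close>
      remains.\<close>
    also have "det (\<chi> i. if i = k then axis k 1 else d i) = A"
    proof -
      have "(\<chi> i. if i = k then axis k 1 else d i) = (\<chi> i. if i = k then axis k 1 else (\<chi> i. d i) $ i)"
        by (rule mat_eqI) auto
      then have "det (\<chi> i. if i = k then axis k 1 else d i) = det (\<chi> i j. if i = k \<or> j = k then (if i = j then 1 else 0) else (\<chi> i. d i) $ i $ j)"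
        by (simp only: det_unit_row)
      also have "(\<chi> i j. if i = k \<or> j = k then (if i = j then 1 else 0) else (\<chi> i. d i) $ i $ j) = mat 1 - principal_block S Z ** cnj_mat (principal_block S Z)"
      proof (rule mat_eqI)
        fix i j
        show "(\<chi> i j. if i = k \<or> j = k then (if i = j then 1 else 0) else (\<chi> i. d i) $ i $ j) $ i $ j = (mat 1 - principal_block S Z ** cnj_mat (principal_block S Z)) $ i $ j"
        proof (cases "i = k \<or> j = k")
          case True
          then have "(principal_block S Z ** cnj_mat (principal_block S Z)) $ i $ j = 0"
            using k by (auto simp: matrix_matrix_mult_def principal_block_nth)
          then show ?thesis using True by (simp add: mat_def)
        next
          case False
          have "G $ i $ j = (\<Sum>l\<in>UNIV. principal_block S Z $ i $ l * cnj (principal_block S Z $ l $ j) + (if l = k then W $ i $ k * cnj (W $ k $ j) else 0))"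
            unfolding G_def matrix_matrix_mult_def vec_lambda_beta
            using False k by (intro sum.cong refl) (auto simp: W_def principal_block_nth)
          also have "\<dots> = (principal_block S Z ** cnj_mat (principal_block S Z)) $ i $ j + W $ i $ k * cnj (W $ k $ j)"
            by (simp add: sum.distrib matrix_matrix_mult_def)
          finally show ?thesis using False by (simp add: d_def mat_def)
        qed
      qed
      finally show ?thesis by (simp add: A_def)
    qed
    finally show ?thesis by simp
  qed
  define p q where "p = (\<chi> i. if i = k then r0 $ k else (if i = k then 1 else 0) - G $ i $ k)"
    and "q = (\<chi> i. if i = k then 0 else - W $ i $ k)"
  define X where "X = (\<chi> i. if i = k then r0 else c 0 i)"
  define \<alpha> \<gamma> where "\<alpha> = det (\<chi> i j. if j = k then p $ i else X $ i $ j)" and "\<gamma> = det (\<chi> i j. if j = k then q $ i else X $ i $ j)"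
  have D0: "det (\<chi> i. if i = k then r0 else c u i) = \<alpha> + u * \<gamma>" for u
  proof -
    have "(\<chi> i. if i = k then r0 else c u i) = (\<chi> i j. if j = k then p $ i + u * q $ i else X $ i $ j)"
      by (rule mat_eqI) (auto simp: p_def q_def X_def c_def)
    then show ?thesis unfolding \<alpha>_def \<gamma>_def by (simp only: det_column_affine)
  qed
  have detM: "det (mat 1 - (W + diag_unit k z) ** cnj_mat (W + diag_unit k z)) = \<alpha> + cnj z * \<gamma> + z * (\<beta> - cnj z * A)" for z
    unfolding M det_row_affine D0 D1 ..
  \<comment> \<open>The diagonal entry is the old value plus the increment; the quadratic is
    re-expanded in the increment, which leaves its leading coefficient unchanged.\<close>
  define z0 where "z0 = Z $ k $ k"
  have ph: "principal_det (insert k S) (Z + diag_unit k z) = Re \<alpha> + Re ((cnj \<gamma> + \<beta>) * (z0 + z)) - Re A * (cmod (z0 + z))\<^sup>2" for z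
  proof -
    have e: "Re (\<alpha> + cnj y * \<gamma> + y * (\<beta> - cnj y * A)) = Re \<alpha> + Re ((cnj \<gamma> + \<beta>) * y) - Re A * (cmod y)\<^sup>2" for y
      unfolding cmod_power2 by (simp add: power2_eq_square algebra_simps)
    show ?thesis unfolding principal_det_def zr detM z0_def by (rule e)
  qed
  show ?thesis
  proof (rule that)
    fix z
    have "principal_det S Z = Re A" by (simp add: principal_det_def A_def)
    then show "principal_det (insert k S) (Z + diag_unit k z)
      = (Re \<alpha> + Re ((cnj \<gamma> + \<beta>) * z0) - Re A * (cmod z0)\<^sup>2) + Re ((cnj \<gamma> + \<beta> - of_real (2 * Re A) * cnj z0) * z) - principal_det S Z * (cmod z)\<^sup>2"
      unfolding ph cmod_power2 by (simp add: power2_eq_square algebra_simps)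
  qed
qed

text \<open>The area depends only on the difference of the squared radii. A negative inner bound
  turns the annulus into a disc, for which the estimate is merely weaker.\<close>

lemma emeasure_annulus_le:
  assumes "a \<le> b"
  shows "emeasure lborel {u :: complex. a < (cmod (u - c))\<^sup>2 \<and> (cmod (u - c))\<^sup>2 \<le> b} \<le> ennreal (pi * (b - a))"
proof (cases "b < 0")
  case True
  have "\<not> (cmod u)\<^sup>2 \<le> b" for u :: complex using True zero_le_power2[of "cmod u"] by linarith
  then show ?thesis by simp
next
  case b: False
  have disc: "emeasure lborel (cball c r) = ennreal (pi * r\<^sup>2)" if "r \<ge> 0" for r
    using that by (simp add: emeasure_cball unit_ball_vol_2)
  have cb: "{u. (cmod (u - c))\<^sup>2 \<le> t} = cball c (sqrt t)" if "t \<ge> 0" for t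
    using that by (auto simp: dist_norm norm_minus_commute real_le_rsqrt real_sqrt_le_iff intro: sqrt_le_D)
      (metis abs_norm_cancel real_sqrt_abs real_sqrt_le_iff real_sqrt_pow2 power_mono norm_ge_zero)
  show ?thesis
  proof (cases "a < 0")
    case True
    have "emeasure lborel {u :: complex. a < (cmod (u - c))\<^sup>2 \<and> (cmod (u - c))\<^sup>2 \<le> b} \<le> emeasure lborel (cball c (sqrt b))"
      using b by (intro emeasure_mono) (auto simp flip: cb)
    also have "\<dots> = ennreal (pi * b)" using b by (simp add: disc)
    also have "\<dots> \<le> ennreal (pi * (b - a))" using True by (intro ennreal_leI) simp
    finally show ?thesis .
  next
    case False
    have "{u :: complex. a < (cmod (u - c))\<^sup>2 \<and> (cmod (u - c))\<^sup>2 \<le> b} = cball c (sqrt b) - cball c (sqrt a)"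
      using False b by (auto simp flip: cb)
    also have "emeasure lborel \<dots> = emeasure lborel (cball c (sqrt b)) - emeasure lborel (cball c (sqrt a))"
      using False assms by (intro emeasure_Diff) (auto simp: disc intro: order_trans[OF _ real_sqrt_le_mono])
    also have "\<dots> = ennreal (pi * b - pi * a)" using False b assms by (simp add: disc ennreal_minus)
    finally show ?thesis by (simp add: right_diff_distrib)
  qed
qed

text \<open>The annulus on which the quadratic lies between \<open>A 2\<^sup>-\<^sup>k\<^sup>-\<^sup>1\<close> and \<open>A 2\<^sup>-\<^sup>k\<close> has area at most \<open>\<pi> 2\<^sup>-\<^sup>k\<^sup>-\<^sup>1\<close>.\<close>

lemma quadratic_power_integral:
  fixes s :: real
  assumes s: "0 \<le> s" "s < 1"
  obtains K :: real where "K \<ge> 0" "\<And>A C b. A > 0 \<Longrightarrow>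
    (\<integral>\<^sup>+ z. indicator {z. cmod z < 1 \<and> 0 < C + Re (b * z) - A * (cmod z)\<^sup>2} z * ennreal ((C + Re (b * z) - A * (cmod z)\<^sup>2) powr (- s)) \<partial>lborel)
     \<le> ennreal (K * A powr (- s))"
proof -
  define h where "h j = (1 / 2 :: real) ^ j" for j :: nat
  have h: "h j > 0" "h (Suc j) = h j / 2" for j by (auto simp: h_def)
  define t where "t j = pi * (h j - h (Suc j)) * h (Suc j) powr (- s)" for j
  \<comment> \<open>A geometric sequence with ratio 2^(s - 1), summable because
    \<open>s < 1\<close>.\<close>
  have tg: "t j = pi * ((1 / 2) powr (1 - s)) ^ Suc j" for j
  proof -
    have "h j - h (Suc j) = h (Suc j)" by (simp add: h_def)
    then have "t j = pi * (h (Suc j) powr 1 * h (Suc j) powr (- s))" using h(1)[of "Suc j"] by (simp add: t_def)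
    also have "h (Suc j) powr 1 * h (Suc j) powr (- s) = h (Suc j) powr (1 - s)"
      using powr_add[of "h (Suc j)" 1 "- s"] by simp
    also have "\<dots> = ((1 / 2) powr (1 - s)) ^ Suc j"
    proof -
      have "h (Suc j) = (1 / 2) powr real (Suc j)" by (simp add: h_def powr_realpow del: of_nat_Suc)
      then have "h (Suc j) powr (1 - s) = ((1 / 2) powr (1 - s)) powr real (Suc j)"
        by (simp only: powr_powr mult.commute)
      then show ?thesis by (simp only: powr_realpow powr_gt_zero)
    qed
    finally show ?thesis .
  qed
  have "ln (1 / 2 :: real) < 0" by (rule ln_less_zero) auto
  then have "(1 / 2 :: real) powr (1 - s) < 1" unfolding powr_def using s by (simp add: mult_pos_neg)
  then have "summable (\<lambda>j. pi * ((1 / 2 :: real) powr (1 - s)) ^ Suc j)"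
    by (intro summable_mult summable_ignore_initial_segment[of _ 1, simplified]) (simp add: summable_geometric)
  moreover have "t = (\<lambda>j. pi * ((1 / 2 :: real) powr (1 - s)) ^ Suc j)" by (rule ext) (rule tg)
  ultimately have tsum: "summable t" by (simp only:)
  have tnn: "t j \<ge> 0" for j using h(1)[of j] by (simp add: t_def h(2))
  \<comment> \<open>The area \<pi> of the unit disc covers the part where \<open>y\<close> is at
    least 1 and the power at most 1; the series covers the annuli. Scaling out \<open>A\<close>
    makes the constant independent of \<open>A\<close>, \<open>C\<close> and
    \<open>b\<close>.\<close>
  define K where "K = pi + suminf t"
  have K: "K \<ge> 0" using tsum tnn by (simp add: K_def suminf_nonneg)
  have main: "(\<integral>\<^sup>+ z. indicator {z. cmod z < 1 \<and> 0 < C + Re (b * z) - A * (cmod z)\<^sup>2} z * ennreal ((C + Re (b * z) - A * (cmod z)\<^sup>2) powr (- s)) \<partial>lborel)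
     \<le> ennreal (K * A powr (- s))" if A: "A > 0" for A C :: real and b
  proof -
    \<comment> \<open>Centre for completing the square: the quadratic becomes \<open>A\<close> times
      \<rho> minus the squared distance from \<open>c\<close>.\<close>
    define c where "c = cnj b / of_real (2 * A)"
    define \<rho> where "\<rho> = C / A + (cmod c)\<^sup>2"
    have q: "C + Re (b * z) - A * (cmod z)\<^sup>2 = A * (\<rho> - (cmod (z - c))\<^sup>2)" for z
    proof -
      have bc: "b = of_real (2 * A) * cnj c" using A by (simp add: c_def)
      show ?thesis unfolding bc \<rho>_def cmod_power2 using A by (simp add: power2_eq_square field_simps)
    qed
    define E where "E j = {u. \<rho> - h j < (cmod (u - c))\<^sup>2 \<and> (cmod (u - c))\<^sup>2 \<le> \<rho> - h (Suc j)}" for j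
    have [measurable]: "ball (0::complex) 1 \<in> sets borel" by simp
    have Em [measurable]: "E j \<in> sets borel" for j unfolding E_def by measurable
    have Ea: "emeasure lborel (E j) \<le> ennreal (pi * (h j - h (Suc j)))" for j
    proof -
      have "emeasure lborel (E j) \<le> ennreal (pi * ((\<rho> - h (Suc j)) - (\<rho> - h j)))"
        unfolding E_def using h(1)[of j] by (intro emeasure_annulus_le) (simp add: h(2))
      then show ?thesis by simp
    qed
    have pt: "indicator {z. cmod z < 1 \<and> 0 < C + Re (b * z) - A * (cmod z)\<^sup>2} z * ennreal ((C + Re (b * z) - A * (cmod z)\<^sup>2) powr (- s))
       \<le> ennreal (A powr (- s)) * (indicator (ball 0 1) z + (\<Sum>j. ennreal (h (Suc j) powr (- s)) * indicator (E j) z))" for z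
    proof (cases "cmod z < 1 \<and> 0 < C + Re (b * z) - A * (cmod z)\<^sup>2")
      case True
      define y where "y = \<rho> - (cmod (z - c))\<^sup>2"
      have y: "y > 0" using True A unfolding q y_def by (simp add: zero_less_mult_iff)
      have "ennreal ((A * y) powr (- s)) = ennreal (A powr (- s)) * ennreal (y powr (- s))"
        using A y by (simp add: powr_mult ennreal_mult)
      moreover have "ennreal (y powr (- s)) \<le> indicator (ball 0 1) z + (\<Sum>j. ennreal (h (Suc j) powr (- s)) * indicator (E j) z)"
      proof (cases "y \<ge> 1")
        case y1: True
        have "y powr (- s) \<le> 1" using powr_mono[of "- s" 0 y] y1 s by simp
        then have "ennreal (y powr (- s)) \<le> indicator (ball 0 1) z" using True by (simp add: ennreal_le_1)
        then show ?thesis by (rule order_trans) simp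
      next
        case y1: False
        obtain n where "(1 / 2) ^ n < y" using real_arch_pow_inv[of y "1/2"] y by auto
        then have "h (Suc n) \<le> y" using y unfolding h(2) by (simp add: h_def)
        then have "\<exists>j. h (Suc j) \<le> y" ..
        \<comment> \<open>The first dyadic level at or below \<open>y\<close>; minimality gives
          \<open>y < h j\<close>, with the level 1 as the default for \<open>j = 0\<close>.\<close>
        define j where "j = (LEAST j. h (Suc j) \<le> y)"
        have j1: "h (Suc j) \<le> y" unfolding j_def using \<open>\<exists>j. h (Suc j) \<le> y\<close> by (rule LeastI_ex)
        have j2: "y < h j"
        proof (cases j)
          case 0
          then show ?thesis using y1 by (simp add: h_def)
        next
          case (Suc i)
          then have "\<not> h (Suc i) \<le> y" using not_less_Least[of i "\<lambda>j. h (Suc j) \<le> y"] by (simp add: j_def)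
          then show ?thesis using Suc by simp
        qed
        have zE: "z \<in> E j" using j1 j2 by (simp add: E_def y_def)
        have "y powr (- s) \<le> h (Suc j) powr (- s)"
          using j1 h(1)[of "Suc j"] s by (intro powr_mono2') auto
        then have "ennreal (y powr (- s)) \<le> ennreal (h (Suc j) powr (- s)) * indicator (E j) z"
          using zE by (simp add: ennreal_leI)
        also have "\<dots> \<le> (\<Sum>j. ennreal (h (Suc j) powr (- s)) * indicator (E j) z)"
        proof -
          have "F j \<le> suminf F" for F :: "nat \<Rightarrow> ennreal" using sum_le_suminf[of F "{j}"] by simp
          then show ?thesis .
        qed
        finally show ?thesis by (rule order_trans) simp
      qed
      moreover have ind1: "indicator {z. cmod z < 1 \<and> 0 < C + Re (b * z) - A * (cmod z)\<^sup>2} z = (1::ennreal)"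
        using True by simp
      ultimately show ?thesis unfolding ind1 q y_def[symmetric] by (simp add: mult_left_mono)
    qed simp
    have "(\<integral>\<^sup>+ z. indicator {z. cmod z < 1 \<and> 0 < C + Re (b * z) - A * (cmod z)\<^sup>2} z * ennreal ((C + Re (b * z) - A * (cmod z)\<^sup>2) powr (- s)) \<partial>lborel)
      \<le> (\<integral>\<^sup>+ z. ennreal (A powr (- s)) * (indicator (ball 0 1) z + (\<Sum>j. ennreal (h (Suc j) powr (- s)) * indicator (E j) z)) \<partial>lborel)"
      by (rule nn_integral_mono) (rule pt)
    also have "\<dots> = ennreal (A powr (- s)) * (\<integral>\<^sup>+ z. indicator (ball 0 1) z + (\<Sum>j. ennreal (h (Suc j) powr (- s)) * indicator (E j) z) \<partial>lborel)"
      by (rule nn_integral_cmult) measurable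
    also have "(\<integral>\<^sup>+ z. indicator (ball (0::complex) 1) z + (\<Sum>j. ennreal (h (Suc j) powr (- s)) * indicator (E j) z) \<partial>lborel)
       = (\<integral>\<^sup>+ z. indicator (ball (0::complex) 1) z \<partial>lborel) + (\<integral>\<^sup>+ z. (\<Sum>j. ennreal (h (Suc j) powr (- s)) * indicator (E j) z) \<partial>lborel)"
      by (rule nn_integral_add) measurable
    also have "(\<integral>\<^sup>+ z. (\<Sum>j. ennreal (h (Suc j) powr (- s)) * indicator (E j) z) \<partial>lborel)
       = (\<Sum>j. (\<integral>\<^sup>+ z. ennreal (h (Suc j) powr (- s)) * indicator (E j) z \<partial>lborel))"
      by (rule nn_integral_suminf) measurable
    also have "(\<Sum>j. (\<integral>\<^sup>+ z. ennreal (h (Suc j) powr (- s)) * indicator (E j) z \<partial>lborel)) \<le> (\<Sum>j. ennreal (t j))"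
    proof (rule suminf_le)
      fix j
      have "(\<integral>\<^sup>+ z. ennreal (h (Suc j) powr (- s)) * indicator (E j) z \<partial>lborel) = ennreal (h (Suc j) powr (- s)) * emeasure lborel (E j)"
        by (simp add: nn_integral_cmult_indicator)
      also have "\<dots> \<le> ennreal (h (Suc j) powr (- s)) * ennreal (pi * (h j - h (Suc j)))" by (intro mult_left_mono Ea) simp
      also have "\<dots> = ennreal (t j)" using h(1)[of j] by (simp add: t_def ennreal_mult[symmetric] h(2) mult_ac)
      finally show "(\<integral>\<^sup>+ z. ennreal (h (Suc j) powr (- s)) * indicator (E j) z \<partial>lborel) \<le> ennreal (t j)" .
    qed auto
    also have "(\<Sum>j. ennreal (t j)) = ennreal (suminf t)" by (rule suminf_ennreal2[OF tnn tsum])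
    also have "(\<integral>\<^sup>+ z. indicator (ball (0::complex) 1) z \<partial>lborel) = ennreal pi"
      by (simp add: emeasure_ball unit_ball_vol_2)
    also have "ennreal pi + ennreal (suminf t) = ennreal K" using tsum tnn by (simp add: K_def suminf_nonneg ennreal_plus)
    also have "ennreal (A powr (- s)) * ennreal K = ennreal (K * A powr (- s))" using K by (simp add: ennreal_mult mult.commute)
    finally show ?thesis by (simp add: mult_left_mono add_left_mono)
  qed
  show ?thesis by (rule that[OF K main])
qed

lemma principal_block_Symm: "Z \<in> Symm_complex \<Longrightarrow> principal_block S Z \<in> Symm_complex"
  by (auto simp: Symm_complex_iff principal_block_nth)

text \<open>Passing to a smaller block is compression by a coordinate projection, which does not
  increase norms.\<close>

lemma principal_block_D_III_mono:
  fixes Z :: "complex^'n^'n"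
  assumes ST: "S \<subseteq> T" and W: "principal_block T Z \<in> D_III"
  shows "principal_block S Z \<in> D_III"
proof -
  define W where "W = principal_block T Z"
  define P where "P v = (\<chi> i. if i \<in> S then v $ i else 0)" for v :: "complex^'n"
  have Pn: "norm (P v) \<le> norm v" for v unfolding norm_vec_def by (intro L2_set_mono) (auto simp: P_def)
  have zS: "principal_block S Z = principal_block S W" using ST by (intro mat_eqI) (auto simp: W_def principal_block_nth)
  have act: "cnj_mat (principal_block S W) *v v = P (cnj_mat W *v P v)" for v
    unfolding vec_eq_iff
  proof
    fix i
    show "(cnj_mat (principal_block S W) *v v) $ i = P (cnj_mat W *v P v) $ i"
      unfolding P_def matrix_vector_mult_def by (auto simp: principal_block_nth intro!: sum.cong)
  qed
  have "norm (cnj_mat (principal_block S W) *v v) < norm v" if v: "v \<noteq> 0" for v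
  proof (cases "P v = 0")
    case True
    have "P 0 = 0" by (simp add: P_def vec_eq_iff)
    then show ?thesis using v True by (simp add: act)
  next
    case False
    have "norm (P (cnj_mat W *v P v)) \<le> norm (cnj_mat W *v P v)" by (rule Pn)
    also have "\<dots> < norm (P v)" using W False unfolding W_def[symmetric] D_III_iff by blast
    also have "\<dots> \<le> norm v" by (rule Pn)
    finally show ?thesis by (simp add: act)
  qed
  moreover have "principal_block S W \<in> Symm_complex" using W by (intro principal_block_Symm) (simp add: W_def D_III_iff)
  ultimately show ?thesis by (simp add: zS D_III_iff)
qed

lemma principal_det_pos: "principal_block S Z \<in> D_III \<Longrightarrow> 0 < principal_det S Z"
  unfolding principal_det_def by (rule D_III_det(1))

lemma continuous_on_det:
  assumes "\<And>i j. continuous_on U (\<lambda>x. A x $ i $ j)"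
  shows "continuous_on U (\<lambda>x. det (A x :: complex^'n^'n))"
  unfolding det_def by (intro continuous_intros assms)

lemma principal_block_continuous: "continuous_on UNIV (principal_block S)"
proof (rule continuous_on_matrix_entries)
  fix i j
  show "continuous_on UNIV (\<lambda>Z. principal_block S Z $ i $ j)"
  proof (cases "i \<in> S \<and> j \<in> S")
    case True
    then show ?thesis by (simp add: principal_block_nth continuous_intros)
  next
    case False
    then have "(\<lambda>Z. principal_block S Z $ i $ j) = (\<lambda>Z. 0)" by (auto simp: principal_block_nth)
    then show ?thesis by (simp only: continuous_on_const)
  qed
qed

lemma principal_det_continuous: "continuous_on UNIV (principal_det S)"
proof -
  have e: "(mat 1 - principal_block S Z ** cnj_mat (principal_block S Z)) $ i $ j = mat 1 $ i $ j - (\<Sum>l\<in>UNIV. principal_block S Z $ i $ l * cnj (principal_block S Z $ l $ j))" for Z :: "complex^'a^'a" and i j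
    by (simp add: matrix_matrix_mult_def)
  show ?thesis
    unfolding principal_det_def[abs_def]
    by (intro continuous_on_Re continuous_on_det, unfold e) (intro continuous_intros principal_block_continuous)
qed

text \<open>Induction on \<open>S\<close>, integrating out one diagonal entry at a time. The
  one-variable bound returns the same negative power of the smaller determinant, so \<open>s\<close>
  does not deteriorate. Averaging over translations in the entry (k, k) takes the place of a slicing
  of the measure.\<close>

lemma principal_det_power_integral_finite:
  fixes S :: "'n::finite set"
  assumes s: "0 \<le> s" "s < 1" and S: "finite S"
  shows "(\<integral>\<^sup>+ Z. indicator (ball 0 R \<inter> {Z. principal_block S Z \<in> D_III}) Z * ennreal (principal_det S Z powr (- s)) \<partial>(lebesgue_symm :: (complex^'n^'n) measure)) < top"
  using S
proof (induction S arbitrary: R rule: finite_induct)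
  case empty
  have "(principal_block {} Z) = 0" for Z :: "complex^'n^'n" by (rule mat_eqI) (simp add: principal_block_nth)
  then have "principal_det {} Z = 1" for Z :: "complex^'n^'n" by (simp add: principal_det_def matrix_matrix_mult_def zero_vec_def[symmetric])
  then have "(\<integral>\<^sup>+ Z. indicator (ball 0 R \<inter> {Z. principal_block {} Z \<in> D_III}) Z * ennreal (principal_det {} Z powr (- s)) \<partial>(lebesgue_symm :: (complex^'n^'n) measure))
    \<le> (\<integral>\<^sup>+ Z. indicator (ball 0 R) Z \<partial>(lebesgue_symm :: (complex^'n^'n) measure))"
    by (intro nn_integral_mono) (auto simp: indicator_def)
  also have "\<dots> < top" using emeasure_bounded[OF bounded_ball] by simp
  finally show ?case .
next
  case (insert k S)
  let ?L = "lebesgue_symm :: (complex^'n^'n) measure"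
  let ?T = "insert k S"
  obtain K :: real where K: "K \<ge> 0" "\<And>A C b. A > 0 \<Longrightarrow>
    (\<integral>\<^sup>+ z. indicator {z. cmod z < 1 \<and> 0 < C + Re (b * z) - A * (cmod z)\<^sup>2} z * ennreal ((C + Re (b * z) - A * (cmod z)\<^sup>2) powr (- s)) \<partial>lborel)
     \<le> ennreal (K * A powr (- s))" by (rule quadratic_power_integral[OF s]) blast
  define g where "g Z = indicator (ball 0 R \<inter> {Z. principal_block ?T Z \<in> D_III}) Z * ennreal (principal_det ?T Z powr (- s))" for Z :: "complex^'n^'n"
  have zm: "principal_block U \<in> borel \<rightarrow>\<^sub>M borel" for U :: "'n set" by (rule borel_measurable_continuous_onI[OF principal_block_continuous])
  have set_m: "{Z. principal_block U Z \<in> D_III} \<in> sets borel" for U :: "'n set"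
    using measurable_sets[OF zm[of U] rel_open_borel[OF D_III_rel_open]] by (simp add: vimage_def)
  have phim: "principal_det U \<in> borel_measurable borel" for U :: "'n set" by (rule borel_measurable_continuous_onI[OF principal_det_continuous])
  have gm: "g \<in> borel_measurable borel"
    unfolding g_def using phim[of ?T] set_m[of ?T] by measurable
  \<comment> \<open>The radius grows by 1 because the averaging translates by vectors of norm below
    1; the induction hypothesis holds for every radius.\<close>
  define gS where "gS Z = indicator (ball 0 (R + 1) \<inter> {Z. principal_block S Z \<in> D_III}) Z * ennreal (principal_det S Z powr (- s))" for Z :: "complex^'n^'n"
  have gSm: "gS \<in> borel_measurable borel"
    unfolding gS_def using phim[of S] set_m[of S] by measurable
  have du: "diag_unit k z \<in> Symm_complex" for z by (auto simp: Symm_complex_iff diag_unit_nth)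
  have dun: "norm (diag_unit k z) \<le> cmod z" for z
  proof -
    have "norm (diag_unit k z) \<le> (\<Sum>i\<in>UNIV. \<Sum>j\<in>UNIV. cmod (diag_unit k z $ i $ j))" by (rule matrix_norm_le_sum)
    also have "\<dots> = (\<Sum>i\<in>UNIV. \<Sum>j\<in>UNIV. if i = k then (if j = k then cmod z else 0) else 0)"
      by (intro sum.cong refl) (auto simp: diag_unit_nth)
    also have "\<dots> = (\<Sum>i\<in>UNIV. if i = k then (\<Sum>j\<in>UNIV. if j = k then cmod z else 0) else 0)"
      by (intro sum.cong refl) auto
    also have "\<dots> = cmod z" by simp
    finally show ?thesis .
  qed
  \<comment> \<open>If some translate has nonzero \<open>g\<close>, then \<open>Z\<close> lies in
    the larger ball and its block over \<open>S\<close>, untouched by the translation, lies in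
    \<open>D_III\<close>. Thus the leading coefficient is positive and the quadratic estimate
    applies.\<close>
  have inner: "(\<integral>\<^sup>+ z. indicator (ball (0::complex) 1) z * g (Z + diag_unit k z) \<partial>lborel) \<le> ennreal K * gS Z" for Z
  proof (cases "\<exists>z\<in>ball 0 1. g (Z + diag_unit k z) \<noteq> 0")
    case False
    then have "indicator (ball (0::complex) 1) z * g (Z + diag_unit k z) = 0" for z by (auto simp: indicator_def)
    then show ?thesis by (simp only:) simp
  next
    case True
    then obtain z0 where z0: "cmod z0 < 1" "g (Z + diag_unit k z0) \<noteq> 0" by auto
    then have z0': "norm (Z + diag_unit k z0) < R" "principal_block ?T (Z + diag_unit k z0) \<in> D_III"
      by (auto simp: g_def indicator_def split: if_splits)
    have "norm Z \<le> norm (Z + diag_unit k z0) + norm (diag_unit k z0)"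
      using norm_triangle_ineq4[of "Z + diag_unit k z0" "diag_unit k z0"] by simp
    then have "norm Z < R + 1" using z0'(1) dun[of z0] z0(1) by linarith
    moreover have "principal_block S (Z + diag_unit k z0) = principal_block S Z"
      using insert(2) by (intro mat_eqI) (auto simp: principal_block_nth diag_unit_nth)
    then have ZS: "principal_block S Z \<in> D_III" using principal_block_D_III_mono[OF _ z0'(2), of S] by auto
    ultimately have gS: "gS Z = ennreal (principal_det S Z powr (- s))" by (simp add: gS_def)
    obtain C b where Cb: "\<And>z. principal_det ?T (Z + diag_unit k z) = C + Re (b * z) - principal_det S Z * (cmod z)\<^sup>2"
      by (rule principal_det_quadratic[OF insert(2), of Z]) blast
    have "(\<integral>\<^sup>+ z. indicator (ball (0::complex) 1) z * g (Z + diag_unit k z) \<partial>lborel)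
      \<le> (\<integral>\<^sup>+ z. indicator {z. cmod z < 1 \<and> 0 < C + Re (b * z) - principal_det S Z * (cmod z)\<^sup>2} z * ennreal ((C + Re (b * z) - principal_det S Z * (cmod z)\<^sup>2) powr (- s)) \<partial>lborel)"
    proof (rule nn_integral_mono)
      fix z
      show "indicator (ball (0::complex) 1) z * g (Z + diag_unit k z)
        \<le> indicator {z. cmod z < 1 \<and> 0 < C + Re (b * z) - principal_det S Z * (cmod z)\<^sup>2} z * ennreal ((C + Re (b * z) - principal_det S Z * (cmod z)\<^sup>2) powr (- s))"
      proof (cases "cmod z < 1 \<and> principal_block ?T (Z + diag_unit k z) \<in> D_III")
        case True
        then have "0 < C + Re (b * z) - principal_det S Z * (cmod z)\<^sup>2" using principal_det_pos[of ?T "Z + diag_unit k z"] unfolding Cb by simp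
        then show ?thesis using True by (auto simp: g_def indicator_def Cb)
      next
        case False
        then show ?thesis by (auto simp: g_def indicator_def)
      qed
    qed
    also have "\<dots> \<le> ennreal (K * principal_det S Z powr (- s))" by (rule K(2)[OF principal_det_pos[OF ZS]])
    also have "\<dots> = ennreal K * gS Z" using K(1) by (simp add: gS ennreal_mult)
    finally show ?thesis .
  qed
  interpret P: pair_sigma_finite ?L "lborel :: complex measure" ..
  have joint: "(\<lambda>x. indicator (ball (0::complex) 1) (snd x) * g (fst x + diag_unit k (snd x))) \<in> borel_measurable (?L \<Otimes>\<^sub>M lborel)"
  proof (intro borel_measurable_times_ennreal)
    show "(\<lambda>x. indicator (ball (0::complex) 1) (snd x)) \<in> borel_measurable (?L \<Otimes>\<^sub>M lborel)"
      by (rule measurable_compose[OF measurable_snd borel_measurable_indicator]) simp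
    have "continuous_on UNIV (\<lambda>x :: (complex^'n^'n) \<times> complex. diag_unit k (snd x))"
    proof (rule continuous_on_matrix_entries)
      fix i j
      show "continuous_on UNIV (\<lambda>x :: (complex^'n^'n) \<times> complex. diag_unit k (snd x) $ i $ j)"
        by (cases "i = k \<and> j = k") (auto simp: diag_unit_nth intro!: continuous_intros)
    qed
    then have "continuous_on UNIV (\<lambda>x :: (complex^'n^'n) \<times> complex. fst x + diag_unit k (snd x))"
      by (intro continuous_intros)
    then have "(\<lambda>x :: (complex^'n^'n) \<times> complex. fst x + diag_unit k (snd x)) \<in> borel \<rightarrow>\<^sub>M borel"
      by (rule borel_measurable_continuous_onI)
    moreover have "sets (?L \<Otimes>\<^sub>M lborel) = sets (borel :: ((complex^'n^'n) \<times> complex) measure)"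
      by (subst borel_prod[symmetric]) (intro sets_pair_measure_cong; simp)
    ultimately have "(\<lambda>x. fst x + diag_unit k (snd x)) \<in> (?L \<Otimes>\<^sub>M lborel) \<rightarrow>\<^sub>M borel"
      by (simp cong: measurable_cong_sets)
    from measurable_compose[OF this gm]
    show "(\<lambda>x. g (fst x + diag_unit k (snd x))) \<in> borel_measurable (?L \<Otimes>\<^sub>M lborel)" .
  qed
  \<comment> \<open>\<pi> is the area of the disc of translations; every translate of
    \<open>g\<close> has the same integral.\<close>
  have "ennreal pi * (\<integral>\<^sup>+ Z. g Z \<partial>?L) = (\<integral>\<^sup>+ z. indicator (ball (0::complex) 1) z * (\<integral>\<^sup>+ Z. g Z \<partial>?L) \<partial>lborel)"
    by (subst nn_integral_multc) (auto simp: emeasure_ball unit_ball_vol_2)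
  also have "\<dots> = (\<integral>\<^sup>+ z. (\<integral>\<^sup>+ Z. indicator (ball (0::complex) 1) z * g (Z + diag_unit k z) \<partial>?L) \<partial>lborel)"
  proof (rule nn_integral_cong)
    fix z
    have "(\<lambda>Z. g (Z + diag_unit k z)) \<in> borel_measurable ?L" using gm by measurable
    then have "(\<integral>\<^sup>+ Z. indicator (ball (0::complex) 1) z * g (Z + diag_unit k z) \<partial>?L) = indicator (ball (0::complex) 1) z * (\<integral>\<^sup>+ Z. g (Z + diag_unit k z) \<partial>?L)"
      by (rule nn_integral_cmult)
    also have "(\<integral>\<^sup>+ Z. g (Z + diag_unit k z) \<partial>?L) = (\<integral>\<^sup>+ Z. g Z \<partial>?L)" by (rule nn_integral_translate[OF du gm])
    finally show "indicator (ball (0::complex) 1) z * (\<integral>\<^sup>+ Z. g Z \<partial>?L) = (\<integral>\<^sup>+ Z. indicator (ball (0::complex) 1) z * g (Z + diag_unit k z) \<partial>?L)" ..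
  qed
  also have "\<dots> = (\<integral>\<^sup>+ Z. (\<integral>\<^sup>+ z. indicator (ball (0::complex) 1) z * g (Z + diag_unit k z) \<partial>lborel) \<partial>?L)"
    using P.Fubini'[of "\<lambda>Z z. indicator (ball (0::complex) 1) z * g (Z + diag_unit k z)"] joint
    by (simp add: case_prod_beta')
  also have "\<dots> \<le> (\<integral>\<^sup>+ Z. ennreal K * gS Z \<partial>?L)" by (rule nn_integral_mono) (rule inner)
  also have "\<dots> = ennreal K * (\<integral>\<^sup>+ Z. gS Z \<partial>?L)" by (rule nn_integral_cmult) (use gSm in simp)
  also have "\<dots> < top" using insert.IH[of "R + 1"] unfolding gS_def by (simp add: ennreal_mult_less_top)
  finally have "ennreal pi * (\<integral>\<^sup>+ Z. g Z \<partial>?L) < top" .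
  then have "(\<integral>\<^sup>+ Z. g Z \<partial>?L) < top" by (auto simp: ennreal_mult_less_top)
  then show ?case unfolding g_def .
qed

abbreviation D_III_weight :: "real \<Rightarrow> complex^'n^'n \<Rightarrow> real" where
  "D_III_weight lam Z \<equiv> Re (det (mat 1 - Z ** cnj_mat Z)) powr (lam - real CARD('n) - 1)"

lemma principal_det_UNIV: "principal_det UNIV Z = Re (det (mat 1 - Z ** cnj_mat Z))"
proof -
  have "principal_block UNIV Z = Z" by (rule mat_eqI) (simp add: principal_block_nth)
  then show ?thesis by (simp add: principal_det_def)
qed

lemma D_III_weight_continuous: "continuous_on D_III (D_III_weight lam)"
proof -
  have "continuous_on D_III (\<lambda>Z :: complex^'a^'a. principal_det UNIV Z powr (lam - real CARD('a) - 1))"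
    using D_III_det(1)
    by (intro continuous_on_powr continuous_on_subset[OF principal_det_continuous] continuous_intros) (force simp: principal_det_UNIV)+
  then show ?thesis by (simp add: principal_det_UNIV)
qed

text \<open>Makes the normalisation in \<open>D_III_measure\<close> meaningful: infinite mass would
  give the zero measure. For a positive exponent the weight is bounded; otherwise the exponent lies
  in (-1, 0] and the inductive estimate is used.\<close>

lemma D_III_weighted_emeasure:
  assumes lam: "lam > real CARD('n::finite)"
  defines "I \<equiv> emeasure (D_III_weighted lam) (D_III :: (complex^'n^'n) set)"
  shows "0 < I" "I < top"
proof -
  let ?L = "lebesgue_symm :: (complex^'n^'n) measure"
  let ?D = "D_III :: (complex^'n^'n) set"
  define e where "e = lam - real CARD('n) - 1"
  have Db: "?D \<in> sets borel" by (rule rel_open_borel[OF D_III_rel_open])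
  have wm: "(\<lambda>Z :: complex^'n^'n. ennreal (principal_det UNIV Z powr e)) \<in> borel_measurable borel"
    using borel_measurable_continuous_onI[OF principal_det_continuous, of "UNIV :: 'n set"] by measurable
  have I: "I = (\<integral>\<^sup>+ Z. indicator ?D Z * ennreal (principal_det UNIV Z powr e) \<partial>?L)"
  proof -
    have s: "?D \<in> sets (restrict_space ?L ?D)" using Db by (simp add: sets_restrict_space_iff)
    have m: "(\<lambda>Z. ennreal (principal_det UNIV Z powr e)) \<in> borel_measurable (restrict_space ?L ?D)"
      using wm by (intro measurable_restrict_space1) simp
    have "I = (\<integral>\<^sup>+ Z. ennreal (principal_det UNIV Z powr e) * indicator ?D Z \<partial>restrict_space ?L ?D)"
      unfolding I_def D_III_weighted_def using emeasure_density[OF m s] by (simp add: principal_det_UNIV e_def)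
    also have "\<dots> = (\<integral>\<^sup>+ Z. ennreal (principal_det UNIV Z powr e) * indicator ?D Z * indicator ?D Z \<partial>?L)"
      using Db by (subst nn_integral_restrict_space) auto
    also have "\<dots> = (\<integral>\<^sup>+ Z. indicator ?D Z * ennreal (principal_det UNIV Z powr e) \<partial>?L)"
      by (intro nn_integral_cong) (auto simp: indicator_def)
    finally show ?thesis .
  qed
  show "0 < I"
  proof (rule ccontr)
    assume "\<not> 0 < I"
    then have "(\<integral>\<^sup>+ Z. indicator ?D Z * ennreal (principal_det UNIV Z powr e) \<partial>?L) = 0" unfolding I by simp
    then have "AE Z in ?L. indicator ?D Z * ennreal (principal_det UNIV Z powr e) = 0"
      using wm Db by (subst (asm) nn_integral_0_iff_AE) (auto intro!: borel_measurable_times_ennreal borel_measurable_indicator)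
    then have "AE Z in ?L. Z \<notin> ?D"
    proof (rule AE_mp, intro AE_I2 impI notI)
      fix Z :: "complex^'n^'n" assume "indicator ?D Z * ennreal (principal_det UNIV Z powr e) = 0" "Z \<in> ?D"
      then show False using D_III_det(1)[of Z] by (simp add: principal_det_UNIV)
    qed
    then have "emeasure ?L ?D = 0" using Db by (subst AE_iff_measurable[symmetric, where P = "\<lambda>Z. Z \<notin> ?D"]) auto
    then show False using D_III_emeasure(1)[where 'n = 'n] by simp
  qed
  obtain R where R: "?D \<subseteq> ball 0 R" using bounded_subset_ballD[OF D_III_bounded, of 0] by blast
  have zU: "principal_block UNIV Z = Z" for Z :: "complex^'n^'n" by (rule mat_eqI) (simp add: principal_block_nth)
  show "I < top"
  proof (cases "e \<le> 0")
    case True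
    define s where "s = - e"
    \<comment> \<open>The bound \<open>s < 1\<close> is the hypothesis that \<open>lam\<close>
      exceeds n.\<close>
    have s: "0 \<le> s" "s < 1" "e = - s" using True lam by (auto simp: s_def e_def)
    have eq: "ball 0 R \<inter> {Z. principal_block UNIV Z \<in> ?D} = ?D" using R by (auto simp: zU)
    show ?thesis unfolding I s(3) using principal_det_power_integral_finite[OF s(1,2) finite_class.finite_UNIV[where 'a = 'n], of R] unfolding eq .
  next
    case False
    have "compact (principal_det UNIV ` cball (0 :: complex^'n^'n) R)"
      by (intro compact_continuous_image continuous_on_subset[OF principal_det_continuous]) auto
    then have "bounded (principal_det UNIV ` cball (0 :: complex^'n^'n) R)" by (rule compact_imp_bounded)
    then obtain B where B0: "\<forall>x\<in>principal_det UNIV ` cball (0 :: complex^'n^'n) R. norm x \<le> B" unfolding bounded_iff ..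
    have B: "\<bar>principal_det UNIV Z\<bar> \<le> B" if "Z \<in> cball 0 R" for Z :: "complex^'n^'n"
      using bspec[OF B0 imageI[OF that]] by simp
    have "I \<le> (\<integral>\<^sup>+ Z. ennreal (B powr e) * indicator ?D Z \<partial>?L)"
      unfolding I
    proof (rule nn_integral_mono)
      fix Z :: "complex^'n^'n"
      show "indicator ?D Z * ennreal (principal_det UNIV Z powr e) \<le> ennreal (B powr e) * indicator ?D Z"
      proof (cases "Z \<in> ?D")
        case True
        then have "0 < principal_det UNIV Z" "principal_det UNIV Z \<le> B" using D_III_det(1)[of Z] B[of Z] R by (auto simp: principal_det_UNIV)
        then show ?thesis using True False by (simp add: ennreal_leI powr_mono2)
      qed simp
    qed
    also have "\<dots> = ennreal (B powr e) * emeasure ?L ?D" using Db by (simp add: nn_integral_cmult_indicator)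
    also have "\<dots> < top" using D_III_emeasure(2)[where 'n = 'n] by (simp add: ennreal_mult_less_top)
    finally show ?thesis .
  qed
qed

section \<open>The three actions\<close>

lemma holomorphic_symm_congruence: "holomorphic_symm (\<lambda>Z :: complex^'n^'n. (A ** Z ** B) $ i $ j) D"
  unfolding matrix_congruence_nth
  by (intro holomorphic_symm_sum holomorphic_symm_mult holomorphic_symm_const holomorphic_symm_entry)

text \<open>Unitary congruences preserve both Lebesgue measure and the weight, so all scaling
  factors and the multiplier are 1.\<close>

lemma elliptic_commutative:
  assumes lam: "lam > real CARD('n::finite)"
  shows "commutative_operators
           (bergman_space D_III (D_III_measure lam))
           (toeplitz_algebra (D_III :: (complex^'n^'n) set) (D_III_measure lam)
             (moment_symbols D_III mu_T))"
proof -
  let ?D = "D_III :: (complex^'n^'n) set"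
  let ?I = "emeasure (D_III_weighted lam) ?D"
  have I: "0 < ?I" "?I < top" using D_III_weighted_emeasure[OF lam] by auto
  interpret weighted_bergman ?D "D_III_weight lam" "inverse ?I" "D_III_measure lam"
  proof
    show "rel_open ?D" by (rule D_III_rel_open)
    show "convex ?D" by (rule D_III_convex)
    show "continuous_on ?D (D_III_weight lam)" by (rule D_III_weight_continuous)
    show "0 < D_III_weight lam Z" if "Z \<in> ?D" for Z using D_III_det(1)[OF that] by simp
    show "0 < inverse ?I" using I(2) by (simp add: ennreal_inverse_positive less_top)
    show "inverse ?I < top" using I(1) by (auto simp: less_top[symmetric] ennreal_inverse_eq_top_iff)
    show "D_III_measure lam = scale_measure (inverse ?I) (density (restrict_space lebesgue_symm ?D) (\<lambda>Z. ennreal (D_III_weight lam Z)))"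
      by (simp add: D_III_measure_def D_III_weighted_def)
  qed
  define G where "G = {\<lambda>Z. V ** Z ** transpose V | V :: complex^'n^'n. V ** transpose (cnj_mat V) = mat 1}"
  have tc: "transpose (cnj_mat V) ** V = mat 1" if "V ** transpose (cnj_mat V) = mat 1" for V :: "complex^'n^'n"
    by (rule matrix_mult_eq_one_commute[OF that])
  have adj: "transpose (cnj_mat V) ** transpose (cnj_mat (transpose (cnj_mat V))) = mat 1"
    if "V ** transpose (cnj_mat V) = mat 1" for V :: "complex^'n^'n"
    using tc[OF that] by (simp add: cnj_mat_transpose)
  have comp: "U ** (V ** Z ** transpose V) ** transpose U = Z" if "U ** V = mat 1" for U V Z :: "complex^'n^'n"
  proof -
    have "transpose V ** transpose U = mat 1" using that by (metis matrix_transpose_mul transpose_mat)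
    moreover have "U ** (V ** Z ** transpose V) ** transpose U = (U ** V) ** Z ** (transpose V ** transpose U)"
      by (simp add: matrix_mul_assoc)
    ultimately show ?thesis using that by simp
  qed
  have Symm_back: "Z \<in> ?D" if V: "V ** transpose (cnj_mat V) = mat 1" and Z: "V ** Z ** transpose V \<in> ?D" for V Z :: "complex^'n^'n"
    using unitary_D_III[OF adj[OF V] Z] unfolding comp[OF tc[OF V]] .
  have sc: "scaling (\<lambda>Z. V ** Z ** transpose V) 1" if V: "V ** transpose (cnj_mat V) = mat 1" for V :: "complex^'n^'n"
  proof -
    have "scaling (\<lambda>Z. V ** Z ** transpose V) (1 / 1)"
    proof (rule scalingI)
      show "V ** Z ** transpose V \<in> ?D" if "Z \<in> ?D" for Z by (rule unitary_D_III[OF V that])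
      show "holomorphic_symm (\<lambda>Z. (V ** Z ** transpose V) $ i $ j) ?D" for i j by (rule holomorphic_symm_congruence)
      show "Z \<in> ?D" if "V ** Z ** transpose V \<in> ?D" for Z by (rule Symm_back[OF V that])
      show "D_III_weight lam (V ** Z ** transpose V) = 1 * D_III_weight lam Z" for Z by (simp add: unitary_det[OF V])
      show "(\<lambda>Z. V ** Z ** transpose V) \<in> borel \<rightarrow>\<^sub>M borel"
        by (rule borel_measurable_continuous_onI[OF continuous_congruence])
      show "(\<integral>\<^sup>+ Z. f (V ** Z ** transpose V) \<partial>L) = ennreal 1 * (\<integral>\<^sup>+ Z. f Z \<partial>L)"
        if "f \<in> borel_measurable borel" for f :: "complex^'n^'n \<Rightarrow> ennreal"
        by (rule scales_lebesgueD[OF unitary_scales_lebesgue[OF V] that])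
    qed auto
    then show ?thesis by simp
  qed
  have orbit: "\<exists>V. V ** transpose (cnj_mat V) = mat 1 \<and> cnj_mat Z = V ** Z ** transpose V" if "Z \<in> ?D" for Z
  proof -
    have "transpose Z = Z" using that by (simp add: D_III_def Symm_complex_def)
    then obtain V :: "complex^'n^'n" where "V ** transpose (cnj_mat V) = mat 1" "V ** Z ** transpose V = cnj_mat Z"
      by (rule conjugate_unitary_congruence)
    then show ?thesis by auto
  qed
  show ?thesis
  proof (rule commutative_moment_symbols)
    show "action_group G"
      unfolding action_group_def
    proof
      fix h assume "h \<in> G"
      then obtain V :: "complex^'n^'n" where V: "V ** transpose (cnj_mat V) = mat 1" and h: "h = (\<lambda>Z. V ** Z ** transpose V)"
        by (auto simp: G_def)
      define h' where "h' = (\<lambda>Z. transpose (cnj_mat V) ** Z ** transpose (transpose (cnj_mat V)))"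
      have "h' \<in> G" unfolding G_def h'_def using adj[OF V] by blast
      moreover have "h (h' Z) = Z \<and> h' (h Z) = Z" for Z
        unfolding h h'_def using comp[OF V] comp[OF tc[OF V]] by auto
      ultimately have "\<exists>h'\<in>G. \<forall>Z\<in>?D. h (h' Z) = Z \<and> h' (h Z) = Z" by auto
      moreover have "\<forall>Z\<in>?D. h Z \<in> ?D" unfolding h using unitary_D_III[OF V] by auto
      moreover have "\<forall>i j. holomorphic_symm (\<lambda>Z. h Z $ i $ j) ?D" unfolding h using holomorphic_symm_congruence by auto
      moreover have "\<exists>c. scaling h c" unfolding h using sc[OF V] by auto
      ultimately show "(\<forall>Z\<in>?D. h Z \<in> ?D) \<and> (\<forall>i j. holomorphic_symm (\<lambda>Z. h Z $ i $ j) ?D) \<and>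
        (\<exists>c. scaling h c) \<and> (\<exists>h'\<in>G. \<forall>Z\<in>?D. h (h' Z) = Z \<and> h' (h Z) = Z)" by simp
    qed
    show "mu_T (h Z) = mu_T Z" if "h \<in> G" "Z \<in> ?D" for h Z
      using that by (auto simp: G_def mu_T_unitary)
    show "cnj_mat z \<in> ?D" if z: "z \<in> ?D" for z
    proof -
      obtain V :: "complex^'n^'n" where "V ** transpose (cnj_mat V) = mat 1" "cnj_mat z = V ** z ** transpose V" using orbit[OF z] by blast
      then show ?thesis using unitary_D_III z by simp
    qed
    show "cnj_mat (cnj_mat z) = z" for z :: "complex^'n^'n" by simp
    show "holomorphic_symm (\<lambda>Z. cnj (cnj_mat Z $ i $ j)) ?D" for i j by (simp add: holomorphic_symm_entry)
    show "holomorphic_symm (\<lambda>_. 1) ?D" by (rule holomorphic_symm_const)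
    show "(1 :: complex) \<noteq> 0" by simp
    show "\<exists>h\<in>G. \<exists>c. scaling h c \<and> cnj_mat z = h z \<and> c * (cmod 1)\<^sup>2 = 1" if z: "z \<in> ?D" for z
    proof -
      obtain V :: "complex^'n^'n" where V: "V ** transpose (cnj_mat V) = mat 1" "cnj_mat z = V ** z ** transpose V" using orbit[OF z] by blast
      have "(\<lambda>Z. V ** Z ** transpose V) \<in> G" using V(1) by (auto simp: G_def)
      moreover have "scaling (\<lambda>Z. V ** Z ** transpose V) 1 \<and> cnj_mat z = V ** z ** transpose V \<and> 1 * (cmod 1)\<^sup>2 = 1"
        using sc[OF V(1)] V(2) by simp
      ultimately show ?thesis by (intro bexI[of _ "\<lambda>Z. V ** Z ** transpose V"] exI[of _ 1])
    qed
  qed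
qed

lemma Siegel_Im_det:
  fixes Z :: "complex^'n^'n"
  assumes Z: "Z \<in> Siegel"
  shows "det (Im_mat Z) \<noteq> 0"
proof (rule det_nonzero_of_kernel, rule ccontr)
  fix x assume "Im_mat Z *v x = 0" "x \<noteq> 0"
  then show False using Z by (auto simp: Siegel_iff)
qed

abbreviation Siegel_weight :: "real \<Rightarrow> complex^'n^'n \<Rightarrow> real" where
  "Siegel_weight lam Z \<equiv> Re (det (\<chi> i j. - \<i> * (Z $ i $ j - cnj (Z $ i $ j)))) powr (lam - real CARD('n) - 1)"

lemma Siegel_weight_det: "Re (det (\<chi> i j. - \<i> * (Z $ i $ j - cnj (Z $ i $ j)))) = det (2 *\<^sub>R Im_mat (Z :: complex^'n^'n))"
proof -
  have "(\<chi> i j. - \<i> * (Z $ i $ j - cnj (Z $ i $ j))) = cmat (2 *\<^sub>R Im_mat Z)"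
    by (rule mat_eqI) (simp add: complex_eq_iff)
  then show ?thesis by (simp add: det_cmat)
qed

lemma Siegel_det_pos:
  fixes Z :: "complex^'n^'n"
  assumes Z: "Z \<in> Siegel"
  shows "0 < det (2 *\<^sub>R Im_mat Z)"
proof -
  \<comment> \<open>The segment from the identity to \<open>2 *\<^sub>R Im_mat Z\<close> consists of
    positive definite, hence invertible, matrices.\<close>
  define B where "B t = (1 - t) *\<^sub>R mat 1 + t *\<^sub>R (2 *\<^sub>R Im_mat Z)" for t :: real
  have nz: "det (B t) \<noteq> 0" if t: "t \<in> {0..1}" for t
  proof (rule det_nonzero_of_kernel, rule ccontr)
    fix x assume Bx: "B t *v x = 0" and x: "x \<noteq> 0"
    have "B t *v x = (1 - t) *\<^sub>R x + (2 * t) *\<^sub>R (Im_mat Z *v x)"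
      by (simp add: B_def matrix_vector_mult_add_rdistrib scaleR_matrix_vector_assoc[symmetric])
    then have "0 = (1 - t) * (x \<bullet> x) + 2 * t * (x \<bullet> (Im_mat Z *v x))"
      using Bx by (metis inner_add_right inner_scaleR_right inner_zero_right)
    moreover have "x \<bullet> x > 0" "x \<bullet> (Im_mat Z *v x) > 0" using x Z by (auto simp: Siegel_iff)
    moreover have "0 \<le> (1 - t) * (x \<bullet> x)" "0 \<le> 2 * t * (x \<bullet> (Im_mat Z *v x))"
      using t calculation(2,3) by auto
    ultimately have "(1 - t) * (x \<bullet> x) = 0" "2 * t * (x \<bullet> (Im_mat Z *v x)) = 0" by linarith+
    then show False using \<open>x \<bullet> x > 0\<close> \<open>x \<bullet> (Im_mat Z *v x) > 0\<close> by auto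
  qed
  have "0 < Re (det (cmat (B 1)))"
  proof (rule det_positive_path)
    show "continuous_on {0..1} (\<lambda>t. cmat (B t) $ i $ j)" for i j
      by (auto simp: B_def intro!: continuous_intros)
    show "Im (det (cmat (B t))) = 0" for t by (simp add: det_cmat)
    show "det (cmat (B t)) \<noteq> 0" if "t \<in> {0..1}" for t using nz[OF that] by (simp add: det_cmat)
    show "0 < Re (det (cmat (B 0)))" by (simp add: B_def det_I)
  qed
  then show ?thesis by (simp add: det_cmat B_def)
qed

lemma Siegel_weight_continuous: "continuous_on Siegel (Siegel_weight lam :: complex^'n^'n \<Rightarrow> real)"
  unfolding Siegel_weight_det
proof (intro continuous_on_powr continuous_on_const)
  show "continuous_on Siegel (\<lambda>Z :: complex^'n^'n. det (2 *\<^sub>R Im_mat Z))"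
    unfolding det_def by (simp add: continuous_intros)
  show "\<forall>Z\<in>Siegel. det (2 *\<^sub>R Im_mat (Z :: complex^'n^'n)) \<noteq> 0" using Siegel_det_pos by force
qed

lemma weighted_bergman_Siegel:
  assumes c: "c > 0"
  shows "weighted_bergman (Siegel :: (complex^'n^'n) set) (Siegel_weight lam) (ennreal c) (Siegel_measure c lam)"
proof
  show "rel_open (Siegel :: (complex^'n^'n) set)" by (rule Siegel_rel_open)
  show "convex (Siegel :: (complex^'n^'n) set)" by (rule Siegel_convex)
  show "continuous_on (Siegel :: (complex^'n^'n) set) (Siegel_weight lam)" by (rule Siegel_weight_continuous)
  show "0 < Siegel_weight lam Z" if "Z \<in> Siegel" for Z :: "complex^'n^'n"
    using Siegel_det_pos[OF that] unfolding Siegel_weight_det by simp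
  show "Siegel_measure c lam = scale_measure (ennreal c)
      (density (restrict_space lebesgue_symm (Siegel :: (complex^'n^'n) set)) (\<lambda>Z. ennreal (Siegel_weight lam Z)))"
    by (simp add: Siegel_measure_def)
qed (use c in auto)

lemma Im_mat_congr: "Im_mat (congr A Z) = A ** Im_mat Z ** transpose A"
  and Re_mat_congr: "Re_mat (congr A Z) = A ** Re_mat Z ** transpose A"
  unfolding congr_def cmat_transpose[symmetric] by (simp_all add: Im_mat_congruence Re_mat_congruence)

text \<open>The product under the trace changes by a similarity, since the inverse transforms
  contragrediently.\<close>

lemma mu_R_congr:
  fixes A :: "real^'n^'n"
  assumes A: "det A \<noteq> 0" and Z: "Z \<in> Siegel"
  shows "mu_R (congr A Z) = mu_R Z"
proof -
  define P where "P = matrix_inv (Im_mat Z)"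
  define B where "B = matrix_inv A"
  have P: "Im_mat Z ** P = mat 1" unfolding P_def by (rule matrix_inv_det[OF Siegel_Im_det[OF Z]])
  have AB: "A ** B = mat 1" unfolding B_def by (rule matrix_inv_det[OF A])
  have BA: "B ** A = mat 1" by (rule matrix_mult_eq_one_commute[OF AB])
  have T: "transpose A ** transpose B = mat 1" using BA by (metis matrix_transpose_mul transpose_mat)
  have "Im_mat (congr A Z) ** (transpose B ** P ** B) = A ** (Im_mat Z ** (transpose A ** transpose B) ** P) ** B"
    unfolding Im_mat_congr by (simp only: matrix_mul_assoc)
  also have "\<dots> = mat 1" by (simp add: T P AB)
  finally have inv: "matrix_inv (Im_mat (congr A Z)) = transpose B ** P ** B" by (rule matrix_inv_eqI)
  have "trace (transpose B ** P ** B ** (A ** Re_mat Z ** transpose A)) = trace (transpose B ** (P ** (B ** A) ** Re_mat Z ** transpose A))"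
    by (simp only: matrix_mul_assoc)
  also have "\<dots> = trace (P ** (B ** A) ** Re_mat Z ** transpose A ** transpose B)"
    by (rule trace_mul_sym)
  also have "\<dots> = trace (P ** (B ** A) ** Re_mat Z ** (transpose A ** transpose B))" by (simp only: matrix_mul_assoc)
  also have "\<dots> = trace (P ** Re_mat Z)" by (simp add: BA T)
  finally show ?thesis by (simp add: mu_R_def inv Re_mat_congr P_def)
qed

lemma Siegel_weight_congr:
  fixes A :: "real^'n^'n"
  assumes A: "det A \<noteq> 0" and Z: "Z \<in> Siegel"
  shows "Siegel_weight lam (congr A Z) = \<bar>det A\<bar> powr (2 * (lam - real CARD('n) - 1)) * Siegel_weight lam Z"
proof -
  have "2 *\<^sub>R (A ** Im_mat Z ** transpose A) = A ** (2 *\<^sub>R Im_mat Z) ** transpose A"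
    by (rule mat_eqI) (simp add: matrix_congruence_nth sum_distrib_left mult_ac)
  then have "det (2 *\<^sub>R Im_mat (congr A Z)) = \<bar>det A\<bar> powr 2 * det (2 *\<^sub>R Im_mat Z)"
    using A by (simp add: Im_mat_congr det_mul power2_eq_square mult_ac)
  then show ?thesis
    unfolding Siegel_weight_det using Siegel_det_pos[OF Z] by (simp only: powr_mult powr_powr)
qed

lemma congr_Siegel: "det A \<noteq> 0 \<Longrightarrow> Z \<in> Siegel \<Longrightarrow> congr A Z \<in> Siegel"
  unfolding congr_def by (rule Siegel_congruence)

text \<open>Cramer's rule writes each entry of the inverse as a quotient of determinants of
  holomorphic matrices.\<close>

lemma holomorphic_symm_matrix_inv:
  assumes "\<And>Z. Z \<in> D \<Longrightarrow> det (Z :: complex^'n^'n) \<noteq> 0"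
  shows "holomorphic_symm (\<lambda>Z. matrix_inv Z $ i $ j) D"
proof -
  have cr: "matrix_inv Z $ i $ j = det (\<chi> k l. if l = i then axis j 1 $ k else Z $ k $ l) / det Z" if Z: "Z \<in> D" for Z
  proof -
    have "Z *v column j (matrix_inv Z) = axis j 1"
    proof -
      have "Z *v column j (matrix_inv Z) = column j (Z ** matrix_inv Z)"
        by (simp add: vec_eq_iff column_def matrix_matrix_mult_def matrix_vector_mult_def)
      also have "\<dots> = axis j 1" using matrix_inv_det[OF assms[OF Z]] by (simp add: vec_eq_iff column_def mat_def axis_def)
      finally show ?thesis .
    qed
    then have "column j (matrix_inv Z) = (\<chi> m. det (\<chi> k l. if l = m then axis j 1 $ k else Z $ k $ l) / det Z)"
      using cramer[OF assms[OF Z]] by blast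
    from arg_cong[OF this, of "\<lambda>x. x $ i"] show ?thesis by (simp add: column_def)
  qed
  have "holomorphic_symm (\<lambda>Z. (\<chi> k l. if l = i then axis j 1 $ k else Z $ k $ l :: complex^'n^'n) $ k $ l) D" for k l
    by (cases "l = i") (simp_all add: holomorphic_symm_const holomorphic_symm_entry)
  then have "holomorphic_symm (\<lambda>Z. det (\<chi> k l. if l = i then axis j 1 $ k else Z $ k $ l :: complex^'n^'n) / det Z) D"
    by (intro holomorphic_symm_divide holomorphic_symm_det holomorphic_symm_entry assms)
  moreover have "holomorphic_symm (\<lambda>Z. matrix_inv Z $ i $ j) D = holomorphic_symm (\<lambda>Z. det (\<chi> k l. if l = i then axis j 1 $ k else Z $ k $ l :: complex^'n^'n) / det Z) D"
    by (rule holomorphic_symm_cong) (rule cr)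
  ultimately show ?thesis by simp
qed

lemma hyperbolic_commutative:
  assumes c: "c > 0"
  shows "commutative_operators
           (bergman_space Siegel (Siegel_measure c lam))
           (toeplitz_algebra (Siegel :: (complex^'n^'n) set) (Siegel_measure c lam)
             (moment_symbols Siegel mu_R))"
proof -
  let ?D = "Siegel :: (complex^'n^'n) set"
  interpret weighted_bergman ?D "Siegel_weight lam" "ennreal c" "Siegel_measure c lam"
    by (rule weighted_bergman_Siegel[OF c])
  define e where "e = lam - real CARD('n) - 1"
  \<comment> \<open>The first summand is the exponent of the Lebesgue factor, the second that of the
    weight. As the real dimension is n(n + 1), the sum is 2 lam, and the multiplier below has the
    modulus of det Z to the power -lam.\<close>
  define kappa where "kappa = 2 * real (card (symm_basis :: (complex^'n^'n) set)) / real CARD('n) + 2 * e"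
  define G where "G = {congr A | A :: real^'n^'n. det A \<noteq> 0}"
  have inverse: "matrix_inv A ** A = mat 1" "A ** matrix_inv A = mat 1" "det (matrix_inv A) \<noteq> 0"
    if "det A \<noteq> 0" for A :: "real^'n^'n"
  proof -
    show 1: "A ** matrix_inv A = mat 1" by (rule matrix_inv_det[OF that])
    then show "matrix_inv A ** A = mat 1" by (rule matrix_mult_eq_one_commute)
    have "det A * det (matrix_inv A) = 1" using arg_cong[OF 1, of det] by (simp add: det_mul det_I)
    then show "det (matrix_inv A) \<noteq> 0" by auto
  qed
  have inverse_act: "congr (matrix_inv A) (congr A Z) = Z" "congr A (congr (matrix_inv A) Z) = Z" if "det A \<noteq> 0" for A :: "real^'n^'n" and Z
    using inverse[OF that] by (simp_all add: congr_mult[symmetric])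
  have holo: "holomorphic_symm (\<lambda>Z. congr A Z $ i $ j) ?D" for A :: "real^'n^'n" and i j
    unfolding congr_def by (rule holomorphic_symm_congruence)
  have sc: "scaling (congr A) (\<bar>det A\<bar> powr (- kappa))" if A: "det A \<noteq> 0" for A :: "real^'n^'n"
  proof -
    have "scaling (congr A) (congr_factor A / \<bar>det A\<bar> powr (2 * e))"
    proof (rule scalingI)
      show "congr A Z \<in> ?D" if "Z \<in> ?D" for Z by (rule congr_Siegel[OF A that])
      show "holomorphic_symm (\<lambda>Z. congr A Z $ i $ j) ?D" for i j by (rule holo)
      show "Z \<in> ?D" if "congr A Z \<in> ?D" for Z
        using congr_Siegel[OF inverse(3)[OF A] that] by (simp only: inverse_act[OF A])
      show "Siegel_weight lam (congr A Z) = \<bar>det A\<bar> powr (2 * e) * Siegel_weight lam Z" if "Z \<in> ?D" for Z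
        unfolding e_def by (rule Siegel_weight_congr[OF A that])
      show "0 < \<bar>det A\<bar> powr (2 * e)" using A by simp
      show "0 < congr_factor A" using congr_factor[OF A] by (simp add: scales_lebesgue_def)
      show "congr A \<in> borel \<rightarrow>\<^sub>M borel" by measurable
      show "(\<integral>\<^sup>+ Z. f (congr A Z) \<partial>L) = ennreal (congr_factor A) * (\<integral>\<^sup>+ Z. f Z \<partial>L)"
        if "f \<in> borel_measurable borel" for f :: "complex^'n^'n \<Rightarrow> ennreal"
        by (rule scales_lebesgueD[OF congr_factor[OF A] that])
    qed
    also have "congr_factor A / \<bar>det A\<bar> powr (2 * e) = \<bar>det A\<bar> powr (- kappa)"
    proof -
      have "- 2 * real (card (symm_basis :: (complex^'n^'n) set)) / real CARD('n) - 2 * e = - kappa" by (simp add: kappa_def)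
      then show ?thesis unfolding congr_factor_eq[OF A] powr_diff[symmetric] by (simp only:)
    qed
    finally show ?thesis .
  qed
  obtain m where m: "holomorphic_symm m ?D" "\<And>Z. Z \<in> ?D \<Longrightarrow> m Z \<noteq> 0" "\<And>Z. Z \<in> ?D \<Longrightarrow> cmod (m Z) = cmod (det Z) powr (- kappa / 2)"
    using holomorphic_symm_det_power[where 'n = 'n, of "- kappa / 2"] by auto
  \<comment> \<open>Conjugating the involution gives the ordinary inverse, which is
    holomorphic.\<close>
  have cnj_inv: "cnj_mat (matrix_inv (cnj_mat Z)) = matrix_inv Z" if Z: "Z \<in> ?D" for Z
  proof -
    have "det (cnj_mat Z) \<noteq> 0" using Siegel_det_nonzero[OF Z] by (simp add: det_cnj_mat)
    then have "cnj_mat Z ** matrix_inv (cnj_mat Z) = mat 1" by (rule matrix_inv_det)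
    from arg_cong[OF this, of cnj_mat] have "Z ** cnj_mat (matrix_inv (cnj_mat Z)) = mat 1"
      by (simp add: cnj_mat_mult)
    then show ?thesis by (rule matrix_inv_eqI[symmetric])
  qed
  show ?thesis
  proof (rule commutative_moment_symbols)
    show "action_group G"
      unfolding action_group_def
    proof
      fix h assume "h \<in> G"
      then obtain A where A: "det A \<noteq> 0" and h: "h = congr A" by (auto simp: G_def)
      have "congr (matrix_inv A) \<in> G" using inverse(3)[OF A] by (auto simp: G_def)
      moreover have "\<forall>Z\<in>?D. h (congr (matrix_inv A) Z) = Z \<and> congr (matrix_inv A) (h Z) = Z"
        unfolding h by (simp add: inverse_act[OF A])
      ultimately have "\<exists>h'\<in>G. \<forall>Z\<in>?D. h (h' Z) = Z \<and> h' (h Z) = Z" by - (rule bexI[where x = "congr (matrix_inv A)"])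
      moreover have "\<forall>Z\<in>?D. h Z \<in> ?D" unfolding h using congr_Siegel[OF A] by auto
      moreover have "\<exists>c. scaling h c" unfolding h using sc[OF A] by auto
      ultimately show "(\<forall>Z\<in>?D. h Z \<in> ?D) \<and> (\<forall>i j. holomorphic_symm (\<lambda>Z. h Z $ i $ j) ?D) \<and>
        (\<exists>c. scaling h c) \<and> (\<exists>h'\<in>G. \<forall>Z\<in>?D. h (h' Z) = Z \<and> h' (h Z) = Z)" using holo unfolding h by simp
    qed
    show "mu_R (h Z) = mu_R Z" if "h \<in> G" "Z \<in> ?D" for h Z
      using that by (auto simp: G_def mu_R_congr)
    show orbit_D: "matrix_inv (cnj_mat z) \<in> ?D" if z: "z \<in> ?D" for z
    proof -
      obtain A :: "real^'n^'n" where "det A \<noteq> 0" "cmat A ** z ** transpose (cmat A) = matrix_inv (cnj_mat z)"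
        by (rule Siegel_inverse_orbit[OF z])
      then show ?thesis using congr_Siegel[OF _ z, of A] by (simp add: congr_def)
    qed
    show "matrix_inv (cnj_mat (matrix_inv (cnj_mat z))) = z" if z: "z \<in> ?D" for z
      unfolding cnj_inv[OF z]
      by (rule matrix_inv_eqI[OF matrix_mult_eq_one_commute[OF matrix_inv_det[OF Siegel_det_nonzero[OF z]]]])
    show "holomorphic_symm (\<lambda>Z. cnj (matrix_inv (cnj_mat Z) $ i $ j)) ?D" for i j
    proof -
      have "cnj (matrix_inv (cnj_mat Z) $ i $ j) = matrix_inv Z $ i $ j" if "Z \<in> ?D" for Z
        using arg_cong[OF cnj_inv[OF that], of "\<lambda>B. B $ i $ j"] by simp
      then have "holomorphic_symm (\<lambda>Z. cnj (matrix_inv (cnj_mat Z) $ i $ j)) ?D = holomorphic_symm (\<lambda>Z. matrix_inv Z $ i $ j) ?D"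
        by (rule holomorphic_symm_cong)
      then show ?thesis using holomorphic_symm_matrix_inv Siegel_det_nonzero by blast
    qed
    show "holomorphic_symm m ?D" by (rule m(1))
    show "m z \<noteq> 0" if "z \<in> ?D" for z by (rule m(2)[OF that])
    show "\<exists>h\<in>G. \<exists>c. scaling h c \<and> matrix_inv (cnj_mat z) = h z \<and> c * (cmod (m z))\<^sup>2 = 1" if z: "z \<in> ?D" for z
    proof -
      obtain A :: "real^'n^'n" where A: "det A \<noteq> 0" "cmat A ** z ** transpose (cmat A) = matrix_inv (cnj_mat z)" "\<bar>det A\<bar> * cmod (det z) = 1"
        by (rule Siegel_inverse_orbit[OF z])
      have "(cmod (m z))\<^sup>2 = cmod (det z) powr (- kappa)"
        using m(3)[OF z] by (simp add: power2_eq_square powr_add[symmetric])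
      then have "\<bar>det A\<bar> powr (- kappa) * (cmod (m z))\<^sup>2 = (\<bar>det A\<bar> * cmod (det z)) powr (- kappa)"
        by (simp add: powr_mult)
      also have "\<dots> = 1" by (simp add: A(3))
      finally have "scaling (congr A) (\<bar>det A\<bar> powr (- kappa)) \<and> matrix_inv (cnj_mat z) = congr A z \<and> \<bar>det A\<bar> powr (- kappa) * (cmod (m z))\<^sup>2 = 1"
        using sc[OF A(1)] A(2) by (simp add: congr_def)
      moreover have "congr A \<in> G" using A(1) by (auto simp: G_def)
      ultimately show ?thesis by (intro bexI[of _ "congr A"] exI[of _ "\<bar>det A\<bar> powr (- kappa)"])
    qed
  qed
qed

text \<open>Real translations preserve Lebesgue measure and leave the weight, a function of the
  imaginary part, unchanged, so the multiplier is 1.\<close>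

lemma parabolic_commutative:
  assumes c: "c > 0"
  shows "commutative_operators
           (bergman_space Siegel (Siegel_measure c lam))
           (toeplitz_algebra (Siegel :: (complex^'n^'n) set) (Siegel_measure c lam)
             (moment_symbols Siegel mu_Symm))"
proof -
  let ?D = "Siegel :: (complex^'n^'n) set"
  interpret weighted_bergman ?D "Siegel_weight lam" "ennreal c" "Siegel_measure c lam"
    by (rule weighted_bergman_Siegel[OF c])
  define G where "G = {\<lambda>Z. Z + cmat S | S :: real^'n^'n. transpose S = S}"
  have S: "cmat S \<in> Symm_complex" if "transpose S = S" for S :: "real^'n^'n"
    using that by (simp add: Symm_transpose cmat_transpose[symmetric])
  have Im_shift: "Im_mat (Z + cmat S) = Im_mat Z" for Z and S :: "real^'n^'n"
    by (rule mat_eqI) simp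
  have shift_iff: "Z + cmat S \<in> ?D \<longleftrightarrow> Z \<in> ?D" if "transpose S = S" "Z \<in> Symm_complex" for Z and S :: "real^'n^'n"
    using that S[OF that(1)] by (simp add: Siegel_iff Im_shift Symm_complex_iff)
  have DS: "Z \<in> Symm_complex" if "Z \<in> ?D" for Z using that by (simp add: Siegel_iff)
  have holo: "holomorphic_symm (\<lambda>Z. (Z + cmat S) $ i $ j) ?D" for S :: "real^'n^'n" and i j
    by (simp add: holomorphic_symm_add holomorphic_symm_entry holomorphic_symm_const)
  have sc: "scaling (\<lambda>Z. Z + cmat S) 1" if T: "transpose S = S" for S :: "real^'n^'n"
  proof -
    have "scaling (\<lambda>Z. Z + cmat S) (1 / 1)"
    proof (rule scalingI)
      show "Z + cmat S \<in> ?D" if "Z \<in> ?D" for Z using that shift_iff[OF T DS[OF that]] by simp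
      show "holomorphic_symm (\<lambda>Z. (Z + cmat S) $ i $ j) ?D" for i j by (rule holo)
      show "Z \<in> ?D" if "Z \<in> Symm_complex" "Z + cmat S \<in> ?D" for Z using that shift_iff[OF T] by simp
      show "Siegel_weight lam (Z + cmat S) = 1 * Siegel_weight lam Z" for Z
        unfolding Siegel_weight_det by (simp add: Im_shift)
      show "(\<integral>\<^sup>+ Z. f (Z + cmat S) \<partial>L) = ennreal 1 * (\<integral>\<^sup>+ Z. f Z \<partial>L)"
        if "f \<in> borel_measurable borel" for f :: "complex^'n^'n \<Rightarrow> ennreal"
        using nn_integral_translate[OF S[OF T] that] by simp
    qed auto
    then show ?thesis by simp
  qed
  \<comment> \<open>\<open>- cnj_mat Z\<close> is \<open>Z\<close> minus twice its real part, so the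
    reflected point is a translate of \<open>Z\<close> by a real symmetric matrix.\<close>
  define R where "R Z = (- 2) *\<^sub>R Re_mat Z" for Z :: "complex^'n^'n"
  have refl: "- cnj_mat Z = Z + cmat (R Z)" for Z
    by (rule mat_eqI) (simp add: R_def complex_eq_iff)
  have R: "transpose (R Z) = R Z" if "Z \<in> ?D" for Z
    using DS[OF that] by (intro mat_eqI) (simp add: R_def Symm_complex_iff transpose_def)
  show ?thesis
  proof (rule commutative_moment_symbols)
    show "action_group G"
      unfolding action_group_def
    proof
      fix h assume "h \<in> G"
      then obtain S where T: "transpose S = S" and h: "h = (\<lambda>Z. Z + cmat S)" by (auto simp: G_def)
      have "transpose (- S) = - S" using T by (simp add: vec_eq_iff transpose_def)
      then have "(\<lambda>Z. Z + cmat (- S)) \<in> G" by (auto simp: G_def)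
      moreover have "\<forall>Z\<in>?D. h (Z + cmat (- S)) = Z \<and> h Z + cmat (- S) = Z"
        unfolding h by (simp add: vec_eq_iff)
      ultimately have "\<exists>h'\<in>G. \<forall>Z\<in>?D. h (h' Z) = Z \<and> h' (h Z) = Z" by - (rule bexI[where x = "\<lambda>Z. Z + cmat (- S)"])
      moreover have "\<forall>Z\<in>?D. h Z \<in> ?D" unfolding h using shift_iff[OF T DS] by auto
      moreover have "\<exists>c. scaling h c" unfolding h using sc[OF T] by auto
      ultimately show "(\<forall>Z\<in>?D. h Z \<in> ?D) \<and> (\<forall>i j. holomorphic_symm (\<lambda>Z. h Z $ i $ j) ?D) \<and>
        (\<exists>c. scaling h c) \<and> (\<exists>h'\<in>G. \<forall>Z\<in>?D. h (h' Z) = Z \<and> h' (h Z) = Z)" using holo unfolding h by auto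
    qed
    show "mu_Symm (h Z) = mu_Symm Z" if "h \<in> G" "Z \<in> ?D" for h Z
      using that by (auto simp: G_def mu_Symm_def Im_shift)
    show "- cnj_mat z \<in> ?D" if "z \<in> ?D" for z
      unfolding refl using shift_iff[OF R[OF that] DS[OF that]] that by simp
    show "- cnj_mat (- cnj_mat z) = z" for z :: "complex^'n^'n" by (simp add: vec_eq_iff)
    show "holomorphic_symm (\<lambda>Z. cnj ((- cnj_mat Z) $ i $ j)) ?D" for i j
      using holomorphic_symm_scale[OF holomorphic_symm_entry, of "-1"] by simp
    show "holomorphic_symm (\<lambda>_. 1) ?D" by (rule holomorphic_symm_const)
    show "(1 :: complex) \<noteq> 0" by simp
    show "\<exists>h\<in>G. \<exists>c. scaling h c \<and> - cnj_mat z = h z \<and> c * (cmod 1)\<^sup>2 = 1" if z: "z \<in> ?D" for z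
    proof -
      have "(\<lambda>Z. Z + cmat (R z)) \<in> G" using R[OF z] by (auto simp: G_def)
      moreover have "scaling (\<lambda>Z. Z + cmat (R z)) 1 \<and> - cnj_mat z = z + cmat (R z) \<and> 1 * (cmod 1)\<^sup>2 = 1"
        using sc[OF R[OF z]] refl by simp
      ultimately show ?thesis by (intro bexI[of _ "\<lambda>Z. Z + cmat (R z)"] exI[of _ 1])
    qed
  qed
qed

theorem theorem5p8:
  fixes lam c :: real
  assumes lam: "lam > real CARD('n::finite)"
    and c: "c > 0"
  shows "commutative_operators
           (bergman_space D_III (D_III_measure lam))
           (toeplitz_algebra (D_III :: (complex^'n^'n) set) (D_III_measure lam)
             (moment_symbols D_III mu_T))
       \<and> commutative_operators
           (bergman_space Siegel (Siegel_measure c lam))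
           (toeplitz_algebra (Siegel :: (complex^'n^'n) set) (Siegel_measure c lam)
             (moment_symbols Siegel mu_R))
       \<and> commutative_operators
           (bergman_space Siegel (Siegel_measure c lam))
           (toeplitz_algebra (Siegel :: (complex^'n^'n) set) (Siegel_measure c lam)
             (moment_symbols Siegel mu_Symm))"
  by (intro conjI elliptic_commutative[OF lam] hyperbolic_commutative[OF c] parabolic_commutative[OF c])

end
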